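(* Let $f, g\in L_p(\mathbb{T}^2)$, $1<p<\infty$, and $\alpha_i>0$, $i=1,2$. Then: (1) $\omega_{\alpha_1,\alpha_2}(f,\delta_1,0)_{L_p(\mathbb{T}^2)}=\omega_{\alpha_1,\alpha_2}(f,0,\delta_2)_{L_p(\mathbb{T}^2)}=\omega_{\alpha_1,\alpha_2}(f,0,0)_{L_p(\mathbb{T}^2)}=0$; (2) $\omega_{\alpha_1,\alpha_2}(f+g,\delta_1,\delta_2)_{L_p(\mathbb{T}^2)}\lesssim \omega_{\alpha_1,\alpha_2}(f,\delta_1,\delta_2)_{L_p(\mathbb{T}^2)}+\omega_{\alpha_1,\alpha_2}(g,\delta_1,\delta_2)_{L_p(\mathbb{T}^2)}$; (3) $\omega_{\alpha_1,\alpha_2}(f,\delta_1,\delta_2)_{L_p(\mathbb{T}^2)}\lesssim \omega_{\alpha_1,\alpha_2}(f,t_1,t_2)_{L_p(\mathbb{T}^2)}$ for $0<\delta_i\le t_i$, $i=1,2$; (4) $\dfrac{\omega_{\alpha_1,\alpha_2}(f,\delta_1,\delta_2)_{L_p(\mathbb{T}^2)}}{\delta_1^{\alpha_1}\delta_2^{\alpha_2}}\lesssim \dfrac{\omega_{\alpha_1,\alpha_2}(f,t_1,t_2)_{L_p(\mathbb{T}^2)}}{t_1^{\alpha_1}t_2^{\alpha_2}}$ for $0<t_i\le\delta_i\le 1$, $i=1,2$; (5) $\omega_{\alpha_1,\alpha_2}(f,\lambda_1\delta_1,\lambda_2\delta_2)_{L_p(\mathbb{T}^2)}\lesssim \lambda_1^{\alpha_1}\lambda_2^{\alpha_2}\,\omega_{\alpha_1,\alpha_2}(f,\delta_1,\delta_2)_{L_p(\mathbb{T}^2)}$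 for $\lambda_i>1$, $i=1,2$; (6) $\omega_{\beta_1,\beta_2}(f,\delta_1,\delta_2)_{L_p(\mathbb{T}^2)}\lesssim \omega_{\alpha_1,\alpha_2}(f,\delta_1,\delta_2)_{L_p(\mathbb{T}^2)}$ for $0<\alpha_i<\beta_i$, $i=1,2$; (7) (Marchaud's inequality) $$\omega_{\alpha_1,\alpha_2}(f,\delta_1,\delta_2)_{L_p(\mathbb{T}^2)}\lesssim \delta_1^{\alpha_1}\delta_2^{\alpha_2}\int_{\delta_1}^1\int_{\delta_2}^1\frac{\omega_{\beta_1,\beta_2}(f,t_1,t_2)_{L_p(\mathbb{T}^2)}}{t_1^{\alpha_1}t_2^{\alpha_2}}\,\frac{dt_2}{t_2}\,\frac{dt_1}{t_1}$$ for $0<\alpha_i<\beta_i$, $0<\delta_i\le\frac12$, $i=1,2$ (here $t_1\in[\delta_1,1]$, $t_2\in[\delta_2,1]$); (8) $\dfrac{\omega_{\alpha_1,\alpha_2}(f,\delta_1,\delta_2)_{L_p(\mathbb{T}^2)}}{\delta_1^{\alpha_1}\delta_2^{\alpha_2}}\lesssim \dfrac{\omega_{\beta_1,\beta_2}(f,\delta_1,\delta_2)_{L_p(\mathbb{T}^2)}}{\delta_1^{\beta_1}\delta_2^{\beta_2}}$ for $0<\alpha_i<\beta_i$, $0<\delta_i<\frac12$, $i=1,2$; (9) if $f\in L_p^0(\mathbb{T}^2)$ has a Weyl derivative $f^{(r_1,r_2)}\in L_p(\mathbb{T}^2)$, then $$\omega_{\beta_1+r_1,\beta_2+r_2}(f,\delta_1,\delta_2)_{L_p(\mathbb{T}^2)}\lesssim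 \delta_1^{r_1}\delta_2^{r_2}\,\omega_{\beta_1,\beta_2}(f^{(r_1,r_2)},\delta_1,\delta_2)_{L_p(\mathbb{T}^2)}$$ for $\beta_i,r_i>0$, $i=1,2$; (10) if $f\in L_p^0(\mathbb{T}^2)$ has a Weyl derivative $f^{(r_1,r_2)}\in L_p(\mathbb{T}^2)$, then $$\omega_{\beta_1,\beta_2}(f^{(r_1,r_2)},\delta_1,\delta_2)_{L_p(\mathbb{T}^2)}\lesssim \int_0^{\delta_1}\int_0^{\delta_2}t_1^{-r_1}t_2^{-r_2}\,\omega_{\beta_1+r_1,\beta_2+r_2}(f,t_1,t_2)_{L_p(\mathbb{T}^2)}\,\frac{dt_2}{t_2}\,\frac{dt_1}{t_1}$$ for $\beta_i,r_i>0$, $i=1,2$. Unless another range is indicated, $\delta_1,\delta_2>0$ are arbitrary.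
   Context: $L_p(\mathbb{T}^2)$, $1<p<\infty$, is the space of measurable functions $f(x,y)$ that are $2\pi$-periodic in each variable with $\|f\|_{L_p(\mathbb{T}^2)}=\big(\int_0^{2\pi}\int_0^{2\pi}|f(x,y)|^p\,dx\,dy\big)^{1/p}<\infty$; $L_p^0(\mathbb{T}^2)$ is the set of $f\in L_p(\mathbb{T}^2)$ with $\int_0^{2\pi}f(x,y)\,dy=0$ for a.e. $x$ and $\int_0^{2\pi}f(x,y)\,dx=0$ for a.e. $y$. For $\alpha_1,\alpha_2>0$ the (fractional) differences are $\Delta_{h_1}^{\alpha_1}(f)=\sum_{\nu=0}^\infty(-1)^\nu\binom{\alpha_1}{\nu}f(x+(\alpha_1-\nu)h_1,y)$ and $\Delta_{h_2}^{\alpha_2}(f)=\sum_{\nu=0}^\infty(-1)^\nu\binom{\alpha_2}{\nu}f(x,y+(\alpha_2-\nu)h_2)$, where $\binom{\alpha}{0}=1$, $\binom{\alpha}{\nu}=\frac{\alpha(\alpha-1)\cdots(\alpha-\nu+1)}{\nu!}$ for $\nu\ge1$. The mixed modulus of smoothness is $\omega_{\alpha_1,\alpha_2}(f,\delta_1,\delta_2)_{L_p(\mathbb{T}^2)}=\sup_{|h_i|\le\delta_i,\,i=1,2}\|\Delta_{h_1}^{\alpha_1}(\Delta_{h_2}^{\alpha_2}(f))\|_{L_p(\mathbb{T}^2)}$. Weyl derivative: for $f$ with zero mean in each variable and Fourier series $\sum_{n_1,n_2\ne0}c_{n_1,n_2}e^{i(n_1x+n_2y)}$, and $\rho_1,\rho_2\ge0$,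 $f^{(\rho_1,\rho_2)}$ (order $\rho_1$ in $x$, $\rho_2$ in $y$) is the function with Fourier series $\sum_{n_1,n_2\neq0}(in_1)^{\rho_1}(in_2)^{\rho_2}c_{n_1,n_2}e^{i(n_1x+n_2y)}$, where $(in)^{\rho}=|n|^\rho e^{i\pi\rho\,\mathrm{sign}(n)/2}$. $A\lesssim B$ means $A\le CB$ with a constant $C>0$ independent of $f,g$ and of $\delta_i,t_i,\lambda_i$ ($C$ may depend on $p$ and on the orders $\alpha_i,\beta_i,r_i$). *)

theory Defs
  imports "HOL-Analysis.Analysis"
begin

text \<open>
  Functions are complex-valued and Lebesgue (not just Borel) measurable. Norms, moduli of
  smoothness and the integrals of moduli take values in \<^typ>\<open>ennreal\<close>, so that an infinite
  quantity is really infinite instead of collapsing to a default value.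
\<close>

definition torus_measure :: "(real \<times> real) measure" where
  "torus_measure = lebesgue_on ({0..2*pi} \<times> {0..2*pi})"

text \<open>There is no \<^const>\<open>powr\<close> on \<^typ>\<open>ennreal\<close>, hence the case distinction.\<close>

definition Lp_norm :: "real \<Rightarrow> (real \<times> real \<Rightarrow> complex) \<Rightarrow> ennreal" where
  "Lp_norm p f =
     (let I = (\<integral>\<^sup>+ z. ennreal (norm (f z) powr p) \<partial>torus_measure)
      in if I = \<infinity> then \<infinity> else ennreal (enn2real I powr (1 / p)))"

definition torus_Lp :: "real \<Rightarrow> (real \<times> real \<Rightarrow> complex) set" where
  "torus_Lp p = {f. f \<in> borel_measurable lebesgue \<and>
     (\<forall>x y. f (x + 2*pi, y) = f (x, y) \<and> f (x, y + 2*pi) = f (x, y)) \<and>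
     Lp_norm p f < \<infinity>}"

definition torus_Lp0 :: "real \<Rightarrow> (real \<times> real \<Rightarrow> complex) set" where
  "torus_Lp0 p = {f \<in> torus_Lp p.
     (AE x in lebesgue. (LINT y|lebesgue_on {0..2*pi}. f (x, y)) = 0) \<and>
     (AE y in lebesgue. (LINT x|lebesgue_on {0..2*pi}. f (x, y)) = 0)}"

text \<open>
  The difference series are taken pointwise. For \<open>f\<close> in \<open>L\<^sub>p\<close> and \<open>\<alpha> > 0\<close> they converge absolutely
  almost everywhere, because the generalised binomial coefficients are absolutely summable;
  the values of \<^const>\<open>suminf\<close> on the exceptional null set do not affect any norm.
\<close>

definition frac_diff1 ::
  "real \<Rightarrow> real \<Rightarrow> (real \<times> real \<Rightarrow> complex) \<Rightarrow> real \<times> real \<Rightarrow> complex" where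
  "frac_diff1 \<alpha> h f =
     (\<lambda>(x, y). \<Sum>\<nu>. (-1) ^ \<nu> * of_real (\<alpha> gchoose \<nu>) * f (x + (\<alpha> - real \<nu>) * h, y))"

definition frac_diff2 ::
  "real \<Rightarrow> real \<Rightarrow> (real \<times> real \<Rightarrow> complex) \<Rightarrow> real \<times> real \<Rightarrow> complex" where
  "frac_diff2 \<alpha> h f =
     (\<lambda>(x, y). \<Sum>\<nu>. (-1) ^ \<nu> * of_real (\<alpha> gchoose \<nu>) * f (x, y + (\<alpha> - real \<nu>) * h))"

definition mixed_modulus ::
  "real \<Rightarrow> real \<Rightarrow> real \<Rightarrow> (real \<times> real \<Rightarrow> complex) \<Rightarrow> real \<Rightarrow> real \<Rightarrow> ennreal" where
  "mixed_modulus p \<alpha>1 \<alpha>2 f \<delta>1 \<delta>2 =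
     (SUP (h1, h2) \<in> {(h1, h2). \<bar>h1\<bar> \<le> \<delta>1 \<and> \<bar>h2\<bar> \<le> \<delta>2}.
        Lp_norm p (frac_diff1 \<alpha>1 h1 (frac_diff2 \<alpha>2 h2 f)))"

definition fourier_coeff :: "(real \<times> real \<Rightarrow> complex) \<Rightarrow> int \<Rightarrow> int \<Rightarrow> complex" where
  "fourier_coeff f n1 n2 =
     (LINT z|torus_measure. f z * cis (- (of_int n1 * fst z + of_int n2 * snd z)))
       / of_real ((2*pi)\<^sup>2)"

text \<open>The branch of \<open>(i n)\<^sup>\<rho>\<close> used for Weyl derivatives, for \<open>n \<noteq> 0\<close>.\<close>

definition weyl_factor :: "real \<Rightarrow> int \<Rightarrow> complex" where
  "weyl_factor \<rho> n = of_real (\<bar>of_int n\<bar> powr \<rho>) * cis (pi * \<rho> * of_int (sgn n) / 2)"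

text \<open>
  A Weyl derivative is determined by its Fourier series only up to a null set, so it is
  rendered as a relation between \<open>f\<close> and a representative \<open>g\<close> of its derivative.
\<close>

definition has_weyl_derivative ::
  "real \<Rightarrow> real \<Rightarrow> (real \<times> real \<Rightarrow> complex) \<Rightarrow> (real \<times> real \<Rightarrow> complex) \<Rightarrow> bool" where
  "has_weyl_derivative \<rho>1 \<rho>2 f g \<longleftrightarrow>
     f \<in> torus_Lp0 1 \<and> g \<in> torus_Lp 1 \<and>
     (\<forall>n1 n2. fourier_coeff g n1 n2 =
        (if n1 \<noteq> 0 \<and> n2 \<noteq> 0
         then weyl_factor \<rho>1 n1 * weyl_factor \<rho>2 n2 * fourier_coeff f n1 n2 else 0))"

end

(* Every difference is a power series sum_k a_k T^k in a translation T, with absolutely summable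
   coefficients. Such series act boundedly on L_p, so one difference dominates another as soon as
   the quotient of their generating functions in x = T is again a power series with absolutely
   summable coefficients. For (4)-(6) the quotients are ((1 - x^m)/(1 - x))^alpha and
   (1 - x)^(beta - alpha). For the Marchaud inequality (1 - x)^alpha is telescoped along
   x, x^2, x^4, ... with errors divisible by (1 - x)^beta; the dyadic sums are then compared with
   integrals of the moduli, and (8) follows from (7).

   For (9) and (10) let first f be a trigonometric polynomial. The Weyl factor (in)^r is the limit
   of u^(-r) (1 - e^(-iun))^r as u decreases to 0: taking u = h/m in the quotient estimate above
   yields (9), and telescoping along u = h/2^j yields (10). For h < 0 the limit has the conjugate
   phase, so the two signs of h have to be compared by the M. Riesz conjugate function theorem; it
   is proved by P. Stein's subharmonicity argument. Fejer means, which contract L_p, converge in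
   L_1 and commute with translations and with Weyl derivatives, carry the estimates over to L_p. *)

theory Submission
  imports Defs "HOL-Real_Asymp.Real_Asymp"
begin

section \<open>Absolutely summable sequences and their symbols\<close>

text \<open>Two features of the fractional setting shape the argument. The coefficients of (1 -
  x)^(-s) have size k^(s-1) and are not summable for s > 0, so a quotient of differences cannot be
  estimated factor by factor: it is the cancellation between numerator and denominator that restores
  summability and yields the power m^alpha. Moreover the expansions needed are about x = 1, on the
  boundary of the disc; they become harmless in w = (1 - x)/2, because w^k has coefficients of
  absolute sum 1. Series of translations along different axes commute, so each bivariate estimate is
  a one-dimensional one applied twice, with constants independent of f and of the step. The Marchaud
  integral ends at 1 while the dyadic sum does not; periodicity closes this gap, since every step is
  congruent modulo 2 pi to one of size at most 4. For the conjugate function, p > 1 means q = p/2 >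
  1/2, and this gives the Laplacian of (u^2 + kappa v^2 + eps)^q a lower bound with the positive
  factor min(1, 2q - 1).\<close>

definition ell1 :: "(nat \<Rightarrow> real) \<Rightarrow> bool" where
  "ell1 a \<longleftrightarrow> summable (\<lambda>k. \<bar>a k\<bar>)"

definition norm1 :: "(nat \<Rightarrow> real) \<Rightarrow> real" where
  "norm1 a = (\<Sum>k. \<bar>a k\<bar>)"

definition cauchy :: "(nat \<Rightarrow> real) \<Rightarrow> (nat \<Rightarrow> real) \<Rightarrow> nat \<Rightarrow> real" where
  "cauchy a b n = (\<Sum>i\<le>n. a i * b (n - i))"

text \<open>Coefficients of F(x^m) when \<open>a\<close> belongs to F(x). As x stands for the
  translation by v, this is the passage from step v to step m v.\<close>

definition dil :: "nat \<Rightarrow> (nat \<Rightarrow> real) \<Rightarrow> nat \<Rightarrow> real" where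
  "dil m a n = (if m dvd n then a (n div m) else 0)"

text \<open>Coefficients of (1 - x)^r; with the sign included, this is the coefficient sequence of
  the difference of order r.\<close>

definition bc :: "real \<Rightarrow> nat \<Rightarrow> real" where
  "bc r k = (- 1) ^ k * (r gchoose k)"

text \<open>Only real x strictly between 0 and 1 are tested. There 1 - x is positive, so that
  \<open>powr\<close> obeys its usual laws, and these values already determine the
  coefficients.\<close>

definition symb :: "(nat \<Rightarrow> real) \<Rightarrow> (real \<Rightarrow> real) \<Rightarrow> bool" where
  "symb a F \<longleftrightarrow> ell1 a \<and> (\<forall>x\<in>{0<..<1}. (\<lambda>k. a k * x ^ k) sums F x)"

text \<open>A norm bound in the algebra of absolutely summable power series, stated for the
  function, so that products, powers and substitutions can be estimated without naming
  coefficients.\<close>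

definition wien :: "(real \<Rightarrow> real) \<Rightarrow> real \<Rightarrow> bool" where
  "wien F C \<longleftrightarrow> (\<exists>a. symb a F \<and> norm1 a \<le> C)"

lemma norm1_nonneg: "ell1 a \<Longrightarrow> norm1 a \<ge> 0"
  unfolding norm1_def ell1_def by (auto intro: suminf_nonneg)

lemma norm1_leI:
  assumes "\<And>N. (\<Sum>k<N. \<bar>a k\<bar>) \<le> C"
  shows "ell1 a" "norm1 a \<le> C"
proof -
  have s: "summable (\<lambda>k. \<bar>a k\<bar>)"
    by (rule summableI_nonneg_bounded[where x=C]) (use assms in auto)
  show "ell1 a" using s by (simp add: ell1_def)
  show "norm1 a \<le> C" unfolding norm1_def by (rule suminf_le_const[OF s]) (use assms in auto)
qed

lemma ell1_dominated:
  assumes "ell1 b" "\<And>k. \<bar>a k\<bar> \<le> b k"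
  shows "ell1 a" "norm1 a \<le> norm1 b"
proof -
  have b: "\<bar>b k\<bar> = b k" for k using assms(2)[of k] by linarith
  have "summable b" using assms(1) b by (simp add: ell1_def)
  then show "ell1 a" unfolding ell1_def
    by (rule summable_comparison_test'[where N=0]) (use assms in auto)
  then show "norm1 a \<le> norm1 b" unfolding norm1_def ell1_def using assms b
    by (intro suminf_le) (auto simp: ell1_def)
qed

lemma ell1_cauchy:
  assumes "ell1 a" "ell1 b"
  shows "ell1 (cauchy a b)" "norm1 (cauchy a b) \<le> norm1 a * norm1 b"
proof -
  define c where "c = cauchy (\<lambda>k. \<bar>a k\<bar>) (\<lambda>k. \<bar>b k\<bar>)"
  have s: "c sums (norm1 a * norm1 b)"
    unfolding c_def norm1_def cauchy_def[abs_def]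
    by (rule Cauchy_product_sums) (use assms in \<open>auto simp: ell1_def\<close>)
  have nn: "c k \<ge> 0" for k unfolding c_def cauchy_def by (auto intro!: sum_nonneg)
  have c1: "ell1 c" using s nn by (simp add: ell1_def sums_summable)
  have le: "\<bar>cauchy a b k\<bar> \<le> c k" for k
    unfolding c_def cauchy_def by (rule order_trans[OF sum_abs]) (auto simp: abs_mult)
  have "norm1 c = norm1 a * norm1 b"
    using sums_unique[OF s] nn by (simp add: norm1_def)
  with ell1_dominated[OF c1 le] show "ell1 (cauchy a b)" "norm1 (cauchy a b) \<le> norm1 a * norm1 b"
    by auto
qed

lemma symb_mult:
  assumes "symb a F" "symb b G"
  shows "symb (cauchy a b) (\<lambda>x. F x * G x)"
  unfolding symb_def
proof (intro conjI ballI)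
  show "ell1 (cauchy a b)" using assms ell1_cauchy by (auto simp: symb_def)
  fix x :: real assume x: "x \<in> {0<..<1}"
  have ab: "summable (\<lambda>k. norm (a k * x ^ k))" if "ell1 a" for a
    by (rule summable_comparison_test'[where N=0 and g="\<lambda>k. \<bar>a k\<bar>"])
       (use that x in \<open>auto simp: ell1_def abs_mult mult_left_le power_le_one\<close>)
  have "(\<lambda>k. \<Sum>i\<le>k. (a i * x ^ i) * (b (k - i) * x ^ (k - i))) sums
          ((\<Sum>k. a k * x ^ k) * (\<Sum>k. b k * x ^ k))"
    by (rule Cauchy_product_sums) (use assms ab in \<open>auto simp: symb_def\<close>)
  also have "(\<lambda>k. \<Sum>i\<le>k. (a i * x ^ i) * (b (k - i) * x ^ (k - i))) = (\<lambda>k. cauchy a b k * x ^ k)"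
  proof
    fix k
    have "(a i * x ^ i) * (b (k - i) * x ^ (k - i)) = a i * b (k - i) * x ^ k" if "i \<le> k" for i
      using that power_add[of x i "k - i"] by (simp add: mult_ac)
    then show "(\<Sum>i\<le>k. (a i * x ^ i) * (b (k - i) * x ^ (k - i))) = cauchy a b k * x ^ k"
      unfolding cauchy_def sum_distrib_right by (intro sum.cong) auto
  qed
  also have "(\<Sum>k. a k * x ^ k) * (\<Sum>k. b k * x ^ k) = F x * G x"
    using assms x by (auto simp: symb_def sums_iff)
  finally show "(\<lambda>k. cauchy a b k * x ^ k) sums (F x * G x)" .
qed

lemma ell1_add: "ell1 a \<Longrightarrow> ell1 b \<Longrightarrow> ell1 (\<lambda>k. a k + b k)"
  unfolding ell1_def
  by (rule summable_comparison_test'[where N=0 and g="\<lambda>k. \<bar>a k\<bar> + \<bar>b k\<bar>"]) (auto intro: summable_add)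

lemma ell1_cmult: "ell1 a \<Longrightarrow> ell1 (\<lambda>k. c * a k)"
  unfolding ell1_def by (simp add: abs_mult summable_mult)

lemma norm1_cmult: "ell1 a \<Longrightarrow> norm1 (\<lambda>k. c * a k) = \<bar>c\<bar> * norm1 a"
  unfolding ell1_def norm1_def by (simp add: abs_mult suminf_mult)

lemma symb_add: "symb a F \<Longrightarrow> symb b G \<Longrightarrow> symb (\<lambda>k. a k + b k) (\<lambda>x. F x + G x)"
  unfolding symb_def by (auto simp: ell1_add distrib_right intro!: sums_add)

lemma symb_cmult: "symb a F \<Longrightarrow> symb (\<lambda>k. c * a k) (\<lambda>x. c * F x)"
  unfolding symb_def by (auto simp: ell1_cmult mult.assoc intro!: sums_mult)

lemma symb_cong: "symb a F \<Longrightarrow> (\<And>x. 0 < x \<Longrightarrow> x < 1 \<Longrightarrow> F x = G x) \<Longrightarrow> symb a G"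
  unfolding symb_def by auto

lemma symb_ell1: "symb a F \<Longrightarrow> ell1 a" by (simp add: symb_def)

lemma wien_cong: "wien F C \<Longrightarrow> (\<And>x. 0 < x \<Longrightarrow> x < 1 \<Longrightarrow> F x = G x) \<Longrightarrow> wien G C"
  unfolding wien_def by (meson symb_cong)

lemma wien_mono: "wien F C \<Longrightarrow> C \<le> D \<Longrightarrow> wien F D"
  unfolding wien_def by (meson order_trans)

lemma wien_nonneg: "wien F C \<Longrightarrow> 0 \<le> C"
  unfolding wien_def using norm1_nonneg symb_ell1 by (meson order_trans)

lemma wien_mult: "wien F C \<Longrightarrow> wien G D \<Longrightarrow> wien (\<lambda>x. F x * G x) (C * D)"
proof -
  assume "wien F C" "wien G D"
  then obtain a b where ab: "symb a F" "norm1 a \<le> C" "symb b G" "norm1 b \<le> D"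
    by (auto simp: wien_def)
  have "norm1 (cauchy a b) \<le> norm1 a * norm1 b"
    using ell1_cauchy ab symb_ell1 by blast
  also have "\<dots> \<le> C * D"
    using ab norm1_nonneg[OF symb_ell1[OF ab(1)]] norm1_nonneg[OF symb_ell1[OF ab(3)]] by (intro mult_mono) auto
  finally show ?thesis using symb_mult[OF ab(1,3)] by (auto simp: wien_def)
qed

lemma wien_cmult: "wien F C \<Longrightarrow> wien (\<lambda>x. c * F x) (\<bar>c\<bar> * C)"
proof -
  assume "wien F C"
  then obtain a where a: "symb a F" "norm1 a \<le> C" by (auto simp: wien_def)
  then show ?thesis using symb_cmult[OF a(1), of c] norm1_cmult[OF symb_ell1[OF a(1)], of c]
    by (auto simp: wien_def intro!: exI[of _ "\<lambda>k. c * a k"] mult_left_mono)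
qed

lemma norm1_dil:
  assumes "ell1 a" "m > 0"
  shows "ell1 (dil m a)" "norm1 (dil m a) = norm1 a"
proof -
  have sm: "strict_mono (\<lambda>k::nat. m * k)" using assms by (simp add: strict_mono_def)
  have z: "\<bar>dil m a n\<bar> = 0" if "n \<notin> range (\<lambda>k. m * k)" for n
    using that by (auto simp: dil_def dvd_def)
  have d: "\<bar>dil m a (m * k)\<bar> = \<bar>a k\<bar>" for k using assms by (simp add: dil_def)
  have "summable (\<lambda>k. \<bar>dil m a (m * k)\<bar>) \<longleftrightarrow> summable (\<lambda>n. \<bar>dil m a n\<bar>)"
    by (rule summable_mono_reindex[OF sm z])
  then show "ell1 (dil m a)" using assms(1) unfolding d ell1_def by blast
  have "(\<Sum>k. \<bar>dil m a (m * k)\<bar>) = (\<Sum>n. \<bar>dil m a n\<bar>)"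
    by (rule suminf_mono_reindex[OF sm z])
  then show "norm1 (dil m a) = norm1 a" unfolding d norm1_def by simp
qed

lemma symb_dil:
  assumes "symb a F" "m > 0"
  shows "symb (dil m a) (\<lambda>x. F (x ^ m))"
  unfolding symb_def
proof (intro conjI ballI)
  show "ell1 (dil m a)" using norm1_dil assms symb_ell1 by blast
  fix x :: real assume x: "x \<in> {0<..<1}"
  have sm: "strict_mono (\<lambda>k::nat. m * k)" using assms by (simp add: strict_mono_def)
  have z: "dil m a n * x ^ n = 0" if "n \<notin> range (\<lambda>k. m * k)" for n
    using that by (auto simp: dil_def dvd_def)
  have d: "dil m a (m * k) * x ^ (m * k) = a k * (x ^ m) ^ k" for k
    using assms by (simp add: dil_def power_mult)
  have "x ^ m \<in> {0<..<1}" using x assms by (simp add: power_less_one_iff)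
  then have "(\<lambda>k. a k * (x ^ m) ^ k) sums F (x ^ m)" using assms by (auto simp: symb_def)
  then show "(\<lambda>n. dil m a n * x ^ n) sums F (x ^ m)"
    unfolding d[symmetric] by (subst (asm) sums_mono_reindex[OF sm z])
qed

lemma wien_dil: "wien F C \<Longrightarrow> m > 0 \<Longrightarrow> wien (\<lambda>x. F (x ^ m)) C"
  unfolding wien_def using symb_dil norm1_dil symb_ell1 by metis

section \<open>Uniqueness of coefficients and the binomial series\<close>

lemma powser_zero_imp_coeff_zero:
  fixes a :: "nat \<Rightarrow> real"
  assumes "\<And>x. x \<in> {0<..<1} \<Longrightarrow> (\<lambda>k. a k * x ^ k) sums 0"
  shows "a = (\<lambda>_. 0)"
proof -
  have "a n = 0" for n
  proof (induction n rule: less_induct)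
    case (less n)
    \<comment> \<open>The coefficients below n vanish by induction, so the series can be divided by
      x^n; letting x tend to 0 from the right then isolates the n-th coefficient.\<close>
    define b where "b = (\<lambda>k. a (k + n))"
    have b: "(\<lambda>k. b k * x ^ k) sums 0" if x: "x \<in> {0<..<1}" for x
    proof -
      have "(\<lambda>k. a (k + n) * x ^ (k + n)) sums (0 - (\<Sum>k<n. a k * x ^ k))"
        using assms[OF x] by (subst sums_iff_shift) simp
      then have "(\<lambda>k. x ^ n * (b k * x ^ k)) sums (x ^ n * 0)"
        using less by (simp add: b_def power_add mult_ac)
      then show ?thesis using x by (subst (asm) sums_mult_iff) auto
    qed
    have sumb: "summable (\<lambda>k. b k * (1/2) ^ k)" using b[of "1/2"] sums_summable by auto
    have "isCont (\<lambda>x. \<Sum>k. b k * x ^ k) 0"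
      by (rule isCont_powser[OF sumb]) auto
    then have "(\<lambda>x. \<Sum>k. b k * x ^ k) \<midarrow>0\<rightarrow> (\<Sum>k. b k * 0 ^ k)"
      by (simp add: isCont_def)
    then have 1: "((\<lambda>x. \<Sum>k. b k * x ^ k) \<longlongrightarrow> b 0) (at_right 0)"
      by (simp add: powser_zero filterlim_at_split)
    have "eventually (\<lambda>x::real. (\<Sum>k. b k * x ^ k) = 0) (at_right 0)"
      unfolding eventually_at_right_field using b by (intro exI[of _ 1]) (auto simp: sums_iff)
    then have "((\<lambda>x. \<Sum>k. b k * x ^ k) \<longlongrightarrow> 0) (at_right 0)"
      by (simp add: tendsto_eventually)
    then have "b 0 = 0" using 1 tendsto_unique trivial_limit_at_right_real by blast
    then show ?case by (simp add: b_def)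
  qed
  then show ?thesis by auto
qed

text \<open>This is how an identity between functions on (0, 1) becomes an identity between
  sequences, and thereby between series of translations.\<close>

lemma symb_unique:
  assumes "symb a F" "symb b F"
  shows "a = b"
proof -
  have "(\<lambda>k. (a k - b k) * x ^ k) sums (F x - F x)" if "x \<in> {0<..<1}" for x
    unfolding left_diff_distrib by (rule sums_diff) (use assms that in \<open>auto simp: symb_def\<close>)
  then have "(\<lambda>k. a k - b k) = (\<lambda>_. 0)"
    by (intro powser_zero_imp_coeff_zero) auto
  then show ?thesis by (auto simp: fun_eq_iff)
qed

text \<open>By the Gamma asymptotics the coefficients are O(n^(-r-1)), which is summable because r >
  0.\<close>

lemma summable_bc:
  assumes "r > 0"
  shows "ell1 (bc r)"
proof -
  have "(\<lambda>n. (r gchoose n) / ((-1)^n / exp ((r+1) * of_real (ln (real n))))) \<longlonglongrightarrow> inverse (Gamma (- r))"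
    by (rule gbinomial_asymptotic)
  then have "Bseq (\<lambda>n. (r gchoose n) / ((-1)^n / exp ((r+1) * of_real (ln (real n)))))"
    using convergentI convergent_imp_Bseq by blast
  then obtain K where K: "\<And>n. norm ((r gchoose n) / ((-1)^n / exp ((r+1) * of_real (ln (real n))))) \<le> K"
    by (auto simp: Bseq_def)
  have "summable (\<lambda>n. K * real n powr (- (r + 1)))"
    using assms by (intro summable_mult) (simp add: summable_real_powr_iff)
  then show ?thesis unfolding ell1_def
  proof (rule summable_comparison_test'[where N=1])
    fix n :: nat assume n: "n \<ge> 1"
    define e where "e = exp ((r + 1) * ln (real n))"
    have e: "e > 0" "real n powr (- (r + 1)) = inverse e"
      using n by (auto simp: e_def powr_def algebra_simps simp flip: exp_minus)
    have "\<bar>r gchoose n\<bar> * e \<le> K"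
      using K[of n] e(1) by (simp add: abs_mult e_def)
    then show "norm \<bar>bc r n\<bar> \<le> K * real n powr (- (r + 1))"
      unfolding e(2) using e(1) by (simp add: bc_def abs_mult field_simps)
  qed
qed

text \<open>The n-th partial sum is, up to sign, the binomial coefficient of r - 1 over n, of size
  O(n^(-r)). In contrast to the symbol on (0, 1) this concerns the boundary point x = 1.\<close>

lemma bc_sums_zero:
  assumes "r > 0"
  shows "bc r sums 0"
proof -
  have "(\<lambda>n. (r - 1 gchoose n) / ((-1)^n / exp ((r-1+1) * of_real (ln (real n))))) \<longlonglongrightarrow> inverse (Gamma (- (r-1)))"
    by (rule gbinomial_asymptotic)
  moreover have "(\<lambda>n. real n powr (- r)) \<longlonglongrightarrow> 0" using assms
    by (intro tendsto_neg_powr filterlim_real_sequentially) auto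
  ultimately have "(\<lambda>n. (r - 1 gchoose n) / ((-1)^n / exp ((r-1+1) * of_real (ln (real n)))) * real n powr (- r)) \<longlonglongrightarrow> inverse (Gamma (- (r-1))) * 0"
    by (rule tendsto_mult)
  then have "(\<lambda>n. (r - 1 gchoose n) / ((-1)^n / exp ((r-1+1) * of_real (ln (real n)))) * real n powr (- r)) \<longlonglongrightarrow> 0" by simp
  moreover have "eventually (\<lambda>n. (r - 1 gchoose n) / ((-1)^n / exp ((r-1+1) * of_real (ln (real n)))) * real n powr (- r)
     = (-1) ^ n * (r - 1 gchoose n)) sequentially"
    using eventually_gt_at_top[of 0]
  proof eventually_elim
    case (elim n)
    define e where "e = exp (r * ln (real n))"
    have e: "e > 0" "real n powr (- r) = inverse e"
      using elim by (auto simp: e_def powr_def simp flip: exp_minus)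
    show ?case unfolding e(2) using e(1)
      by (simp add: e_def[symmetric] field_simps)
  qed
  ultimately have "(\<lambda>n. (-1) ^ n * (r - 1 gchoose n)) \<longlonglongrightarrow> 0"
    by (rule Lim_transform_eventually)
  then have "(\<lambda>n. \<Sum>k\<le>n. bc r k) \<longlonglongrightarrow> 0"
    using gbinomial_sum_lower_neg[of r] by (simp add: bc_def mult.commute)
  then show ?thesis by (simp add: sums_def_le)
qed

lemma symb_bc:
  assumes "r \<ge> 0"
  shows "symb (bc r) (\<lambda>x. (1 - x) powr r)"
proof -
  have l1: "ell1 (bc r)"
  proof (cases "r = 0")
    case True
    \<comment> \<open>For r = 0 the sequence is the unit of the convolution, to which the decay
      estimate does not apply.\<close>
    have "bc r k = 0" if "k > 0" for k using that True by (cases k) (auto simp: bc_def)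
    then show ?thesis unfolding ell1_def by (intro summable_finite[of "{0}"]) auto
  qed (use assms summable_bc in auto)
  show ?thesis unfolding symb_def
  proof (intro conjI ballI l1)
    fix x :: real assume "x \<in> {0<..<1}"
    then have "(\<lambda>n. (r gchoose n) * (- x)^n) sums (1 + - x) powr r"
      by (intro gen_binomial_real) auto
    then show "(\<lambda>k. bc r k * x ^ k) sums (1 - x) powr r"
      by (simp add: bc_def power_minus[of x] mult_ac)
  qed
qed

lemma wien_bc: "r \<ge> 0 \<Longrightarrow> wien (\<lambda>x. (1 - x) powr r) (norm1 (bc r))"
  unfolding wien_def using symb_bc by blast

section \<open>Double series and the substitution of (1 - x)/2\<close>

lemma infsum_nat_eq_suminf:
  fixes g :: "nat \<Rightarrow> 'a::banach"
  assumes "g summable_on UNIV"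
  shows "infsum g UNIV = suminf g"
  using assms has_sum_imp_sums has_sum_infsum sums_unique by blast

text \<open>Absolute summability gives unconditional summability over all index pairs, which may
  then be summed by columns or along antidiagonals. The first form lets series of translations
  commute, the second composes them.\<close>

lemma double_series:
  fixes f :: "nat \<Rightarrow> nat \<Rightarrow> 'a::banach"
  assumes A1: "\<And>k. summable (\<lambda>n. norm (f k n))"
    and A2: "summable (\<lambda>k. \<Sum>n. norm (f k n))"
  shows "(\<lambda>n. \<Sum>k. f k n) sums (\<Sum>k. \<Sum>n. f k n)"
    and "(\<lambda>N. \<Sum>i\<le>N. f i (N - i)) sums (\<Sum>k. \<Sum>n. f k n)"
proof -
  let ?F = "\<lambda>(k,n). f k n"
  have inner: "(\<lambda>n. norm (f k n)) summable_on UNIV" for k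
    using A1[of k] by (simp add: summable_on_UNIV_nonneg_real_iff)
  have abs: "(\<lambda>z. norm (?F z)) summable_on UNIV \<times> UNIV"
    unfolding Infinite_Sum.abs_summable_on_Sigma_iff
  proof (intro conjI ballI)
    have eq: "infsum (\<lambda>y. norm (f x y)) UNIV = (\<Sum>n. norm (f x n))" for x
      by (rule infsum_nat_eq_suminf[OF inner])
    show "(\<lambda>x. norm (infsum (\<lambda>y. norm (?F (x, y))) UNIV)) summable_on UNIV"
      using A2 by (simp add: eq summable_on_UNIV_nonneg_real_iff suminf_nonneg[OF A1])
  qed (use inner in simp)
  then have summ: "?F summable_on UNIV \<times> UNIV" by (rule Infinite_Sum.abs_summable_summable)
  have in1: "(\<lambda>n. f k n) summable_on UNIV" for k
    using A1 norm_summable_imp_summable_on by blast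
  have in2: "(\<lambda>k. f k n) summable_on UNIV" for n
  proof -
    have "?F summable_on (UNIV \<times> {n})" using summ by (rule summable_on_subset_banach) auto
    then have "(?F \<circ> (\<lambda>k. (k, n))) summable_on UNIV"
      by (subst summable_on_reindex[symmetric]) (auto simp: inj_on_def image_def times_eq_iff intro: arg_cong2[where f="(summable_on)", THEN iffD1, rotated] 
          elim!: back_subst[where P="\<lambda>A. _ summable_on A"])
    then show ?thesis by (simp add: o_def)
  qed
  have out1: "(\<lambda>k. infsum (f k) UNIV) summable_on UNIV"
    using summable_on_Sigma_banach[OF summ] by simp
  have val: "(\<Sum>k. \<Sum>n. f k n) = infsum ?F (UNIV \<times> UNIV)"
    using infsum_Sigma_banach[OF summ] out1 by (simp add: infsum_nat_eq_suminf in1)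
  have summ2: "(\<lambda>(n,k). f k n) summable_on UNIV \<times> UNIV"
    using summ by (subst summable_on_reindex_bij_witness[where i=prod.swap and j=prod.swap and T="UNIV \<times> UNIV" and h="?F"]) auto
  have out2: "(\<lambda>n. infsum (\<lambda>k. f k n) UNIV) summable_on UNIV"
    using summable_on_Sigma_banach[OF summ2] by simp
  have "infsum (\<lambda>n. infsum (\<lambda>k. f k n) UNIV) UNIV = infsum ?F (UNIV \<times> UNIV)"
    using infsum_swap_banach[OF summ] infsum_Sigma_banach[OF summ] by simp
  then show "(\<lambda>n. \<Sum>k. f k n) sums (\<Sum>k. \<Sum>n. f k n)"
    using has_sum_imp_sums[OF has_sum_infsum[OF out2]] val by (simp add: infsum_nat_eq_suminf in2)
  let ?G = "\<lambda>(N, i). f i (N - i)"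
  have bij: "bij_betw (\<lambda>(N, i). (i, N - i)) (Sigma UNIV (\<lambda>N. {..N})) (UNIV \<times> (UNIV :: nat set))"
    by (rule bij_betwI[where g="\<lambda>(i, j). (i + j, i)"]) auto
  have G: "?G = (\<lambda>z. ?F ((\<lambda>(N, i). (i, N - i)) z))" by (auto simp: fun_eq_iff)
  have summG: "?G summable_on (Sigma UNIV (\<lambda>N. {..N}))"
    unfolding G using summable_on_reindex_bij_betw[OF bij, of ?F] summ by simp
  have valG: "infsum ?G (Sigma UNIV (\<lambda>N. {..N})) = infsum ?F (UNIV \<times> UNIV)"
    unfolding G using infsum_reindex_bij_betw[OF bij, of ?F] by simp
  have "(\<lambda>N. infsum (\<lambda>i. f i (N - i)) {..N}) summable_on UNIV"
    using summable_on_Sigma_banach[OF summG] by simp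
  then show "(\<lambda>N. \<Sum>i\<le>N. f i (N - i)) sums (\<Sum>k. \<Sum>n. f k n)"
    using has_sum_imp_sums[OF has_sum_infsum] infsum_Sigma_banach[OF summG] valG val by fastforce
qed

text \<open>The coefficients of ((1 - x)/2)^k have absolute sum exactly 1, so the substitution does
  not increase the norm. Taylor expansions about x = 1 can thus be carried out inside the
  algebra.\<close>

lemma wien_half:
  assumes "ell1 b"
  shows "wien (\<lambda>x. \<Sum>k. b k * ((1 - x) / 2) ^ k) (norm1 b)"
proof -
  define p :: "nat \<Rightarrow> nat \<Rightarrow> real" where "p k n = (-1) ^ n * real (k choose n) / 2 ^ k" for k n
  have fin: "n \<notin> {..k} \<Longrightarrow> p k n = 0" for k n by (simp add: p_def)
  have pabs: "(\<lambda>n. \<bar>p k n\<bar>) sums 1" for k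
  proof -
    have "(\<Sum>n\<le>k. real (k choose n)) = 2 ^ k"
      using choose_row_sum[of k] by (metis of_nat_sum of_nat_numeral of_nat_power)
    then have "(\<Sum>n\<le>k. \<bar>p k n\<bar>) = 1" by (simp add: p_def abs_mult flip: sum_divide_distrib)
    with sums_finite[of "{..k}" "\<lambda>n. \<bar>p k n\<bar>"] fin show ?thesis by simp
  qed
  have pval: "(\<lambda>n. p k n * x ^ n) sums ((1 - x) / 2) ^ k" for k x
  proof -
    have "(1 - x) ^ k = (\<Sum>n\<le>k. real (k choose n) * (- x) ^ n)"
      using binomial_ring[of "- x" 1 k] by simp
    then have "((1 - x) / 2) ^ k = (\<Sum>n\<le>k. p k n * x ^ n)"
      by (simp add: p_def power_divide sum_divide_distrib power_minus[of x] mult_ac)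
    with sums_finite[of "{..k}" "\<lambda>n. p k n * x ^ n"] fin show ?thesis by simp
  qed
  define a where "a n = (\<Sum>k. b k * p k n)" for n
  have bs: "summable (\<lambda>k. \<bar>b k\<bar>)" using assms by (simp add: ell1_def)
  have pb: "\<bar>p k n\<bar> \<le> 1" for k n
    using sum_le_suminf[OF sums_summable[OF pabs[of k]], of "{n}"] sums_unique[OF pabs[of k]] by simp
  have sbp: "summable (\<lambda>k. \<bar>b k * p k n\<bar>)" for n
    by (rule summable_comparison_test'[OF bs, of 0]) (use pb in \<open>auto simp: abs_mult mult_left_le\<close>)
  have "(\<Sum>n<M. \<bar>a n\<bar>) \<le> norm1 b" for M
  proof -
    have "(\<Sum>n<M. \<bar>a n\<bar>) \<le> (\<Sum>n<M. \<Sum>k. \<bar>b k * p k n\<bar>)"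
      unfolding a_def by (intro sum_mono summable_rabs sbp)
    also have "\<dots> = (\<Sum>k. \<Sum>n<M. \<bar>b k * p k n\<bar>)" by (intro suminf_sum[symmetric] sbp)
    also have "\<dots> \<le> (\<Sum>k. \<bar>b k\<bar>)"
    proof (intro suminf_le bs summable_sum sbp)
      fix k
      have "(\<Sum>n<M. \<bar>b k * p k n\<bar>) = \<bar>b k\<bar> * (\<Sum>n<M. \<bar>p k n\<bar>)"
        by (simp add: abs_mult sum_distrib_left)
      also have "\<dots> \<le> \<bar>b k\<bar> * 1"
        using sum_le_suminf[OF sums_summable[OF pabs[of k]], of "{..<M}"] sums_unique[OF pabs[of k]]
        by (intro mult_left_mono) auto
      finally show "(\<Sum>n<M. \<bar>b k * p k n\<bar>) \<le> \<bar>b k\<bar>" by simp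
    qed
    finally show ?thesis by (simp add: norm1_def)
  qed
  note a = norm1_leI[OF this]
  have "symb a (\<lambda>x. \<Sum>k. b k * ((1 - x) / 2) ^ k)"
    unfolding symb_def
  proof (intro conjI ballI a)
    fix x :: real assume x: "x \<in> {0<..<1}"
    let ?f = "\<lambda>k n. b k * p k n * x ^ n"
    have xn: "x ^ n \<le> 1" "0 \<le> x ^ n" for n using x by (auto simp: power_le_one)
    have op_dominates: "norm (?f k n) \<le> \<bar>b k\<bar> * \<bar>p k n\<bar>" for k n
      using xn[of n] by (simp add: abs_mult mult_left_le)
    have s1: "summable (\<lambda>n. norm (?f k n))" for k
      by (rule summable_comparison_test'[where N=0, OF summable_mult[OF sums_summable[OF pabs[of k]]]])
         (use op_dominates in auto)
    have "(\<Sum>n. norm (?f k n)) \<le> \<bar>b k\<bar>" for k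
      using suminf_le[OF op_dominates s1 summable_mult[OF sums_summable[OF pabs[of k]]]]
        suminf_mult[OF sums_summable[OF pabs[of k]], of "\<bar>b k\<bar>"] sums_unique[OF pabs[of k]] by simp
    then have s2: "summable (\<lambda>k. \<Sum>n. norm (?f k n))"
      using suminf_nonneg[OF s1] by (intro summable_comparison_test'[where N=0, OF bs]) simp
    have "(\<lambda>n. \<Sum>k. ?f k n) sums (\<Sum>k. \<Sum>n. ?f k n)"
      by (rule double_series(1)[OF s1 s2])
    moreover have "(\<Sum>k. ?f k n) = a n * x ^ n" for n
      unfolding a_def by (rule suminf_mult2[symmetric]) (rule summable_rabs_cancel[OF sbp])
    moreover have "(\<Sum>n. ?f k n) = b k * ((1 - x) / 2) ^ k" for k
      using sums_unique[OF sums_mult[OF pval[of k x], of "b k"]] by (simp add: mult.assoc)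
    ultimately show "(\<lambda>n. a n * x ^ n) sums (\<Sum>k. b k * ((1 - x) / 2) ^ k)" by simp
  qed
  then show ?thesis using a by (auto simp: wien_def)
qed

lemma wien_power:
  assumes "wien F C"
  shows "wien (\<lambda>x. F x ^ k) (C ^ k)"
proof (induction k)
  case 0
  have "symb (bc 0) (\<lambda>x. 1)" by (rule symb_cong[OF symb_bc[of 0]]) auto
  moreover have "norm1 (bc 0) \<le> 1"
  proof (rule norm1_leI(2))
    fix N show "(\<Sum>k<N. \<bar>bc 0 k\<bar>) \<le> 1"
    proof -
      have "(\<Sum>k<N. \<bar>bc 0 k\<bar>) = (\<Sum>k<N. if k = 0 then 1 else 0)"
        by (intro sum.cong) (auto simp: bc_def gbinomial_0_left)
      then show ?thesis by simp
    qed
  qed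
  ultimately show ?case by (auto simp: wien_def)
next
  case (Suc k)
  then show ?case using wien_mult[OF assms Suc] by simp
qed

section \<open>Multipliers in the Wiener algebra\<close>

context
  fixes s :: real
  assumes s: "0 < s" "s < 1"
begin

text \<open>The coefficients of \<open>(1 - x) powr - s\<close>, which are not summable.\<close>

private definition A :: "nat \<Rightarrow> real" where "A k = bc (- s) k"

private lemma A0: "A 0 = 1" by (simp add: A_def bc_def)

private lemma A_Suc: "A (Suc k) = A k * ((real k + s) / (real k + 1))"
proof -
  have "A k = pochhammer s k / fact k" for k
    by (simp add: A_def bc_def gbinomial_pochhammer flip: power_mult_distrib)
  then show ?thesis by (simp add: pochhammer_Suc add.commute mult.commute)
qed

private lemma A_pos: "A k > 0"
  by (induction k) (use s in \<open>auto simp: A0 A_Suc\<close>)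

text \<open>The sums are coefficients of (1 - x)^(-s-1), whence the closed form. It is used to add
  up the contributions of the m residue classes.\<close>

private lemma sum_A: "(\<Sum>i<m. A i) = real m * A m / s"
proof (induction m)
  case (Suc m)
  have "(\<Sum>i<Suc m. A i) = real m * A m / s + A m" using Suc by simp
  also have "\<dots> = A m * (real m + s) / s" using s by (simp add: field_simps)
  also have "\<dots> = real (Suc m) * A (Suc m) / s" by (simp add: A_Suc add.commute)
  finally show ?case .
qed simp

text \<open>\<open>V\<close> decreases, \<open>U\<close> increases and \<open>U k\<close> stays
  below \<open>V (Suc k)\<close>, so both bounds hold with the limit L of \<open>V\<close>, which is
  1/Gamma(s). Having the same constant on both sides is what makes later differences
  telescope.\<close>

private lemma A_bounds: "\<exists>L. 0 \<le> L \<and> L \<le> 1 \<and> (\<forall>k. L * real (k + 1) powr (s - 1) \<le> A k) \<and>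
    (\<forall>k\<ge>1. A k \<le> L * real k powr (s - 1))"
proof -
  define V where "V k = A k * real (k + 1) powr (1 - s)" for k
  define U where "U k = A (Suc k) * real (k + 1) powr (1 - s)" for k
  \<comment> \<open>Bernoulli's inequality for exponents in [0, 1], from Young's inequality with
    weights t and 1 - t.\<close>
  have bern: "(1 + x) powr t \<le> 1 + t * x" if "x \<ge> 0" "0 \<le> t" "t \<le> 1" for x t :: real
  proof -
    have "(1 + x) powr t * 1 powr (1 - t) \<le> t * (1 + x) + (1 - t) * 1"
      by (rule Youngs_inequality_0) (use that in auto)
    then show ?thesis by (simp add: algebra_simps)
  qed
  have V: "V (Suc k) \<le> V k" for k
  proof -
    define x where "x = 1 / (real k + 1)"
    have x: "x > 0" by (simp add: x_def)
    have eq: "real (Suc k + 1) = real (k + 1) * (1 + x)" by (simp add: x_def field_simps)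
    have "(real k + s) / (real k + 1) = 1 - (1 - s) * x" by (simp add: x_def field_simps)
    then have "V (Suc k) = V k * ((1 - (1 - s) * x) * (1 + x) powr (1 - s))"
      unfolding V_def eq using x by (simp add: A_Suc powr_mult)
    also have "(1 - (1 - s) * x) * (1 + x) powr (1 - s) \<le> (1 - (1 - s) * x) * (1 + (1 - s) * x)"
      using s x by (intro mult_left_mono bern) (auto simp: x_def field_simps)
    also have "\<dots> = 1 - ((1 - s) * x)\<^sup>2" by (simp add: algebra_simps power2_eq_square)
    also have "\<dots> \<le> 1" by simp
    finally show ?thesis using A_pos[of k] by (simp add: V_def mult_left_le)
  qed
  have U: "U k \<le> U (Suc k)" for k
  proof -
    define x where "x = 1 / (real k + 1)"
    have x: "x > 0" by (simp add: x_def)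
    have eq: "real (Suc k + 1) = real (k + 1) * (1 + x)" by (simp add: x_def field_simps)
    have "1 + s * x = (real (Suc k) + s) * x" "1 + x = (real (Suc k) + 1) * x"
      by (simp_all add: x_def field_simps)
    then have "(real (Suc k) + s) / (real (Suc k) + 1) = (1 + s * x) / (1 + x)" using x by simp
    then have "U (Suc k) = U k * ((1 + s * x) / (1 + x) * (1 + x) powr (1 - s))"
      unfolding U_def eq A_Suc[of "Suc k"] using x by (simp add: powr_mult)
    also have "(1 + s * x) / (1 + x) * (1 + x) powr (1 - s) = (1 + s * x) / (1 + x) powr s"
      using x by (simp add: powr_diff)
    finally have eq2: "U (Suc k) = U k * ((1 + s * x) / (1 + x) powr s)" .
    have "1 \<le> (1 + s * x) / (1 + x) powr s" using bern[of x s] s x by simp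
    then have "U k * 1 \<le> U k * ((1 + s * x) / (1 + x) powr s)"
      using A_pos[of "Suc k"] by (intro mult_left_mono) (auto simp: U_def)
    then show ?thesis unfolding eq2 by simp
  qed
  have UV: "U k \<le> V (Suc k)" for k
    unfolding U_def V_def using A_pos[of "Suc k"] s by (intro mult_left_mono powr_mono2) auto
  have decV: "decseq V" using V by (simp add: decseq_Suc_iff)
  have incU: "incseq U" using U by (simp add: incseq_Suc_iff)
  have Vnn: "V k \<ge> 0" for k using A_pos[of k] by (simp add: V_def)
  obtain L where L: "V \<longlonglongrightarrow> L" "\<And>k. L \<le> V k"
    using decseq_convergent[OF decV, of 0] Vnn by blast
  have "L \<le> V 0" by (rule L)
  then have "L \<le> 1" by (simp add: V_def A0)
  moreover have "0 \<le> L" using L(1) Vnn by (intro LIMSEQ_le_const) auto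
  moreover have "U k \<le> L" for k
  proof (rule LIMSEQ_le_const[OF L(1)], intro exI[of _ "Suc k"] allI impI)
    fix n assume "Suc k \<le> n"
    then have "U k \<le> U (n - 1)" using incU by (auto simp: incseq_def)
    also have "\<dots> \<le> V n" using UV[of "n - 1"] \<open>Suc k \<le> n\<close> by simp
    finally show "U k \<le> V n" .
  qed
  moreover have "L * real (k + 1) powr (s - 1) \<le> A k" for k
  proof -
    have "L * real (k + 1) powr (s - 1) \<le> V k * real (k + 1) powr (s - 1)"
      using L(2) by (intro mult_right_mono) auto
    also have "\<dots> = A k" by (simp add: V_def mult.assoc flip: powr_add)
    finally show ?thesis .
  qed
  moreover have "A k \<le> L * real k powr (s - 1)" if "k \<ge> 1" for k
  proof -
    have "A k = U (k - 1) * real k powr (s - 1)" using that by (simp add: U_def mult.assoc flip: powr_add)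
    also have "\<dots> \<le> L * real k powr (s - 1)"
      using \<open>\<And>k. U k \<le> L\<close> by (intro mult_right_mono) auto
    finally show ?thesis .
  qed
  ultimately show ?thesis by blast
qed

text \<open>Coefficient form of (1 - x)^s (1 - x)^(-s) = 1, by Vandermonde's convolution; the
  product rule for symbols does not cover the second factor, which is not summable.\<close>

private lemma cauchy_bc_A: "(\<Sum>j\<le>J. bc s j * A (J - j)) = (if J = 0 then 1 else 0)"
proof -
  have "(\<Sum>j\<le>J. bc s j * A (J - j)) = (-1) ^ J * (\<Sum>j\<le>J. (s gchoose j) * (- s gchoose (J - j)))"
    unfolding sum_distrib_left
  proof (intro sum.cong refl)
    fix j assume "j \<in> {..J}"
    then have "(-1::real) ^ J = (-1) ^ j * (-1) ^ (J - j)" by (simp flip: power_add)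
    then show "bc s j * A (J - j) = (-1) ^ J * ((s gchoose j) * (- s gchoose (J - j)))"
      by (simp add: A_def bc_def)
  qed
  also have "(\<Sum>j\<le>J. (s gchoose j) * (- s gchoose (J - j))) = (s + - s gchoose J)"
    by (simp add: atMost_atLeast0 gbinomial_Vandermonde)
  also have "\<dots> = (if J = 0 then 1 else 0)" by (simp add: gbinomial_0_left)
  finally show ?thesis by simp
qed

text \<open>With K = m^(s-1), both \<open>A (J * m + i)\<close> and K times \<open>A J\<close> lie
  between L K (J + 1)^(s-1) and L K J^(s-1) when J is at least 1. Their distances are therefore
  dominated by a telescoping sum; the term J = 0 adds A i + K.\<close>

private lemma d_bound:
  assumes "m > 0" "i < m"
  shows "ell1 (\<lambda>J. A (J * m + i) - real m powr (s - 1) * A J)"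
    and "norm1 (\<lambda>J. A (J * m + i) - real m powr (s - 1) * A J) \<le> A i + 2 * real m powr (s - 1)"
proof -
  obtain L where L: "0 \<le> L" "L \<le> 1" "\<And>k. L * real (k + 1) powr (s - 1) \<le> A k"
    "\<And>k. k \<ge> 1 \<Longrightarrow> A k \<le> L * real k powr (s - 1)" using A_bounds by blast
  define K where "K = real m powr (s - 1)"
  have K: "K > 0" using assms by (simp add: K_def)
  let ?d = "\<lambda>J. A (J * m + i) - K * A J"
  have d: "\<bar>?d J\<bar> \<le> L * K * (real J powr (s - 1) - real (J + 1) powr (s - 1))" if J: "J \<ge> 1" for J
  proof -
    have "A (J * m + i) \<le> L * real (J * m + i) powr (s - 1)" using J assms by (intro L) (simp add: Suc_leI)
    also have "\<dots> \<le> L * real (J * m) powr (s - 1)"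
      using L(1) s J assms by (intro mult_left_mono powr_mono2') auto
    finally have 1: "A (J * m + i) \<le> L * K * real J powr (s - 1)"
      by (simp add: K_def powr_mult mult_ac)
    have "real (J * m + i + 1) \<le> real ((J + 1) * m)"
      using assms by (intro of_nat_mono) simp
    then have "L * real ((J + 1) * m) powr (s - 1) \<le> L * real (J * m + i + 1) powr (s - 1)"
      using L(1) s \<open>real (J * m + i + 1) \<le> _\<close> by (intro mult_left_mono powr_mono2') (simp_all add: add_nonneg_pos del: of_nat_mult)
    also have "\<dots> \<le> A (J * m + i)" by (rule L)
    finally have 2: "L * K * real (J + 1) powr (s - 1) \<le> A (J * m + i)"
      by (simp only: K_def powr_mult of_nat_mult of_nat_0_le_iff mult_ac)
    have 3: "K * A J \<le> L * K * real J powr (s - 1)"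
      using mult_left_mono[OF L(4)[OF J], of K] K by (simp add: mult_ac)
    have 4: "L * K * real (J + 1) powr (s - 1) \<le> K * A J"
      using mult_left_mono[OF L(3)[of J], of K] K by (simp add: mult_ac)
    show ?thesis unfolding right_diff_distrib using 1 2 3 4 by linarith
  qed
  have partial: "(\<Sum>J<Suc N. \<bar>?d J\<bar>) \<le> A i + K + L * K * (1 - real (N + 1) powr (s - 1))" for N
  proof (induction N)
    case 0
    have "\<bar>?d 0\<bar> \<le> A i + K" using A_pos[of i] K by (simp add: A0)
    then show ?case by simp
  next
    case (Suc N)
    then show ?case using d[of "Suc N"] by (simp add: algebra_simps)
  qed
  have "(\<Sum>J<N. \<bar>?d J\<bar>) \<le> A i + 2 * K" for N
  proof -
    have "(\<Sum>J<N. \<bar>?d J\<bar>) \<le> (\<Sum>J<Suc N. \<bar>?d J\<bar>)" by simp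
    also have "\<dots> \<le> A i + K + L * K * (1 - real (N + 1) powr (s - 1))" by (rule partial)
    also have "L * K * (1 - real (N + 1) powr (s - 1)) \<le> 1 * K * 1"
      using L K s powr_mono2'[of "1 - s" 1 "real (N + 1)"] powr_mono[of "s - 1" 0 "real (N + 1)"]
      by (intro mult_mono) auto
    finally show ?thesis by simp
  qed
  note n = norm1_leI[OF this]
  show "ell1 (\<lambda>J. A (J * m + i) - real m powr (s - 1) * A J)" using n(1) by (simp add: K_def)
  show "norm1 (\<lambda>J. A (J * m + i) - real m powr (s - 1) * A J) \<le> A i + 2 * real m powr (s - 1)"
    using n(2) by (simp add: K_def)
qed

text \<open>The dilated sequence lives on multiples of m, so a coefficient of the product sees only
  one residue class of A. Replacing that class by m^(s-1) times A itself gives a unit sequence, and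
  only the summable error of the preceding lemma remains.\<close>

private lemma cauchy_dil:
  assumes "m > 0" "i < m"
  shows "cauchy (dil m (bc s)) A (J * m + i) =
     (if J = 0 then real m powr (s - 1) else 0) + cauchy (bc s) (\<lambda>J. A (J * m + i) - real m powr (s - 1) * A J) J"
proof -
  have "cauchy (dil m (bc s)) A (J * m + i) = (\<Sum>n\<in>(\<lambda>j. j * m) ` {..J}. bc s (n div m) * A (J * m + i - n))"
    unfolding cauchy_def
  proof (rule sum.mono_neutral_cong_right)
    show "\<forall>n\<in>{..J * m + i} - (\<lambda>j. j * m) ` {..J}. dil m (bc s) n * A (J * m + i - n) = 0"
    proof
      fix n assume n: "n \<in> {..J * m + i} - (\<lambda>j. j * m) ` {..J}"
      have "\<not> m dvd n"
      proof
        assume "m dvd n"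
        then obtain j where j: "n = j * m" by (metis dvd_def mult.commute)
        then have "j * m < (J + 1) * m" using n assms by simp
        then have "j \<le> J" using mult_less_cancel2 by (metis Suc_eq_plus1 less_Suc_eq_le)
        then show False using n j by auto
      qed
      then show "dil m (bc s) n * A (J * m + i - n) = 0" by (simp add: dil_def)
    qed
  qed (use assms in \<open>auto simp: dil_def intro: trans_le_add1\<close>)
  also have "\<dots> = (\<Sum>j\<le>J. bc s j * A (J * m + i - j * m))"
    using assms by (subst sum.reindex) (auto simp: inj_on_def)
  also have "\<dots> = (\<Sum>j\<le>J. bc s j * A ((J - j) * m + i))"
    by (intro sum.cong refl) (simp add: diff_mult_distrib)
  also have "\<dots> = (\<Sum>j\<le>J. bc s j * (real m powr (s - 1) * A (J - j)) + bc s j * (A ((J - j) * m + i) - real m powr (s - 1) * A (J - j)))"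
    by (intro sum.cong refl) (simp add: algebra_simps)
  also have "\<dots> = real m powr (s - 1) * (\<Sum>j\<le>J. bc s j * A (J - j)) + cauchy (bc s) (\<lambda>J. A (J * m + i) - real m powr (s - 1) * A J) J"
    by (simp add: sum.distrib cauchy_def sum_distrib_left mult_ac)
  also have "real m powr (s - 1) * (\<Sum>j\<le>J. bc s j * A (J - j)) = (if J = 0 then real m powr (s - 1) else 0)"
    by (simp add: cauchy_bc_A)
  finally show ?thesis .
qed

text \<open>Summed along residue classes, class i costs K + |bc s| (A i + 2K) with K = m^(s-1). The
  m classes together cost a multiple of m^s, because m K = m^s and the A i below m add up to m A m /
  s, with A m at most K.\<close>

lemma wien_geometric_frac:
  assumes m: "m > 0"
  shows "wien (\<lambda>x. ((1 - x ^ m) / (1 - x)) powr s) ((1 + norm1 (bc s) * (1 / s + 2)) * real m powr s)"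
proof -
  let ?c = "cauchy (dil m (bc s)) A"
  let ?K = "real m powr (s - 1)"
  have lbc: "ell1 (bc s)" using s summable_bc by auto
  have Km: "real m * ?K = real m powr s" using m by (simp add: powr_diff)
  have B: "norm1 (bc s) \<ge> 0" using norm1_nonneg lbc by auto
  have row: "(\<Sum>J<M. \<bar>?c (J * m + i)\<bar>) \<le> ?K + norm1 (bc s) * (A i + 2 * ?K)" if i: "i < m" for i M
  proof -
    let ?d = "\<lambda>J. A (J * m + i) - ?K * A J"
    note dd = d_bound[OF m i]
    note cc = ell1_cauchy[OF lbc dd(1)]
    have "(\<Sum>J<M. \<bar>?c (J * m + i)\<bar>) \<le> (\<Sum>J<M. (if J = 0 then ?K else 0) + \<bar>cauchy (bc s) ?d J\<bar>)"
      unfolding cauchy_dil[OF m i] by (intro sum_mono order_trans[OF abs_triangle_ineq]) simp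
    also have "\<dots> = (\<Sum>J<M. (if J = 0 then ?K else 0)) + (\<Sum>J<M. \<bar>cauchy (bc s) ?d J\<bar>)"
      by (rule sum.distrib)
    also have "(\<Sum>J<M. (if J = 0 then ?K else 0)) \<le> ?K" by simp
    also have "(\<Sum>J<M. \<bar>cauchy (bc s) ?d J\<bar>) \<le> norm1 (cauchy (bc s) ?d)"
      using cc(1) unfolding norm1_def ell1_def by (intro sum_le_suminf) auto
    also have "\<dots> \<le> norm1 (bc s) * norm1 ?d" by (rule cc)
    also have "\<dots> \<le> norm1 (bc s) * (A i + 2 * ?K)" by (intro mult_left_mono dd B)
    finally show ?thesis by simp
  qed
  have Am: "A m \<le> ?K"
  proof -
    obtain L where L: "0 \<le> L" "L \<le> 1" "\<And>k. k \<ge> 1 \<Longrightarrow> A k \<le> L * real k powr (s - 1)" using A_bounds by blast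
    have "A m \<le> L * ?K" using L(3) m by simp
    also have "\<dots> \<le> ?K" using L by (simp add: mult_left_le_one_le)
    finally show ?thesis .
  qed
  have "(\<Sum>n<N. \<bar>?c n\<bar>) \<le> (1 + norm1 (bc s) * (1 / s + 2)) * real m powr s" for N
  proof -
    have "(\<Sum>n<N. \<bar>?c n\<bar>) \<le> (\<Sum>n<N * m. \<bar>?c n\<bar>)" using m by (intro sum_mono2) auto
    also have "\<dots> = (\<Sum>J<N. \<Sum>n\<in>{J * m..<J * m + m}. \<bar>?c n\<bar>)"
      by (rule sum.nat_group[symmetric])
    also have "\<dots> = (\<Sum>J<N. \<Sum>i<m. \<bar>?c (J * m + i)\<bar>)"
    proof (rule sum.cong[OF refl])
      fix J
      show "(\<Sum>n\<in>{J * m..<J * m + m}. \<bar>?c n\<bar>) = (\<Sum>i<m. \<bar>?c (J * m + i)\<bar>)"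
        by (rule sum.reindex_bij_witness[where i="\<lambda>i. J * m + i" and j="\<lambda>n. n - J * m"]) auto
    qed
    also have "\<dots> = (\<Sum>i<m. \<Sum>J<N. \<bar>?c (J * m + i)\<bar>)" by (rule sum.swap)
    also have "\<dots> \<le> (\<Sum>i<m. ?K + norm1 (bc s) * (A i + 2 * ?K))" by (intro sum_mono row) auto
    also have "\<dots> = real m * ?K + norm1 (bc s) * ((\<Sum>i<m. A i) + 2 * (real m * ?K))"
      by (simp add: sum.distrib distrib_left mult_ac flip: sum_distrib_left sum_distrib_right)
    also have "\<dots> \<le> real m * ?K + norm1 (bc s) * (real m * ?K / s + 2 * (real m * ?K))"
      unfolding sum_A using Am B s by (intro add_mono mult_left_mono divide_right_mono) auto
    also have "\<dots> = (1 + norm1 (bc s) * (1 / s + 2)) * real m powr s"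
      unfolding Km by (simp add: algebra_simps)
    finally show ?thesis .
  qed
  note c = norm1_leI[OF this]
  have "symb ?c (\<lambda>x. ((1 - x ^ m) / (1 - x)) powr s)"
    unfolding symb_def
  proof (intro conjI ballI c)
    fix x :: real assume x: "x \<in> {0<..<1}"
    have b1: "(\<lambda>k. A k * x ^ k) sums (1 - x) powr (- s)"
      using gen_binomial_real[of "- x" "- s"] x by (simp add: A_def bc_def power_minus[of x] mult_ac)
    have d1: "ell1 (dil m (bc s))" "(\<lambda>k. dil m (bc s) k * x ^ k) sums (1 - x ^ m) powr s"
      using symb_dil[OF symb_bc m, of s] x s by (auto simp: symb_def)
    have n1: "summable (\<lambda>k. norm (dil m (bc s) k * x ^ k))"
      by (rule summable_comparison_test'[where N=0 and g="\<lambda>k. \<bar>dil m (bc s) k\<bar>"])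
         (use d1 x in \<open>auto simp: ell1_def abs_mult mult_left_le power_le_one\<close>)
    have n2: "summable (\<lambda>k. norm (A k * x ^ k))"
      using b1 A_pos x by (simp add: abs_mult sums_summable less_imp_le)
    have "(\<lambda>k. \<Sum>i\<le>k. (dil m (bc s) i * x ^ i) * (A (k - i) * x ^ (k - i))) sums
            ((\<Sum>k. dil m (bc s) k * x ^ k) * (\<Sum>k. A k * x ^ k))"
      by (rule Cauchy_product_sums[OF n1 n2])
    also have "(\<Sum>k. dil m (bc s) k * x ^ k) * (\<Sum>k. A k * x ^ k) = ((1 - x ^ m) / (1 - x)) powr s"
      using sums_unique[OF b1] sums_unique[OF d1(2)] x
      by (simp add: powr_minus powr_divide power_le_one field_simps)
    also have "(\<lambda>k. \<Sum>i\<le>k. (dil m (bc s) i * x ^ i) * (A (k - i) * x ^ (k - i))) = (\<lambda>k. ?c k * x ^ k)"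
    proof
      fix k
      have "(dil m (bc s) i * x ^ i) * (A (k - i) * x ^ (k - i)) = dil m (bc s) i * A (k - i) * x ^ k" if "i \<le> k" for i
        using that power_add[of x i "k - i"] by (simp add: mult_ac)
      then show "(\<Sum>i\<le>k. (dil m (bc s) i * x ^ i) * (A (k - i) * x ^ (k - i))) = ?c k * x ^ k"
        unfolding cauchy_def sum_distrib_right by (intro sum.cong) auto
    qed
    finally show "(\<lambda>k. ?c k * x ^ k) sums ((1 - x ^ m) / (1 - x)) powr s" .
  qed
  then show ?thesis using c by (auto simp: wien_def)
qed

end

text \<open>The integer part of alpha is a power of the polynomial 1 + x + ... + x^(m-1), of norm m;
  only the fractional part needs the cancellation argument. The two bounds multiply to
  m^alpha.\<close>

lemma wien_geometric:
  assumes "\<alpha> > 0"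
  shows "\<exists>C>0. \<forall>m>0. wien (\<lambda>x. ((1 - x ^ m) / (1 - x)) powr \<alpha>) (C * real m powr \<alpha>)"
proof -
  define k where "k = nat \<lfloor>\<alpha>\<rfloor>"
  define s where "s = \<alpha> - real k"
  have ks: "\<alpha> = real k + s" "0 \<le> s" "s < 1" unfolding s_def k_def using assms by linarith+
  have one: "wien (\<lambda>x. (1 - x ^ m) / (1 - x)) (real m)" if "m > 0" for m
  proof -
    define a where "a = (\<lambda>k. if k < m then 1 else (0::real))"
    have fin: "(\<lambda>k. \<bar>a k\<bar>) sums (\<Sum>k<m. \<bar>a k\<bar>)" by (rule sums_finite) (auto simp: a_def)
    have "symb a (\<lambda>x. (1 - x ^ m) / (1 - x))" unfolding symb_def
    proof (intro conjI ballI)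
      show "ell1 a" using fin by (auto simp: ell1_def sums_iff)
      fix x :: real assume x: "x \<in> {0<..<1}"
      have "(\<lambda>k. a k * x ^ k) sums (\<Sum>k<m. a k * x ^ k)" by (rule sums_finite) (auto simp: a_def)
      also have "(\<Sum>k<m. a k * x ^ k) = (1 - x ^ m) / (1 - x)"
        using x sum_gp_strict[of x m] by (simp add: a_def)
      finally show "(\<lambda>k. a k * x ^ k) sums ((1 - x ^ m) / (1 - x))" .
    qed
    moreover have "norm1 a \<le> real m" using sums_unique[OF fin] by (simp add: norm1_def a_def)
    ultimately show ?thesis by (auto simp: wien_def)
  qed
  have pow: "y powr \<alpha> = y ^ k * y powr s" if "y > 0" for y :: real
    using that ks(1) by (simp add: powr_add powr_realpow)
  have pos: "0 < (1 - x ^ m) / (1 - x)" if "0 < x" "x < 1" "m > 0" for x :: real and m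
    using that by (simp add: power_less_one_iff)
  show ?thesis
  proof (cases "s = 0")
    case True
    have "wien (\<lambda>x. ((1 - x ^ m) / (1 - x)) powr \<alpha>) (1 * real m powr \<alpha>)" if "m > 0" for m
      using wien_power[OF one[OF that], of k]
      by (rule wien_cong[OF wien_mono]) (use that pos[OF _ _ that] pow True in auto)
    then show ?thesis by (intro exI[of _ 1]) auto
  next
    case False
    then have s: "0 < s" using ks by auto
    let ?C = "1 + norm1 (bc s) * (1 / s + 2)"
    have "?C > 0" using s norm1_nonneg[OF summable_bc[OF s]] by (intro add_pos_nonneg mult_nonneg_nonneg) auto
    moreover have "wien (\<lambda>x. ((1 - x ^ m) / (1 - x)) powr \<alpha>) (?C * real m powr \<alpha>)" if "m > 0" for m
      using wien_mult[OF wien_power[OF one[OF that], of k] wien_geometric_frac[OF s ks(3) that]]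
      by (rule wien_cong[OF wien_mono]) (use that pos[OF _ _ that] pow in \<open>auto simp: mult_ac\<close>)
    ultimately show ?thesis by blast
  qed
qed

text \<open>With \<open>w = (1 - x) / 2\<close> one has \<open>(1 + x) / 2 = 1 - w\<close>, and \<open>w\<close> has norm 1 in the algebra,
  so Taylor remainders in \<open>w\<close> at \<open>w = 0\<close> (that is, at \<open>x = 1\<close>) stay in the algebra.\<close>

lemma wien_marchaud:
  assumes "\<alpha> > 0"
  shows "\<exists>R C. wien R C \<and> (\<forall>x\<in>{0<..<1}. (1 - x) powr \<alpha> = 2 powr (- \<alpha>) * (1 - x ^ 2) powr \<alpha> + (1 - x) powr (\<alpha> + 1) * R x)"
proof -
  \<comment> \<open>From 1 - x = 2w and 1 - x^2 = (1 - x) * 2 * (1 - w) the remainder is (1 - (1 -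
    w)^alpha) / (2w): the binomial series shifted by one place, with factor -1/2.\<close>
  define b where "b = (\<lambda>k. - (1/2) * bc \<alpha> (Suc k))"
  have "ell1 b" using summable_bc[OF assms] summable_Suc_iff[of "\<lambda>k. \<bar>bc \<alpha> k\<bar>"]
    unfolding b_def by (intro ell1_cmult) (simp add: ell1_def)
  from wien_half[OF this] have w: "wien (\<lambda>x. \<Sum>k. b k * ((1 - x) / 2) ^ k) (norm1 b)" .
  have "(1 - x) powr \<alpha> = 2 powr (- \<alpha>) * (1 - x ^ 2) powr \<alpha> + (1 - x) powr (\<alpha> + 1) * (\<Sum>k. b k * ((1 - x) / 2) ^ k)"
    if x: "x \<in> {0<..<1}" for x
  proof -
    define w where "w = (1 - x) / 2"
    have w: "0 < w" "w < 1" using x by (auto simp: w_def)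
    have "(\<lambda>k. bc \<alpha> k * w ^ k) sums (1 - w) powr \<alpha>"
      using symb_bc[of \<alpha>] assms w by (auto simp: symb_def)
    then have "(\<lambda>k. bc \<alpha> (Suc k) * w ^ Suc k) sums ((1 - w) powr \<alpha> - bc \<alpha> 0 * w ^ 0)"
      by (subst sums_Suc_iff) simp
    then have "(\<lambda>k. - (1 / (2 * w)) * (bc \<alpha> (Suc k) * w ^ Suc k)) sums (- (1 / (2 * w)) * ((1 - w) powr \<alpha> - 1))"
      by (intro sums_mult) (simp add: bc_def)
    also have "(\<lambda>k. - (1 / (2 * w)) * (bc \<alpha> (Suc k) * w ^ Suc k)) = (\<lambda>k. b k * w ^ k)"
      using w by (simp add: b_def)
    also have "- (1 / (2 * w)) * ((1 - w) powr \<alpha> - 1) = (1 - (1 - w) powr \<alpha>) / (2 * w)"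
      by (simp add: diff_divide_distrib)
    finally have R: "(\<Sum>k. b k * w ^ k) = (1 - (1 - w) powr \<alpha>) / (2 * w)"
      by (simp add: sums_iff)
    have 1: "1 - x ^ 2 = (1 - x) * (2 * (1 - w))" by (simp add: w_def power2_eq_square field_simps)
    have "2 powr (- \<alpha>) * (1 - x ^ 2) powr \<alpha> = (1 - x) powr \<alpha> * (1 - w) powr \<alpha> * (2 powr (- \<alpha>) * 2 powr \<alpha>)"
      unfolding 1 by (simp only: powr_mult mult_ac)
    also have "2 powr (- \<alpha>) * 2 powr \<alpha> = 1" by (simp flip: powr_add)
    finally have 2: "2 powr (- \<alpha>) * (1 - x ^ 2) powr \<alpha> = (1 - x) powr \<alpha> * (1 - w) powr \<alpha>" by simp
    have "(1 - x) powr (\<alpha> + 1) * ((1 - (1 - w) powr \<alpha>) / (2 * w)) = (1 - x) powr \<alpha> * (1 - (1 - w) powr \<alpha>)"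
    proof -
      have "(1 - x) powr (\<alpha> + 1) = (1 - x) powr \<alpha> * (2 * w)" using x by (simp add: powr_add w_def)
      then show ?thesis using w by simp
    qed
    then show ?thesis unfolding w_def[symmetric] R 2 by (simp add: algebra_simps)
  qed
  with w show ?thesis by blast
qed

text \<open>The correction coefficients q are found one at a time: each new term is chosen so that
  the sum vanishes to one order more at w = 0, which permits one more division by w.\<close>

lemma half_cancellation:
  assumes r: "r > 0"
  shows "N \<ge> 1 \<Longrightarrow> \<exists>q b. q 0 = 1 \<and> ell1 b \<and> (\<forall>w\<in>{0<..<1/2}.
     (\<lambda>k. b k * w ^ k) sums ((\<Sum>k<N. q k * (2 * w) ^ k * (1 - 2 ^ k * (1 - w) powr (r + real k))) / w ^ N))"
proof (induction N rule: nat_induct_at_least)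
  case base
  let ?b = "\<lambda>k. - bc r (Suc k)"
  have "ell1 ?b" using summable_bc[OF r] summable_Suc_iff[of "\<lambda>k. \<bar>bc r k\<bar>"]
    by (simp add: ell1_def)
  moreover have "(\<lambda>k. ?b k * w ^ k) sums ((1 - (1 - w) powr r) / w)" if w: "w \<in> {0<..<1/2}" for w :: real
  proof -
    have "(\<lambda>k. bc r k * w ^ k) sums (1 - w) powr r" using symb_bc[of r] r w by (auto simp: symb_def)
    then have "(\<lambda>k. bc r (Suc k) * w ^ Suc k) sums ((1 - w) powr r - bc r 0 * w ^ 0)"
      by (subst sums_Suc_iff) simp
    then have "(\<lambda>k. - (1 / w) * (bc r (Suc k) * w ^ Suc k)) sums (- (1 / w) * ((1 - w) powr r - 1))"
      by (intro sums_mult) (simp add: bc_def)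
    also have "(\<lambda>k. - (1 / w) * (bc r (Suc k) * w ^ Suc k)) = (\<lambda>k. ?b k * w ^ k)" using w by auto
    also have "- (1 / w) * ((1 - w) powr r - 1) = (1 - (1 - w) powr r) / w" by (simp add: diff_divide_distrib)
    finally show ?thesis .
  qed
  ultimately show ?case by (intro exI[of _ "\<lambda>_. 1"] exI[of _ ?b]) auto
next
  case (Suc N)
  then obtain q b where q: "q 0 = 1" "ell1 b" and b: "\<And>w. w \<in> {0<..<1/2} \<Longrightarrow>
     (\<lambda>k. b k * w ^ k) sums ((\<Sum>k<N. q k * (2 * w) ^ k * (1 - 2 ^ k * (1 - w) powr (r + real k))) / w ^ N)"
    by blast
  \<comment> \<open>The new term contributes t * 2^N * (1 - 2^N) to the constant coefficient, so
    this t cancels b 0. The denominator is nonzero since N is at least 1.\<close>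
  define t where "t = b 0 / (2 ^ N * (2 ^ N - 1))"
  define q' where "q' = q(N := t)"
  define c where "c k = b k + t * 2 ^ N * (bc 0 k + - (2 ^ N) * bc (r + real N) k)" for k
  have two: "(2::real) ^ N > 1" using Suc by simp
  have rN: "r + real N > 0" using r by linarith
  have l0: "ell1 (bc 0)" using symb_bc[of 0] symb_ell1 by auto
  have ellc: "ell1 c" unfolding c_def
    by (intro ell1_add q ell1_cmult l0 summable_bc rN)
  have c0: "c 0 = 0" using two by (simp add: c_def t_def bc_def field_simps)
  let ?S = "\<lambda>w. (\<Sum>k<N. q k * (2 * w) ^ k * (1 - 2 ^ k * (1 - w) powr (r + real k)))"
  have cs: "(\<lambda>k. c k * w ^ k) sums (?S w / w ^ N + t * 2 ^ N * (1 - 2 ^ N * (1 - w) powr (r + real N)))"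
    if w: "w \<in> {0<..<1/2}" for w
  proof -
    have 1: "(\<lambda>k. bc (r + real N) k * w ^ k) sums (1 - w) powr (r + real N)"
      using symb_bc[of "r + real N"] rN w by (auto simp: symb_def)
    have 2: "(\<lambda>k. bc 0 k * w ^ k) sums 1"
      using symb_bc[of 0] w by (auto simp: symb_def)
    have "(\<lambda>k. b k * w ^ k + t * 2 ^ N * (bc 0 k * w ^ k + - (2 ^ N) * (bc (r + real N) k * w ^ k))) sums
      (?S w / w ^ N + t * 2 ^ N * (1 + - (2 ^ N) * (1 - w) powr (r + real N)))"
      by (intro sums_add sums_mult b w 1 2)
    then show ?thesis by (simp add: c_def algebra_simps)
  qed
  have "(\<lambda>k. c (Suc k) * w ^ k) sums ((\<Sum>k<Suc N. q' k * (2 * w) ^ k * (1 - 2 ^ k * (1 - w) powr (r + real k))) / w ^ Suc N)"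
    if w: "w \<in> {0<..<1/2}" for w
  proof -
    have "(\<lambda>k. c (Suc k) * w ^ Suc k) sums (?S w / w ^ N + t * 2 ^ N * (1 - 2 ^ N * (1 - w) powr (r + real N)))"
      using cs[OF w] c0 by (subst sums_Suc_iff) simp
    then have "(\<lambda>k. (1 / w) * (c (Suc k) * w ^ Suc k)) sums ((1 / w) * (?S w / w ^ N + t * 2 ^ N * (1 - 2 ^ N * (1 - w) powr (r + real N))))"
      by (rule sums_mult)
    also have "(\<lambda>k. (1 / w) * (c (Suc k) * w ^ Suc k)) = (\<lambda>k. c (Suc k) * w ^ k)" using w by auto
    also have "(1 / w) * (?S w / w ^ N + t * 2 ^ N * (1 - 2 ^ N * (1 - w) powr (r + real N)))
       = (?S w + t * (2 * w) ^ N * (1 - 2 ^ N * (1 - w) powr (r + real N))) / w ^ Suc N"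
      using w by (simp add: add_divide_distrib power_mult_distrib distrib_left)
    also have "?S w + t * (2 * w) ^ N * (1 - 2 ^ N * (1 - w) powr (r + real N)) =
        (\<Sum>k<Suc N. q' k * (2 * w) ^ k * (1 - 2 ^ k * (1 - w) powr (r + real k)))"
      by (simp add: q'_def)
    finally show ?thesis .
  qed
  moreover have "ell1 (\<lambda>k. c (Suc k))" using ellc summable_Suc_iff[of "\<lambda>k. \<bar>c k\<bar>"] by (simp add: ell1_def)
  moreover have "q' 0 = 1" using q Suc by (simp add: q'_def)
  ultimately show ?case by blast
qed

text \<open>Doubling the step of a translation is the passage from x to x^2. Thus the corrected
  symbol, divided by the r-th power of the step, changes under doubling only by a multiple of (1 -
  x)^(r + N).\<close>

lemma wien_telescope:
  assumes r: "r > 0" and N: "N \<ge> 1"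
  shows "\<exists>q R C. q 0 = 1 \<and> wien R C \<and> (\<forall>x\<in>{0<..<1}.
     (\<Sum>k<N. q k * (1 - x) powr (r + real k)) - 2 powr (- r) * (\<Sum>k<N. q k * (1 - x ^ 2) powr (r + real k))
       = (1 - x) powr (r + real N) * R x)"
proof -
  obtain q b where q: "q 0 = 1" "ell1 b" and b: "\<And>w. w \<in> {0<..<1/2} \<Longrightarrow>
     (\<lambda>k. b k * w ^ k) sums ((\<Sum>k<N. q k * (2 * w) ^ k * (1 - 2 ^ k * (1 - w) powr (r + real k))) / w ^ N)"
    using half_cancellation[OF r N] by blast
  let ?R = "\<lambda>x. (1 / 2 ^ N) * (\<Sum>k. b k * ((1 - x) / 2) ^ k)"
  have "(\<Sum>k<N. q k * (1 - x) powr (r + real k)) - 2 powr (- r) * (\<Sum>k<N. q k * (1 - x ^ 2) powr (r + real k))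
       = (1 - x) powr (r + real N) * ?R x" if x: "x \<in> {0<..<1}" for x
  proof -
    define w where "w = (1 - x) / 2"
    have w: "w \<in> {0<..<1/2}" "1 - w > 0" "1 - x = 2 * w" using x by (auto simp: w_def)
    have 1: "1 - x ^ 2 = (1 - x) * (2 * (1 - w))" by (simp add: w_def power2_eq_square field_simps)
    have e: "2 powr (- r) * (1 - x ^ 2) powr (r + real k) = (1 - x) powr r * ((2 * w) ^ k * (2 ^ k * (1 - w) powr (r + real k)))" for k
    proof -
      have "2 powr (- r) * (1 - x ^ 2) powr (r + real k) = (2 powr (- r) * 2 powr (r + real k)) * ((1 - x) powr (r + real k) * (1 - w) powr (r + real k))"
        unfolding 1 by (simp only: powr_mult mult_ac)
      also have "2 powr (- r) * 2 powr (r + real k) = 2 ^ k" by (simp add: powr_realpow flip: powr_add)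
      also have "(1 - x) powr (r + real k) = (1 - x) powr r * (2 * w) ^ k"
        using x w by (simp add: powr_add powr_realpow)
      finally show ?thesis by (simp add: mult_ac)
    qed
    have e2: "(1 - x) powr (r + real k) = (1 - x) powr r * (2 * w) ^ k" for k
      using x w by (simp add: powr_add powr_realpow)
    have "(\<Sum>k<N. q k * (1 - x) powr (r + real k)) - 2 powr (- r) * (\<Sum>k<N. q k * (1 - x ^ 2) powr (r + real k))
      = (\<Sum>k<N. q k * ((1 - x) powr (r + real k)) - q k * (2 powr (- r) * (1 - x ^ 2) powr (r + real k)))"
      by (simp add: sum_subtractf sum_distrib_left mult_ac)
    also have "\<dots> = (1 - x) powr r * (\<Sum>k<N. q k * (2 * w) ^ k * (1 - 2 ^ k * (1 - w) powr (r + real k)))"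
      unfolding e e2 sum_distrib_left by (intro sum.cong refl) (simp add: algebra_simps)
    also have "(\<Sum>k<N. q k * (2 * w) ^ k * (1 - 2 ^ k * (1 - w) powr (r + real k))) = w ^ N * (\<Sum>k. b k * w ^ k)"
    proof -
      have nz: "w ^ N \<noteq> 0" using w(1) by simp
      have div: "S = c * t" if "c \<noteq> 0" "S / c = t" for S c t :: real using that by auto
      show ?thesis by (rule div[OF nz sums_unique[OF b[OF w(1)]]])
    qed
    finally show ?thesis unfolding e2 by (simp add: w_def[symmetric] power_mult_distrib)
  qed
  moreover have "wien ?R (\<bar>1 / 2 ^ N\<bar> * norm1 b)" by (intro wien_cmult wien_half q)
  ultimately show ?thesis using q(1) by blast
qed

section \<open>Translations and \<open>L\<^sub>p\<close> norms on the torus\<close>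

text \<open>Polymorphic in the codomain, since it is applied also to predicates and to
  \<open>ennreal\<close>-valued integrands.\<close>

definition per :: "(real \<times> real \<Rightarrow> 'a) \<Rightarrow> bool" where
  "per f \<longleftrightarrow> (\<forall>x y. f (x + 2*pi, y) = f (x, y) \<and> f (x, y + 2*pi) = f (x, y))"

lemma per_int:
  assumes "per f"
  shows "f (x + 2*pi * of_int k, y + 2*pi * of_int l) = f (x, y)"
proof -
  have n1: "f (x + 2*pi * real n, y) = f (x, y)" for x y n
  proof (induction n)
    case (Suc n)
    have "f (x + 2*pi * real (Suc n), y) = f (x + 2*pi * real n + 2*pi, y)" by (simp add: algebra_simps)
    also have "\<dots> = f (x, y)" using Suc assms by (simp add: per_def)
    finally show ?case .
  qed simp
  have n2: "f (x, y + 2*pi * real n) = f (x, y)" for x y n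
  proof (induction n)
    case (Suc n)
    have "f (x, y + 2*pi * real (Suc n)) = f (x, y + 2*pi * real n + 2*pi)" by (simp add: algebra_simps)
    also have "\<dots> = f (x, y)" using Suc assms by (simp add: per_def)
    finally show ?case .
  qed simp
  have i1: "f (x + 2*pi * of_int k, y) = f (x, y)" for x y k
  proof (cases "k \<ge> 0")
    case True
    then show ?thesis using n1[of x "nat k" y] by simp
  next
    case False
    then show ?thesis using n1[of "x + 2*pi * of_int k" "nat (- k)" y] by simp
  qed
  have i2: "f (x, y + 2*pi * of_int k) = f (x, y)" for x y k
  proof (cases "k \<ge> 0")
    case True
    then show ?thesis using n2[of x y "nat k"] by simp
  next
    case False
    then show ?thesis using n2[of x "y + 2*pi * of_int k" "nat (- k)"] by simp
  qed
  show ?thesis by (simp add: i1 i2)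
qed

lemma lebesgue_shift: "(lebesgue :: ('a::euclidean_space) measure) = distr lebesgue lebesgue (\<lambda>x. x + v)"
  using lebesgue_affine_euclidean[of "\<lambda>_. 1" v]
  by (simp add: euclidean_representation density_1 add.commute)

lemma measurable_lebesgue_shift [measurable]: "(\<lambda>x. x + (v::'a::euclidean_space)) \<in> lebesgue \<rightarrow>\<^sub>M lebesgue"
  using lebesgue_affine_measurable[of "\<lambda>_. 1" v]
  by (simp add: euclidean_representation add.commute)

lemma borel_measurable_lebesgue_shift:
  fixes v :: "'a::euclidean_space"
  assumes "f \<in> borel_measurable lebesgue"
  shows "(\<lambda>z. f (z + v)) \<in> borel_measurable lebesgue"
  using measurable_compose[OF measurable_lebesgue_shift assms] .

lemma nn_integral_lebesgue_shift:
  fixes v :: "'a::euclidean_space"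
  assumes "f \<in> borel_measurable lebesgue"
  shows "(\<integral>\<^sup>+ z. f (z + v) \<partial>lebesgue) = (\<integral>\<^sup>+ z. f z \<partial>lebesgue)"
  using assms by (subst (2) lebesgue_shift[of v]) (subst nn_integral_distr, auto)

lemma sets_torus_Q: "{0..2*pi} \<times> {0..2*pi} \<in> sets (lebesgue :: (real \<times> real) measure)"
proof -
  have "{0..2*pi} \<times> {0..2*pi} = cbox (0, 0) (2*pi, 2*pi)" by (simp add: cbox_Pair_eq)
  then show ?thesis by (metis lmeasurable_cbox fmeasurableD)
qed

lemma space_torus: "space torus_measure = {0..2*pi} \<times> {0..2*pi}"
  by (simp add: torus_measure_def space_restrict_space)

lemma nn_integral_torus:
  "nn_integral torus_measure f = (\<integral>\<^sup>+ z. f z * indicator ({0..2*pi} \<times> {0..2*pi}) z \<partial>lebesgue)"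
  unfolding torus_measure_def by (rule nn_integral_restrict_space) (simp add: sets_torus_Q)

lemma measurable_torusI: "f \<in> borel_measurable lebesgue \<Longrightarrow> f \<in> borel_measurable torus_measure"
  unfolding torus_measure_def by (rule measurable_restrict_space1)

lemma emeasure_torus: "emeasure torus_measure (space torus_measure) = ennreal ((2*pi)\<^sup>2)"
proof -
  have eq: "{0..2*pi} \<times> {0..2*pi} = cbox (0, 0) (2*pi, 2*pi)" by (simp add: cbox_Pair_eq)
  have "emeasure torus_measure (space torus_measure) = emeasure lebesgue ({0..2*pi} \<times> {0..2*pi})"
    unfolding space_torus unfolding torus_measure_def
    by (rule emeasure_restrict_space) (auto simp: sets_torus_Q)
  also have "\<dots> = ennreal ((2*pi)\<^sup>2)"
  proof -
    have "emeasure lebesgue (cbox (0::real, 0::real) (2*pi, 2*pi)) = emeasure lborel (cbox (0, 0) (2*pi, 2*pi))"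
      by (simp add: emeasure_completion)
    also have "\<dots> = ennreal (measure lborel (cbox (0::real, 0::real) (2*pi, 2*pi)))"
      using emeasure_lborel_cbox_finite[of "(0::real, 0::real)" "(2*pi, 2*pi)"] by (intro emeasure_eq_ennreal_measure) auto
    also have "\<dots> = ennreal ((2*pi)\<^sup>2)"
      by (simp add: content_Pair power2_eq_square)
    finally show ?thesis unfolding eq .
  qed
  finally show ?thesis .
qed

lemma finite_measure_torus: "finite_measure torus_measure"
  by (rule finite_measureI) (simp add: emeasure_torus)

lemma line_null:
  "{z :: real \<times> real. fst z = c} \<in> null_sets lebesgue" "{z :: real \<times> real. snd z = c} \<in> null_sets lebesgue"
proof -
  have "negligible {z :: real \<times> real. z \<bullet> (1, 0) = c}" "negligible {z :: real \<times> real. z \<bullet> (0, 1) = c}"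
    by (rule negligible_standard_hyperplane, simp add: Basis_prod_def)+
  then show "{z :: real \<times> real. fst z = c} \<in> null_sets lebesgue" "{z :: real \<times> real. snd z = c} \<in> null_sets lebesgue"
    by (simp_all add: inner_prod_def negligible_iff_null_sets)
qed

text \<open>The closed square overlaps its lattice translates along edges, which are null sets; the
  half-open one tiles the plane exactly.\<close>

lemma nn_integral_torus_half_open:
  "nn_integral torus_measure f = (\<integral>\<^sup>+ z. f z * indicator ({0..<2*pi} \<times> {0..<2*pi}) z \<partial>lebesgue)"
  unfolding nn_integral_torus
proof (rule nn_integral_cong_AE)
  have "AE z :: real \<times> real in lebesgue. fst z \<noteq> 2*pi" "AE z :: real \<times> real in lebesgue. snd z \<noteq> 2*pi"
    using AE_not_in[OF line_null(1)[of "2*pi"]] AE_not_in[OF line_null(2)[of "2*pi"]] by simp_all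
  then show "AE z in lebesgue. f z * indicator ({0..2*pi} \<times> {0..2*pi}) z = f z * indicator ({0..<2*pi} \<times> {0..<2*pi}) z"
    by eventually_elim (auto simp: indicator_def)
qed

text \<open>The integral over the shifted square is cut by all lattice translates of the square Q.
  Each piece is moved back into Q, where the integrand is unchanged by periodicity, and the pieces
  of the shifted square again tile the plane.\<close>

lemma nn_integral_torus_shift:
  assumes [measurable]: "\<phi> \<in> borel_measurable lebesgue" and per: "per \<phi>"
  shows "(\<integral>\<^sup>+ z. \<phi> (z + v) \<partial>torus_measure) = (\<integral>\<^sup>+ z. \<phi> z \<partial>torus_measure)"
proof -
  let ?Q = "{0..<2*pi} \<times> {0..<2*pi} :: (real \<times> real) set"
  let ?C = "count_space (UNIV :: (int \<times> int) set)"
  define \<tau> :: "int \<times> int \<Rightarrow> real \<times> real" where "\<tau> l = (2*pi * of_int (fst l), 2*pi * of_int (snd l))" for l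
  have pt: "\<phi> (z + \<tau> l) = \<phi> z" for z l
    using per_int[OF per, of "fst z" "fst l" "snd z" "snd l"] by (cases z) (simp add: \<tau>_def)
  have Qm: "?Q \<in> sets lebesgue"
  proof -
    have "?Q \<in> sets borel" unfolding borel_prod[symmetric] by measurable
    then show ?thesis by (simp add: sets_completionI_sets)
  qed
  have Qind: "(\<lambda>z. indicator ?Q z :: ennreal) \<in> borel_measurable lebesgue" using Qm by simp
  have Qs: "(\<lambda>z. indicator ?Q (z + w) :: ennreal) \<in> borel_measurable lebesgue" for w
    by (rule borel_measurable_lebesgue_shift[OF Qind])
  \<comment> \<open>The indicators of the lattice translates form a partition of unity: in each
    coordinate exactly one multiple of 2 pi, given by a floor, leads into the half-open
    interval.\<close>
  have tile: "(\<integral>\<^sup>+ l. indicator ?Q (z + \<tau> l) \<partial>?C) = (1 :: ennreal)" for z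
  proof -
    have u: "\<exists>!k::int. x + 2*pi * of_int k \<in> {0..<2*pi}" for x :: real
    proof -
      let ?k = "- \<lfloor>x / (2*pi)\<rfloor>"
      have *: "x + 2*pi * of_int k \<in> {0..<2*pi} \<longleftrightarrow> of_int (- k) \<le> x / (2*pi) \<and> x / (2*pi) < of_int (- k) + 1" for k
        by (auto simp: field_simps)
      show ?thesis unfolding * floor_eq_iff[symmetric] by (rule ex1I[of _ ?k]) auto
    qed
    obtain k where k: "\<And>k'. fst z + 2*pi * of_int k' \<in> {0..<2*pi} \<longleftrightarrow> k' = k" using u[of "fst z"] by metis
    obtain l where l: "\<And>k'. snd z + 2*pi * of_int k' \<in> {0..<2*pi} \<longleftrightarrow> k' = l" using u[of "snd z"] by metis
    have mem: "z + \<tau> m \<in> ?Q \<longleftrightarrow> m = (k, l)" for m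
      using k[of "fst m"] l[of "snd m"] by (cases z; cases m) (simp add: \<tau>_def)
    have "(\<integral>\<^sup>+ m. indicator ?Q (z + \<tau> m) \<partial>?C) = (\<integral>\<^sup>+ m. indicator {(k, l)} m \<partial>?C)"
      by (rule nn_integral_cong) (simp only: indicator_def mem singleton_iff)
    also have "\<dots> = 1" by simp
    finally show ?thesis .
  qed
  have "(\<integral>\<^sup>+ z. \<phi> (z + v) \<partial>torus_measure) = (\<integral>\<^sup>+ z. \<phi> (z + v) * indicator ?Q (z + v + - v) \<partial>lebesgue)"
    unfolding nn_integral_torus_half_open by simp
  also have "\<dots> = (\<integral>\<^sup>+ z. \<phi> z * indicator ?Q (z + - v) \<partial>lebesgue)"
    using nn_integral_lebesgue_shift[of "\<lambda>z. \<phi> z * indicator ?Q (z + - v)" v] Qs[of "- v"] by simp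
  also have "\<dots> = (\<integral>\<^sup>+ z. \<integral>\<^sup>+ l. \<phi> z * indicator ?Q (z + - v) * indicator ?Q (z + \<tau> l) \<partial>?C \<partial>lebesgue)"
    by (simp add: nn_integral_cmult tile)
  also have "\<dots> = (\<integral>\<^sup>+ l. \<integral>\<^sup>+ z. \<phi> z * indicator ?Q (z + - v) * indicator ?Q (z + \<tau> l) \<partial>lebesgue \<partial>?C)"
    by (rule nn_integral_count_space_nn_integral) (use Qs in \<open>auto simp del: add_uminus_conv_diff\<close>)
  also have "\<dots> = (\<integral>\<^sup>+ l. \<integral>\<^sup>+ z. \<phi> z * indicator ?Q (z + \<tau> (- l) + - v) * indicator ?Q z \<partial>lebesgue \<partial>?C)"
  proof (rule nn_integral_cong)
    fix l
    have [simp]: "\<tau> (- l) = - \<tau> l" by (simp add: \<tau>_def)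
    have "(\<lambda>z. \<phi> z * indicator ?Q (z + - v) * indicator ?Q (z + \<tau> l)) \<in> borel_measurable lebesgue"
      using Qs by (auto simp del: add_uminus_conv_diff)
    from nn_integral_lebesgue_shift[OF this, of "- \<tau> l"]
    show "(\<integral>\<^sup>+ z. \<phi> z * indicator ?Q (z + - v) * indicator ?Q (z + \<tau> l) \<partial>lebesgue) =
       (\<integral>\<^sup>+ z. \<phi> z * indicator ?Q (z + \<tau> (- l) + - v) * indicator ?Q z \<partial>lebesgue)"
      using pt[of _ "- l"] by simp
  qed
  also have "\<dots> = (\<integral>\<^sup>+ z. \<integral>\<^sup>+ l. \<phi> z * indicator ?Q (z + \<tau> (- l) + - v) * indicator ?Q z \<partial>?C \<partial>lebesgue)"
  proof (rule nn_integral_count_space_nn_integral[symmetric])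
    fix l show "(\<lambda>z. \<phi> z * indicator ?Q (z + \<tau> (- l) + - v) * indicator ?Q z) \<in> borel_measurable lebesgue"
      unfolding add.assoc using Qs Qind by (auto simp del: add_uminus_conv_diff)
  qed auto
  also have "\<dots> = (\<integral>\<^sup>+ z. \<phi> z * indicator ?Q z * (\<integral>\<^sup>+ l. indicator ?Q (z + - v + \<tau> (- l)) \<partial>?C) \<partial>lebesgue)"
  proof (rule nn_integral_cong)
    fix z
    have eq: "(\<lambda>l. \<phi> z * indicator ?Q (z + \<tau> (- l) + - v) * indicator ?Q z) =
       (\<lambda>l. \<phi> z * indicator ?Q z * indicator ?Q (z + - v + \<tau> (- l)))"
      by (rule ext) (simp only: add_ac mult_ac)
    show "(\<integral>\<^sup>+ l. \<phi> z * indicator ?Q (z + \<tau> (- l) + - v) * indicator ?Q z \<partial>?C) =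
        \<phi> z * indicator ?Q z * (\<integral>\<^sup>+ l. indicator ?Q (z + - v + \<tau> (- l)) \<partial>?C)"
      unfolding eq by (rule nn_integral_cmult) auto
  qed
  also have "\<dots> = (\<integral>\<^sup>+ z. \<phi> z * indicator ?Q z * (\<integral>\<^sup>+ l. indicator ?Q (z + - v + \<tau> l) \<partial>?C) \<partial>lebesgue)"
  proof -
    have neg: "(\<integral>\<^sup>+ l. g (- l) \<partial>?C) = (\<integral>\<^sup>+ l. g l \<partial>?C)" for g :: "int \<times> int \<Rightarrow> ennreal"
      by (rule nn_integral_bij_count_space) (rule bij_betwI[where g=uminus], auto)
    show ?thesis
      by (rule nn_integral_cong, rule arg_cong2[where f="(*)", OF refl]) (rule neg)
  qed
  also have "\<dots> = nn_integral torus_measure \<phi>"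
    unfolding tile nn_integral_torus_half_open by simp
  finally show ?thesis .
qed

text \<open>The shift formula applied to the indicator of the exceptional set; this is why the set
  is required to be measurable and periodic.\<close>

lemma AE_torus_shift:
  assumes m: "{z. \<not> P z} \<in> sets lebesgue" and per: "per P" and ae: "AE z in torus_measure. P z"
  shows "AE z in torus_measure. P (z + v)"
proof -
  let ?\<phi> = "\<lambda>z. indicator {z. \<not> P z} z :: ennreal"
  have mm: "?\<phi> \<in> borel_measurable lebesgue" using m by simp
  have "per ?\<phi>" using per by (auto simp: per_def indicator_def)
  from nn_integral_torus_shift[OF mm this, of v]
  have "(\<integral>\<^sup>+ z. ?\<phi> (z + v) \<partial>torus_measure) = (\<integral>\<^sup>+ z. ?\<phi> z \<partial>torus_measure)" .
  also have "\<dots> = 0" using ae by (subst nn_integral_0_iff_AE) (auto intro: measurable_torusI mm elim!: eventually_mono)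
  finally have "AE z in torus_measure. ?\<phi> (z + v) = 0"
    by (subst (asm) nn_integral_0_iff_AE) (auto intro!: measurable_torusI borel_measurable_lebesgue_shift mm)
  then show ?thesis by eventually_elim (auto simp: indicator_def split: if_splits)
qed

section \<open>The p-th power integral and Minkowski's inequality\<close>

definition pint :: "real \<Rightarrow> (real \<times> real \<Rightarrow> complex) \<Rightarrow> ennreal" where
  "pint p f = (\<integral>\<^sup>+ z. ennreal (norm (f z) powr p) \<partial>torus_measure)"

lemma Lp_norm_pint: "Lp_norm p f = (if pint p f = \<infinity> then \<infinity> else ennreal (enn2real (pint p f) powr (1 / p)))"
  by (simp add: Lp_norm_def pint_def Let_def)

lemma Lp_norm_less_top: "Lp_norm p f < \<infinity> \<longleftrightarrow> pint p f < \<infinity>"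
  by (auto simp: Lp_norm_pint top.not_eq_extremum)

text \<open>\<open>Lp_norm\<close> is defined through a case distinction and
  \<open>enn2real\<close>. For finite bounds this equivalence replaces it by the p-th power
  integral, on which the estimates are carried out.\<close>

lemma Lp_norm_le_iff:
  assumes "p > 0" "c \<ge> 0"
  shows "Lp_norm p f \<le> ennreal c \<longleftrightarrow> pint p f \<le> ennreal (c powr p)"
proof (cases "pint p f")
  case (real r)
  then have "Lp_norm p f = ennreal (r powr (1 / p))" by (simp add: Lp_norm_pint)
  moreover have "r powr (1 / p) \<le> c \<longleftrightarrow> r \<le> c powr p"
  proof
    assume "r powr (1 / p) \<le> c"
    then have "(r powr (1 / p)) powr p \<le> c powr p" using assms by (intro powr_mono2) auto
    then show "r \<le> c powr p" using assms real by (cases "r = 0") (auto simp: powr_powr)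
  next
    assume "r \<le> c powr p"
    then have "r powr (1 / p) \<le> (c powr p) powr (1 / p)" using assms real by (intro powr_mono2) auto
    then show "r powr (1 / p) \<le> c" using assms by (cases "c = 0") (auto simp: powr_powr)
  qed
  ultimately show ?thesis using real assms by simp
next
  case top
  then show ?thesis by (simp add: Lp_norm_pint top_unique)
qed

lemma Lp_norm_cong_AE:
  assumes "AE z in torus_measure. f z = g z"
  shows "Lp_norm p f = Lp_norm p g"
proof -
  have "pint p f = pint p g" unfolding pint_def
    by (rule nn_integral_cong_AE) (use assms in \<open>auto elim!: eventually_mono\<close>)
  then show ?thesis by (simp add: Lp_norm_pint)
qed

lemma Lp_norm_mono:
  assumes "\<And>z. norm (f z) \<le> norm (g z)" "p > 0"
  shows "Lp_norm p f \<le> Lp_norm p g"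
proof (cases "Lp_norm p g")
  case (real c)
  have "pint p f \<le> pint p g" unfolding pint_def
    using assms by (intro nn_integral_mono ennreal_leI powr_mono2) auto
  then show ?thesis using Lp_norm_le_iff[OF assms(2) real(1)] real by (metis order_trans order_refl)
qed (auto simp: top_unique)

lemma Lp_norm_zero: "p > 0 \<Longrightarrow> Lp_norm p (\<lambda>z. 0) = 0"
  by (simp add: Lp_norm_pint pint_def)

lemma Lp_norm_shift:
  assumes "f \<in> borel_measurable lebesgue" "per f"
  shows "Lp_norm p (\<lambda>z. f (z + v)) = Lp_norm p f"
proof -
  have "pint p (\<lambda>z. f (z + v)) = pint p f" unfolding pint_def
    by (rule nn_integral_torus_shift[where \<phi>="\<lambda>z. ennreal (norm (f z) powr p)"])
       (use assms in \<open>auto simp: per_def\<close>)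
  then show ?thesis by (simp add: Lp_norm_pint)
qed

lemma torus_Lp_iff: "f \<in> torus_Lp p \<longleftrightarrow> f \<in> borel_measurable lebesgue \<and> per f \<and> Lp_norm p f < \<infinity>"
  by (auto simp: torus_Lp_def per_def)

text \<open>Convexity: the graph of the p-th power lies above its tangent at t. Summed or integrated
  with t equal to a mean value it gives Jensen's inequality, which is how it is used for series and
  for the Fejer kernel.\<close>

lemma powr_tangent:
  assumes "p > 1" "y \<ge> 0" "t \<ge> (0::real)"
  shows "t powr p + p * t powr (p - 1) * (y - t) \<le> y powr p"
proof (cases "t = 0")
  case False
  then have t: "t > 0" using assms by simp
  define q where "q = p / (p - 1)"
  have q: "q > 1" "1 / p + 1 / q = 1" using assms by (auto simp: q_def field_simps)
  have "y * t powr (p - 1) \<le> y powr p / p + (t powr (p - 1)) powr q / q"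
    by (rule Youngs_inequality) (use assms q in auto)
  also have "(t powr (p - 1)) powr q = t powr p" using assms by (simp add: powr_powr q_def)
  finally have "p * (y * t powr (p - 1)) \<le> p * (y powr p / p + t powr p / q)"
    using assms by (intro mult_left_mono) auto
  also have "\<dots> = y powr p + (p - 1) * t powr p" using assms by (simp add: q_def field_simps)
  finally have "p * (y * t powr (p - 1)) \<le> y powr p + (p - 1) * t powr p" .
  moreover have "t powr (p - 1) * t = t powr p" using t by (simp add: powr_diff)
  ultimately show ?thesis by (simp add: algebra_simps)
qed (use assms in auto)

text \<open>Convexity at the points x/c and y/d with weights c and d. Minkowski's inequality results
  when c and d approach the norms of the two summands.\<close>

lemma Jensen_two:
  assumes "p > 1" "c > 0" "d > 0" "x \<ge> 0" "y \<ge> (0::real)"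
  shows "(x + y) powr p \<le> (c + d) powr (p - 1) * (c powr (1 - p) * x powr p + d powr (1 - p) * y powr p)"
proof -
  define t where "t = (x + y) / (c + d)"
  have t: "t \<ge> 0" using assms by (simp add: t_def)
  have 1: "t powr p + p * t powr (p - 1) * (x / c - t) \<le> (x / c) powr p"
    by (rule powr_tangent) (use assms t in auto)
  have 2: "t powr p + p * t powr (p - 1) * (y / d - t) \<le> (y / d) powr p"
    by (rule powr_tangent) (use assms t in auto)
  have "c * (t powr p + p * t powr (p - 1) * (x / c - t)) + d * (t powr p + p * t powr (p - 1) * (y / d - t))
     \<le> c * (x / c) powr p + d * (y / d) powr p"
    using 1 2 assms by (intro add_mono mult_left_mono) auto
  moreover have "c * (t powr p + p * t powr (p - 1) * (x / c - t)) + d * (t powr p + p * t powr (p - 1) * (y / d - t))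
     = (c + d) * t powr p + p * t powr (p - 1) * (x + y - (c + d) * t)"
    using assms by (simp add: field_simps)
  moreover have "x + y - (c + d) * t = 0" using assms by (simp add: t_def)
  ultimately have 3: "(c + d) * t powr p \<le> c * (x / c) powr p + d * (y / d) powr p" by simp
  have 4: "c * (x / c) powr p = c powr (1 - p) * x powr p" "d * (y / d) powr p = d powr (1 - p) * y powr p"
    using assms by (simp_all add: powr_divide powr_diff)
  have "(x + y) powr p = (c + d) powr (p - 1) * ((c + d) * t powr p)"
    using assms by (simp add: t_def powr_divide powr_diff)
  also have "\<dots> \<le> (c + d) powr (p - 1) * (c powr (1 - p) * x powr p + d powr (1 - p) * y powr p)"
    using 3 4 by (intro mult_left_mono) auto
  finally show ?thesis .
qed

text \<open>The weights of \<open>Jensen_two\<close> have to be positive, so they are taken slightly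
  larger than the two norms and the excess e is removed at the end.\<close>

lemma Lp_norm_triangle:
  assumes p: "p > 1" and [measurable]: "f \<in> borel_measurable lebesgue" "g \<in> borel_measurable lebesgue"
  shows "Lp_norm p (\<lambda>z. f z + g z) \<le> Lp_norm p f + Lp_norm p g"
proof (cases "Lp_norm p f + Lp_norm p g")
  case (real r)
  have [measurable]: "f \<in> borel_measurable torus_measure" "g \<in> borel_measurable torus_measure"
    by (rule measurable_torusI, fact)+
  have *: "Lp_norm p (\<lambda>z. f z + g z) \<le> ennreal (c + d)"
    if c: "c > 0" "Lp_norm p f \<le> ennreal c" and d: "d > 0" "Lp_norm p g \<le> ennreal d" for c d
  proof -
    have pf: "pint p f \<le> ennreal (c powr p)" "pint p g \<le> ennreal (d powr p)"
      using Lp_norm_le_iff[of p] p c d by auto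
    have "pint p (\<lambda>z. f z + g z) \<le> (\<integral>\<^sup>+ z. ennreal ((c + d) powr (p - 1)) *
       (ennreal (c powr (1 - p)) * ennreal (norm (f z) powr p) + ennreal (d powr (1 - p)) * ennreal (norm (g z) powr p)) \<partial>torus_measure)"
      unfolding pint_def
    proof (rule nn_integral_mono)
      fix z
      have "norm (f z + g z) powr p \<le> (norm (f z) + norm (g z)) powr p"
        using p by (intro powr_mono2 norm_triangle_ineq) auto
      also have "\<dots> \<le> (c + d) powr (p - 1) * (c powr (1 - p) * norm (f z) powr p + d powr (1 - p) * norm (g z) powr p)"
        by (rule Jensen_two) (use p c d in auto)
      finally show "ennreal (norm (f z + g z) powr p) \<le> ennreal ((c + d) powr (p - 1)) *
       (ennreal (c powr (1 - p)) * ennreal (norm (f z) powr p) + ennreal (d powr (1 - p)) * ennreal (norm (g z) powr p))"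
        by (simp add: ennreal_leI flip: ennreal_mult' ennreal_plus)
    qed
    also have "\<dots> = ennreal ((c + d) powr (p - 1)) *
       (ennreal (c powr (1 - p)) * pint p f + ennreal (d powr (1 - p)) * pint p g)"
      unfolding pint_def by (simp add: nn_integral_cmult nn_integral_add)
    also have "\<dots> \<le> ennreal ((c + d) powr (p - 1)) *
       (ennreal (c powr (1 - p)) * ennreal (c powr p) + ennreal (d powr (1 - p)) * ennreal (d powr p))"
      using pf by (intro mult_left_mono add_mono) auto
    also have "\<dots> = ennreal ((c + d) powr (p - 1) * (c powr (1 - p) * c powr p + d powr (1 - p) * d powr p))"
      by (simp flip: ennreal_mult' ennreal_plus)
    also have "(c + d) powr (p - 1) * (c powr (1 - p) * c powr p + d powr (1 - p) * d powr p) = (c + d) powr p"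
      using c d by (simp add: powr_diff flip: powr_add)
    finally show ?thesis using Lp_norm_le_iff[of p "c + d"] p c d by auto
  qed
  obtain a b where ab: "a \<ge> 0" "b \<ge> 0" "Lp_norm p f = ennreal a" "Lp_norm p g = ennreal b"
    using real by (cases "Lp_norm p f"; cases "Lp_norm p g") auto
  have "Lp_norm p (\<lambda>z. f z + g z) \<le> ennreal (a + b) + ennreal e" if "e > 0" for e
  proof -
    have "Lp_norm p (\<lambda>z. f z + g z) \<le> ennreal ((a + e / 2) + (b + e / 2))"
      by (rule *) (use that ab in \<open>auto intro!: ennreal_leI\<close>)
    also have "\<dots> = ennreal (a + b) + ennreal e" using that ab by (simp flip: ennreal_plus)
    finally show ?thesis .
  qed
  then have "Lp_norm p (\<lambda>z. f z + g z) \<le> ennreal (a + b)" by (rule ennreal_le_epsilon)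
  then show ?thesis using ab by simp
qed (auto simp: top_unique)

lemma Lp_norm_cmult:
  assumes p: "p > 0" and [measurable]: "f \<in> borel_measurable lebesgue" and fin: "Lp_norm p f < \<infinity>"
  shows "Lp_norm p (\<lambda>z. c * f z) = ennreal (norm c) * Lp_norm p f"
proof -
  have [measurable]: "f \<in> borel_measurable torus_measure" by (rule measurable_torusI) fact
  have "pint p (\<lambda>z. c * f z) = ennreal (norm c powr p) * pint p f"
    unfolding pint_def by (simp add: norm_mult powr_mult ennreal_mult' nn_integral_cmult)
  moreover obtain r where r: "r \<ge> 0" "pint p f = ennreal r"
    using fin unfolding Lp_norm_less_top by (cases "pint p f") auto
  ultimately show ?thesis using p r
    by (simp add: Lp_norm_pint powr_mult powr_powr flip: ennreal_mult')
qed

lemma torus_Lp_add: "p > 1 \<Longrightarrow> f \<in> torus_Lp p \<Longrightarrow> g \<in> torus_Lp p \<Longrightarrow> (\<lambda>z. f z + g z) \<in> torus_Lp p"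
  using Lp_norm_triangle[of p f g] unfolding torus_Lp_iff
  by (auto simp: per_def intro: le_less_trans)

lemma torus_Lp_cmult: "p > 0 \<Longrightarrow> f \<in> torus_Lp p \<Longrightarrow> (\<lambda>z. c * f z) \<in> torus_Lp p"
  using Lp_norm_cmult[of p f c] unfolding torus_Lp_iff
  by (auto simp: per_def ennreal_mult_less_top)

text \<open>The torus has finite measure and a number is at most 1 plus its p-th power.\<close>

lemma torus_L1:
  assumes p: "p > 1" and f: "f \<in> torus_Lp p"
  shows "(\<integral>\<^sup>+ z. ennreal (norm (f z)) \<partial>torus_measure) < \<infinity>"
proof -
  have [measurable]: "f \<in> borel_measurable torus_measure" using f by (auto simp: torus_Lp_iff intro: measurable_torusI)
  have "(\<integral>\<^sup>+ z. ennreal (norm (f z)) \<partial>torus_measure) \<le> (\<integral>\<^sup>+ z. 1 + ennreal (norm (f z) powr p) \<partial>torus_measure)"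
  proof (rule nn_integral_mono)
    fix z
    have "norm (f z) \<le> 1 + norm (f z) powr p"
    proof (cases "norm (f z) \<le> 1")
      case False
      then have "norm (f z) powr 1 \<le> norm (f z) powr p" using p by (intro powr_mono) auto
      then show ?thesis using False by simp
    qed (auto intro: add_increasing2)
    then show "ennreal (norm (f z)) \<le> 1 + ennreal (norm (f z) powr p)"
      by (simp add: ennreal_leI flip: ennreal_1 ennreal_plus)
  qed
  also have "\<dots> = emeasure torus_measure (space torus_measure) + pint p f"
    unfolding pint_def by (subst nn_integral_add) auto
  also have "\<dots> < \<infinity>" using f Lp_norm_less_top[of p f] by (auto simp: torus_Lp_iff emeasure_torus)
  finally show ?thesis .
qed

section \<open>Series of translations\<close>

text \<open>The series of powers of the translation by v. A fractional difference also contains a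
  forward shift by alpha h, which is left out here because it commutes with the series and preserves
  norms.\<close>

definition op :: "(nat \<Rightarrow> real) \<Rightarrow> real \<times> real \<Rightarrow> (real \<times> real \<Rightarrow> complex) \<Rightarrow> real \<times> real \<Rightarrow> complex" where
  "op a v f z = (\<Sum>k. of_real (a k) * f (z - real k *\<^sub>R v))"

lemma op_shift: "op a v (\<lambda>z. f (z + w)) z = op a v f (z + w)"
  unfolding op_def by (simp add: algebra_simps)

lemma per_op: "per f \<Longrightarrow> per (op a v f)"
proof -
  assume per: "per f"
  have 1: "f (z + (2*pi, 0)) = f z" "f (z + (0, 2*pi)) = f z" for z
    using per by (cases z, simp add: per_def)+
  have "op a v f (z + (2*pi, 0)) = op a v f z" "op a v f (z + (0, 2*pi)) = op a v f z" for z
    by (simp_all flip: op_shift add: 1)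
  from this[of "(x, y)" for x y] show ?thesis by (simp add: per_def)
qed

lemma measurable_op:
  assumes "f \<in> borel_measurable lebesgue"
  shows "op a v f \<in> borel_measurable lebesgue"
proof -
  have "(\<lambda>z. f (z + - (real k *\<^sub>R v))) \<in> borel_measurable lebesgue" for k
    by (rule borel_measurable_lebesgue_shift[OF assms])
  then have [measurable]: "(\<lambda>z. f (z - real k *\<^sub>R v)) \<in> borel_measurable lebesgue" for k by simp
  show ?thesis unfolding op_def[abs_def] by measurable
qed

lemma nn_integral_norm_shift:
  assumes "f \<in> torus_Lp p"
  shows "(\<integral>\<^sup>+ z. ennreal (norm (f (z - v)) powr q) \<partial>torus_measure) = (\<integral>\<^sup>+ z. ennreal (norm (f z) powr q) \<partial>torus_measure)"
  using nn_integral_torus_shift[of "\<lambda>z. ennreal (norm (f z) powr q)" "- v"] assms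
  by (auto simp: torus_Lp_iff per_def)

text \<open>Nothing has to be shown when the right side is infinite. When it is finite the series
  converges absolutely, so that \<open>suminf\<close> is a genuine sum and the tangent inequality
  can be summed term by term.\<close>

lemma Jensen_series:
  fixes a :: "nat \<Rightarrow> real" and f :: "nat \<Rightarrow> complex"
  assumes p: "p > 1" and a: "ell1 a"
  shows "ennreal (norm (\<Sum>k. of_real (a k) * f k) powr p) \<le>
    ennreal (norm1 a powr (p - 1)) * (\<Sum>k. ennreal \<bar>a k\<bar> * ennreal (norm (f k) powr p))"
proof -
  define S where "S = norm1 a"
  have as: "summable (\<lambda>k. \<bar>a k\<bar>)" using a by (simp add: ell1_def)
  have S0: "S \<ge> 0" using norm1_nonneg[OF a] by (simp add: S_def)
  show ?thesis
  proof (cases "S = 0")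
    case True
    then have "\<bar>a k\<bar> = 0" for k
      using as suminf_eq_zero_iff[OF as] by (simp add: S_def norm1_def)
    then show ?thesis using p by simp
  next
    case False
    then have S: "S > 0" using S0 by simp
    show ?thesis
    proof (cases "(\<Sum>k. ennreal (\<bar>a k\<bar> * norm (f k) powr p)) = top")
      case True
      then show ?thesis using S by (simp add: S_def ennreal_mult' ennreal_mult_eq_top_iff top_unique)
    next
      case False
      have sp: "summable (\<lambda>k. \<bar>a k\<bar> * norm (f k) powr p)"
        by (rule summable_suminf_not_top) (use False in auto)
      have le1: "norm (f k) \<le> 1 + norm (f k) powr p" for k
      proof (cases "norm (f k) \<le> 1")
        case False
        then have "norm (f k) powr 1 \<le> norm (f k) powr p" using p by (intro powr_mono) auto
        then show ?thesis using False by simp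
      qed (auto intro: add_increasing2)
      have s1: "summable (\<lambda>k. \<bar>a k\<bar> * norm (f k))"
      proof (rule summable_comparison_test'[where N=0])
        show "summable (\<lambda>k. \<bar>a k\<bar> + \<bar>a k\<bar> * norm (f k) powr p)" by (intro summable_add as sp)
        show "norm (\<bar>a k\<bar> * norm (f k)) \<le> \<bar>a k\<bar> + \<bar>a k\<bar> * norm (f k) powr p" for k
          using mult_left_mono[OF le1[of k], of "\<bar>a k\<bar>"] by (simp add: abs_mult algebra_simps)
      qed
      define t where "t = (\<Sum>k. \<bar>a k\<bar> * norm (f k))"
      have t: "t \<ge> 0" unfolding t_def by (rule suminf_nonneg[OF s1]) auto
      \<comment> \<open>The tangent point is the weighted mean; with this choice the linear terms
        cancel after summation.\<close>
      define \<tau> where "\<tau> = t / S"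
      have \<tau>: "\<tau> \<ge> 0" using t S by (simp add: \<tau>_def)
      have tang: "\<bar>a k\<bar> * (\<tau> powr p - p * \<tau> powr p) + (p * \<tau> powr (p - 1)) * (\<bar>a k\<bar> * norm (f k)) \<le> \<bar>a k\<bar> * norm (f k) powr p" for k
      proof -
        have e: "\<tau> powr (p - 1) * \<tau> = \<tau> powr p" using \<tau> by (cases "\<tau> = 0") (auto simp: powr_diff)
        have "\<bar>a k\<bar> * (\<tau> powr p + p * \<tau> powr (p - 1) * (norm (f k) - \<tau>)) \<le> \<bar>a k\<bar> * norm (f k) powr p"
          by (intro mult_left_mono powr_tangent) (use p \<tau> in auto)
        also have "\<bar>a k\<bar> * (\<tau> powr p + p * \<tau> powr (p - 1) * (norm (f k) - \<tau>)) =
            \<bar>a k\<bar> * (\<tau> powr p - p * \<tau> powr p) + (p * \<tau> powr (p - 1)) * (\<bar>a k\<bar> * norm (f k))"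
          unfolding e[symmetric] by (simp add: algebra_simps)
        finally show ?thesis .
      qed
      have sl: "summable (\<lambda>k. \<bar>a k\<bar> * (\<tau> powr p - p * \<tau> powr p) + (p * \<tau> powr (p - 1)) * (\<bar>a k\<bar> * norm (f k)))"
        by (intro summable_add summable_mult summable_mult2 as s1)
      have "(\<Sum>k. \<bar>a k\<bar> * (\<tau> powr p - p * \<tau> powr p) + (p * \<tau> powr (p - 1)) * (\<bar>a k\<bar> * norm (f k)))
           = S * (\<tau> powr p - p * \<tau> powr p) + (p * \<tau> powr (p - 1)) * t"
        unfolding S_def norm1_def t_def
        by (subst suminf_add[symmetric])
           (auto intro!: summable_mult summable_mult2 as s1 simp: suminf_mult[OF s1] suminf_mult2[OF as])
      also have "\<dots> = S * \<tau> powr p"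
      proof -
        have "\<tau> powr (p - 1) * t = S * \<tau> powr p"
        proof -
          have "t = \<tau> * S" using S by (simp add: \<tau>_def)
          then have "\<tau> powr (p - 1) * t = \<tau> powr (p - 1) * \<tau> * S" by simp
          also have "\<tau> powr (p - 1) * \<tau> = \<tau> powr p" using \<tau> by (cases "\<tau> = 0") (auto simp: powr_diff)
          finally show ?thesis by simp
        qed
        then show ?thesis by (simp add: algebra_simps)
      qed
      finally have "S * \<tau> powr p \<le> (\<Sum>k. \<bar>a k\<bar> * norm (f k) powr p)"
        using suminf_le[OF tang sl sp] by simp
      then have main: "t powr p \<le> S powr (p - 1) * (\<Sum>k. \<bar>a k\<bar> * norm (f k) powr p)"
      proof -
        assume h: "S * \<tau> powr p \<le> (\<Sum>k. \<bar>a k\<bar> * norm (f k) powr p)"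
        have "t powr p = S powr (p - 1) * (S * \<tau> powr p)"
          using S t by (simp add: \<tau>_def powr_divide powr_diff)
        also have "\<dots> \<le> S powr (p - 1) * (\<Sum>k. \<bar>a k\<bar> * norm (f k) powr p)"
          using h by (intro mult_left_mono) auto
        finally show ?thesis .
      qed
      have "norm (\<Sum>k. of_real (a k) * f k) \<le> t"
        unfolding t_def using summable_norm[of "\<lambda>k. of_real (a k) * f k"] s1 by (simp add: norm_mult)
      then have "norm (\<Sum>k. of_real (a k) * f k) powr p \<le> t powr p" using p by (intro powr_mono2) auto
      also note main
      finally have "ennreal (norm (\<Sum>k. of_real (a k) * f k) powr p) \<le> ennreal (S powr (p - 1) * (\<Sum>k. \<bar>a k\<bar> * norm (f k) powr p))"
        by (rule ennreal_leI)
      also have "\<dots> = ennreal (S powr (p - 1)) * ennreal (\<Sum>k. \<bar>a k\<bar> * norm (f k) powr p)"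
        by (intro ennreal_mult suminf_nonneg sp) auto
      also have "ennreal (\<Sum>k. \<bar>a k\<bar> * norm (f k) powr p) = (\<Sum>k. ennreal (\<bar>a k\<bar> * norm (f k) powr p))"
        by (intro suminf_ennreal2[symmetric] sp) auto
      finally show ?thesis by (simp add: S_def ennreal_mult')
    qed
  qed
qed

text \<open>Integrating Jensen's inequality term by term, all translates have the same integral; the
  factors S^(p-1) and S combine to S^p for S = \<open>norm1 a\<close>.\<close>

lemma Lp_norm_op_le:
  assumes p: "p > 1" and f: "f \<in> torus_Lp p" and a: "ell1 a"
  shows "Lp_norm p (op a v f) \<le> ennreal (norm1 a) * Lp_norm p f"
proof -
  have fm: "f \<in> borel_measurable lebesgue" using f by (simp add: torus_Lp_iff)
  have sm: "(\<lambda>z. f (z + - (real k *\<^sub>R v))) \<in> borel_measurable lebesgue" for k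
    by (rule borel_measurable_lebesgue_shift[OF fm])
  have [measurable]: "(\<lambda>z. f (z - real k *\<^sub>R v)) \<in> borel_measurable torus_measure" for k
    using measurable_torusI[OF sm[of k]] by simp
  have S0: "norm1 a \<ge> 0" by (rule norm1_nonneg[OF a])
  obtain N where N: "N \<ge> 0" "Lp_norm p f = ennreal N"
    using f by (cases "Lp_norm p f") (auto simp: torus_Lp_iff)
  have pN: "pint p f \<le> ennreal (N powr p)" using Lp_norm_le_iff[of p N f] p N by simp
  have "pint p (op a v f) \<le> (\<integral>\<^sup>+ z. ennreal (norm1 a powr (p - 1)) * (\<Sum>k. ennreal \<bar>a k\<bar> * ennreal (norm (f (z - real k *\<^sub>R v)) powr p)) \<partial>torus_measure)"
    unfolding pint_def op_def by (intro nn_integral_mono Jensen_series p a)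
  also have "\<dots> = ennreal (norm1 a powr (p - 1)) * (\<Sum>k. ennreal \<bar>a k\<bar> * (\<integral>\<^sup>+ z. ennreal (norm (f (z - real k *\<^sub>R v)) powr p) \<partial>torus_measure))"
    by (simp add: nn_integral_cmult nn_integral_suminf)
  also have "\<dots> = ennreal (norm1 a powr (p - 1)) * (\<Sum>k. ennreal \<bar>a k\<bar> * pint p f)"
    unfolding nn_integral_norm_shift[OF f] pint_def ..
  also have "\<dots> = ennreal (norm1 a powr (p - 1)) * (ennreal (norm1 a) * pint p f)"
    using a unfolding ell1_def norm1_def by (subst ennreal_suminf_multc) (simp add: suminf_ennreal2)
  also have "\<dots> \<le> ennreal (norm1 a powr (p - 1)) * (ennreal (norm1 a) * ennreal (N powr p))"
    by (intro mult_left_mono pN) auto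
  also have "\<dots> = ennreal ((norm1 a * N) powr p)"
    using S0 by (cases "norm1 a = 0") (auto simp: powr_diff powr_mult mult.assoc[symmetric] simp flip: ennreal_mult' intro: arg_cong[where f=ennreal])
  finally show ?thesis using Lp_norm_le_iff[of p "norm1 a * N"] p N S0 by (simp add: ennreal_mult')
qed

lemma torus_Lp_op:
  assumes "p > 1" "f \<in> torus_Lp p" "ell1 a"
  shows "op a v f \<in> torus_Lp p"
  using Lp_norm_op_le[OF assms, of v] assms measurable_op[of f a v] per_op[of f a v]
  by (auto simp: torus_Lp_iff ennreal_mult_less_top intro: le_less_trans)

text \<open>The double series of absolute values has a finite integral, since f is integrable and
  translations preserve its integral; hence it is finite almost everywhere.\<close>

lemma AE_op_op_summable:
  assumes p: "p > 1" and f: "f \<in> torus_Lp p" and a: "ell1 a" "ell1 b"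
  shows "AE z in torus_measure.
    (\<forall>k. summable (\<lambda>l. norm (of_real (a k) * (of_real (b l) * f (z - real k *\<^sub>R v - real l *\<^sub>R w))))) \<and>
    summable (\<lambda>k. \<Sum>l. norm (of_real (a k) * (of_real (b l) * f (z - real k *\<^sub>R v - real l *\<^sub>R w))))"
proof -
  have fm: "f \<in> borel_measurable lebesgue" using f by (simp add: torus_Lp_iff)
  have sm: "(\<lambda>z. f (z + - (real k *\<^sub>R v + real l *\<^sub>R w))) \<in> borel_measurable lebesgue" for k l
    by (rule borel_measurable_lebesgue_shift[OF fm])
  have [measurable]: "(\<lambda>z. f (z - (real k *\<^sub>R v + real l *\<^sub>R w))) \<in> borel_measurable torus_measure" for k l
    using measurable_torusI[OF sm[of k l]] by (simp only: add_uminus_conv_diff)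
  define N where "N = (\<integral>\<^sup>+ z. ennreal (norm (f z)) \<partial>torus_measure)"
  have N: "N < \<infinity>" unfolding N_def by (rule torus_L1[OF p f])
  have sh: "(\<integral>\<^sup>+ z. ennreal (norm (f (z - u))) \<partial>torus_measure) = N" for u
    using nn_integral_norm_shift[OF f, of u 1] by (simp add: N_def)
  let ?G = "\<lambda>z. \<Sum>k. \<Sum>l. ennreal \<bar>a k\<bar> * (ennreal \<bar>b l\<bar> * ennreal (norm (f (z - (real k *\<^sub>R v + real l *\<^sub>R w)))))"
  have "nn_integral torus_measure ?G = (\<Sum>k. \<Sum>l. ennreal \<bar>a k\<bar> * (ennreal \<bar>b l\<bar> * N))"
    by (simp add: nn_integral_suminf nn_integral_cmult sh)
  also have "\<dots> = ennreal (norm1 a) * (ennreal (norm1 b) * N)"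
    using a unfolding ell1_def norm1_def
    by (simp add: ennreal_suminf_cmult ennreal_suminf_multc suminf_ennreal2)
  also have "\<dots> < \<infinity>" using N by (simp add: ennreal_mult_less_top)
  finally have "AE z in torus_measure. ?G z \<noteq> \<infinity>" by (intro nn_integral_PInf_AE) auto
  then show ?thesis
  proof eventually_elim
    case (elim z)
    let ?n = "\<lambda>k l. norm (of_real (a k) * (of_real (b l) * f (z - real k *\<^sub>R v - real l *\<^sub>R w)))"
    have "ennreal (?n k l) = ennreal \<bar>a k\<bar> * (ennreal \<bar>b l\<bar> * ennreal (norm (f (z - (real k *\<^sub>R v + real l *\<^sub>R w)))))" for k l
      unfolding diff_diff_eq[of z] norm_mult by (simp add: ennreal_mult')
    then have G: "(\<Sum>k. \<Sum>l. ennreal (?n k l)) \<noteq> top"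
      using elim by (simp only: infinity_ennreal_def not_False_eq_True)
    define n where "n k l = ?n k l" for k l
    have nn: "n k l \<ge> 0" for k l by (simp add: n_def)
    have G': "(\<Sum>k. \<Sum>l. ennreal (n k l)) \<noteq> top" using G by (simp only: n_def not_False_eq_True)
    have in1: "summable (n k)" for k
    proof (rule summable_suminf_not_top[OF nn])
      have "(\<Sum>l. ennreal (n k l)) \<le> (\<Sum>k. \<Sum>l. ennreal (n k l))"
        using sum_le_suminf[of "\<lambda>k. \<Sum>l. ennreal (n k l)" "{k}"] by simp
      then show "(\<Sum>l. ennreal (n k l)) \<noteq> top" using G' by (metis top_unique)
    qed
    have out1: "(\<Sum>l. ennreal (n k l)) = ennreal (\<Sum>l. n k l)" for k by (rule suminf_ennreal2[OF nn in1])
    have "summable (\<lambda>k. \<Sum>l. n k l)"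
      using G' unfolding out1 by (intro summable_suminf_not_top suminf_nonneg in1 nn)
    with in1 show ?case unfolding n_def by blast
  qed
qed

lemma op_op_eq:
  assumes "\<And>k. summable (\<lambda>l. norm (of_real (a k) * (of_real (b l) * f (z - real k *\<^sub>R v - real l *\<^sub>R w))))"
  shows "op a v (op b w f) z = (\<Sum>k. \<Sum>l. of_real (a k) * (of_real (b l) * f (z - real k *\<^sub>R v - real l *\<^sub>R w)))"
  unfolding op_def
proof (rule suminf_cong)
  fix k
  show "of_real (a k) * (\<Sum>l. of_real (b l) * f (z - real k *\<^sub>R v - real l *\<^sub>R w)) =
      (\<Sum>l. of_real (a k) * (of_real (b l) * f (z - real k *\<^sub>R v - real l *\<^sub>R w)))"
  \<comment> \<open>For a k = 0 the inner series may diverge, but then both sides vanish.\<close>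
  proof (cases "a k = 0")
    case False
    then have "summable (\<lambda>l. of_real (b l) * f (z - real k *\<^sub>R v - real l *\<^sub>R w))"
      using summable_norm_cancel[OF assms[of k]] by (simp add: summable_cmult_iff)
    then show ?thesis by (simp add: suminf_mult)
  qed simp
qed

text \<open>Summation by rows against summation by columns. The two steps may differ, which is what
  separates the two variables.\<close>

lemma op_commute:
  assumes p: "p > 1" and f: "f \<in> torus_Lp p" and a: "ell1 a" "ell1 b"
  shows "AE z in torus_measure. op a v (op b w f) z = op b w (op a v f) z"
  using AE_op_op_summable[OF p f a, of v w] AE_op_op_summable[OF p f a(2,1), of w v]
proof eventually_elim
  case (elim z)
  let ?t = "\<lambda>k l. of_real (a k) * (of_real (b l) * f (z - real k *\<^sub>R v - real l *\<^sub>R w))"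
  have "(\<lambda>l. \<Sum>k. ?t k l) sums (\<Sum>k. \<Sum>l. ?t k l)"
    using elim by (intro double_series(1)) auto
  then have "(\<Sum>k. \<Sum>l. ?t k l) = (\<Sum>l. \<Sum>k. ?t k l)" by (simp add: sums_iff)
  moreover have "op a v (op b w f) z = (\<Sum>k. \<Sum>l. ?t k l)" using elim by (intro op_op_eq) auto
  moreover have "op b w (op a v f) z = (\<Sum>l. \<Sum>k. of_real (b l) * (of_real (a k) * f (z - real l *\<^sub>R w - real k *\<^sub>R v)))"
    using elim by (intro op_op_eq) auto
  moreover have "of_real (b l) * (of_real (a k) * f (z - real l *\<^sub>R w - real k *\<^sub>R v)) = ?t k l" for k l
    by (simp add: diff_diff_eq add.commute mult_ac)
  ultimately show ?case by simp
qed

text \<open>With a common step, the terms on one antidiagonal carry the same translate; collecting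
  them turns composition into multiplication of symbols.\<close>

lemma op_cauchy:
  assumes p: "p > 1" and f: "f \<in> torus_Lp p" and a: "ell1 a" "ell1 b"
  shows "AE z in torus_measure. op a v (op b v f) z = op (cauchy a b) v f z"
  using AE_op_op_summable[OF p f a, of v v]
proof eventually_elim
  case (elim z)
  let ?t = "\<lambda>k l. of_real (a k) * (of_real (b l) * f (z - real k *\<^sub>R v - real l *\<^sub>R v))"
  have "(\<lambda>N. \<Sum>i\<le>N. ?t i (N - i)) sums (\<Sum>k. \<Sum>l. ?t k l)"
    using elim by (intro double_series(2)) auto
  moreover have "(\<Sum>i\<le>N. ?t i (N - i)) = of_real (cauchy a b N) * f (z - real N *\<^sub>R v)" for N
    unfolding cauchy_def of_real_sum sum_distrib_right
  proof (rule sum.cong[OF refl])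
    fix i assume "i \<in> {..N}"
    then have "real i *\<^sub>R v + real (N - i) *\<^sub>R v = real N *\<^sub>R v"
      unfolding scaleR_left.add[symmetric] by (simp add: of_nat_diff)
    then show "?t i (N - i) = of_real (a i * b (N - i)) * f (z - real N *\<^sub>R v)"
      unfolding diff_diff_eq by simp
  qed
  ultimately have "(\<Sum>k. \<Sum>l. ?t k l) = (\<Sum>N. of_real (cauchy a b N) * f (z - real N *\<^sub>R v))"
    by (simp add: sums_iff)
  moreover have "op a v (op b v f) z = (\<Sum>k. \<Sum>l. ?t k l)" using elim by (intro op_op_eq) auto
  ultimately show ?case by (simp add: op_def)
qed

text \<open>Lets differences with steps m v and v be compared as two series in the same
  translation.\<close>

lemma op_dil:
  assumes "m > 0"
  shows "op a (real m *\<^sub>R v) f = op (dil m a) v f"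
proof
  fix z
  have sm: "strict_mono (\<lambda>k::nat. m * k)" using assms by (simp add: strict_mono_def)
  have "(\<Sum>k. of_real (dil m a (m * k)) * f (z - real (m * k) *\<^sub>R v)) = (\<Sum>n. of_real (dil m a n) * f (z - real n *\<^sub>R v))"
  proof (rule suminf_mono_reindex[OF sm])
    fix n assume "n \<notin> range (\<lambda>k. m * k)"
    then have "dil m a n = 0" by (auto simp: dil_def dvd_def)
    then show "of_real (dil m a n) * f (z - real n *\<^sub>R v) = 0" by simp
  qed
  moreover have "dil m a (m * k) = a k" "real (m * k) *\<^sub>R v = real k *\<^sub>R real m *\<^sub>R v" for k
    using assms by (simp_all add: dil_def mult.commute)
  ultimately show "op a (real m *\<^sub>R v) f z = op (dil m a) v f z"
    by (simp only: op_def)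
qed

lemma AE_op_summable:
  assumes p: "p > 1" and f: "f \<in> torus_Lp p" and a: "ell1 a"
  shows "AE z in torus_measure. summable (\<lambda>k. of_real (a k) * f (z - real k *\<^sub>R v))"
proof -
  \<comment> \<open>\<open>bc 0\<close> is the unit sequence, so row 0 of the double series is the
    single series in question.\<close>
  have l0: "ell1 (bc 0)" using symb_bc[of 0] symb_ell1 by auto
  show ?thesis using AE_op_op_summable[OF p f l0 a, of v v]
  proof eventually_elim
    case (elim z)
    have "summable (\<lambda>l. norm (of_real (bc 0 0) * (of_real (a l) * f (z - real 0 *\<^sub>R v - real l *\<^sub>R v))))"
      using conjunct1[OF elim] by (rule spec)
    then have "summable (\<lambda>l. norm (of_real (a l) * f (z - real l *\<^sub>R v)))" by (simp add: bc_def)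
    then show ?case by (rule summable_norm_cancel)
  qed
qed

lemma op_lincomb:
  assumes p: "p > 1" and f: "f \<in> torus_Lp p" and a: "ell1 a" "ell1 b"
  shows "AE z in torus_measure. op (\<lambda>k. c * a k + d * b k) v f z = of_real c * op a v f z + of_real d * op b v f z"
  using AE_op_summable[OF p f a(1), of v] AE_op_summable[OF p f a(2), of v]
proof eventually_elim
  case (elim z)
  have "op (\<lambda>k. c * a k + d * b k) v f z =
      (\<Sum>k. of_real c * (of_real (a k) * f (z - real k *\<^sub>R v)) + of_real d * (of_real (b k) * f (z - real k *\<^sub>R v)))"
    unfolding op_def by (intro suminf_cong) (simp add: distrib_right mult.assoc)
  also have "\<dots> = of_real c * op a v f z + of_real d * op b v f z"
    unfolding op_def suminf_mult[OF elim(1), symmetric] suminf_mult[OF elim(2), symmetric]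
    by (intro suminf_add[symmetric] summable_mult elim)
  finally show ?case .
qed

lemma op_add_fun:
  assumes p: "p > 1" and f: "f \<in> torus_Lp p" "g \<in> torus_Lp p" and a: "ell1 a"
  shows "AE z in torus_measure. op a v (\<lambda>z. f z + g z) z = op a v f z + op a v g z"
  using AE_op_summable[OF p f(1) a, of v] AE_op_summable[OF p f(2) a, of v]
proof eventually_elim
  case (elim z)
  then show ?case unfolding op_def distrib_left by (intro suminf_add[symmetric])
qed

lemma op_cong_AE:
  assumes fg: "f \<in> torus_Lp p" "g \<in> torus_Lp p" and ae: "AE z in torus_measure. f z = g z"
  shows "AE z in torus_measure. op a v f z = op a v g z"
proof -
  have m: "{z. f z \<noteq> g z} \<in> sets lebesgue"
  proof -
    have [measurable]: "f \<in> borel_measurable lebesgue" "g \<in> borel_measurable lebesgue" using fg by (auto simp: torus_Lp_iff)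
    have "{z \<in> space lebesgue. f z \<noteq> g z} \<in> sets lebesgue" by measurable
    then show ?thesis by simp
  qed
  have "per (\<lambda>z. f z = g z)" using fg by (auto simp: torus_Lp_iff per_def)
  then have "AE z in torus_measure. f (z + - (real k *\<^sub>R v)) = g (z + - (real k *\<^sub>R v))" for k
    by (intro AE_torus_shift[where P="\<lambda>z. f z = g z"] m ae) auto
  then have "AE z in torus_measure. \<forall>k. f (z - real k *\<^sub>R v) = g (z - real k *\<^sub>R v)"
    by (simp add: AE_all_countable)
  then show ?thesis by eventually_elim (simp add: op_def)
qed

section \<open>Fractional differences as series of translations\<close>

lemma frac_diff1_op: "frac_diff1 \<alpha> h f = (\<lambda>z. op (bc \<alpha>) (h, 0) f (z + (\<alpha> * h, 0)))"
proof
  fix z :: "real \<times> real"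
  obtain x y where z: "z = (x, y)" by (cases z)
  show "frac_diff1 \<alpha> h f z = op (bc \<alpha>) (h, 0) f (z + (\<alpha> * h, 0))"
    by (simp add: frac_diff1_def op_def bc_def z left_diff_distrib add_diff_eq)
qed

lemma frac_diff2_op: "frac_diff2 \<alpha> h f = (\<lambda>z. op (bc \<alpha>) (0, h) f (z + (0, \<alpha> * h)))"
proof
  fix z :: "real \<times> real"
  obtain x y where z: "z = (x, y)" by (cases z)
  show "frac_diff2 \<alpha> h f z = op (bc \<alpha>) (0, h) f (z + (0, \<alpha> * h))"
    by (simp add: frac_diff2_def op_def bc_def z left_diff_distrib add_diff_eq)
qed

text \<open>The two forward shifts combine into one translation of the whole expression, which
  leaves its norm unchanged by periodicity.\<close>

lemma mixed_modulus_op: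
  assumes "p > 1" "f \<in> torus_Lp p" "\<alpha>1 > 0" "\<alpha>2 > 0"
  shows "mixed_modulus p \<alpha>1 \<alpha>2 f \<delta>1 \<delta>2 = (SUP (h1, h2) \<in> {(h1, h2). \<bar>h1\<bar> \<le> \<delta>1 \<and> \<bar>h2\<bar> \<le> \<delta>2}.
     Lp_norm p (op (bc \<alpha>1) (h1, 0) (op (bc \<alpha>2) (0, h2) f)))"
proof -
  have "Lp_norm p (frac_diff1 \<alpha>1 h1 (frac_diff2 \<alpha>2 h2 f)) = Lp_norm p (op (bc \<alpha>1) (h1, 0) (op (bc \<alpha>2) (0, h2) f))" for h1 h2
  proof -
    let ?g = "op (bc \<alpha>1) (h1, 0) (op (bc \<alpha>2) (0, h2) f)"
    have "?g \<in> torus_Lp p" using assms by (intro torus_Lp_op summable_bc)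
    then have "Lp_norm p (\<lambda>z. ?g (z + ((\<alpha>1 * h1, 0) + (0, \<alpha>2 * h2)))) = Lp_norm p ?g"
      by (intro Lp_norm_shift) (auto simp: torus_Lp_iff)
    then show ?thesis unfolding frac_diff1_op frac_diff2_op op_shift by (simp add: add.assoc)
  qed
  then show ?thesis by (simp add: mixed_modulus_def)
qed

lemma suminf_swap_ennreal: "(\<Sum>i. \<Sum>j. f i j :: ennreal) = (\<Sum>j. \<Sum>i. f i j)"
proof -
  have "(\<Sum>i. \<Sum>j. f i j) = (\<Sum>i. \<integral>\<^sup>+ j. f i j \<partial>count_space UNIV)"
    by (simp add: nn_integral_count_space_nat)
  also have "\<dots> = (\<integral>\<^sup>+ j. (\<Sum>i. f i j) \<partial>count_space UNIV)"
    by (rule nn_integral_suminf[symmetric]) simp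
  finally show ?thesis by (simp add: nn_integral_count_space_nat)
qed

lemma suminf_shift_le_ennreal: "(\<Sum>j. f (j + k) :: ennreal) \<le> (\<Sum>j. f j)"
  using suminf_offset[of f k] by (simp add: summableI)

lemma torus_Lp_measurable: "f \<in> torus_Lp p \<Longrightarrow> f \<in> borel_measurable lebesgue"
  by (simp add: torus_Lp_iff)

section \<open>Domination between differences and Marchaud's telescoping\<close>

definition op_dominates :: "real \<Rightarrow> (nat \<Rightarrow> real) \<Rightarrow> (nat \<Rightarrow> real) \<Rightarrow> real \<Rightarrow> bool" where
  "op_dominates p a b C \<longleftrightarrow> (\<forall>f\<in>torus_Lp p. \<forall>v. Lp_norm p (op a v f) \<le> ennreal C * Lp_norm p (op b v f))"

lemma domD: "op_dominates p a b C \<Longrightarrow> f \<in> torus_Lp p \<Longrightarrow> Lp_norm p (op a v f) \<le> ennreal C * Lp_norm p (op b v f)"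
  unfolding op_dominates_def by blast

text \<open>The factorisation is checked on functions only; uniqueness of coefficients makes
  \<open>a\<close> the convolution of \<open>b\<close> with a summable sequence, and
  \<open>op_cauchy\<close> turns this into a composition of operators.\<close>

lemma op_dominate:
  assumes p: "p > 1" and a: "symb a (\<lambda>x. G x * B x)" and b: "symb b B" and G: "wien G K"
  shows "op_dominates p a b K"
  unfolding op_dominates_def
proof (intro ballI allI)
  fix f v assume f: "f \<in> torus_Lp p"
  obtain c where c: "symb c G" "norm1 c \<le> K" using G by (auto simp: wien_def)
  have "a = cauchy c b" by (rule symb_unique[OF a symb_mult[OF c(1) b]])
  then have "AE z in torus_measure. op c v (op b v f) z = op a v f z"
    using op_cauchy[OF p f symb_ell1[OF c(1)] symb_ell1[OF b]] by simp
  then have "Lp_norm p (op a v f) = Lp_norm p (op c v (op b v f))"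
    by (intro Lp_norm_cong_AE) (auto elim: eventually_mono)
  also have "\<dots> \<le> ennreal (norm1 c) * Lp_norm p (op b v f)"
    using p f b c symb_ell1 by (intro Lp_norm_op_le torus_Lp_op) auto
  also have "\<dots> \<le> ennreal K * Lp_norm p (op b v f)"
    using c by (intro mult_right_mono ennreal_leI) auto
  finally show "Lp_norm p (op a v f) \<le> ennreal K * Lp_norm p (op b v f)" .
qed

lemma dom_scale:
  assumes p: "p > 1" and \<alpha>: "\<alpha> > 0"
  shows "\<exists>C>0. \<forall>m>0. op_dominates p (dil m (bc \<alpha>)) (bc \<alpha>) (C * real m powr \<alpha>)"
proof -
  obtain C where C: "C > 0" "\<And>m. m > 0 \<Longrightarrow> wien (\<lambda>x. ((1 - x ^ m) / (1 - x)) powr \<alpha>) (C * real m powr \<alpha>)"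
    using wien_geometric[OF \<alpha>] by blast
  have "op_dominates p (dil m (bc \<alpha>)) (bc \<alpha>) (C * real m powr \<alpha>)" if m: "m > 0" for m
  proof (rule op_dominate[OF p _ symb_bc C(2)[OF m]])
    show "symb (dil m (bc \<alpha>)) (\<lambda>x. ((1 - x ^ m) / (1 - x)) powr \<alpha> * (1 - x) powr \<alpha>)"
      by (rule symb_cong[OF symb_dil[OF symb_bc m]]) (use \<alpha> in \<open>auto simp: powr_divide\<close>)
  qed (use \<alpha> in auto)
  then show ?thesis using C(1) by blast
qed

lemma dom_higher:
  assumes p: "p > 1" and \<alpha>: "\<alpha> > 0" "\<alpha> < \<beta>"
  shows "\<exists>C>0. op_dominates p (bc \<beta>) (bc \<alpha>) C"
proof -
  have "op_dominates p (bc \<beta>) (bc \<alpha>) (norm1 (bc (\<beta> - \<alpha>)) + 1)"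
  proof (rule op_dominate[OF p _ symb_bc])
    show "symb (bc \<beta>) (\<lambda>x. (1 - x) powr (\<beta> - \<alpha>) * (1 - x) powr \<alpha>)"
      by (rule symb_cong[OF symb_bc]) (use \<alpha> in \<open>auto simp flip: powr_add\<close>)
    show "wien (\<lambda>x. (1 - x) powr (\<beta> - \<alpha>)) (norm1 (bc (\<beta> - \<alpha>)) + 1)"
      by (rule wien_mono[OF wien_bc]) (use \<alpha> in auto)
  qed (use \<alpha> in auto)
  moreover have "norm1 (bc (\<beta> - \<alpha>)) + 1 > 0" using norm1_nonneg[OF summable_bc[of "\<beta> - \<alpha>"]] \<alpha> by simp
  ultimately show ?thesis by blast
qed

text \<open>The remainder contains (1 - x)^(alpha + 1). Since beta is at most alpha + 1, splitting
  off (1 - x)^beta leaves a nonnegative power, which belongs to the algebra.\<close>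

lemma marchaud_step:
  assumes p: "p > 1" and \<alpha>: "\<alpha> > 0" "\<alpha> < \<beta>" "\<beta> \<le> \<alpha> + 1"
  shows "\<exists>C>0. \<forall>f\<in>torus_Lp p. \<forall>v. Lp_norm p (op (bc \<alpha>) v f) \<le>
     ennreal (2 powr (- \<alpha>)) * Lp_norm p (op (bc \<alpha>) (2 *\<^sub>R v) f) + ennreal C * Lp_norm p (op (bc \<beta>) v f)"
proof -
  obtain R C where R: "wien R C" and eq: "\<And>x. x \<in> {0<..<1} \<Longrightarrow>
     (1 - x) powr \<alpha> = 2 powr (- \<alpha>) * (1 - x ^ 2) powr \<alpha> + (1 - x) powr (\<alpha> + 1) * R x"
    using wien_marchaud[OF \<alpha>(1)] by blast
  define e where "e k = bc \<alpha> k + - (2 powr (- \<alpha>)) * dil 2 (bc \<alpha>) k" for k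
  define K where "K = norm1 (bc (\<alpha> + 1 - \<beta>)) * C"
  have e: "symb e (\<lambda>x. ((1 - x) powr (\<alpha> + 1 - \<beta>) * R x) * (1 - x) powr \<beta>)"
    unfolding e_def
  proof (rule symb_cong[OF symb_add[OF symb_bc symb_cmult[OF symb_dil[OF symb_bc]]]])
    fix x :: real assume x: "0 < x" "x < 1"
    have "(1 - x) powr (\<alpha> + 1) = (1 - x) powr (\<alpha> + 1 - \<beta>) * (1 - x) powr \<beta>"
      by (simp flip: powr_add)
    then show "(1 - x) powr \<alpha> + - (2 powr - \<alpha>) * (1 - x ^ 2) powr \<alpha> = ((1 - x) powr (\<alpha> + 1 - \<beta>) * R x) * (1 - x) powr \<beta>"
      using eq[of x] x by simp
  qed (use \<alpha> in auto)
  have dome: "op_dominates p e (bc \<beta>) K"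
  proof (rule op_dominate[OF p e symb_bc])
    show "wien (\<lambda>x. (1 - x) powr (\<alpha> + 1 - \<beta>) * R x) K"
      unfolding K_def by (rule wien_mult[OF wien_bc R]) (use \<alpha> in auto)
  qed (use \<alpha> in auto)
  have ell: "ell1 (bc \<alpha>)" "ell1 (dil 2 (bc \<alpha>))" "ell1 e" using \<alpha> e symb_ell1 norm1_dil summable_bc by auto
  have "Lp_norm p (op (bc \<alpha>) v f) \<le>
     ennreal (2 powr (- \<alpha>)) * Lp_norm p (op (bc \<alpha>) (2 *\<^sub>R v) f) + ennreal (max K 1) * Lp_norm p (op (bc \<beta>) v f)"
    if f: "f \<in> torus_Lp p" for f v
  proof -
    define g where "g z = of_real (2 powr (- \<alpha>)) * op (dil 2 (bc \<alpha>)) v f z" for z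
    define h where "h z = of_real 1 * op e v f z" for z
    have T: "op (dil 2 (bc \<alpha>)) v f \<in> torus_Lp p" "op e v f \<in> torus_Lp p"
      using p f ell by (auto intro: torus_Lp_op)
    have T2: "g \<in> torus_Lp p" "h \<in> torus_Lp p"
      unfolding g_def[abs_def] h_def[abs_def] using p T by (auto intro: torus_Lp_cmult)
    have "AE z in torus_measure. op (\<lambda>k. 2 powr (- \<alpha>) * dil 2 (bc \<alpha>) k + 1 * e k) v f z = g z + h z"
      unfolding g_def h_def by (rule op_lincomb[OF p f ell(2,3)])
    moreover have "(\<lambda>k. 2 powr (- \<alpha>) * dil 2 (bc \<alpha>) k + 1 * e k) = bc \<alpha>" by (simp add: e_def)
    ultimately have "Lp_norm p (op (bc \<alpha>) v f) = Lp_norm p (\<lambda>z. g z + h z)"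
      by (intro Lp_norm_cong_AE) simp
    also have "\<dots> \<le> Lp_norm p g + Lp_norm p h"
      by (rule Lp_norm_triangle[OF p T2(1)[THEN torus_Lp_measurable] T2(2)[THEN torus_Lp_measurable]])
    also have "Lp_norm p g = ennreal (2 powr (- \<alpha>)) * Lp_norm p (op (dil 2 (bc \<alpha>)) v f)"
      unfolding g_def[abs_def] using T p by (subst Lp_norm_cmult) (auto simp: torus_Lp_iff)
    also have "op (dil 2 (bc \<alpha>)) v f = op (bc \<alpha>) (2 *\<^sub>R v) f" using op_dil[of 2 "bc \<alpha>" v f] by simp
    also have "Lp_norm p h \<le> ennreal (max K 1) * Lp_norm p (op (bc \<beta>) v f)"
    proof -
      have "Lp_norm p h \<le> ennreal K * Lp_norm p (op (bc \<beta>) v f)" using domD[OF dome f, of v] by (simp add: h_def[abs_def])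
      also have "\<dots> \<le> ennreal (max K 1) * Lp_norm p (op (bc \<beta>) v f)"
        by (intro mult_right_mono ennreal_leI) auto
      finally show ?thesis .
    qed
    finally show ?thesis by (simp add: add_left_mono)
  qed
  then show ?thesis by (intro exI[of _ "max K 1"]) auto
qed

text \<open>Iteration along the steps v, 2v, 4v, ... leaves a remainder 2^(-alpha J) times a
  difference of f, which tends to 0 because differences of order alpha are bounded uniformly in the
  step.\<close>

lemma marchaud_series_small:
  assumes p: "p > 1" and \<alpha>: "\<alpha> > 0" "\<alpha> < \<beta>" "\<beta> \<le> \<alpha> + 1"
  shows "\<exists>C>0. \<forall>f\<in>torus_Lp p. \<forall>v. Lp_norm p (op (bc \<alpha>) v f) \<le>
     ennreal C * (\<Sum>j. ennreal (2 powr (- \<alpha> * real j)) * Lp_norm p (op (bc \<beta>) (2 ^ j *\<^sub>R v) f))"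
proof -
  obtain C where C: "C > 0" and step: "\<And>f v. f \<in> torus_Lp p \<Longrightarrow> Lp_norm p (op (bc \<alpha>) v f) \<le>
     ennreal (2 powr (- \<alpha>)) * Lp_norm p (op (bc \<alpha>) (2 *\<^sub>R v) f) + ennreal C * Lp_norm p (op (bc \<beta>) v f)"
    using marchaud_step[OF assms] by blast
  have "Lp_norm p (op (bc \<alpha>) v f) \<le>
     ennreal C * (\<Sum>j. ennreal (2 powr (- \<alpha> * real j)) * Lp_norm p (op (bc \<beta>) (2 ^ j *\<^sub>R v) f))"
    if f: "f \<in> torus_Lp p" for f v
  proof -
    let ?q = "\<lambda>j. ennreal (2 powr (- \<alpha> * real j))"
    let ?X = "\<lambda>j. Lp_norm p (op (bc \<alpha>) (2 ^ j *\<^sub>R v) f)"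
    let ?Y = "\<lambda>j. Lp_norm p (op (bc \<beta>) (2 ^ j *\<^sub>R v) f)"
    have it: "?X 0 \<le> ?q J * ?X J + (\<Sum>j<J. ennreal C * (?q j * ?Y j))" for J
    proof (induction J)
      case (Suc J)
      have "?q J * ?X J \<le> ?q J * (ennreal (2 powr (- \<alpha>)) * ?X (Suc J) + ennreal C * ?Y J)"
        using step[OF f, of "2 ^ J *\<^sub>R v"] by (intro mult_left_mono) auto
      also have "\<dots> = ?q J * ennreal (2 powr (- \<alpha>)) * ?X (Suc J) + ennreal C * (?q J * ?Y J)"
        by (simp only: distrib_left mult.assoc mult.left_commute)
      also have "?q J * ennreal (2 powr (- \<alpha>)) = ?q (Suc J)"
        by (simp add: algebra_simps flip: ennreal_mult' powr_add)
      finally have *: "?q J * ?X J \<le> ?q (Suc J) * ?X (Suc J) + ennreal C * (?q J * ?Y J)" .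
      have "?X 0 \<le> ?q J * ?X J + (\<Sum>j<J. ennreal C * (?q j * ?Y j))" by (rule Suc)
      also have "\<dots> \<le> ?q (Suc J) * ?X (Suc J) + ennreal C * (?q J * ?Y J) + (\<Sum>j<J. ennreal C * (?q j * ?Y j))"
        by (intro add_right_mono *)
      also have "\<dots> = ?q (Suc J) * ?X (Suc J) + (\<Sum>j<Suc J. ennreal C * (?q j * ?Y j))"
        by (simp only: sum.lessThan_Suc add_ac)
      finally show ?case .
    qed simp
    obtain B where B: "B \<ge> 0" "\<And>w. Lp_norm p (op (bc \<alpha>) w f) \<le> ennreal B"
    proof -
      obtain N where "N \<ge> 0" "Lp_norm p f = ennreal N"
        using f by (cases "Lp_norm p f") (auto simp: torus_Lp_iff)
      then show ?thesis
        using that[of "norm1 (bc \<alpha>) * N"] Lp_norm_op_le[OF p f summable_bc[OF \<alpha>(1)]] norm1_nonneg[OF summable_bc[OF \<alpha>(1)]]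
        by (simp add: ennreal_mult')
    qed
    let ?S = "ennreal C * (\<Sum>j. ?q j * ?Y j)"
    have le: "?X 0 \<le> ennreal (2 powr (- \<alpha> * real J) * B) + ?S" for J
    proof -
      have "?X 0 \<le> ?q J * ?X J + (\<Sum>j<J. ennreal C * (?q j * ?Y j))" by (rule it)
      also have "?q J * ?X J \<le> ?q J * ennreal B" by (intro mult_left_mono B) auto
      also have "(\<Sum>j<J. ennreal C * (?q j * ?Y j)) \<le> (\<Sum>j. ennreal C * (?q j * ?Y j))"
        by (intro sum_le_suminf) auto
      also have "\<dots> = ?S" by (rule ennreal_suminf_cmult)
      finally show ?thesis using B by (simp add: ennreal_mult')
    qed
    have "?X 0 \<le> ?S"
    proof (rule ennreal_le_epsilon)
      fix e :: real assume e: "e > 0"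
      have "(\<lambda>J. (2 powr (- \<alpha>)) ^ J * B) \<longlonglongrightarrow> 0 * B"
        using \<alpha> by (intro tendsto_mult LIMSEQ_power_zero tendsto_const) (auto simp: powr_less_one)
      then have "eventually (\<lambda>J. (2 powr (- \<alpha>)) ^ J * B < e) sequentially"
        using e by (intro order_tendstoD) auto
      then obtain J where "(2 powr (- \<alpha>)) ^ J * B < e" by (auto simp: eventually_sequentially)
      then have "2 powr (- \<alpha> * real J) * B \<le> e" by (simp add: powr_powr flip: powr_realpow)
      then have "ennreal (2 powr (- \<alpha> * real J) * B) + ?S \<le> ennreal e + ?S"
        by (intro add_right_mono ennreal_leI)
      with le[of J] show "?X 0 \<le> ?S + ennreal e" by (simp add: add.commute order_trans)
    qed
    then show ?thesis by simp
  qed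
  then show ?thesis using C by blast
qed

text \<open>A gap between the orders larger than 1 is bridged by unit increments. The series for
  alpha + 1 is inserted into the one for alpha; the resulting double sum collapses because the inner
  series decays faster by 2^(-k).\<close>

lemma marchaud_series:
  assumes p: "p > 1" and \<alpha>: "\<alpha> > 0" "\<alpha> < \<beta>"
  shows "\<exists>C>0. \<forall>f\<in>torus_Lp p. \<forall>v. Lp_norm p (op (bc \<alpha>) v f) \<le>
     ennreal C * (\<Sum>j. ennreal (2 powr (- \<alpha> * real j)) * Lp_norm p (op (bc \<beta>) (2 ^ j *\<^sub>R v) f))"
proof -
  have "\<exists>C>0. \<forall>f\<in>torus_Lp p. \<forall>v. Lp_norm p (op (bc \<alpha>) v f) \<le>
     ennreal C * (\<Sum>j. ennreal (2 powr (- \<alpha> * real j)) * Lp_norm p (op (bc \<beta>) (2 ^ j *\<^sub>R v) f))"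
    if "\<alpha> > 0" "\<alpha> < \<beta>" "\<beta> \<le> \<alpha> + real n" for n \<alpha>
    using that
  proof (induction n arbitrary: \<alpha>)
    case 0
    then show ?case by simp
  next
    case (Suc n)
    show ?case
    proof (cases "\<beta> \<le> \<alpha> + 1")
      case True
      then show ?thesis using marchaud_series_small[OF p, of \<alpha> \<beta>] Suc by blast
    next
      case False
      obtain C where C: "C > 0" and 1: "\<And>f v. f \<in> torus_Lp p \<Longrightarrow> Lp_norm p (op (bc \<alpha>) v f) \<le>
         ennreal C * (\<Sum>j. ennreal (2 powr (- \<alpha> * real j)) * Lp_norm p (op (bc (\<alpha> + 1)) (2 ^ j *\<^sub>R v) f))"
        using marchaud_series_small[OF p, of \<alpha> "\<alpha> + 1"] Suc by auto
      obtain D where D: "D > 0" and 2: "\<And>f v. f \<in> torus_Lp p \<Longrightarrow> Lp_norm p (op (bc (\<alpha> + 1)) v f) \<le>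
         ennreal D * (\<Sum>j. ennreal (2 powr (- (\<alpha> + 1) * real j)) * Lp_norm p (op (bc \<beta>) (2 ^ j *\<^sub>R v) f))"
        using Suc.IH[of "\<alpha> + 1"] Suc.prems False by auto
      have "Lp_norm p (op (bc \<alpha>) v f) \<le> ennreal (C * D * 2) *
          (\<Sum>j. ennreal (2 powr (- \<alpha> * real j)) * Lp_norm p (op (bc \<beta>) (2 ^ j *\<^sub>R v) f))"
        if f: "f \<in> torus_Lp p" for f v
      proof -
        define h where "h n = ennreal (2 powr (- \<alpha> * real n)) * Lp_norm p (op (bc \<beta>) (2 ^ n *\<^sub>R v) f)" for n
        have trm: "ennreal (2 powr (- \<alpha> * real j)) * Lp_norm p (op (bc (\<alpha> + 1)) (2 ^ j *\<^sub>R v) f)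
            \<le> ennreal D * (\<Sum>k. ennreal ((1/2) ^ k) * h (k + j))" for j
        proof -
          have "ennreal (2 powr (- \<alpha> * real j)) * Lp_norm p (op (bc (\<alpha> + 1)) (2 ^ j *\<^sub>R v) f)
            \<le> ennreal (2 powr (- \<alpha> * real j)) * (ennreal D * (\<Sum>k. ennreal (2 powr (- (\<alpha> + 1) * real k)) * Lp_norm p (op (bc \<beta>) (2 ^ k *\<^sub>R 2 ^ j *\<^sub>R v) f)))"
            by (intro mult_left_mono 2[OF f]) auto
          also have "\<dots> = ennreal D * (\<Sum>k. ennreal (2 powr (- \<alpha> * real j)) * (ennreal (2 powr (- (\<alpha> + 1) * real k)) * Lp_norm p (op (bc \<beta>) (2 ^ k *\<^sub>R 2 ^ j *\<^sub>R v) f)))"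
            by (simp only: ennreal_suminf_cmult mult.left_commute)
          also have "(\<lambda>k. ennreal (2 powr (- \<alpha> * real j)) * (ennreal (2 powr (- (\<alpha> + 1) * real k)) * Lp_norm p (op (bc \<beta>) (2 ^ k *\<^sub>R 2 ^ j *\<^sub>R v) f)))
             = (\<lambda>k. ennreal ((1/2) ^ k) * h (k + j))"
          proof
            fix k
            \<comment> \<open>The surplus (1/2)^k of order alpha + 1 over order alpha remains when
              everything is expressed by j + k; summed over k it gives the factor 2 of the
              constant.\<close>
            have "2 powr (- \<alpha> * real j) * 2 powr (- (\<alpha> + 1) * real k) = (1/2) ^ k * 2 powr (- \<alpha> * real (k + j))"
            proof -
              have "(1/2::real) ^ k = 2 powr (- real k)" by (simp add: powr_minus powr_realpow power_one_over inverse_eq_divide)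
              then show ?thesis by (simp add: algebra_simps flip: powr_add)
            qed
            then show "ennreal (2 powr (- \<alpha> * real j)) * (ennreal (2 powr (- (\<alpha> + 1) * real k)) * Lp_norm p (op (bc \<beta>) (2 ^ k *\<^sub>R 2 ^ j *\<^sub>R v) f)) = ennreal ((1/2) ^ k) * h (k + j)"
              unfolding h_def by (simp only: mult.assoc[symmetric] ennreal_mult'[symmetric] powr_ge_zero zero_le_power zero_le_divide_1_iff zero_le_numeral scaleR_scaleR power_add)
          qed
          finally show ?thesis .
        qed
        have "Lp_norm p (op (bc \<alpha>) v f) \<le> ennreal C * (\<Sum>j. ennreal D * (\<Sum>k. ennreal ((1/2) ^ k) * h (k + j)))"
          by (rule order_trans[OF 1[OF f]]) (intro mult_left_mono suminf_le trm, auto)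
        also have "\<dots> = ennreal (C * D) * (\<Sum>j. \<Sum>k. ennreal ((1/2) ^ k) * h (k + j))"
          using C D by (simp add: ennreal_suminf_cmult ennreal_mult' mult.assoc)
        also have "(\<Sum>j. \<Sum>k. ennreal ((1/2) ^ k) * h (k + j)) = (\<Sum>k. \<Sum>j. ennreal ((1/2) ^ k) * h (k + j))"
          by (rule suminf_swap_ennreal)
        also have "\<dots> = (\<Sum>k. ennreal ((1/2) ^ k) * (\<Sum>j. h (j + k)))" by (simp add: ennreal_suminf_cmult add.commute)
        also have "\<dots> \<le> (\<Sum>k. ennreal ((1/2) ^ k) * (\<Sum>j. h j))"
          by (intro suminf_le mult_left_mono suminf_shift_le_ennreal) auto
        also have "\<dots> = (\<Sum>k. ennreal ((1/2) ^ k)) * (\<Sum>j. h j)" by (rule ennreal_suminf_multc)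
        also have "(\<Sum>k. ennreal ((1/2) ^ k)) = ennreal 2"
          using suminf_geometric[of "1/2::real"] by (subst suminf_ennreal2) auto
        finally show ?thesis using C D unfolding h_def
          by (simp add: ennreal_mult' mult.assoc mult_left_mono)
      qed
      then show ?thesis using C D by (intro exI[of _ "C * D * 2"]) auto
    qed
  qed
  from this[of \<alpha> "nat \<lceil>\<beta> - \<alpha>\<rceil>"] show ?thesis using \<alpha> by (auto simp: le_nat_iff) (smt (verit) le_of_int_ceiling of_int_0_le_iff real_nat_ceiling_ge)
qed

text \<open>On periodic functions the step matters only modulo 2 pi, which makes large steps
  accessible to bounds for small ones.\<close>

lemma op_periodic:
  assumes "per f"
  shows "op a (h1 + 2*pi * of_int k, h2 + 2*pi * of_int l) f = op a (h1, h2) f"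
proof
  fix z :: "real \<times> real"
  obtain x y where z: "z = (x, y)" by (cases z)
  have "f (x - real n * (h1 + 2*pi * of_int k), y - real n * (h2 + 2*pi * of_int l)) = f (x - real n * h1, y - real n * h2)" for n
    using per_int[OF assms, of "x - real n * h1" "- (int n * k)" "y - real n * h2" "- (int n * l)"]
    by (simp add: algebra_simps)
  then show "op a (h1 + 2*pi * of_int k, h2 + 2*pi * of_int l) f z = op a (h1, h2) f z"
    by (simp add: op_def z)
qed

lemma Lp_norm_op_swap:
  assumes "p > 1" "f \<in> torus_Lp p" "ell1 a" "ell1 b"
  shows "Lp_norm p (op a v (op b w f)) = Lp_norm p (op b w (op a v f))"
  by (rule Lp_norm_cong_AE[OF op_commute[OF assms]])

text \<open>A one-dimensional domination acts on the outermost operator only; commuting the two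
  operators gives access to the inner one.\<close>

lemma dom_biv:
  assumes p: "p > 1" and d: "op_dominates p a1 b1 C1" "op_dominates p a2 b2 C2" and f: "f \<in> torus_Lp p"
    and e: "ell1 a1" "ell1 b1" "ell1 a2" "ell1 b2" and C: "C1 \<ge> 0"
  shows "Lp_norm p (op a1 v (op a2 w f)) \<le> ennreal (C1 * C2) * Lp_norm p (op b1 v (op b2 w f))"
proof -
  have "Lp_norm p (op a1 v (op a2 w f)) \<le> ennreal C1 * Lp_norm p (op b1 v (op a2 w f))"
    by (rule domD[OF d(1) torus_Lp_op[OF p f e(3)]])
  also have "\<dots> = ennreal C1 * Lp_norm p (op a2 w (op b1 v f))"
    by (simp only: Lp_norm_op_swap[OF p f e(2,3), of v w])
  also have "\<dots> \<le> ennreal C1 * (ennreal C2 * Lp_norm p (op b2 w (op b1 v f)))"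
    by (intro mult_left_mono domD[OF d(2)] torus_Lp_op[OF p f e(2)]) auto
  also have "\<dots> = ennreal (C1 * C2) * Lp_norm p (op b1 v (op b2 w f))"
    using C by (simp only: Lp_norm_op_swap[OF p f e(2,4), of v w] ennreal_mult' mult.assoc)
  finally show ?thesis .
qed

lemma scale_biv:
  assumes p: "p > 1" and \<alpha>: "\<alpha>1 > 0" "\<alpha>2 > 0"
  shows "\<exists>C>0. \<forall>f\<in>torus_Lp p. \<forall>m1>0. \<forall>m2>0. \<forall>h1 h2.
    Lp_norm p (op (bc \<alpha>1) (real m1 * h1, 0) (op (bc \<alpha>2) (0, real m2 * h2) f)) \<le>
    ennreal (C * (real m1 powr \<alpha>1 * real m2 powr \<alpha>2)) * Lp_norm p (op (bc \<alpha>1) (h1, 0) (op (bc \<alpha>2) (0, h2) f))"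
proof -
  obtain C1 C2 where C: "C1 > 0" "C2 > 0"
    and d: "\<And>m. m > 0 \<Longrightarrow> op_dominates p (dil m (bc \<alpha>1)) (bc \<alpha>1) (C1 * real m powr \<alpha>1)"
     "\<And>m. m > 0 \<Longrightarrow> op_dominates p (dil m (bc \<alpha>2)) (bc \<alpha>2) (C2 * real m powr \<alpha>2)"
    using dom_scale[OF p \<alpha>(1)] dom_scale[OF p \<alpha>(2)] by blast
  show ?thesis
  proof (intro exI[of _ "C1 * C2"] conjI ballI allI impI)
    fix f m1 m2 h1 h2 assume f: "f \<in> torus_Lp p" and m: "m1 > (0::nat)" "m2 > (0::nat)"
    have e: "op (bc \<alpha>1) (real m1 * h1, 0) = op (dil m1 (bc \<alpha>1)) (h1, 0)"
      "op (bc \<alpha>2) (0, real m2 * h2) = op (dil m2 (bc \<alpha>2)) (0, h2)"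
      using op_dil[OF m(1), of "bc \<alpha>1" "(h1, 0)"] op_dil[OF m(2), of "bc \<alpha>2" "(0, h2)"] by auto
    show "Lp_norm p (op (bc \<alpha>1) (real m1 * h1, 0) (op (bc \<alpha>2) (0, real m2 * h2) f)) \<le>
    ennreal (C1 * C2 * (real m1 powr \<alpha>1 * real m2 powr \<alpha>2)) * Lp_norm p (op (bc \<alpha>1) (h1, 0) (op (bc \<alpha>2) (0, h2) f))"
      using dom_biv[OF p d(1)[OF m(1)] d(2)[OF m(2)] f, of "(h1, 0)" "(0, h2)"] C \<alpha> m
      unfolding e by (simp add: summable_bc norm1_dil mult_ac)
  qed (use C in auto)
qed

text \<open>The expansion in the second variable is applied inside each term of the first series,
  after interchanging the two differences.\<close>

lemma marchaud_biv:
  assumes p: "p > 1" and \<alpha>: "\<alpha>1 > 0" "\<alpha>2 > 0" "\<alpha>1 < \<beta>1" "\<alpha>2 < \<beta>2"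
  shows "\<exists>C>0. \<forall>f\<in>torus_Lp p. \<forall>h1 h2.
    Lp_norm p (op (bc \<alpha>1) (h1, 0) (op (bc \<alpha>2) (0, h2) f)) \<le>
    ennreal C * (\<Sum>j. ennreal (2 powr (- \<alpha>1 * real j)) * (\<Sum>k. ennreal (2 powr (- \<alpha>2 * real k)) *
       Lp_norm p (op (bc \<beta>1) (2 ^ j * h1, 0) (op (bc \<beta>2) (0, 2 ^ k * h2) f))))"
proof -
  obtain C where C: "C > 0" and 1: "\<And>f v. f \<in> torus_Lp p \<Longrightarrow> Lp_norm p (op (bc \<alpha>1) v f) \<le>
     ennreal C * (\<Sum>j. ennreal (2 powr (- \<alpha>1 * real j)) * Lp_norm p (op (bc \<beta>1) (2 ^ j *\<^sub>R v) f))"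
    using marchaud_series[OF p \<alpha>(1,3)] by blast
  obtain D where D: "D > 0" and 2: "\<And>f v. f \<in> torus_Lp p \<Longrightarrow> Lp_norm p (op (bc \<alpha>2) v f) \<le>
     ennreal D * (\<Sum>j. ennreal (2 powr (- \<alpha>2 * real j)) * Lp_norm p (op (bc \<beta>2) (2 ^ j *\<^sub>R v) f))"
    using marchaud_series[OF p \<alpha>(2,4)] by blast
  show ?thesis
  proof (intro exI[of _ "C * D"] conjI ballI allI)
    fix f h1 h2 assume f: "f \<in> torus_Lp p"
    have e: "ell1 (bc \<alpha>1)" "ell1 (bc \<alpha>2)" "ell1 (bc \<beta>1)" "ell1 (bc \<beta>2)" using \<alpha> summable_bc by auto
    let ?Y = "\<lambda>j k. Lp_norm p (op (bc \<beta>1) (2 ^ j * h1, 0) (op (bc \<beta>2) (0, 2 ^ k * h2) f))"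
    have in2: "Lp_norm p (op (bc \<beta>1) (2 ^ j * h1, 0) (op (bc \<alpha>2) (0, h2) f)) \<le>
       ennreal D * (\<Sum>k. ennreal (2 powr (- \<alpha>2 * real k)) * ?Y j k)" for j
      using 2[OF torus_Lp_op[OF p f e(3)], of "(0, h2)" "(2 ^ j * h1, 0)"]
      by (simp add: Lp_norm_op_swap[OF p f e(2,3), of "(0, h2)" "(2 ^ j * h1, 0)"]
         Lp_norm_op_swap[OF p f e(4,3), of "(0, _)" "(2 ^ j * h1, 0)"])
    have "Lp_norm p (op (bc \<alpha>1) (h1, 0) (op (bc \<alpha>2) (0, h2) f)) \<le>
       ennreal C * (\<Sum>j. ennreal (2 powr (- \<alpha>1 * real j)) * Lp_norm p (op (bc \<beta>1) (2 ^ j * h1, 0) (op (bc \<alpha>2) (0, h2) f)))"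
      using 1[OF torus_Lp_op[OF p f e(2)], of "(h1, 0)"] by simp
    also have "\<dots> \<le> ennreal C * (\<Sum>j. ennreal (2 powr (- \<alpha>1 * real j)) * (ennreal D * (\<Sum>k. ennreal (2 powr (- \<alpha>2 * real k)) * ?Y j k)))"
      by (intro mult_left_mono suminf_le in2) auto
    also have "\<dots> = ennreal (C * D) * (\<Sum>j. ennreal (2 powr (- \<alpha>1 * real j)) * (\<Sum>k. ennreal (2 powr (- \<alpha>2 * real k)) * ?Y j k))"
      using C by (simp only: mult.left_commute[of _ "ennreal D"] ennreal_suminf_cmult ennreal_mult'[OF less_imp_le] mult.assoc)
    finally show "Lp_norm p (op (bc \<alpha>1) (h1, 0) (op (bc \<alpha>2) (0, h2) f)) \<le> \<dots>" .
  qed (use C D in auto)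
qed

section \<open>Inequalities between moduli of smoothness\<close>

lemma borel_measurable_mono_ennreal:
  fixes W :: "real \<Rightarrow> ennreal"
  assumes "mono W"
  shows "W \<in> borel_measurable borel"
proof (rule borel_measurableI_greater)
  fix y
  \<comment> \<open>Superlevel sets of a monotone function are intervals. For moduli this is the
    source of measurability in the scale parameter.\<close>
  have "is_interval {x. y < W x}"
    unfolding is_interval_1 using assms by (auto intro: less_le_trans dest: monoD)
  then show "{x \<in> space borel. y < W x} \<in> sets borel" by (simp add: real_interval_borel_measurable)
qed

lemma suminf_disjoint_nn_integral_le:
  fixes \<phi> :: "real \<Rightarrow> ennreal"
  assumes m: "\<phi> \<in> borel_measurable borel" and d: "disjoint_family I" and I: "\<And>n::nat. I n \<in> sets borel" and sub: "\<And>n. I n \<subseteq> S"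
  shows "(\<Sum>n. \<integral>\<^sup>+ t \<in> I n. \<phi> t \<partial>lborel) \<le> (\<integral>\<^sup>+ t \<in> S. \<phi> t \<partial>lborel)"
proof -
  have "(\<Sum>n. \<integral>\<^sup>+ t \<in> I n. \<phi> t \<partial>lborel) = (\<integral>\<^sup>+ t \<in> (\<Union>n. I n). \<phi> t \<partial>lborel)"
    by (rule nn_integral_disjoint_family[symmetric]) (use m d I in auto)
  also have "\<dots> \<le> (\<integral>\<^sup>+ t \<in> S. \<phi> t \<partial>lborel)"
    using sub by (intro nn_integral_mono) (auto simp: indicator_def)
  finally show ?thesis .
qed

lemma disjoint_family_Ioc:
  fixes a b :: "nat \<Rightarrow> real"
  assumes "(\<forall>n m. n < m \<longrightarrow> b n \<le> a m) \<or> (\<forall>n m. n < m \<longrightarrow> b m \<le> a n)"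
  shows "disjoint_family (\<lambda>n. {a n<..b n})"
proof -
  have "{a n<..b n} \<inter> {a m<..b m} = {}" if "n < m" for n m
    using assms that by (force dest: spec)
  then show ?thesis unfolding disjoint_family_on_def by (metis Int_commute linorder_neqE_nat)
qed

lemma nn_integral_Ioc_lower:
  fixes \<phi> :: "real \<Rightarrow> ennreal"
  assumes "a \<le> b" "\<And>t. a < t \<Longrightarrow> t \<le> b \<Longrightarrow> c \<le> \<phi> t"
  shows "c * ennreal (b - a) \<le> (\<integral>\<^sup>+ t \<in> {a<..b}. \<phi> t \<partial>lborel)"
proof -
  have "c * ennreal (b - a) = (\<integral>\<^sup>+ t. c * indicator {a<..b} t \<partial>lborel)"
    using assms by (subst nn_integral_cmult_indicator) auto
  also have "\<dots> \<le> (\<integral>\<^sup>+ t \<in> {a<..b}. \<phi> t \<partial>lborel)"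
    using assms by (intro nn_integral_mono) (auto simp: indicator_def)
  finally show ?thesis .
qed

lemma ennreal_divide_ennreal_pos: "c > 0 \<Longrightarrow> x / ennreal c = ennreal (1 / c) * x"
  by (simp add: divide_ennreal_def inverse_ennreal mult.commute inverse_eq_divide)

text \<open>With u = h/2^j, on (u/2, u] the doubling condition bounds W u by K W t, while t^(-r)/t
  is at least u^(-r)/u. The interval has length u/2, which accounts for the factor 2K.\<close>

lemma dyadic_sum_le_integral_0:
  fixes W :: "real \<Rightarrow> ennreal"
  assumes W: "mono W" and K: "K > 0" "\<And>t. t > 0 \<Longrightarrow> W (2 * t) \<le> ennreal K * W t" and r: "r > 0" and h: "h > 0"
  shows "(\<Sum>j. ennreal ((h / 2 ^ j) powr (- r)) * W (h / 2 ^ j)) \<le>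
    ennreal (2 * K) * (\<integral>\<^sup>+ t \<in> {0<..h}. ennreal (t powr (- r)) * W t / ennreal t \<partial>lborel)"
proof -
  have [measurable]: "W \<in> borel_measurable borel" by (rule borel_measurable_mono_ennreal[OF W])
  let ?\<phi> = "\<lambda>t. ennreal (t powr (- r)) * W t / ennreal t"
  have trm: "ennreal ((h / 2 ^ j) powr (- r)) * W (h / 2 ^ j) \<le> ennreal (2 * K) * (\<integral>\<^sup>+ t \<in> {h / 2 ^ Suc j<..h / 2 ^ j}. ?\<phi> t \<partial>lborel)" for j
  proof -
    define u where "u = h / 2 ^ j"
    have u: "u > 0" "h / 2 ^ Suc j = u / 2" using h by (auto simp: u_def)
    have "ennreal (u powr (- r) / (u * K)) * W u * ennreal (u - u / 2) \<le> (\<integral>\<^sup>+ t \<in> {u / 2<..u}. ?\<phi> t \<partial>lborel)"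
    proof (rule nn_integral_Ioc_lower)
      fix t assume t: "u / 2 < t" "t \<le> u"
      have "W u \<le> ennreal K * W (u / 2)" using K(2)[of "u / 2"] u by simp
      also have "\<dots> \<le> ennreal K * W t" using t W by (intro mult_left_mono monoD[OF W]) auto
      finally have Wu: "W u \<le> ennreal K * W t" .
      have "ennreal (u powr (- r) / (u * K)) * W u \<le> ennreal (u powr (- r) / (u * K)) * (ennreal K * W t)"
        by (intro mult_left_mono Wu) auto
      also have "\<dots> = ennreal (u powr (- r) / u) * W t"
        using u K by (simp add: mult.assoc[symmetric] flip: ennreal_mult')
      also have "\<dots> \<le> ennreal (t powr (- r) / t) * W t"
        using t u r by (intro mult_right_mono ennreal_leI frac_le powr_mono2') auto
      also have "\<dots> = ?\<phi> t" using t u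
        by (subst ennreal_divide_ennreal_pos) (auto simp: mult.assoc[symmetric] simp flip: ennreal_mult')
      finally show "ennreal (u powr (- r) / (u * K)) * W u \<le> ?\<phi> t" .
    qed (use u in auto)
    then have "ennreal (2 * K) * (ennreal (u powr (- r) / (u * K)) * W u * ennreal (u - u / 2)) \<le> ennreal (2 * K) * (\<integral>\<^sup>+ t \<in> {u / 2<..u}. ?\<phi> t \<partial>lborel)"
      by (rule mult_left_mono) auto
    also have "ennreal (2 * K) * (ennreal (u powr (- r) / (u * K)) * W u * ennreal (u - u / 2)) =
       (ennreal (2 * K) * ennreal (u powr (- r) / (u * K)) * ennreal (u - u / 2)) * W u" by (simp only: mult_ac)
    also have "ennreal (2 * K) * ennreal (u powr (- r) / (u * K)) * ennreal (u - u / 2) = ennreal (u powr (- r))"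
      using u K by (simp flip: ennreal_mult')
    finally show ?thesis unfolding u_def[symmetric] u(2) .
  qed
  have "(\<Sum>j. ennreal ((h / 2 ^ j) powr (- r)) * W (h / 2 ^ j)) \<le> (\<Sum>j. ennreal (2 * K) * (\<integral>\<^sup>+ t \<in> {h / 2 ^ Suc j<..h / 2 ^ j}. ?\<phi> t \<partial>lborel))"
    by (intro suminf_le trm) auto
  also have "\<dots> = ennreal (2 * K) * (\<Sum>j. \<integral>\<^sup>+ t \<in> {h / 2 ^ Suc j<..h / 2 ^ j}. ?\<phi> t \<partial>lborel)"
    by (rule ennreal_suminf_cmult)
  also have "\<dots> \<le> ennreal (2 * K) * (\<integral>\<^sup>+ t \<in> {0<..h}. ?\<phi> t \<partial>lborel)"
  proof (intro mult_left_mono suminf_disjoint_nn_integral_le disjoint_family_Ioc disjI2 allI impI)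
    fix n m :: nat assume "n < m"
    then have "(2::real) ^ Suc n \<le> 2 ^ m" by (intro power_increasing) auto
    then show "h / 2 ^ m \<le> h / 2 ^ Suc n" using h by (intro divide_left_mono) auto
  next
    fix n :: nat
    have "h / 2 ^ n \<le> h / 1" using h by (intro divide_left_mono) auto
    then show "{h / 2 ^ Suc n<..h / 2 ^ n} \<subseteq> {0<..h}" using h by (auto intro: less_trans[rotated])
  qed auto
  finally show ?thesis .
qed

text \<open>Terms with 2^(j+1) d at most 1 are compared with the integral over their own dyadic
  interval. For the infinitely many others W is bounded by K W(1/2), W(1/2) by the integral over
  (1/2, 1], and the geometric tail supplies d^alpha.\<close>

lemma dyadic_sum_le_integral_1:
  fixes W :: "real \<Rightarrow> ennreal"
  assumes W: "mono W" and K: "K > 0" "\<And>t. t > 0 \<Longrightarrow> W t \<le> ennreal K * W (1/2)" and \<alpha>: "\<alpha> > 0"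
    and d: "0 < d" "d \<le> 1/2"
  shows "(\<Sum>j. ennreal (2 powr (- \<alpha> * real j)) * W (2 ^ j * d)) \<le>
    ennreal ((2 powr (\<alpha> + 1) + 2 * K * 2 powr \<alpha> / (1 - 2 powr (- \<alpha>))) * d powr \<alpha>) *
     (\<integral>\<^sup>+ t \<in> {d..1}. W t / ennreal (t powr \<alpha>) / ennreal t \<partial>lborel)"
proof -
  have [measurable]: "W \<in> borel_measurable borel" by (rule borel_measurable_mono_ennreal[OF W])
  define \<phi> where "\<phi> t = W t / ennreal (t powr \<alpha>) / ennreal t" for t
  have \<phi>m: "\<phi> \<in> borel_measurable borel" unfolding \<phi>_def[abs_def] by measurable
  define \<Phi> where "\<Phi> = (\<integral>\<^sup>+ t \<in> {d..1}. \<phi> t \<partial>lborel)"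
  have \<phi>: "\<phi> t = ennreal (t powr (- \<alpha>) / t) * W t" if "t > 0" for t
  proof -
    have "ennreal (t powr (- \<alpha>) / t) = ennreal (1 / t * (1 / t powr \<alpha>))"
      by (simp add: powr_minus_divide mult.commute)
    also have "\<dots> = ennreal (1 / t) * ennreal (1 / t powr \<alpha>)" using that by (intro ennreal_mult') auto
    finally show ?thesis using that
      by (simp only: \<phi>_def ennreal_divide_ennreal_pos powr_gt_zero mult.assoc)
  qed
  define q where "q = 2 powr (- \<alpha>)"
  have q: "0 < q" "q < 1" using \<alpha> by (auto simp: q_def powr_less_one)
  have qj: "2 powr (- \<alpha> * real j) = q ^ j" for j by (simp add: q_def powr_powr flip: powr_realpow)
  \<comment> \<open>Cut off at 1, these intervals stay inside the domain of integration for every j;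
    for tail indices their integral is merely a nonnegative surplus.\<close>
  let ?I = "\<lambda>j::nat. {2 ^ j * d<..2 ^ Suc j * d} \<inter> {..1}"
  let ?e = "\<lambda>j::nat. if 2 ^ Suc j * d > 1 then q ^ j else 0"
  have half: "W (1/2) \<le> ennreal 2 * \<Phi>"
  proof -
    have "W (1/2) * ennreal (1 - 1/2) \<le> (\<integral>\<^sup>+ t \<in> {1/2<..1}. \<phi> t \<partial>lborel)"
    proof (rule nn_integral_Ioc_lower)
      fix t :: real assume t: "1/2 < t" "t \<le> 1"
      have "t powr 0 \<le> t powr (- \<alpha>)" using t \<alpha> by (intro powr_mono') auto
      then have "1 \<le> t powr (- \<alpha>) / t" using t by (simp add: field_simps)
      then have "1 * W (1/2) \<le> ennreal (t powr (- \<alpha>) / t) * W t"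
        by (intro mult_mono monoD[OF W]) (use t in \<open>auto simp flip: ennreal_1 intro: ennreal_leI\<close>)
      then show "W (1/2) \<le> \<phi> t" using \<phi>[of t] t by simp
    qed auto
    also have "\<dots> \<le> \<Phi>" unfolding \<Phi>_def using d by (intro nn_integral_mono) (auto simp: indicator_def)
    finally have "ennreal 2 * (W (1/2) * ennreal (1 - 1/2)) \<le> ennreal 2 * \<Phi>" by (rule mult_left_mono) simp
    moreover have "ennreal 2 * (W (1/2) * ennreal (1 - 1/2)) = W (1/2)"
    proof -
      have "ennreal 2 * ennreal (1 - 1/2) = 1" by (subst ennreal_mult'[symmetric]) auto
      then show ?thesis by (simp only: mult.left_commute[of "ennreal 2"] mult_1_right)
    qed
    ultimately show ?thesis by simp
  qed
  have trm: "ennreal (q ^ j) * W (2 ^ j * d) \<le>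
     ennreal (2 powr (\<alpha> + 1) * d powr \<alpha>) * (\<integral>\<^sup>+ t \<in> ?I j. \<phi> t \<partial>lborel) + ennreal (2 * K) * \<Phi> * ennreal (?e j)" for j
  proof (cases "2 ^ Suc j * d > 1")
    case True
    have "W (2 ^ j * d) \<le> ennreal K * (ennreal 2 * \<Phi>)"
      by (rule order_trans[OF K(2)]) (use d half in \<open>auto intro: mult_left_mono\<close>)
    then have "ennreal (q ^ j) * W (2 ^ j * d) \<le> ennreal (q ^ j) * (ennreal K * (ennreal 2 * \<Phi>))"
      by (rule mult_left_mono) simp
    also have "\<dots> = ennreal (2 * K) * \<Phi> * ennreal (?e j)"
      using True K by (simp only: if_True ennreal_mult' mult_ac zero_le_numeral)
    finally show ?thesis by (simp add: add_increasing)
  next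
    case False
    define u where "u = 2 ^ j * d"
    have u: "u > 0" "2 ^ Suc j * d = 2 * u" "2 * u \<le> 1" using d False by (auto simp: u_def)
    have I: "?I j = {u<..2 * u}" unfolding u(2) u_def[symmetric] using u(3) by auto
    have "ennreal ((2 * u) powr (- \<alpha>) / (2 * u)) * W u * ennreal (2 * u - u) \<le> (\<integral>\<^sup>+ t \<in> {u<..2 * u}. \<phi> t \<partial>lborel)"
    proof (rule nn_integral_Ioc_lower)
      fix t assume t: "u < t" "t \<le> 2 * u"
      have "ennreal ((2 * u) powr (- \<alpha>) / (2 * u)) * W u \<le> ennreal (t powr (- \<alpha>) / t) * W t"
        by (intro mult_mono ennreal_leI frac_le powr_mono2' monoD[OF W]) (use t u \<alpha> in auto)
      then show "ennreal ((2 * u) powr (- \<alpha>) / (2 * u)) * W u \<le> \<phi> t" using \<phi>[of t] t u by simp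
    qed (use u in auto)
    then have "ennreal (2 powr (\<alpha> + 1) * d powr \<alpha>) * (ennreal ((2 * u) powr (- \<alpha>) / (2 * u)) * W u * ennreal (2 * u - u)) \<le>
       ennreal (2 powr (\<alpha> + 1) * d powr \<alpha>) * (\<integral>\<^sup>+ t \<in> {u<..2 * u}. \<phi> t \<partial>lborel)"
      by (rule mult_left_mono) simp
    also have "ennreal (2 powr (\<alpha> + 1) * d powr \<alpha>) * (ennreal ((2 * u) powr (- \<alpha>) / (2 * u)) * W u * ennreal (2 * u - u))
       = ennreal (2 powr (\<alpha> + 1) * d powr \<alpha>) * ennreal ((2 * u) powr (- \<alpha>) / (2 * u)) * ennreal (2 * u - u) * W u"
      by (simp only: mult_ac)
    also have "ennreal (2 powr (\<alpha> + 1) * d powr \<alpha>) * ennreal ((2 * u) powr (- \<alpha>) / (2 * u)) * ennreal (2 * u - u) = ennreal (q ^ j)"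
    proof -
      have "2 powr (\<alpha> + 1) * d powr \<alpha> * ((2 * u) powr (- \<alpha>) / (2 * u)) * (2 * u - u) = 2 powr \<alpha> * (d powr \<alpha> * ((2 * u) powr (- \<alpha>)))"
        using u by (simp add: powr_add)
      moreover have e: "(2 * u) powr (- \<alpha>) = 2 powr (- \<alpha>) * (q ^ j * d powr (- \<alpha>))"
        unfolding u_def using d by (simp add: powr_mult qj[symmetric] powr_powr mult.commute flip: powr_realpow)
      moreover have "2 powr \<alpha> * (d powr \<alpha> * (2 powr (- \<alpha>) * (q ^ j * d powr (- \<alpha>)))) = (2 powr \<alpha> * 2 powr (- \<alpha>)) * (d powr \<alpha> * d powr (- \<alpha>)) * q ^ j"
        by (simp only: mult_ac)
      moreover have "(2 powr \<alpha> * 2 powr (- \<alpha>)) * (d powr \<alpha> * d powr (- \<alpha>)) * q ^ j = q ^ j" using d by (simp flip: powr_add)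
      ultimately have *: "2 powr (\<alpha> + 1) * d powr \<alpha> * ((2 * u) powr (- \<alpha>) / (2 * u)) * (2 * u - u) = q ^ j" by simp
      have "ennreal (2 powr (\<alpha> + 1) * d powr \<alpha>) * ennreal ((2 * u) powr (- \<alpha>) / (2 * u)) * ennreal (2 * u - u) =
        ennreal (2 powr (\<alpha> + 1) * d powr \<alpha> * ((2 * u) powr (- \<alpha>) / (2 * u)) * (2 * u - u))"
        using u by (subst ennreal_mult', simp)+ simp
      then show ?thesis unfolding * .
    qed
    finally show ?thesis unfolding I unfolding u_def[symmetric] by (rule add_increasing2[rotated]) simp
  qed
  have esum: "(\<Sum>j. ennreal (?e j)) \<le> ennreal (2 powr \<alpha> / (1 - q) * d powr \<alpha>)"
  proof -
    have "\<exists>j::nat. 2 ^ Suc j * d > 1"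
    proof -
      obtain n where "1 / d < 2 ^ n" using real_arch_pow[of 2 "1/d"] by auto
      then show ?thesis using d by (intro exI[of _ n]) (simp add: field_simps)
    qed
    \<comment> \<open>The first index whose dyadic interval leaves (0, 1]. It satisfies 2^(-j0) <
      2d, so the geometric tail starting there is at most a constant times d^alpha.\<close>
    define j0 where "j0 = (LEAST j::nat. 2 ^ Suc j * d > 1)"
    have j0: "2 ^ Suc j0 * d > 1" unfolding j0_def by (rule LeastI_ex) fact
    have low: "?e j = 0" if "j < j0" for j using not_less_Least[of j "\<lambda>j. 2 ^ Suc j * d > 1"] that by (simp add: j0_def)
    have "(\<Sum>j. ennreal (?e j)) = (\<Sum>j. ennreal (?e (j + j0))) + (\<Sum>j<j0. ennreal (?e j))"
      by (rule suminf_offset) (simp add: summableI)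
    also have "(\<Sum>j<j0. ennreal (?e j)) = 0" using low by simp
    also have "(\<Sum>j. ennreal (?e (j + j0))) \<le> (\<Sum>j. ennreal (q ^ j0 * q ^ j))"
      by (intro suminf_le ennreal_leI) (use q in \<open>auto simp: power_add mult.commute\<close>)
    also have "(\<Sum>j. ennreal (q ^ j0 * q ^ j)) = ennreal (q ^ j0 * (1 / (1 - q)))"
      using q suminf_geometric[of q] suminf_mult[of "\<lambda>j. q ^ j" "q ^ j0"] by (subst suminf_ennreal2) auto
    also have "q ^ j0 \<le> (2 * d) powr \<alpha>"
    proof -
      have "q ^ j0 = (1 / 2 ^ j0) powr \<alpha>" unfolding qj[symmetric]
        by (simp add: powr_divide powr_powr powr_minus inverse_eq_divide mult.commute flip: powr_realpow)
      also have "1 / 2 ^ j0 < 2 * d" using j0 by (simp add: field_simps)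
      then have "(1 / 2 ^ j0) powr \<alpha> \<le> (2 * d) powr \<alpha>" using \<alpha> by (intro powr_mono2) auto
      finally show ?thesis .
    qed
    then have "ennreal (q ^ j0 * (1 / (1 - q))) \<le> ennreal (2 powr \<alpha> / (1 - q) * d powr \<alpha>)"
      using q by (intro ennreal_leI) (simp add: powr_mult divide_right_mono)
    finally show ?thesis by simp
  qed
  have "(\<Sum>j. ennreal (2 powr (- \<alpha> * real j)) * W (2 ^ j * d)) \<le>
    (\<Sum>j. ennreal (2 powr (\<alpha> + 1) * d powr \<alpha>) * (\<integral>\<^sup>+ t \<in> ?I j. \<phi> t \<partial>lborel) + ennreal (2 * K) * \<Phi> * ennreal (?e j))"
    unfolding qj by (intro suminf_le trm) auto
  also have "\<dots> = ennreal (2 powr (\<alpha> + 1) * d powr \<alpha>) * (\<Sum>j. \<integral>\<^sup>+ t \<in> ?I j. \<phi> t \<partial>lborel) + ennreal (2 * K) * \<Phi> * (\<Sum>j. ennreal (?e j))"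
    by (subst suminf_add[symmetric]) (simp_all only: summableI ennreal_suminf_cmult)
  also have "\<dots> \<le> ennreal (2 powr (\<alpha> + 1) * d powr \<alpha>) * \<Phi> + ennreal (2 * K) * \<Phi> * ennreal (2 powr \<alpha> / (1 - q) * d powr \<alpha>)"
  proof (intro add_mono mult_left_mono esum)
    show "(\<Sum>j. \<integral>\<^sup>+ t \<in> ?I j. \<phi> t \<partial>lborel) \<le> \<Phi>" unfolding \<Phi>_def
    proof (rule suminf_disjoint_nn_integral_le[OF \<phi>m])
      have "disjoint_family (\<lambda>j::nat. {2 ^ j * d<..2 ^ Suc j * d})"
      proof (intro disjoint_family_Ioc disjI1 allI impI)
        fix n m :: nat assume "n < m"
        then have "(2::real) ^ Suc n \<le> 2 ^ m" by (intro power_increasing) auto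
        then show "2 ^ Suc n * d \<le> 2 ^ m * d" using d by (intro mult_right_mono) auto
      qed
      then show "disjoint_family ?I" unfolding disjoint_family_on_def by blast
      fix n :: nat
      have "1 * d \<le> 2 ^ n * d" using d by (intro mult_right_mono) auto
      then show "?I n \<subseteq> {d..1}" by auto
    qed auto
  qed auto
  also have "\<dots> = ennreal ((2 powr (\<alpha> + 1) + 2 * K * 2 powr \<alpha> / (1 - 2 powr (- \<alpha>))) * d powr \<alpha>) * \<Phi>"
  proof -
    have "ennreal (2 * K) * \<Phi> * ennreal (2 powr \<alpha> / (1 - q) * d powr \<alpha>) = ennreal (2 * K * (2 powr \<alpha> / (1 - q) * d powr \<alpha>)) * \<Phi>"
    proof -
      have "ennreal (2 * K * (2 powr \<alpha> / (1 - q) * d powr \<alpha>)) = ennreal (2 * K) * ennreal (2 powr \<alpha> / (1 - q) * d powr \<alpha>)"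
        by (rule ennreal_mult') (use K in auto)
      then show ?thesis by (simp only: mult_ac)
    qed
    then have "ennreal (2 powr (\<alpha> + 1) * d powr \<alpha>) * \<Phi> + ennreal (2 * K) * \<Phi> * ennreal (2 powr \<alpha> / (1 - q) * d powr \<alpha>)
       = (ennreal (2 powr (\<alpha> + 1) * d powr \<alpha>) + ennreal (2 * K * (2 powr \<alpha> / (1 - q) * d powr \<alpha>))) * \<Phi>"
      by (simp only: distrib_right)
    also have "ennreal (2 powr (\<alpha> + 1) * d powr \<alpha>) + ennreal (2 * K * (2 powr \<alpha> / (1 - q) * d powr \<alpha>)) =
       ennreal (2 powr (\<alpha> + 1) * d powr \<alpha> + 2 * K * (2 powr \<alpha> / (1 - q) * d powr \<alpha>))"
      using K q by (intro ennreal_plus[symmetric]) auto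
    also have "2 powr (\<alpha> + 1) * d powr \<alpha> + 2 * K * (2 powr \<alpha> / (1 - q) * d powr \<alpha>) = (2 powr (\<alpha> + 1) + 2 * K * 2 powr \<alpha> / (1 - 2 powr (- \<alpha>))) * d powr \<alpha>"
      by (simp add: q_def algebra_simps)
    finally show ?thesis .
  qed
  finally show ?thesis unfolding \<Phi>_def \<phi>_def .
qed

lemma ennreal_mult3: "0 \<le> x \<Longrightarrow> 0 \<le> y \<Longrightarrow> ennreal x * ennreal y * ennreal z = ennreal (x * y * z)"
  by (simp add: ennreal_mult')

section \<open>Basic inequalities for the mixed modulus\<close>

lemma mm_ge:
  assumes "p > 1" "f \<in> torus_Lp p" "\<alpha>1 > 0" "\<alpha>2 > 0" "\<bar>h1\<bar> \<le> \<delta>1" "\<bar>h2\<bar> \<le> \<delta>2"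
  shows "Lp_norm p (op (bc \<alpha>1) (h1, 0) (op (bc \<alpha>2) (0, h2) f)) \<le> mixed_modulus p \<alpha>1 \<alpha>2 f \<delta>1 \<delta>2"
  unfolding mixed_modulus_op[OF assms(1-4)] by (rule SUP_upper2[of "(h1, h2)"]) (use assms in auto)

lemma mm_le:
  assumes "p > 1" "f \<in> torus_Lp p" "\<alpha>1 > 0" "\<alpha>2 > 0"
    "\<And>h1 h2. \<bar>h1\<bar> \<le> \<delta>1 \<Longrightarrow> \<bar>h2\<bar> \<le> \<delta>2 \<Longrightarrow> Lp_norm p (op (bc \<alpha>1) (h1, 0) (op (bc \<alpha>2) (0, h2) f)) \<le> B"
  shows "mixed_modulus p \<alpha>1 \<alpha>2 f \<delta>1 \<delta>2 \<le> B"
  unfolding mixed_modulus_op[OF assms(1-4)] by (rule SUP_least) (use assms(5) in auto)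

lemma mm_mono:
  assumes "\<delta>1 \<le> t1" "\<delta>2 \<le> t2"
  shows "mixed_modulus p \<alpha>1 \<alpha>2 f \<delta>1 \<delta>2 \<le> mixed_modulus p \<alpha>1 \<alpha>2 f t1 t2"
  unfolding mixed_modulus_def by (rule SUP_subset_mono) (use assms in auto)

text \<open>For step 0 the series is the sum of all coefficients times f z, and this sum is the
  value 0 of (1 - x)^alpha at x = 1.\<close>

lemma op_zero_shift:
  assumes "\<alpha> > 0"
  shows "op (bc \<alpha>) 0 f = (\<lambda>z. 0)"
proof
  fix z
  have "(\<lambda>k. complex_of_real (bc \<alpha> k) * f z) sums (of_real 0 * f z)"
    by (intro sums_mult2 sums_of_real bc_sums_zero assms)
  then show "op (bc \<alpha>) 0 f z = 0" by (simp add: op_def sums_iff)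
qed

lemma op_zero_fun: "op a v (\<lambda>z. 0) = (\<lambda>z. 0)"
  by (simp add: op_def fun_eq_iff)

lemma mm_zero:
  assumes "p > 1" "f \<in> torus_Lp p" "\<alpha>1 > 0" "\<alpha>2 > 0" "\<delta>1 = 0 \<or> \<delta>2 = 0"
  shows "mixed_modulus p \<alpha>1 \<alpha>2 f \<delta>1 \<delta>2 = 0"
proof -
  have "mixed_modulus p \<alpha>1 \<alpha>2 f \<delta>1 \<delta>2 \<le> 0"
  proof (rule mm_le[OF assms(1-4)])
    fix h1 h2 assume "\<bar>h1\<bar> \<le> \<delta>1" "\<bar>h2\<bar> \<le> \<delta>2"
    then have "h1 = 0 \<or> h2 = 0" using assms(5) by auto
    then have "op (bc \<alpha>1) (h1, 0) (op (bc \<alpha>2) (0, h2) f) = (\<lambda>z. 0)"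
      using op_zero_shift[of \<alpha>1] op_zero_shift[of \<alpha>2] assms(3,4) by (auto simp: zero_prod_def op_zero_fun)
    then show "Lp_norm p (op (bc \<alpha>1) (h1, 0) (op (bc \<alpha>2) (0, h2) f)) \<le> 0"
      using assms(1) by (simp add: Lp_norm_zero)
  qed
  then show ?thesis by simp
qed

lemma mm_add:
  assumes p: "p > 1" and f: "f \<in> torus_Lp p" "g \<in> torus_Lp p" and \<alpha>: "\<alpha>1 > 0" "\<alpha>2 > 0"
  shows "mixed_modulus p \<alpha>1 \<alpha>2 (\<lambda>z. f z + g z) \<delta>1 \<delta>2 \<le> mixed_modulus p \<alpha>1 \<alpha>2 f \<delta>1 \<delta>2 + mixed_modulus p \<alpha>1 \<alpha>2 g \<delta>1 \<delta>2"
proof (rule mm_le[OF p torus_Lp_add[OF p f] \<alpha>])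
  fix h1 h2 assume h: "\<bar>h1\<bar> \<le> \<delta>1" "\<bar>h2\<bar> \<le> \<delta>2"
  have e: "ell1 (bc \<alpha>1)" "ell1 (bc \<alpha>2)" using \<alpha> summable_bc by auto
  let ?B = "op (bc \<alpha>2) (0, h2)" and ?A = "op (bc \<alpha>1) (h1, 0)"
  have T: "?B f \<in> torus_Lp p" "?B g \<in> torus_Lp p" using p f e torus_Lp_op by auto
  have T2: "?A (?B f) \<in> torus_Lp p" "?A (?B g) \<in> torus_Lp p" using p T e torus_Lp_op by auto
  have "AE z in torus_measure. ?A (?B (\<lambda>z. f z + g z)) z = ?A (\<lambda>z. ?B f z + ?B g z) z"
    by (intro op_cong_AE[where p=p] op_add_fun[where p=p] torus_Lp_op torus_Lp_add p f e)
  moreover have "AE z in torus_measure. ?A (\<lambda>z. ?B f z + ?B g z) z = ?A (?B f) z + ?A (?B g) z"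
    by (rule op_add_fun[OF p T e(1)])
  ultimately have "AE z in torus_measure. ?A (?B (\<lambda>z. f z + g z)) z = ?A (?B f) z + ?A (?B g) z"
    by eventually_elim simp
  then have "Lp_norm p (?A (?B (\<lambda>z. f z + g z))) = Lp_norm p (\<lambda>z. ?A (?B f) z + ?A (?B g) z)"
    by (rule Lp_norm_cong_AE)
  also have "\<dots> \<le> Lp_norm p (?A (?B f)) + Lp_norm p (?A (?B g))"
    by (rule Lp_norm_triangle[OF p T2[THEN torus_Lp_measurable]])
  also have "\<dots> \<le> mixed_modulus p \<alpha>1 \<alpha>2 f \<delta>1 \<delta>2 + mixed_modulus p \<alpha>1 \<alpha>2 g \<delta>1 \<delta>2"
    by (intro add_mono mm_ge p f \<alpha> h)
  finally show "Lp_norm p (?A (?B (\<lambda>z. f z + g z))) \<le> \<dots>" .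
qed

text \<open>A step of size at most delta is m times a step of size at most t, with m the ceiling of
  delta/t. Since delta/t is at least 1, m is at most 2 delta/t; the powers of 2 enter the
  constant.\<close>

lemma mm_scale:
  assumes p: "p > 1" and \<alpha>: "\<alpha>1 > 0" "\<alpha>2 > 0"
  shows "\<exists>C>0. \<forall>f\<in>torus_Lp p. \<forall>\<delta>1 \<delta>2 t1 t2. 0 < t1 \<and> t1 \<le> \<delta>1 \<and> 0 < t2 \<and> t2 \<le> \<delta>2 \<longrightarrow>
    mixed_modulus p \<alpha>1 \<alpha>2 f \<delta>1 \<delta>2 \<le> ennreal (C * ((\<delta>1 / t1) powr \<alpha>1 * (\<delta>2 / t2) powr \<alpha>2)) * mixed_modulus p \<alpha>1 \<alpha>2 f t1 t2"
proof -
  obtain C where C: "C > 0" and sc0: "\<forall>f\<in>torus_Lp p. \<forall>m1>0. \<forall>m2>0. \<forall>h1 h2.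
    Lp_norm p (op (bc \<alpha>1) (real m1 * h1, 0) (op (bc \<alpha>2) (0, real m2 * h2) f)) \<le>
    ennreal (C * (real m1 powr \<alpha>1 * real m2 powr \<alpha>2)) * Lp_norm p (op (bc \<alpha>1) (h1, 0) (op (bc \<alpha>2) (0, h2) f))"
    using scale_biv[OF p \<alpha>] by (elim exE conjE)
  note sc = sc0[rule_format]
  let ?D = "C * (2 powr \<alpha>1 * 2 powr \<alpha>2)"
  show ?thesis
  proof (intro exI[of _ ?D] conjI ballI allI impI)
    fix f and \<delta>1 \<delta>2 t1 t2 :: real assume f: "f \<in> torus_Lp p" and "0 < t1 \<and> t1 \<le> \<delta>1 \<and> 0 < t2 \<and> t2 \<le> (\<delta>2::real)"
    then have t: "0 < t1" "t1 \<le> \<delta>1" "0 < t2" "t2 \<le> \<delta>2" by auto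
    have ex: "\<exists>m::nat. m > 0 \<and> \<delta> \<le> m * t \<and> m \<le> 2 * (\<delta> / t)" if "0 < t" "t \<le> \<delta>" for t \<delta> :: real
    proof -
      have 1: "1 \<le> \<delta> / t" using that by simp
      then have "real (nat \<lceil>\<delta> / t\<rceil>) = of_int \<lceil>\<delta> / t\<rceil>" by simp
      then have "\<delta> / t \<le> real (nat \<lceil>\<delta> / t\<rceil>)" "real (nat \<lceil>\<delta> / t\<rceil>) \<le> \<delta> / t + 1"
        using le_of_int_ceiling[of "\<delta> / t"] of_int_ceiling_le_add_one[of "\<delta> / t"] by (simp_all only:)
      moreover have "0 < real (nat \<lceil>\<delta> / t\<rceil>)" using 1 by simp
      moreover have "real (nat \<lceil>\<delta> / t\<rceil>) \<le> 2 * (\<delta> / t)" using 1 calculation(2) by linarith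
      moreover have "\<delta> \<le> real (nat \<lceil>\<delta> / t\<rceil>) * t"
        using iffD1[OF pos_divide_le_eq[OF that(1)]] calculation(1) by blast
      ultimately show ?thesis by blast
    qed
    obtain m1 :: nat where m1: "m1 > 0" "\<delta>1 \<le> m1 * t1" "m1 \<le> 2 * (\<delta>1 / t1)" using ex[OF t(1,2)] by (elim exE conjE) simp
    obtain m2 :: nat where m2: "m2 > 0" "\<delta>2 \<le> m2 * t2" "m2 \<le> 2 * (\<delta>2 / t2)" using ex[OF t(3,4)] by (elim exE conjE) simp
    show "mixed_modulus p \<alpha>1 \<alpha>2 f \<delta>1 \<delta>2 \<le> ennreal (?D * ((\<delta>1 / t1) powr \<alpha>1 * (\<delta>2 / t2) powr \<alpha>2)) * mixed_modulus p \<alpha>1 \<alpha>2 f t1 t2"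
    proof (rule mm_le[OF p f \<alpha>])
      fix h1 h2 assume h: "\<bar>h1\<bar> \<le> \<delta>1" "\<bar>h2\<bar> \<le> \<delta>2"
      have hm: "\<bar>h1 / m1\<bar> \<le> t1" "\<bar>h2 / m2\<bar> \<le> t2"
        using h m1 m2 by (auto simp: abs_divide pos_divide_le_eq mult.commute)
      have "Lp_norm p (op (bc \<alpha>1) (h1, 0) (op (bc \<alpha>2) (0, h2) f)) \<le>
         ennreal (C * (real m1 powr \<alpha>1 * real m2 powr \<alpha>2)) * Lp_norm p (op (bc \<alpha>1) (h1 / m1, 0) (op (bc \<alpha>2) (0, h2 / m2) f))"
        using sc[OF f m1(1) m2(1), of "h1 / m1" "h2 / m2"] m1(1) m2(1) by simp
      also have "\<dots> \<le> ennreal (?D * ((\<delta>1 / t1) powr \<alpha>1 * (\<delta>2 / t2) powr \<alpha>2)) * mixed_modulus p \<alpha>1 \<alpha>2 f t1 t2"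
      proof (rule mult_mono[OF ennreal_leI mm_ge[OF p f \<alpha> hm]])
        have "real m1 powr \<alpha>1 \<le> (2 * (\<delta>1 / t1)) powr \<alpha>1" "real m2 powr \<alpha>2 \<le> (2 * (\<delta>2 / t2)) powr \<alpha>2"
          using m1 m2 \<alpha> by (auto intro!: powr_mono2)
        then have "C * (real m1 powr \<alpha>1 * real m2 powr \<alpha>2) \<le> C * ((2 * (\<delta>1 / t1)) powr \<alpha>1 * (2 * (\<delta>2 / t2)) powr \<alpha>2)"
          using C by (intro mult_left_mono mult_mono) auto
        also have "\<dots> = ?D * ((\<delta>1 / t1) powr \<alpha>1 * (\<delta>2 / t2) powr \<alpha>2)" by (simp only: powr_mult mult_ac)
        finally show "C * (real m1 powr \<alpha>1 * real m2 powr \<alpha>2) \<le> \<dots>" .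
      qed auto
      finally show "Lp_norm p (op (bc \<alpha>1) (h1, 0) (op (bc \<alpha>2) (0, h2) f)) \<le> \<dots>" .
    qed
  qed (use C in auto)
qed

text \<open>Modulo 2 pi every step has size at most pi, hence below 4, and is therefore 8 times a
  step of size at most 1/2. Arbitrarily large scales are thus controlled by the scale 1/2.\<close>

lemma mm_half:
  assumes p: "p > 1" and \<alpha>: "\<alpha>1 > 0" "\<alpha>2 > 0"
  shows "\<exists>K>0. \<forall>f\<in>torus_Lp p. \<forall>t s.
     mixed_modulus p \<alpha>1 \<alpha>2 f t s \<le> ennreal K * mixed_modulus p \<alpha>1 \<alpha>2 f (1/2) s \<and>
     mixed_modulus p \<alpha>1 \<alpha>2 f t s \<le> ennreal K * mixed_modulus p \<alpha>1 \<alpha>2 f t (1/2)"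
proof -
  obtain C where C: "C > 0" and sc0: "\<forall>f\<in>torus_Lp p. \<forall>m1>0. \<forall>m2>0. \<forall>h1 h2.
    Lp_norm p (op (bc \<alpha>1) (real m1 * h1, 0) (op (bc \<alpha>2) (0, real m2 * h2) f)) \<le>
    ennreal (C * (real m1 powr \<alpha>1 * real m2 powr \<alpha>2)) * Lp_norm p (op (bc \<alpha>1) (h1, 0) (op (bc \<alpha>2) (0, h2) f))"
    using scale_biv[OF p \<alpha>] by (elim exE conjE)
  note sc = sc0[rule_format]
  have red: "\<exists>h' k. h = 8 * h' + 2*pi * of_int k \<and> \<bar>h'\<bar> \<le> 1/2" for h :: real
  proof -
    let ?k = "round (h / (2*pi))"
    have "\<bar>of_int ?k - h / (2*pi)\<bar> \<le> 1/2" by (rule of_int_round_abs_le)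
    then have "2*pi * \<bar>of_int ?k - h / (2*pi)\<bar> \<le> 2*pi * (1/2)" by (intro mult_left_mono) auto
    moreover have "2*pi * \<bar>of_int ?k - h / (2*pi)\<bar> = \<bar>2*pi * (of_int ?k - h / (2*pi))\<bar>" by (simp add: abs_mult)
    moreover have "2*pi * (of_int ?k - h / (2*pi)) = 2*pi * of_int ?k - h" by (simp add: right_diff_distrib)
    ultimately have "\<bar>h - 2*pi * of_int ?k\<bar> \<le> 4" using pi_less_4 by linarith
    then have "\<bar>(h - 2*pi * of_int ?k) / 8\<bar> \<le> 1/2" by (simp only: abs_divide) simp
    moreover have "h = 8 * ((h - X) / 8) + X" for X :: real by (simp add: field_simps)
    ultimately show ?thesis by blast
  qed
  let ?K = "C * (8 powr \<alpha>1 + 8 powr \<alpha>2)"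
  show ?thesis
  proof (intro exI[of _ ?K] conjI ballI allI)
    fix f t s assume f: "f \<in> torus_Lp p"
    have perf: "per f" using f by (simp add: torus_Lp_iff)
    show "mixed_modulus p \<alpha>1 \<alpha>2 f t s \<le> ennreal ?K * mixed_modulus p \<alpha>1 \<alpha>2 f (1/2) s"
    proof (rule mm_le[OF p f \<alpha>])
      fix h1 h2 assume h: "\<bar>h1\<bar> \<le> t" "\<bar>h2\<bar> \<le> s"
      obtain h' k where h': "h1 = 8 * h' + 2*pi * of_int k" "\<bar>h'\<bar> \<le> 1/2" using red by blast
      have "op (bc \<alpha>1) (h1, 0) (op (bc \<alpha>2) (0, h2) f) = op (bc \<alpha>1) (real 8 * h', 0) (op (bc \<alpha>2) (0, real 1 * h2) f)"
        using op_periodic[OF per_op[OF perf], of "bc \<alpha>1" "8 * h'" k 0 0] h' by simp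
      then have "Lp_norm p (op (bc \<alpha>1) (h1, 0) (op (bc \<alpha>2) (0, h2) f)) \<le>
         ennreal (C * (real 8 powr \<alpha>1 * real 1 powr \<alpha>2)) * Lp_norm p (op (bc \<alpha>1) (h', 0) (op (bc \<alpha>2) (0, h2) f))"
        using sc[OF f, of 8 1 h' h2] by simp
      also have "\<dots> \<le> ennreal ?K * mixed_modulus p \<alpha>1 \<alpha>2 f (1/2) s"
        by (intro mult_mono ennreal_leI mm_ge p f \<alpha>) (use C h h' in \<open>auto intro: mult_left_mono\<close>)
      finally show "Lp_norm p (op (bc \<alpha>1) (h1, 0) (op (bc \<alpha>2) (0, h2) f)) \<le> \<dots>" .
    qed
    show "mixed_modulus p \<alpha>1 \<alpha>2 f t s \<le> ennreal ?K * mixed_modulus p \<alpha>1 \<alpha>2 f t (1/2)"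
    proof (rule mm_le[OF p f \<alpha>])
      fix h1 h2 assume h: "\<bar>h1\<bar> \<le> t" "\<bar>h2\<bar> \<le> s"
      obtain h' k where h': "h2 = 8 * h' + 2*pi * of_int k" "\<bar>h'\<bar> \<le> 1/2" using red by blast
      have "op (bc \<alpha>1) (h1, 0) (op (bc \<alpha>2) (0, h2) f) = op (bc \<alpha>1) (real 1 * h1, 0) (op (bc \<alpha>2) (0, real 8 * h') f)"
        using op_periodic[OF perf, of "bc \<alpha>2" 0 0 "8 * h'" k] h' by simp
      then have "Lp_norm p (op (bc \<alpha>1) (h1, 0) (op (bc \<alpha>2) (0, h2) f)) \<le>
         ennreal (C * (real 1 powr \<alpha>1 * real 8 powr \<alpha>2)) * Lp_norm p (op (bc \<alpha>1) (h1, 0) (op (bc \<alpha>2) (0, h') f))"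
        using sc[OF f, of 1 8 h1 h'] by simp
      also have "\<dots> \<le> ennreal ?K * mixed_modulus p \<alpha>1 \<alpha>2 f t (1/2)"
        by (intro mult_mono ennreal_leI mm_ge p f \<alpha>) (use C h h' in \<open>auto intro: mult_left_mono\<close>)
      finally show "Lp_norm p (op (bc \<alpha>1) (h1, 0) (op (bc \<alpha>2) (0, h2) f)) \<le> \<dots>" .
    qed
  qed (use C in \<open>auto intro!: mult_pos_pos add_pos_pos\<close>)
qed

lemma mm_higher:
  assumes p: "p > 1" and \<alpha>: "\<alpha>1 > 0" "\<alpha>2 > 0" "\<alpha>1 < \<beta>1" "\<alpha>2 < \<beta>2"
  shows "\<exists>C>0. \<forall>f\<in>torus_Lp p. \<forall>\<delta>1 \<delta>2. mixed_modulus p \<beta>1 \<beta>2 f \<delta>1 \<delta>2 \<le> ennreal C * mixed_modulus p \<alpha>1 \<alpha>2 f \<delta>1 \<delta>2"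
proof -
  obtain C D where C: "C > 0" "D > 0" "op_dominates p (bc \<beta>1) (bc \<alpha>1) C" "op_dominates p (bc \<beta>2) (bc \<alpha>2) D"
    using dom_higher[OF p \<alpha>(1,3)] dom_higher[OF p \<alpha>(2,4)] by blast
  have e: "ell1 (bc \<beta>1)" "ell1 (bc \<alpha>1)" "ell1 (bc \<beta>2)" "ell1 (bc \<alpha>2)" using \<alpha> summable_bc by auto
  have \<beta>: "\<beta>1 > 0" "\<beta>2 > 0" using \<alpha> by auto
  show ?thesis
  proof (intro exI[of _ "C * D"] conjI ballI allI)
    fix f \<delta>1 \<delta>2 assume f: "f \<in> torus_Lp p"
    show "mixed_modulus p \<beta>1 \<beta>2 f \<delta>1 \<delta>2 \<le> ennreal (C * D) * mixed_modulus p \<alpha>1 \<alpha>2 f \<delta>1 \<delta>2"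
    proof (rule mm_le[OF p f \<beta>])
      fix h1 h2 assume h: "\<bar>h1\<bar> \<le> \<delta>1" "\<bar>h2\<bar> \<le> \<delta>2"
      have "Lp_norm p (op (bc \<beta>1) (h1, 0) (op (bc \<beta>2) (0, h2) f)) \<le> ennreal (C * D) * Lp_norm p (op (bc \<alpha>1) (h1, 0) (op (bc \<alpha>2) (0, h2) f))"
        by (rule dom_biv[OF p C(3,4) f e]) (use C in auto)
      also have "\<dots> \<le> ennreal (C * D) * mixed_modulus p \<alpha>1 \<alpha>2 f \<delta>1 \<delta>2"
        by (intro mult_left_mono mm_ge p f \<alpha>(1,2) h) auto
      finally show "Lp_norm p (op (bc \<beta>1) (h1, 0) (op (bc \<beta>2) (0, h2) f)) \<le> \<dots>" .
    qed
  qed (use C in auto)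
qed

lemma mono_mm2: "mono (\<lambda>s. mixed_modulus p \<alpha>1 \<alpha>2 f t s)"
  by (intro monoI mm_mono) auto

lemma borel_measurable_mm2 [measurable]: "mixed_modulus p \<alpha>1 \<alpha>2 f t \<in> borel_measurable borel"
  by (rule borel_measurable_mono_ennreal[OF mono_mm2])

text \<open>The double dyadic sum is turned into integrals one variable at a time, for which the
  modulus must be monotone and controlled by its value at 1/2 in each variable.\<close>

lemma mm_marchaud:
  assumes p: "p > 1" and \<alpha>: "\<alpha>1 > 0" "\<alpha>2 > 0" "\<alpha>1 < \<beta>1" "\<alpha>2 < \<beta>2"
  shows "\<exists>C>0. \<forall>f \<in> torus_Lp p. \<forall>\<delta>1 \<delta>2.
        0 < \<delta>1 \<and> \<delta>1 \<le> 1/2 \<and> 0 < \<delta>2 \<and> \<delta>2 \<le> 1/2 \<longrightarrow>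
        mixed_modulus p \<alpha>1 \<alpha>2 f \<delta>1 \<delta>2 \<le>
          ennreal C * (ennreal (\<delta>1 powr \<alpha>1 * \<delta>2 powr \<alpha>2) *
            (\<integral>\<^sup>+ t1 \<in> {\<delta>1..1}. (\<integral>\<^sup>+ t2 \<in> {\<delta>2..1}.
               mixed_modulus p \<beta>1 \<beta>2 f t1 t2 / ennreal (t1 powr \<alpha>1 * t2 powr \<alpha>2)
               / ennreal t2 \<partial>lborel) / ennreal t1 \<partial>lborel))"
proof -
  obtain C where C: "C > 0" and mar: "\<And>f h1 h2. f \<in> torus_Lp p \<Longrightarrow>
    Lp_norm p (op (bc \<alpha>1) (h1, 0) (op (bc \<alpha>2) (0, h2) f)) \<le>
    ennreal C * (\<Sum>j. ennreal (2 powr (- \<alpha>1 * real j)) * (\<Sum>k. ennreal (2 powr (- \<alpha>2 * real k)) *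
       Lp_norm p (op (bc \<beta>1) (2 ^ j * h1, 0) (op (bc \<beta>2) (0, 2 ^ k * h2) f))))"
    using marchaud_biv[OF p \<alpha>] by blast
  have \<beta>: "\<beta>1 > 0" "\<beta>2 > 0" using \<alpha> by auto
  obtain K where K: "K > 0" and half: "\<And>f t s. f \<in> torus_Lp p \<Longrightarrow>
     mixed_modulus p \<beta>1 \<beta>2 f t s \<le> ennreal K * mixed_modulus p \<beta>1 \<beta>2 f (1/2) s"
     "\<And>f t s. f \<in> torus_Lp p \<Longrightarrow> mixed_modulus p \<beta>1 \<beta>2 f t s \<le> ennreal K * mixed_modulus p \<beta>1 \<beta>2 f t (1/2)"
    using mm_half[OF p \<beta>] by blast
  define D where "D \<alpha> = 2 powr (\<alpha> + 1) + 2 * K * 2 powr \<alpha> / (1 - 2 powr (- \<alpha>))" for \<alpha>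
  have D: "D \<alpha> > 0" if "\<alpha> > 0" for \<alpha>
  proof -
    have "2 powr (- \<alpha>) < (1::real)" using that by (simp add: powr_less_one)
    then show ?thesis unfolding D_def using K by (intro add_pos_nonneg divide_nonneg_nonneg) auto
  qed
  show ?thesis
  proof (intro exI[of _ "C * (D \<alpha>1 * D \<alpha>2)"] conjI ballI allI impI)
    fix f \<delta>1 \<delta>2 assume f: "f \<in> torus_Lp p" and "0 < \<delta>1 \<and> \<delta>1 \<le> (1/2::real) \<and> 0 < \<delta>2 \<and> \<delta>2 \<le> (1/2::real)"
    then have d: "0 < \<delta>1" "\<delta>1 \<le> 1/2" "0 < \<delta>2" "\<delta>2 \<le> 1/2" by auto
    let ?w = "mixed_modulus p \<beta>1 \<beta>2 f"
    \<comment> \<open>The inner integral as a function of the outer variable: it inherits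
      monotonicity and the bound by the value at 1/2, so the one-dimensional comparison applies a
      second time.\<close>
    define \<Omega> where "\<Omega> t1 = (\<integral>\<^sup>+ t2 \<in> {\<delta>2..1}. ?w t1 t2 / ennreal (t2 powr \<alpha>2) / ennreal t2 \<partial>lborel)" for t1
    have mono\<Omega>: "mono \<Omega>" unfolding \<Omega>_def
      by (intro monoI nn_integral_mono mult_right_mono divide_right_mono_ennreal mm_mono) auto
    have half\<Omega>: "\<Omega> t \<le> ennreal K * \<Omega> (1/2)" for t
    proof -
      have "\<Omega> t \<le> (\<integral>\<^sup>+ t2. ennreal K * (?w (1/2) t2 / ennreal (t2 powr \<alpha>2) / ennreal t2 * indicator {\<delta>2..1} t2) \<partial>lborel)"
        unfolding \<Omega>_def
      proof (rule nn_integral_mono)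
        fix t2
        have "?w t t2 / ennreal (t2 powr \<alpha>2) / ennreal t2 * indicator {\<delta>2..1} t2 \<le> (ennreal K * ?w (1/2) t2) / ennreal (t2 powr \<alpha>2) / ennreal t2 * indicator {\<delta>2..1} t2"
          by (intro mult_right_mono divide_right_mono_ennreal half f) auto
        also have "\<dots> = ennreal K * (?w (1/2) t2 / ennreal (t2 powr \<alpha>2) / ennreal t2 * indicator {\<delta>2..1} t2)"
          unfolding divide_ennreal_def by (simp only: mult.assoc)
        finally show "?w t t2 / ennreal (t2 powr \<alpha>2) / ennreal t2 * indicator {\<delta>2..1} t2 \<le> \<dots>" .
      qed
      also have "\<dots> = ennreal K * \<Omega> (1/2)" unfolding \<Omega>_def by (rule nn_integral_cmult) measurable
      finally show ?thesis .
    qed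
    have conv: "\<Omega> t1 / ennreal (t1 powr \<alpha>1) / ennreal t1 = (\<integral>\<^sup>+ t2 \<in> {\<delta>2..1}. ?w t1 t2 / ennreal (t1 powr \<alpha>1 * t2 powr \<alpha>2) / ennreal t2 \<partial>lborel) / ennreal t1"
      if "t1 > 0" for t1
    proof -
      have "\<Omega> t1 / ennreal (t1 powr \<alpha>1) = ennreal (1 / t1 powr \<alpha>1) * \<Omega> t1"
        using that by (intro ennreal_divide_ennreal_pos) simp
      also have "\<dots> = (\<integral>\<^sup>+ t2. ennreal (1 / t1 powr \<alpha>1) * (?w t1 t2 / ennreal (t2 powr \<alpha>2) / ennreal t2 * indicator {\<delta>2..1} t2) \<partial>lborel)"
        unfolding \<Omega>_def by (rule nn_integral_cmult[symmetric]) measurable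
      also have "\<dots> = (\<integral>\<^sup>+ t2 \<in> {\<delta>2..1}. ?w t1 t2 / ennreal (t1 powr \<alpha>1 * t2 powr \<alpha>2) / ennreal t2 \<partial>lborel)"
      proof (rule nn_integral_cong)
        fix t2
        show "ennreal (1 / t1 powr \<alpha>1) * (?w t1 t2 / ennreal (t2 powr \<alpha>2) / ennreal t2 * indicator {\<delta>2..1} t2) =
          ?w t1 t2 / ennreal (t1 powr \<alpha>1 * t2 powr \<alpha>2) / ennreal t2 * indicator {\<delta>2..1} t2"
        proof (cases "t2 \<in> {\<delta>2..1}")
          case True
          then have t2: "t2 > 0" "t2 powr \<alpha>2 > 0" "t1 powr \<alpha>1 * t2 powr \<alpha>2 > 0" using d that by auto
          have "ennreal (1 / (t1 powr \<alpha>1 * t2 powr \<alpha>2)) = ennreal (1 / t1 powr \<alpha>1) * ennreal (1 / t2 powr \<alpha>2)"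
            by (subst ennreal_mult'[symmetric]) auto
          then show ?thesis
            by (simp only: ennreal_divide_ennreal_pos[OF t2(1)] ennreal_divide_ennreal_pos[OF t2(2)] ennreal_divide_ennreal_pos[OF t2(3)] mult_ac)
        qed simp
      qed
      finally show ?thesis by simp
    qed
    have inner: "(\<Sum>k. ennreal (2 powr (- \<alpha>2 * real k)) * ?w t (2 ^ k * \<delta>2)) \<le> ennreal (D \<alpha>2 * \<delta>2 powr \<alpha>2) * \<Omega> t" for t
      unfolding D_def \<Omega>_def by (rule dyadic_sum_le_integral_1[OF mono_mm2 K half(2)[OF f] \<alpha>(2) d(3,4)])
    have "(\<Sum>j. ennreal (2 powr (- \<alpha>1 * real j)) * \<Omega> (2 ^ j * \<delta>1)) \<le>
       ennreal (D \<alpha>1 * \<delta>1 powr \<alpha>1) * (\<integral>\<^sup>+ t \<in> {\<delta>1..1}. \<Omega> t / ennreal (t powr \<alpha>1) / ennreal t \<partial>lborel)"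
      unfolding D_def by (rule dyadic_sum_le_integral_1[OF mono\<Omega> K half\<Omega> \<alpha>(1) d(1,2)])
    also have "(\<integral>\<^sup>+ t \<in> {\<delta>1..1}. \<Omega> t / ennreal (t powr \<alpha>1) / ennreal t \<partial>lborel) = (\<integral>\<^sup>+ t1 \<in> {\<delta>1..1}. (\<integral>\<^sup>+ t2 \<in> {\<delta>2..1}.
               ?w t1 t2 / ennreal (t1 powr \<alpha>1 * t2 powr \<alpha>2)
               / ennreal t2 \<partial>lborel) / ennreal t1 \<partial>lborel)" (is "_ = ?I")
    proof (rule nn_integral_cong)
      fix t1
      show "\<Omega> t1 / ennreal (t1 powr \<alpha>1) / ennreal t1 * indicator {\<delta>1..1} t1 = (\<integral>\<^sup>+ t2 \<in> {\<delta>2..1}.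
               ?w t1 t2 / ennreal (t1 powr \<alpha>1 * t2 powr \<alpha>2) / ennreal t2 \<partial>lborel) / ennreal t1 * indicator {\<delta>1..1} t1"
        by (cases "t1 \<in> {\<delta>1..1}") (use conv[of t1] d in auto)
    qed
    finally have outer: "(\<Sum>j. ennreal (2 powr (- \<alpha>1 * real j)) * \<Omega> (2 ^ j * \<delta>1)) \<le> ennreal (D \<alpha>1 * \<delta>1 powr \<alpha>1) * ?I" .
    show "mixed_modulus p \<alpha>1 \<alpha>2 f \<delta>1 \<delta>2 \<le> ennreal (C * (D \<alpha>1 * D \<alpha>2)) * (ennreal (\<delta>1 powr \<alpha>1 * \<delta>2 powr \<alpha>2) * ?I)"
    proof (rule mm_le[OF p f \<alpha>(1,2)])
      fix h1 h2 assume h: "\<bar>h1\<bar> \<le> \<delta>1" "\<bar>h2\<bar> \<le> \<delta>2"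
      have "Lp_norm p (op (bc \<alpha>1) (h1, 0) (op (bc \<alpha>2) (0, h2) f)) \<le>
        ennreal C * (\<Sum>j. ennreal (2 powr (- \<alpha>1 * real j)) * (\<Sum>k. ennreal (2 powr (- \<alpha>2 * real k)) * ?w (2 ^ j * \<delta>1) (2 ^ k * \<delta>2)))"
        by (rule order_trans[OF mar[OF f]])
           (intro mult_left_mono suminf_le mm_ge p f \<beta>, use h in \<open>auto simp: abs_mult\<close>)
      also have "\<dots> \<le> ennreal C * (\<Sum>j. ennreal (2 powr (- \<alpha>1 * real j)) * (ennreal (D \<alpha>2 * \<delta>2 powr \<alpha>2) * \<Omega> (2 ^ j * \<delta>1)))"
        by (intro mult_left_mono suminf_le inner) auto
      also have "\<dots> = ennreal C * (ennreal (D \<alpha>2 * \<delta>2 powr \<alpha>2) * (\<Sum>j. ennreal (2 powr (- \<alpha>1 * real j)) * \<Omega> (2 ^ j * \<delta>1)))"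
        by (simp only: mult.left_commute[of _ "ennreal (D \<alpha>2 * \<delta>2 powr \<alpha>2)"] ennreal_suminf_cmult)
      also have "\<dots> \<le> ennreal C * (ennreal (D \<alpha>2 * \<delta>2 powr \<alpha>2) * (ennreal (D \<alpha>1 * \<delta>1 powr \<alpha>1) * ?I))"
        by (intro mult_left_mono outer) auto
      also have "\<dots> = ennreal (C * (D \<alpha>1 * D \<alpha>2)) * (ennreal (\<delta>1 powr \<alpha>1 * \<delta>2 powr \<alpha>2) * ?I)"
      proof -
        have "ennreal C * (ennreal (D \<alpha>2 * \<delta>2 powr \<alpha>2) * ennreal (D \<alpha>1 * \<delta>1 powr \<alpha>1)) = ennreal (C * ((D \<alpha>2 * \<delta>2 powr \<alpha>2) * (D \<alpha>1 * \<delta>1 powr \<alpha>1)))"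
          using C D[OF \<alpha>(1)] D[OF \<alpha>(2)] by (subst ennreal_mult', simp)+ simp
        also have "C * ((D \<alpha>2 * \<delta>2 powr \<alpha>2) * (D \<alpha>1 * \<delta>1 powr \<alpha>1)) = (C * (D \<alpha>1 * D \<alpha>2)) * (\<delta>1 powr \<alpha>1 * \<delta>2 powr \<alpha>2)"
          by (simp only: mult_ac)
        also have "ennreal \<dots> = ennreal (C * (D \<alpha>1 * D \<alpha>2)) * ennreal (\<delta>1 powr \<alpha>1 * \<delta>2 powr \<alpha>2)"
          using C D[OF \<alpha>(1)] D[OF \<alpha>(2)] by (intro ennreal_mult') auto
        finally show ?thesis by (simp only: mult.assoc[symmetric])
      qed
      finally show "Lp_norm p (op (bc \<alpha>1) (h1, 0) (op (bc \<alpha>2) (0, h2) f)) \<le> \<dots>" .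
    qed
  qed (use C D \<alpha> in auto)
qed

lemma nn_integral_powr_le:
  assumes "c > 0" "d > 0"
  shows "(\<integral>\<^sup>+ t \<in> {d..1}. ennreal (t powr (c - 1)) \<partial>lborel) \<le> ennreal (1 / c)"
proof -
  have "(\<integral>\<^sup>+ t \<in> {d..1}. ennreal (t powr (c - 1)) \<partial>lborel) \<le> (\<integral>\<^sup>+ t. ennreal (t powr (c - 1)) * indicator {0..1} t \<partial>lborel)"
    using assms by (intro nn_integral_mono) (auto simp: indicator_def)
  also have "\<dots> = ennreal (1 powr (c - 1 + 1) / (c - 1 + 1))"
    by (rule nn_integral_has_integral_lebesgue'[OF _ has_integral_powr_from_0]) (use assms in auto)
  finally show ?thesis by simp
qed

text \<open>In the Marchaud integral the modulus at (t1, t2) is at most a constant times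
  (t1/\<delta>1)^\<beta>1 (t2/\<delta>2)^\<beta>2 times the modulus at (\<delta>1, \<delta>2). What
  is left are integrals of t^(c - 1) with c = \<beta> - \<alpha> > 0, bounded by 1/c.\<close>

lemma mm_lower_order:
  assumes p: "p > 1" and \<alpha>: "\<alpha>1 > 0" "\<alpha>2 > 0" "\<alpha>1 < \<beta>1" "\<alpha>2 < \<beta>2"
  shows "\<exists>C>0. \<forall>f \<in> torus_Lp p. \<forall>\<delta>1 \<delta>2.
        0 < \<delta>1 \<and> \<delta>1 < 1/2 \<and> 0 < \<delta>2 \<and> \<delta>2 < 1/2 \<longrightarrow>
        mixed_modulus p \<alpha>1 \<alpha>2 f \<delta>1 \<delta>2 / ennreal (\<delta>1 powr \<alpha>1 * \<delta>2 powr \<alpha>2) \<le>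
          ennreal C * (mixed_modulus p \<beta>1 \<beta>2 f \<delta>1 \<delta>2 / ennreal (\<delta>1 powr \<beta>1 * \<delta>2 powr \<beta>2))"
proof -
  have \<beta>: "\<beta>1 > 0" "\<beta>2 > 0" using \<alpha> by auto
  obtain C where C: "C > 0" and mar: "\<And>f \<delta>1 \<delta>2. f \<in> torus_Lp p \<Longrightarrow> 0 < \<delta>1 \<Longrightarrow> \<delta>1 \<le> 1/2 \<Longrightarrow> 0 < \<delta>2 \<Longrightarrow> \<delta>2 \<le> 1/2 \<Longrightarrow>
        mixed_modulus p \<alpha>1 \<alpha>2 f \<delta>1 \<delta>2 \<le>
          ennreal C * (ennreal (\<delta>1 powr \<alpha>1 * \<delta>2 powr \<alpha>2) *
            (\<integral>\<^sup>+ t1 \<in> {\<delta>1..1}. (\<integral>\<^sup>+ t2 \<in> {\<delta>2..1}.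
               mixed_modulus p \<beta>1 \<beta>2 f t1 t2 / ennreal (t1 powr \<alpha>1 * t2 powr \<alpha>2)
               / ennreal t2 \<partial>lborel) / ennreal t1 \<partial>lborel))"
    using mm_marchaud[OF p \<alpha>] by blast
  obtain K where K: "K > 0" and sc: "\<And>f \<delta>1 \<delta>2 t1 t2. f \<in> torus_Lp p \<Longrightarrow> 0 < t1 \<Longrightarrow> t1 \<le> \<delta>1 \<Longrightarrow> 0 < t2 \<Longrightarrow> t2 \<le> \<delta>2 \<Longrightarrow>
    mixed_modulus p \<beta>1 \<beta>2 f \<delta>1 \<delta>2 \<le> ennreal (K * ((\<delta>1 / t1) powr \<beta>1 * (\<delta>2 / t2) powr \<beta>2)) * mixed_modulus p \<beta>1 \<beta>2 f t1 t2"
    using mm_scale[OF p \<beta>] by blast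
  define c1 where "c1 = \<beta>1 - \<alpha>1"
  define c2 where "c2 = \<beta>2 - \<alpha>2"
  have c: "c1 > 0" "c2 > 0" using \<alpha> by (auto simp: c1_def c2_def)
  show ?thesis
  proof (intro exI[of _ "C * (K / (c1 * c2))"] conjI ballI allI impI)
    fix f \<delta>1 \<delta>2 assume f: "f \<in> torus_Lp p" and "0 < \<delta>1 \<and> \<delta>1 < (1/2::real) \<and> 0 < \<delta>2 \<and> \<delta>2 < (1/2::real)"
    then have d: "0 < \<delta>1" "\<delta>1 \<le> 1/2" "0 < \<delta>2" "\<delta>2 \<le> 1/2" by auto
    define w where "w = mixed_modulus p \<beta>1 \<beta>2 f \<delta>1 \<delta>2"
    define A where "A = \<delta>1 powr \<alpha>1 * \<delta>2 powr \<alpha>2"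
    define B where "B = \<delta>1 powr \<beta>1 * \<delta>2 powr \<beta>2"
    have AB: "A > 0" "B > 0" using d by (auto simp: A_def B_def)
    have pt: "mixed_modulus p \<beta>1 \<beta>2 f t1 t2 / ennreal (t1 powr \<alpha>1 * t2 powr \<alpha>2) / ennreal t2
       \<le> ennreal (t1 powr c1 * (K / B)) * w * ennreal (t2 powr (c2 - 1))" if t: "\<delta>1 \<le> t1" "\<delta>2 \<le> t2" for t1 t2
    proof -
      have tp: "t1 > 0" "t2 > 0" "t1 powr \<alpha>1 * t2 powr \<alpha>2 > 0" using t d by auto
      have "mixed_modulus p \<beta>1 \<beta>2 f t1 t2 / ennreal (t1 powr \<alpha>1 * t2 powr \<alpha>2) / ennreal t2 \<le>
         (ennreal (K * ((t1 / \<delta>1) powr \<beta>1 * (t2 / \<delta>2) powr \<beta>2)) * w) / ennreal (t1 powr \<alpha>1 * t2 powr \<alpha>2) / ennreal t2"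
        unfolding w_def by (intro divide_right_mono_ennreal sc f d t)
      also have "\<dots> = (ennreal (1 / t2) * ennreal (1 / (t1 powr \<alpha>1 * t2 powr \<alpha>2)) * ennreal (K * ((t1 / \<delta>1) powr \<beta>1 * (t2 / \<delta>2) powr \<beta>2))) * w"
        by (simp only: ennreal_divide_ennreal_pos[OF tp(2)] ennreal_divide_ennreal_pos[OF tp(3)] mult.assoc)
      also have "ennreal (1 / t2) * ennreal (1 / (t1 powr \<alpha>1 * t2 powr \<alpha>2)) * ennreal (K * ((t1 / \<delta>1) powr \<beta>1 * (t2 / \<delta>2) powr \<beta>2))
         = ennreal (1 / t2 * (1 / (t1 powr \<alpha>1 * t2 powr \<alpha>2)) * (K * ((t1 / \<delta>1) powr \<beta>1 * (t2 / \<delta>2) powr \<beta>2)))"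
        by (rule ennreal_mult3) (use tp in auto)
      also have "1 / t2 * (1 / (t1 powr \<alpha>1 * t2 powr \<alpha>2)) * (K * ((t1 / \<delta>1) powr \<beta>1 * (t2 / \<delta>2) powr \<beta>2)) =
          t1 powr c1 * (K / B) * t2 powr (c2 - 1)"
        using tp by (simp add: powr_divide powr_diff B_def c1_def c2_def mult_ac)
      also have "ennreal \<dots> = ennreal (t1 powr c1 * (K / B)) * ennreal (t2 powr (c2 - 1))"
        using K AB by (intro ennreal_mult') auto
      finally show ?thesis by (simp only: mult_ac)
    qed
    have in1: "(\<integral>\<^sup>+ t2 \<in> {\<delta>2..1}. mixed_modulus p \<beta>1 \<beta>2 f t1 t2 / ennreal (t1 powr \<alpha>1 * t2 powr \<alpha>2) / ennreal t2 \<partial>lborel)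
       \<le> ennreal (t1 powr c1 * (K / B)) * w * ennreal (1 / c2)" if t1: "\<delta>1 \<le> t1" for t1
    proof -
      have "(\<integral>\<^sup>+ t2 \<in> {\<delta>2..1}. mixed_modulus p \<beta>1 \<beta>2 f t1 t2 / ennreal (t1 powr \<alpha>1 * t2 powr \<alpha>2) / ennreal t2 \<partial>lborel)
        \<le> (\<integral>\<^sup>+ t2. (ennreal (t1 powr c1 * (K / B)) * w) * (ennreal (t2 powr (c2 - 1)) * indicator {\<delta>2..1} t2) \<partial>lborel)"
        using pt[OF t1] by (intro nn_integral_mono) (auto simp: indicator_def)
      also have "\<dots> = (ennreal (t1 powr c1 * (K / B)) * w) * (\<integral>\<^sup>+ t2. ennreal (t2 powr (c2 - 1)) * indicator {\<delta>2..1} t2 \<partial>lborel)"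
        by (rule nn_integral_cmult) measurable
      also have "\<dots> \<le> (ennreal (t1 powr c1 * (K / B)) * w) * ennreal (1 / c2)"
        by (intro mult_left_mono nn_integral_powr_le) (use c d in auto)
      finally show ?thesis .
    qed
    have "(\<integral>\<^sup>+ t1 \<in> {\<delta>1..1}. (\<integral>\<^sup>+ t2 \<in> {\<delta>2..1}.
               mixed_modulus p \<beta>1 \<beta>2 f t1 t2 / ennreal (t1 powr \<alpha>1 * t2 powr \<alpha>2)
               / ennreal t2 \<partial>lborel) / ennreal t1 \<partial>lborel)
       \<le> (\<integral>\<^sup>+ t1. (ennreal (K / B) * w * ennreal (1 / c2)) * (ennreal (t1 powr (c1 - 1)) * indicator {\<delta>1..1} t1) \<partial>lborel)" (is "?I \<le> _")
    proof (rule nn_integral_mono)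
      fix t1
      show "(\<integral>\<^sup>+ t2 \<in> {\<delta>2..1}. mixed_modulus p \<beta>1 \<beta>2 f t1 t2 / ennreal (t1 powr \<alpha>1 * t2 powr \<alpha>2)
               / ennreal t2 \<partial>lborel) / ennreal t1 * indicator {\<delta>1..1} t1 \<le> (ennreal (K / B) * w * ennreal (1 / c2)) * (ennreal (t1 powr (c1 - 1)) * indicator {\<delta>1..1} t1)"
      proof (cases "t1 \<in> {\<delta>1..1}")
        case True
        then have t1: "t1 > 0" "\<delta>1 \<le> t1" using d by auto
        have "(\<integral>\<^sup>+ t2 \<in> {\<delta>2..1}. mixed_modulus p \<beta>1 \<beta>2 f t1 t2 / ennreal (t1 powr \<alpha>1 * t2 powr \<alpha>2)
               / ennreal t2 \<partial>lborel) / ennreal t1 \<le> (ennreal (t1 powr c1 * (K / B)) * w * ennreal (1 / c2)) / ennreal t1"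
          by (intro divide_right_mono_ennreal in1 t1)
        also have "\<dots> = ennreal (1 / t1) * ennreal (t1 powr c1 * (K / B)) * (w * ennreal (1 / c2))"
          by (simp only: ennreal_divide_ennreal_pos[OF t1(1)] mult.assoc)
        also have "ennreal (1 / t1) * ennreal (t1 powr c1 * (K / B)) = ennreal (1 / t1 * (t1 powr c1 * (K / B)))"
          using t1 by (intro ennreal_mult'[symmetric]) auto
        also have "1 / t1 * (t1 powr c1 * (K / B)) = (K / B) * t1 powr (c1 - 1)" using t1 by (simp add: powr_diff mult_ac)
        also have "ennreal \<dots> = ennreal (K / B) * ennreal (t1 powr (c1 - 1))" using K AB by (intro ennreal_mult') auto
        finally have *: "(\<integral>\<^sup>+ t2 \<in> {\<delta>2..1}. mixed_modulus p \<beta>1 \<beta>2 f t1 t2 / ennreal (t1 powr \<alpha>1 * t2 powr \<alpha>2)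
               / ennreal t2 \<partial>lborel) / ennreal t1 \<le> ennreal (K / B) * ennreal (t1 powr (c1 - 1)) * (w * ennreal (1 / c2))" .
        have i: "indicator {\<delta>1..1} t1 = (1::ennreal)" using True by simp
        show ?thesis using * by (simp only: i mult_1_right mult_1_left mult_ac)
      qed simp
    qed
    also have "\<dots> = (ennreal (K / B) * w * ennreal (1 / c2)) * (\<integral>\<^sup>+ t1. ennreal (t1 powr (c1 - 1)) * indicator {\<delta>1..1} t1 \<partial>lborel)"
      by (rule nn_integral_cmult) measurable
    also have "\<dots> \<le> (ennreal (K / B) * w * ennreal (1 / c2)) * ennreal (1 / c1)"
      by (intro mult_left_mono nn_integral_powr_le) (use c d in auto)
    finally have I: "?I \<le> (ennreal (K / B) * w * ennreal (1 / c2)) * ennreal (1 / c1)" .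
    have "mixed_modulus p \<alpha>1 \<alpha>2 f \<delta>1 \<delta>2 / ennreal A \<le>
      ennreal (1 / A) * (ennreal C * (ennreal A * ((ennreal (K / B) * w * ennreal (1 / c2)) * ennreal (1 / c1))))"
      unfolding ennreal_divide_ennreal_pos[OF AB(1)] unfolding A_def
      by (intro mult_left_mono order_trans[OF mar[OF f d]] I) auto
    also have "\<dots> = (ennreal (1 / A) * ennreal C * ennreal A * ennreal (K / B) * ennreal (1 / c2) * ennreal (1 / c1)) * w"
      by (simp only: mult_ac)
    also have "ennreal (1 / A) * ennreal C * ennreal A * ennreal (K / B) * ennreal (1 / c2) * ennreal (1 / c1) = ennreal (1 / A * C * A * (K / B) * (1 / c2) * (1 / c1))"
      using AB C K c by (subst ennreal_mult', simp)+ simp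
    also have "1 / A * C * A * (K / B) * (1 / c2) * (1 / c1) = C * (K / (c1 * c2)) * (1 / B)" using AB by simp
    also have "ennreal \<dots> = ennreal (C * (K / (c1 * c2))) * ennreal (1 / B)" using C K c by (intro ennreal_mult') auto
    also have "ennreal (C * (K / (c1 * c2))) * ennreal (1 / B) * w = ennreal (C * (K / (c1 * c2))) * (w / ennreal B)"
      unfolding ennreal_divide_ennreal_pos[OF AB(2)] by (simp only: mult.assoc)
    finally show "mixed_modulus p \<alpha>1 \<alpha>2 f \<delta>1 \<delta>2 / ennreal (\<delta>1 powr \<alpha>1 * \<delta>2 powr \<alpha>2) \<le>
       ennreal (C * (K / (c1 * c2))) * (mixed_modulus p \<beta>1 \<beta>2 f \<delta>1 \<delta>2 / ennreal (\<delta>1 powr \<beta>1 * \<delta>2 powr \<beta>2))"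
      unfolding w_def A_def B_def .
  qed (use C K c in auto)
qed

section \<open>The conjugate function\<close>

lemma convex_bounded_above_mono:
  fixes m m' m'' :: "real \<Rightarrow> real"
  assumes d1: "\<And>s. (m has_real_derivative m' s) (at s)" and d2: "\<And>s. (m' has_real_derivative m'' s) (at s)"
    and pos: "\<And>s. m'' s \<ge> 0" and bd: "\<And>s. s \<le> 0 \<Longrightarrow> m s \<le> B" and s: "s \<le> 0"
  shows "m s \<le> m 0"
proof -
  have mono: "m' x \<le> m' y" if "x \<le> y" for x y
    by (rule DERIV_nonneg_imp_nondecreasing[OF that]) (use d2 pos in blast)
  have nn: "m' x \<ge> 0" if "x \<le> 0" for x
  proof (rule ccontr)
    assume "\<not> m' x \<ge> 0"
    then have c: "m' x < 0" by simp
    \<comment> \<open>The tangent at x, which has negative slope, reaches height B + 1 at this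
      point; convexity keeps m above it, against the bound B.\<close>
    define y where "y = x - (B - m x + 1) / (- m' x)"
    have "B - m x \<ge> 0" using bd[OF that] by simp
    then have y: "y < x" using c by (simp add: y_def divide_pos_neg)
    obtain z where z: "y < z" "z < x" "m x - m y = (x - y) * m' z"
      using MVT2[OF y, of m m'] d1 by blast
    have "(x - y) * m' z \<le> (x - y) * m' x" using mono[of z x] z y by (intro mult_left_mono) auto
    also have "\<dots> = - (B - m x + 1)" using c by (simp add: y_def field_simps)
    finally have "m y \<ge> B + 1" using z by linarith
    moreover have "m y \<le> B" using y that by (intro bd) simp
    ultimately show False by simp
  qed
  show ?thesis
    by (rule DERIV_nonneg_imp_nondecreasing[OF s]) (use d1 nn in blast)
qed

text \<open>Here s is the logarithm of the radius and t the angle. The t-part of the Laplacian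
  integrates to 0 over a period, so the mean is convex in s, and a convex function bounded above
  towards minus infinity is nondecreasing.\<close>

lemma subharmonic_mean_mono:
  fixes g gs gss gt gtt :: "real \<Rightarrow> real \<Rightarrow> real"
  assumes ds: "\<And>s t. ((\<lambda>s. g s t) has_real_derivative gs s t) (at s)"
    and dss: "\<And>s t. ((\<lambda>s. gs s t) has_real_derivative gss s t) (at s)"
    and dt: "\<And>s t. (gt s has_real_derivative gtt s t) (at t)"
    and cont: "continuous_on UNIV (\<lambda>(s, t). g s t)" "continuous_on UNIV (\<lambda>(s, t). gs s t)"
      "continuous_on UNIV (\<lambda>(s, t). gss s t)"
    and per: "\<And>s. gt s (2*pi) = gt s 0"
    and sub: "\<And>s t. gss s t + gtt s t \<ge> 0"
    and bd: "\<And>s t. s \<le> 0 \<Longrightarrow> g s t \<le> B" and s: "s \<le> 0"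
  shows "integral {0..2*pi} (g s) \<le> integral {0..2*pi} (g 0)"
proof -
  have sl: "continuous_on S (h s)" if "continuous_on UNIV (\<lambda>(s, t). h s t)" for h :: "real \<Rightarrow> real \<Rightarrow> real" and s S
  proof -
    have "continuous_on S (\<lambda>t. (s, t))" by (intro continuous_intros)
    from continuous_on_compose2[OF that this] show ?thesis by simp
  qed
  have int: "h s integrable_on {0..2*pi}" if "continuous_on UNIV (\<lambda>(s, t). h s t)" for h :: "real \<Rightarrow> real \<Rightarrow> real" and s
    by (rule integrable_continuous_real[OF sl[OF that]])
  have lei: "((\<lambda>s. integral {0..2*pi} (h s)) has_real_derivative integral {0..2*pi} (h' s)) (at s)"
    if "\<And>s t. ((\<lambda>s. h s t) has_real_derivative h' s t) (at s)" "continuous_on UNIV (\<lambda>(s, t). h s t)"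
      "continuous_on UNIV (\<lambda>(s, t). h' s t)" for h h' :: "real \<Rightarrow> real \<Rightarrow> real" and s
    using leibniz_rule_field_derivative[of UNIV 0 "2*pi" h h' s] that int[OF that(2)]
    by (auto simp: cbox_interval intro: continuous_on_subset)
  have "integral {0..2*pi} (gss s) \<ge> 0" for s
  proof -
    have "(gtt s has_integral (gt s (2*pi) - gt s 0)) {0..2*pi}"
      by (rule fundamental_theorem_of_calculus)
         (auto intro: has_field_derivative_at_within dt simp flip: has_real_derivative_iff_has_vector_derivative)
    then have "(gtt s has_integral 0) {0..2*pi}" using per by simp
    moreover have "(gss s has_integral integral {0..2*pi} (gss s)) {0..2*pi}" using int[OF cont(3)] by (rule integrable_integral)
    ultimately have "((\<lambda>t. gss s t + gtt s t) has_integral (integral {0..2*pi} (gss s) + 0)) {0..2*pi}"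
      by (intro has_integral_add)
    from has_integral_nonneg[OF this] show ?thesis using sub by simp
  qed
  moreover have "integral {0..2*pi} (g s) \<le> 2*pi * B" if "s \<le> 0" for s
  proof -
    have "integral {0..2*pi} (g s) \<le> integral {0..2*pi} (\<lambda>t. B)"
      using that bd int[OF cont(1)] by (intro integral_le) auto
    then show ?thesis by simp
  qed
  ultimately show ?thesis
    using convex_bounded_above_mono[OF lei[OF ds cont(1,2)] lei[OF dss cont(2,3)], of "2*pi * B" s] s by blast
qed

text \<open>With D the squared modulus of the derivative, the two sides are Laplacians of q-th
  powers, without and with \<kappa>. They compare with \<rho>1^(q-1) D and \<rho>^(q-1) D, with
  factors 4 q max(1, q) above and 2 q min(1, 2q - 1) below; the power of \<kappa> relates \<rho>1 to
  \<rho>. The sign of q - 1 decides whether the gradient term helps or has to be absorbed.\<close>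

lemma laplacian_bounds:
  fixes q \<kappa> \<rho> \<rho>1 u v D :: real
  assumes q: "q > 1/2" and k: "0 < \<kappa>" "\<kappa> \<le> 1" and e: "\<epsilon> > 0" and D: "D \<ge> 0"
    and r: "\<rho> = u\<^sup>2 + \<kappa> * v\<^sup>2 + \<epsilon>" and r1: "\<rho>1 = u\<^sup>2 + v\<^sup>2 + \<epsilon>"
  shows "4 * q * (q - 1) * \<rho>1 powr (q - 2) * ((u\<^sup>2 + v\<^sup>2) * D) + 4 * q * \<rho>1 powr (q - 1) * D \<le>
     2 * max 1 q / min 1 (2 * q - 1) * \<kappa> powr (- max (q - 1) 0) *
       (4 * q * (q - 1) * \<rho> powr (q - 2) * ((u\<^sup>2 + \<kappa>\<^sup>2 * v\<^sup>2) * D) + 2 * q * (1 + \<kappa>) * \<rho> powr (q - 1) * D)"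
proof -
  let ?c = "min 1 (2 * q - 1)"
  have c: "?c > 0" using q by auto
  have pos: "\<rho> > 0" "\<rho>1 > 0" using k e unfolding r r1 by (auto intro!: add_nonneg_pos)
  have le: "u\<^sup>2 + v\<^sup>2 \<le> \<rho>1" "u\<^sup>2 + \<kappa>\<^sup>2 * v\<^sup>2 \<le> \<rho>" "\<rho> \<le> \<rho>1" "\<kappa> * \<rho>1 \<le> \<rho>"
  proof -
    have "\<kappa>\<^sup>2 \<le> \<kappa>" using k by (simp add: power2_eq_square mult_left_le)
    then have "\<kappa>\<^sup>2 * v\<^sup>2 \<le> \<kappa> * v\<^sup>2" by (intro mult_right_mono) auto
    then show "u\<^sup>2 + \<kappa>\<^sup>2 * v\<^sup>2 \<le> \<rho>" using e unfolding r by linarith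
    have "\<kappa> * v\<^sup>2 \<le> 1 * v\<^sup>2" "\<kappa> * u\<^sup>2 \<le> 1 * u\<^sup>2" "\<kappa> * \<epsilon> \<le> 1 * \<epsilon>" using k e by (intro mult_right_mono; simp)+
    then show "\<rho> \<le> \<rho>1" "\<kappa> * \<rho>1 \<le> \<rho>" unfolding r r1 by (auto simp: distrib_left)
  qed (use e r1 in auto)
  have pw: "x powr (q - 2) * x = x powr (q - 1)" if "x > 0" for x :: real
    using that powr_add[of x "q - 2" 1] by simp
  have up: "4 * q * (q - 1) * \<rho>1 powr (q - 2) * ((u\<^sup>2 + v\<^sup>2) * D) + 4 * q * \<rho>1 powr (q - 1) * D \<le> 4 * q * max 1 q * (\<rho>1 powr (q - 1) * D)"
  proof (cases "q \<ge> 1")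
    case True
    have "4 * q * (q - 1) * \<rho>1 powr (q - 2) * ((u\<^sup>2 + v\<^sup>2) * D) \<le> 4 * q * (q - 1) * \<rho>1 powr (q - 2) * (\<rho>1 * D)"
      using True D le q by (intro mult_left_mono mult_right_mono) auto
    also have "\<dots> = 4 * q * (q - 1) * (\<rho>1 powr (q - 1) * D)" by (simp add: pw[OF pos(2), symmetric])
    finally show ?thesis using True by (simp add: algebra_simps)
  next
    case False
    then have "4 * q * (q - 1) * (\<rho>1 powr (q - 2) * ((u\<^sup>2 + v\<^sup>2) * D)) \<le> 0"
      using q D by (intro mult_nonpos_nonneg mult_nonneg_nonpos) auto
    then show ?thesis using False by (simp add: mult.assoc)
  qed
  have low: "2 * q * ?c * (\<rho> powr (q - 1) * D) \<le> 4 * q * (q - 1) * \<rho> powr (q - 2) * ((u\<^sup>2 + \<kappa>\<^sup>2 * v\<^sup>2) * D) + 2 * q * (1 + \<kappa>) * \<rho> powr (q - 1) * D"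
  proof (cases "q \<ge> 1")
    case True
    have A: "0 \<le> 4 * q * (q - 1) * \<rho> powr (q - 2) * ((u\<^sup>2 + \<kappa>\<^sup>2 * v\<^sup>2) * D)" using True D by auto
    have "2 * q * ?c * (\<rho> powr (q - 1) * D) \<le> 2 * q * (1 + \<kappa>) * (\<rho> powr (q - 1) * D)"
      using D k q by (intro mult_right_mono mult_left_mono) auto
    then have B: "2 * q * ?c * (\<rho> powr (q - 1) * D) \<le> 2 * q * (1 + \<kappa>) * \<rho> powr (q - 1) * D"
      by (simp only: mult.assoc)
    show ?thesis using add_mono[OF A B] by simp
  next
    case False
    have "\<rho> powr (q - 2) * ((u\<^sup>2 + \<kappa>\<^sup>2 * v\<^sup>2) * D) \<le> \<rho> powr (q - 2) * (\<rho> * D)"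
      using D le by (intro mult_left_mono mult_right_mono) auto
    also have "\<dots> = \<rho> powr (q - 1) * D" by (simp add: pw[OF pos(1), symmetric])
    finally have "4 * q * (q - 1) * (\<rho> powr (q - 1) * D) \<le> 4 * q * (q - 1) * (\<rho> powr (q - 2) * ((u\<^sup>2 + \<kappa>\<^sup>2 * v\<^sup>2) * D))"
      using False q by (intro mult_left_mono_neg) (auto intro: mult_nonneg_nonpos)
    moreover have "2 * q * 1 * (\<rho> powr (q - 1) * D) \<le> 2 * q * (1 + \<kappa>) * (\<rho> powr (q - 1) * D)"
      using D k q by (intro mult_right_mono mult_left_mono) auto
    ultimately have "(4 * q * (q - 1) + 2 * q) * (\<rho> powr (q - 1) * D) \<le> 4 * q * (q - 1) * \<rho> powr (q - 2) * ((u\<^sup>2 + \<kappa>\<^sup>2 * v\<^sup>2) * D) + 2 * q * (1 + \<kappa>) * \<rho> powr (q - 1) * D"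
      by (simp only: distrib_right mult.assoc mult_1_right)
    moreover have "4 * q * (q - 1) + 2 * q = 2 * q * ?c" using False by (simp add: min_def algebra_simps)
    ultimately show ?thesis by simp
  qed
  have comp: "\<rho>1 powr (q - 1) \<le> \<kappa> powr (- max (q - 1) 0) * \<rho> powr (q - 1)"
  proof (cases "q \<ge> 1")
    case True
    have "(\<kappa> * \<rho>1) powr (q - 1) \<le> \<rho> powr (q - 1)" using le pos k True by (intro powr_mono2) auto
    then have A: "\<kappa> powr (- (q - 1)) * (\<kappa> powr (q - 1) * \<rho>1 powr (q - 1)) \<le> \<kappa> powr (- (q - 1)) * \<rho> powr (q - 1)"
      by (intro mult_left_mono) (simp_all add: powr_mult)
    have B: "\<kappa> powr (- (q - 1)) * (\<kappa> powr (q - 1) * \<rho>1 powr (q - 1)) = \<rho>1 powr (q - 1)"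
      using k by (simp add: mult.assoc[symmetric] flip: powr_add)
    have M: "max (q - 1) 0 = q - 1" using True by simp
    show ?thesis unfolding M using A unfolding B .
  next
    case False
    then show ?thesis using le pos k by (simp add: powr_mono2')
  qed
  have "4 * q * max 1 q * (\<rho>1 powr (q - 1) * D) \<le> 4 * q * max 1 q * (\<kappa> powr (- max (q - 1) 0) * \<rho> powr (q - 1) * D)"
    using comp D q by (intro mult_left_mono mult_right_mono) auto
  also have "\<dots> = 2 * max 1 q / ?c * \<kappa> powr (- max (q - 1) 0) * (2 * q * ?c * (\<rho> powr (q - 1) * D))"
    using c by simp
  also have "\<dots> \<le> 2 * max 1 q / ?c * \<kappa> powr (- max (q - 1) 0) *
       (4 * q * (q - 1) * \<rho> powr (q - 2) * ((u\<^sup>2 + \<kappa>\<^sup>2 * v\<^sup>2) * D) + 2 * q * (1 + \<kappa>) * \<rho> powr (q - 1) * D)"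
    using c q by (intro mult_left_mono low) auto
  finally show ?thesis using up by linarith
qed

context
  fixes I :: "'i set" and a b :: "'i \<Rightarrow> real" and m :: "'i \<Rightarrow> nat"
begin

text \<open>\<open>UU\<close> and \<open>VV\<close> are the real and imaginary parts of the k-th
  derivative of the sum of (a i + i b i) exp(m i (s + i t)), an analytic polynomial in logarithmic
  polar coordinates.\<close>

definition UU :: "nat \<Rightarrow> real \<Rightarrow> real \<Rightarrow> real" where
  "UU k s t = (\<Sum>i\<in>I. real (m i) ^ k * exp (real (m i) * s) * (a i * cos (real (m i) * t) - b i * sin (real (m i) * t)))"

definition VV :: "nat \<Rightarrow> real \<Rightarrow> real \<Rightarrow> real" where
  "VV k s t = (\<Sum>i\<in>I. real (m i) ^ k * exp (real (m i) * s) * (a i * sin (real (m i) * t) + b i * cos (real (m i) * t)))"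

private lemma deriv_UU_s: "((\<lambda>s. UU k s t) has_real_derivative UU (Suc k) s t) (at s)"
  unfolding UU_def by (rule DERIV_sum) (auto intro!: derivative_eq_intros)

private lemma deriv_VV_s: "((\<lambda>s. VV k s t) has_real_derivative VV (Suc k) s t) (at s)"
  unfolding VV_def by (rule DERIV_sum) (auto intro!: derivative_eq_intros)

private lemma deriv_UU_t: "(UU k s has_real_derivative - VV (Suc k) s t) (at t)"
  unfolding UU_def[abs_def] VV_def sum_negf[symmetric]
  by (rule DERIV_sum) (auto intro!: derivative_eq_intros simp: algebra_simps)

private lemma deriv_VV_t: "(VV k s has_real_derivative UU (Suc k) s t) (at t)"
  unfolding UU_def VV_def[abs_def]
  by (rule DERIV_sum) (auto intro!: derivative_eq_intros simp: algebra_simps)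

private lemma cont_UU [continuous_intros]: "continuous_on S (\<lambda>x. UU k (fst x) (snd x))"
  unfolding UU_def by (intro continuous_intros)

private lemma cont_VV [continuous_intros]: "continuous_on S (\<lambda>x. VV k (fst x) (snd x))"
  unfolding VV_def by (intro continuous_intros)

private lemma per_UU: "UU k s (2*pi) = UU k s 0" "VV k s (2*pi) = VV k s 0"
proof -
  have "cos (real n * (2*pi)) = 1" "sin (real n * (2*pi)) = 0" for n
    using cos_2npi[of n] sin_2npi[of n] by (simp_all add: mult_ac)
  then show "UU k s (2*pi) = UU k s 0" "VV k s (2*pi) = VV k s 0" by (simp_all add: UU_def VV_def)
qed

text \<open>As all frequencies are at least 1, both functions vanish like exp(s) towards the centre
  s = -\<infinity>.\<close>

private lemma small_UV:
  assumes "\<And>i. i \<in> I \<Longrightarrow> m i \<ge> 1" "s \<le> 0"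
  shows "\<bar>UU 0 s t\<bar> \<le> (\<Sum>i\<in>I. \<bar>a i\<bar> + \<bar>b i\<bar>) * exp s" "\<bar>VV 0 s t\<bar> \<le> (\<Sum>i\<in>I. \<bar>a i\<bar> + \<bar>b i\<bar>) * exp s"
proof -
  have e: "exp (real (m i) * s) \<le> exp s" if "i \<in> I" for i
  proof -
    have "real (m i) * s \<le> 1 * s" using assms(1)[OF that] assms(2) by (intro mult_right_mono_neg) auto
    then show ?thesis by simp
  qed
  have cs: "\<bar>x * cos t\<bar> \<le> \<bar>x\<bar>" "\<bar>x * sin t\<bar> \<le> \<bar>x\<bar>" for x t :: real
    by (simp_all add: abs_mult mult_left_le)
  have 1: "\<bar>x * cos t - y * sin t\<bar> \<le> \<bar>x\<bar> + \<bar>y\<bar>" "\<bar>x * sin t + y * cos t\<bar> \<le> \<bar>x\<bar> + \<bar>y\<bar>" for x y t :: real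
    using cs(1)[of x t] cs(2)[of y t] cs(2)[of x t] cs(1)[of y t] by linarith+
  show "\<bar>UU 0 s t\<bar> \<le> (\<Sum>i\<in>I. \<bar>a i\<bar> + \<bar>b i\<bar>) * exp s" "\<bar>VV 0 s t\<bar> \<le> (\<Sum>i\<in>I. \<bar>a i\<bar> + \<bar>b i\<bar>) * exp s"
    unfolding UU_def VV_def sum_distrib_right
    by (rule order_trans[OF sum_abs], rule sum_mono, unfold power_0 mult_1_left abs_mult abs_exp_cancel,
        subst mult.commute, intro mult_mono 1 e, auto)+
qed

text \<open>For suitable \<open>\<kappa>\<close> and \<open>K\<close> the function \<open>K (u\<^sup>2 + \<kappa> v\<^sup>2 + \<epsilon>)\<^sup>q - (u\<^sup>2 + v\<^sup>2 + \<epsilon>)\<^sup>q\<close> of the conjugate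
  harmonic functions \<open>u\<close>, \<open>v\<close> is subharmonic, so that its means over the circles \<open>s = const\<close> increase
  from a value near 0 at \<open>s = -\<infinity>\<close>. For small \<open>\<kappa>\<close> the \<open>v\<close>-part of the first summand is absorbed.\<close>

definition RR :: "real \<Rightarrow> real \<Rightarrow> real \<Rightarrow> real \<Rightarrow> real" where
  "RR \<kappa> \<epsilon> s t = (UU 0 s t)\<^sup>2 + \<kappa> * (VV 0 s t)\<^sup>2 + \<epsilon>"

text \<open>First and second partial derivatives of \<open>RR\<close>. Those in t are rewritten by
  the Cauchy-Riemann equations, so that only derivatives in s occur.\<close>

private definition PS where "PS \<kappa> s t = 2 * (UU 0 s t * UU 1 s t + \<kappa> * (VV 0 s t * VV 1 s t))"
private definition PT where "PT \<kappa> s t = 2 * (- (UU 0 s t * VV 1 s t) + \<kappa> * (VV 0 s t * UU 1 s t))"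
private definition PSS where "PSS \<kappa> s t = 2 * ((UU 1 s t)\<^sup>2 + UU 0 s t * UU 2 s t + \<kappa> * ((VV 1 s t)\<^sup>2 + VV 0 s t * VV 2 s t))"
private definition PTT where "PTT \<kappa> s t = 2 * ((VV 1 s t)\<^sup>2 - UU 0 s t * UU 2 s t + \<kappa> * ((UU 1 s t)\<^sup>2 - VV 0 s t * VV 2 s t))"

private lemma RR_pos: "\<epsilon> > 0 \<Longrightarrow> \<kappa> > 0 \<Longrightarrow> RR \<kappa> \<epsilon> s t > 0"
  unfolding RR_def by (intro add_nonneg_pos add_nonneg_nonneg) auto

private lemma d_RR_s: "((\<lambda>s. RR \<kappa> \<epsilon> s t) has_real_derivative PS \<kappa> s t) (at s)"
  unfolding RR_def PS_def
  by (auto intro!: derivative_eq_intros deriv_UU_s deriv_VV_s simp: algebra_simps)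

private lemma d_RR_t: "(RR \<kappa> \<epsilon> s has_real_derivative PT \<kappa> s t) (at t)"
  unfolding RR_def[abs_def] PT_def
  by (auto intro!: derivative_eq_intros deriv_UU_t deriv_VV_t simp: algebra_simps)

private lemma d_PS: "((\<lambda>s. PS \<kappa> s t) has_real_derivative PSS \<kappa> s t) (at s)"
  unfolding PS_def PSS_def
  by (auto intro!: derivative_eq_intros deriv_UU_s deriv_VV_s simp: algebra_simps power2_eq_square numeral_2_eq_2)

private lemma d_PT: "(PT \<kappa> s has_real_derivative PTT \<kappa> s t) (at t)"
  unfolding PT_def[abs_def] PTT_def
  by (auto intro!: derivative_eq_intros deriv_UU_t deriv_VV_t simp: algebra_simps power2_eq_square numeral_2_eq_2)

private definition GSS where "GSS q \<kappa> \<epsilon> s t = q * ((q - 1) * RR \<kappa> \<epsilon> s t powr (q - 2) * PS \<kappa> s t * PS \<kappa> s t + RR \<kappa> \<epsilon> s t powr (q - 1) * PSS \<kappa> s t)"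
private definition GTT where "GTT q \<kappa> \<epsilon> s t = q * ((q - 1) * RR \<kappa> \<epsilon> s t powr (q - 2) * PT \<kappa> s t * PT \<kappa> s t + RR \<kappa> \<epsilon> s t powr (q - 1) * PTT \<kappa> s t)"

private lemma d_G:
  assumes "\<epsilon> > 0" "\<kappa> > 0"
  shows "((\<lambda>s. RR \<kappa> \<epsilon> s t powr q) has_real_derivative q * (RR \<kappa> \<epsilon> s t powr (q - 1) * PS \<kappa> s t)) (at s)"
    "((\<lambda>s. q * (RR \<kappa> \<epsilon> s t powr (q - 1) * PS \<kappa> s t)) has_real_derivative GSS q \<kappa> \<epsilon> s t) (at s)"
    "((\<lambda>t. q * (RR \<kappa> \<epsilon> s t powr (q - 1) * PT \<kappa> s t)) has_real_derivative GTT q \<kappa> \<epsilon> s t) (at t)"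
proof -
  have 1: "((\<lambda>s. RR \<kappa> \<epsilon> s t powr r) has_real_derivative r * RR \<kappa> \<epsilon> s t powr (r - 1) * PS \<kappa> s t) (at s)" for r
    using DERIV_fun_powr[OF d_RR_s RR_pos[OF assms], where r=r] by simp
  have 2: "((\<lambda>t. RR \<kappa> \<epsilon> s t powr r) has_real_derivative r * RR \<kappa> \<epsilon> s t powr (r - 1) * PT \<kappa> s t) (at t)" for r
    using DERIV_fun_powr[OF d_RR_t RR_pos[OF assms], where r=r] by simp
  show "((\<lambda>s. RR \<kappa> \<epsilon> s t powr q) has_real_derivative q * (RR \<kappa> \<epsilon> s t powr (q - 1) * PS \<kappa> s t)) (at s)"
    using 1[of q] by (simp add: mult.assoc)
  have q2: "q - 1 - 1 = q - 2" by simp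
  show "((\<lambda>s. q * (RR \<kappa> \<epsilon> s t powr (q - 1) * PS \<kappa> s t)) has_real_derivative GSS q \<kappa> \<epsilon> s t) (at s)"
    using DERIV_cmult[OF DERIV_mult[OF 1[of "q - 1"] d_PS], of q] unfolding GSS_def q2 by (simp add: mult_ac add_ac)
  show "((\<lambda>t. q * (RR \<kappa> \<epsilon> s t powr (q - 1) * PT \<kappa> s t)) has_real_derivative GTT q \<kappa> \<epsilon> s t) (at t)"
    using DERIV_cmult[OF DERIV_mult[OF 2[of "q - 1"] d_PT], of q] unfolding GTT_def q2 by (simp add: mult_ac add_ac)
qed

text \<open>The cross terms of the squared gradient cancel by the Cauchy-Riemann equations, and the
  second derivatives of u and v cancel by harmonicity; only the squared modulus of the first
  derivative survives.\<close>

private lemma laplace_G: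
  "GSS q \<kappa> \<epsilon> s t + GTT q \<kappa> \<epsilon> s t =
    4 * q * (q - 1) * RR \<kappa> \<epsilon> s t powr (q - 2) * (((UU 0 s t)\<^sup>2 + \<kappa>\<^sup>2 * (VV 0 s t)\<^sup>2) * ((UU 1 s t)\<^sup>2 + (VV 1 s t)\<^sup>2)) +
    2 * q * (1 + \<kappa>) * RR \<kappa> \<epsilon> s t powr (q - 1) * ((UU 1 s t)\<^sup>2 + (VV 1 s t)\<^sup>2)"
proof -
  have 1: "PS \<kappa> s t * PS \<kappa> s t + PT \<kappa> s t * PT \<kappa> s t = 4 * (((UU 0 s t)\<^sup>2 + \<kappa>\<^sup>2 * (VV 0 s t)\<^sup>2) * ((UU 1 s t)\<^sup>2 + (VV 1 s t)\<^sup>2))"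
    unfolding PS_def PT_def by (simp add: power2_eq_square algebra_simps)
  have 2: "PSS \<kappa> s t + PTT \<kappa> s t = 2 * (1 + \<kappa>) * ((UU 1 s t)\<^sup>2 + (VV 1 s t)\<^sup>2)"
    unfolding PSS_def PTT_def by (simp add: algebra_simps)
  have "GSS q \<kappa> \<epsilon> s t + GTT q \<kappa> \<epsilon> s t = q * (q - 1) * RR \<kappa> \<epsilon> s t powr (q - 2) * (PS \<kappa> s t * PS \<kappa> s t + PT \<kappa> s t * PT \<kappa> s t)
      + q * RR \<kappa> \<epsilon> s t powr (q - 1) * (PSS \<kappa> s t + PTT \<kappa> s t)"
    unfolding GSS_def GTT_def by (simp add: algebra_simps)
  then show ?thesis unfolding 1 2 by (simp only: mult_ac)
qed

private lemma cont_RR [continuous_intros]: "continuous_on S (\<lambda>x. RR \<kappa> \<epsilon> (fst x) (snd x))"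
  unfolding RR_def by (intro continuous_intros)

private lemma cont_RR_powr [continuous_intros]:
  "\<epsilon> > 0 \<Longrightarrow> \<kappa> > 0 \<Longrightarrow> continuous_on S (\<lambda>x. RR \<kappa> \<epsilon> (fst x) (snd x) powr r)"
  by (intro continuous_intros) (use RR_pos in \<open>auto simp: less_imp_neq[symmetric]\<close>)

private lemma cont_P [continuous_intros]: "continuous_on S (\<lambda>x. PS \<kappa> (fst x) (snd x))" "continuous_on S (\<lambda>x. PSS \<kappa> (fst x) (snd x))"
  unfolding PS_def PSS_def by (intro continuous_intros)+

text \<open>The mean of the subharmonic difference over the unit circle s = 0 is at least its mean
  over a small circle, where u and v are negligible against \<epsilon>. That lower bound is the
  error term.\<close>

lemma conjugate_energy:
  assumes m: "\<And>i. i \<in> I \<Longrightarrow> m i \<ge> 1" and q: "q > 1/2" and k: "0 < \<kappa>" "\<kappa> \<le> 1" and e: "\<epsilon> > 0"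
  defines "K \<equiv> 2 * max 1 q / min 1 (2 * q - 1) * \<kappa> powr (- max (q - 1) 0)"
  shows "integral {0..2*pi} (\<lambda>t. RR 1 \<epsilon> 0 t powr q) \<le> K * integral {0..2*pi} (\<lambda>t. RR \<kappa> \<epsilon> 0 t powr q) + 2*pi * (2 * \<epsilon>) powr q"
proof -
  define B where "B = (\<Sum>i\<in>I. \<bar>a i\<bar> + \<bar>b i\<bar>)"
  have K: "K > 0" unfolding K_def using q k by (intro mult_pos_pos divide_pos_pos) auto
  define g where "g s t = K * RR \<kappa> \<epsilon> s t powr q - RR 1 \<epsilon> s t powr q" for s t
  \<comment> \<open>Chosen so that (B exp s0)^2 is at most \<epsilon>/2. Then u^2 and v^2 are at
    most \<epsilon>/2 each, and u^2 + v^2 + \<epsilon> is at most 2\<epsilon>.\<close>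
  define s0 where "s0 = min 0 (ln (\<epsilon> / (2 * (B\<^sup>2 + 1))) / 2)"
  have s0: "s0 \<le> 0" by (simp add: s0_def)
  have mean: "integral {0..2*pi} (g s0) \<le> integral {0..2*pi} (g 0)"
  proof (rule subharmonic_mean_mono)
    fix s t
    show "((\<lambda>s. g s t) has_real_derivative K * (q * (RR \<kappa> \<epsilon> s t powr (q - 1) * PS \<kappa> s t)) - q * (RR 1 \<epsilon> s t powr (q - 1) * PS 1 s t)) (at s)"
      unfolding g_def by (intro DERIV_diff DERIV_cmult d_G) (use k e in auto)
    show "((\<lambda>s. K * (q * (RR \<kappa> \<epsilon> s t powr (q - 1) * PS \<kappa> s t)) - q * (RR 1 \<epsilon> s t powr (q - 1) * PS 1 s t)) has_real_derivative
       K * GSS q \<kappa> \<epsilon> s t - GSS q 1 \<epsilon> s t) (at s)"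
      by (intro DERIV_diff DERIV_cmult d_G) (use k e in auto)
    show "((\<lambda>t. K * (q * (RR \<kappa> \<epsilon> s t powr (q - 1) * PT \<kappa> s t)) - q * (RR 1 \<epsilon> s t powr (q - 1) * PT 1 s t)) has_real_derivative
       K * GTT q \<kappa> \<epsilon> s t - GTT q 1 \<epsilon> s t) (at t)"
      by (intro DERIV_diff DERIV_cmult d_G) (use k e in auto)
    show "K * (q * (RR \<kappa> \<epsilon> s (2*pi) powr (q - 1) * PT \<kappa> s (2*pi))) - q * (RR 1 \<epsilon> s (2*pi) powr (q - 1) * PT 1 s (2*pi)) =
       K * (q * (RR \<kappa> \<epsilon> s 0 powr (q - 1) * PT \<kappa> s 0)) - q * (RR 1 \<epsilon> s 0 powr (q - 1) * PT 1 s 0)"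
      by (simp only: RR_def PT_def per_UU)
    have "GSS q 1 \<epsilon> s t + GTT q 1 \<epsilon> s t \<le> K * (GSS q \<kappa> \<epsilon> s t + GTT q \<kappa> \<epsilon> s t)"
      using laplacian_bounds[OF q k e, of "(UU 1 s t)\<^sup>2 + (VV 1 s t)\<^sup>2" "RR \<kappa> \<epsilon> s t" "UU 0 s t" "VV 0 s t" "RR 1 \<epsilon> s t"]
      unfolding laplace_G K_def by (simp add: RR_def)
    then show "0 \<le> K * GSS q \<kappa> \<epsilon> s t - GSS q 1 \<epsilon> s t + (K * GTT q \<kappa> \<epsilon> s t - GTT q 1 \<epsilon> s t)"
      by (simp add: distrib_left)
    show "g s t \<le> K * (2 * B\<^sup>2 + \<epsilon>) powr q" if "s \<le> 0"
    proof -
      have "B \<ge> 0" unfolding B_def by (intro sum_nonneg) auto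
      then have "B * exp s \<le> B * 1" using that by (intro mult_left_mono) auto
      then have "\<bar>UU 0 s t\<bar> \<le> B" "\<bar>VV 0 s t\<bar> \<le> B"
        using small_UV[OF m that, of t] unfolding B_def by auto
      then have UV: "(UU 0 s t)\<^sup>2 \<le> B\<^sup>2" "(VV 0 s t)\<^sup>2 \<le> B\<^sup>2" by (simp_all add: abs_le_square_iff[symmetric])
      have "\<kappa> * (VV 0 s t)\<^sup>2 \<le> 1 * B\<^sup>2" using k UV by (intro mult_mono) auto
      then have "RR \<kappa> \<epsilon> s t \<le> 2 * B\<^sup>2 + \<epsilon>" using UV unfolding RR_def by simp
      then have "RR \<kappa> \<epsilon> s t powr q \<le> (2 * B\<^sup>2 + \<epsilon>) powr q"
        using q RR_pos[OF e k(1), of s t] by (intro powr_mono2) auto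
      then have "K * RR \<kappa> \<epsilon> s t powr q \<le> K * (2 * B\<^sup>2 + \<epsilon>) powr q" using K by (intro mult_left_mono) auto
      moreover have "0 \<le> RR 1 \<epsilon> s t powr q" by simp
      ultimately show ?thesis unfolding g_def by linarith
    qed
  next
    have k1: "(1::real) > 0" by simp
    show "continuous_on UNIV (\<lambda>(s, t). g s t)"
      unfolding g_def case_prod_beta by (intro continuous_intros e k k1)
    show "continuous_on UNIV (\<lambda>(s, t). K * (q * (RR \<kappa> \<epsilon> s t powr (q - 1) * PS \<kappa> s t)) - q * (RR 1 \<epsilon> s t powr (q - 1) * PS 1 s t))"
      unfolding case_prod_beta by (intro continuous_intros e k k1)
    show "continuous_on UNIV (\<lambda>(s, t). K * GSS q \<kappa> \<epsilon> s t - GSS q 1 \<epsilon> s t)"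
      unfolding GSS_def case_prod_beta
      by (intro continuous_on_diff continuous_on_mult continuous_on_add continuous_on_const cont_RR_powr cont_P e k k1)
  qed (rule s0)
  have k1: "(1::real) > 0" by simp
  have cont: "continuous_on {0..2*pi} (\<lambda>t. RR \<kappa> \<epsilon> s t powr q)" if "\<kappa> > 0" for s \<kappa>
  proof -
    have "continuous_on {0..2*pi} (\<lambda>t. (s, t))" by (intro continuous_intros)
    from continuous_on_compose2[OF cont_RR_powr[OF e that, of UNIV q] this] show ?thesis by simp
  qed
  have int: "(\<lambda>t. RR \<kappa> \<epsilon> s t powr q) integrable_on {0..2*pi}" if "\<kappa> > 0" for s \<kappa>
    by (rule integrable_continuous_real[OF cont[OF that]])
  have "- (2*pi * (2 * \<epsilon>) powr q) \<le> integral {0..2*pi} (g s0)"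
  proof -
    have "integral {0..2*pi} (\<lambda>t. - ((2 * \<epsilon>) powr q)) \<le> integral {0..2*pi} (g s0)"
    proof (rule integral_le)
      show "g s0 integrable_on {0..2*pi}" unfolding g_def[abs_def]
        using int[OF k(1)] int[OF k1] by (intro integrable_diff integrable_on_mult_right) auto
      fix t
      have "exp (2 * s0) \<le> \<epsilon> / (2 * (B\<^sup>2 + 1))"
      proof -
        have pos: "\<epsilon> / (2 * (B\<^sup>2 + 1)) > 0" using e by (intro divide_pos_pos mult_pos_pos add_nonneg_pos) auto
        have "2 * s0 \<le> ln (\<epsilon> / (2 * (B\<^sup>2 + 1)))" by (simp add: s0_def min_def)
        then have "exp (2 * s0) \<le> exp (ln (\<epsilon> / (2 * (B\<^sup>2 + 1))))" by (simp only: exp_le_cancel_iff)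
        then show ?thesis unfolding exp_ln[OF pos] .
      qed
      then have "(B\<^sup>2 + 1) * exp (2 * s0) \<le> (B\<^sup>2 + 1) * (\<epsilon> / (2 * (B\<^sup>2 + 1)))" by (rule mult_left_mono) auto
      also have "\<dots> = \<epsilon> / 2"
      proof -
        have X: "X * (\<epsilon> / (2 * X)) = \<epsilon> / 2" if "X > 0" for X :: real using that by simp
        show ?thesis by (rule X) (intro add_nonneg_pos, auto)
      qed
      finally have "(B\<^sup>2 + 1) * exp (2 * s0) \<le> \<epsilon> / 2" .
      moreover have "B\<^sup>2 * exp (2 * s0) \<le> (B\<^sup>2 + 1) * exp (2 * s0)" by (intro mult_right_mono) auto
      moreover have "(B * exp s0)\<^sup>2 = B\<^sup>2 * exp (2 * s0)" by (simp add: power_mult_distrib exp_double)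
      ultimately have Be: "(B * exp s0)\<^sup>2 \<le> \<epsilon> / 2" by linarith
      have "(UU 0 s0 t)\<^sup>2 \<le> (B * exp s0)\<^sup>2" "(VV 0 s0 t)\<^sup>2 \<le> (B * exp s0)\<^sup>2"
        using small_UV[OF m s0, of t] unfolding B_def by (auto simp: abs_le_square_iff[symmetric])
      then have "RR 1 \<epsilon> s0 t \<le> 2 * \<epsilon>" using Be unfolding RR_def by simp
      then have "RR 1 \<epsilon> s0 t powr q \<le> (2 * \<epsilon>) powr q" using q RR_pos[OF e k1, of s0 t] by (intro powr_mono2) auto
      moreover have "0 \<le> K * RR \<kappa> \<epsilon> s0 t powr q" using K by simp
      ultimately show "- ((2 * \<epsilon>) powr q) \<le> g s0 t" unfolding g_def by linarith
    qed auto
    then show ?thesis by simp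
  qed
  also note mean
  also have "integral {0..2*pi} (g 0) = K * integral {0..2*pi} (\<lambda>t. RR \<kappa> \<epsilon> 0 t powr q) - integral {0..2*pi} (\<lambda>t. RR 1 \<epsilon> 0 t powr q)"
    unfolding g_def[abs_def]
    by (subst integral_diff[OF integrable_on_mult_right[OF int[OF k(1)]] int[OF k1]]) simp
  finally show ?thesis by simp
qed

end

lemma three_powr_le:
  fixes x y z :: real
  assumes "x \<ge> 0" "y \<ge> 0" "z \<ge> 0" "q > 0"
  shows "(x + y + z) powr q \<le> 3 powr q * (x powr q + y powr q + z powr q)"
proof -
  define M where "M = max x (max y z)"
  have "(x + y + z) powr q \<le> (3 * M) powr q"
    using assms by (intro powr_mono2) (auto simp: M_def)
  also have "\<dots> = 3 powr q * M powr q" by (simp add: powr_mult)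
  also have "M powr q \<le> x powr q + y powr q + z powr q"
    unfolding M_def max_def using powr_ge_zero[of x q] powr_ge_zero[of y q] powr_ge_zero[of z q] by auto
  finally show ?thesis by simp
qed

text \<open>With q = p/2 the energy inequality bounds the integral of |v|^p by that of |u|^p, by
  half of itself, and by an error that vanishes with \<epsilon>. Both integrals are finite, so the
  half can be absorbed.\<close>

lemma conjugate_Lp_bound:
  assumes p: "p > (1::real)"
  shows "\<exists>A>0. \<forall>I a b m. finite I \<and> (\<forall>i\<in>I. m i \<ge> 1) \<longrightarrow>
    integral {0..2*pi} (\<lambda>t. \<bar>VV I a b m 0 0 t\<bar> powr p) \<le> A * integral {0..2*pi} (\<lambda>t. \<bar>UU I a b m 0 0 t\<bar> powr p)"
proof -
  define q where "q = p / 2"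
  have q: "q > 1/2" "q > 0" using p by (auto simp: q_def)
  define L where "L = 2 * max 1 q / min 1 (2 * q - 1)"
  have L: "L > 0" unfolding L_def using q by (intro divide_pos_pos) auto
  have L2: "L \<ge> 1"
  proof -
    have "2 * max 1 q / min 1 (2 * q - 1) \<ge> 2 * 1 / 1" using q by (intro frac_le) auto
    then show ?thesis by (simp add: L_def)
  qed
  \<comment> \<open>The constant K grows like \<kappa>^(-max(q-1, 0)), so K \<kappa>^q behaves like
    \<kappa>^(min(1, q)). Setting this last power equal to X makes the coefficient of the v-term
    exactly 1/2.\<close>
  define X where "X = 1 / (2 * 3 powr q * L)"
  define \<kappa> where "\<kappa> = X powr (1 / min 1 q)"
  have three: "3 powr q \<ge> (1::real)" using q by (simp add: ge_one_powr_ge_zero)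
  have X: "X > 0" "X \<le> 1"
  proof -
    show "X > 0" using L by (simp add: X_def)
    have "1 * 1 * 1 \<le> 2 * 3 powr q * L" using three L2 by (intro mult_mono) auto
    moreover have "0 < 2 * 3 powr q * L" using L by simp
    ultimately show "X \<le> 1" unfolding X_def by (subst divide_le_eq_1_pos) simp_all
  qed
  have k: "\<kappa> > 0" "\<kappa> \<le> 1" using X q by (auto simp: \<kappa>_def intro!: powr_le1)
  define K where "K = L * \<kappa> powr (- max (q - 1) 0)"
  have K: "K > 0" using L k by (simp add: K_def)
  have Kk: "K * 3 powr q * \<kappa> powr q = 1 / 2"
  proof -
    have "\<kappa> powr (- max (q - 1) 0) * \<kappa> powr q = \<kappa> powr (min 1 q)"
      by (simp flip: powr_add) (simp add: min_def max_def)
    also have "\<dots> = X" using X q by (simp add: \<kappa>_def powr_powr)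
    finally have "K * 3 powr q * \<kappa> powr q = L * 3 powr q * X" by (simp add: K_def mult_ac)
    also have "\<dots> = 1 / 2" using L by (simp add: X_def)
    finally show ?thesis .
  qed
  show ?thesis
  proof (intro exI[of _ "2 * (K * 3 powr q)"] conjI allI impI)
    fix I :: "'a set" and a b and m :: "'a \<Rightarrow> nat" assume "finite I \<and> (\<forall>i\<in>I. m i \<ge> 1)"
    then have m: "\<And>i. i \<in> I \<Longrightarrow> m i \<ge> 1" by auto
    let ?U = "UU I a b m 0 0" and ?V = "VV I a b m 0 0"
    define IU where "IU = integral {0..2*pi} (\<lambda>t. \<bar>?U t\<bar> powr p)"
    define IV where "IV = integral {0..2*pi} (\<lambda>t. \<bar>?V t\<bar> powr p)"
    have cU: "continuous_on {0..2*pi} ?U" "continuous_on {0..2*pi} ?V"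
      unfolding UU_def[abs_def] VV_def[abs_def] by (intro continuous_intros)+
    have iU: "(\<lambda>t. \<bar>?U t\<bar> powr p) integrable_on {0..2*pi}" "(\<lambda>t. \<bar>?V t\<bar> powr p) integrable_on {0..2*pi}"
      by (intro integrable_continuous_real continuous_on_powr' continuous_on_rabs continuous_on_const cU; use p in auto)+
    have sq: "(x\<^sup>2) powr q = \<bar>x\<bar> powr p" for x :: real
    proof -
      have e: "x\<^sup>2 = \<bar>x\<bar> powr 2" by (simp add: powr_numeral)
      show ?thesis unfolding e powr_powr by (simp add: q_def)
    qed
    define C where "C = 2*pi * (K * 3 powr q + 2 powr q)"
    have C: "C > 0" unfolding C_def using K by (intro mult_pos_pos add_pos_pos) auto
    have main: "IV \<le> 2 * (K * 3 powr q) * IU + 2 * C * \<epsilon> powr q" if e: "\<epsilon> > 0" for \<epsilon>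
    proof -
      have RRc: "(\<lambda>t. RR I a b m \<kappa> \<epsilon> 0 t powr q) integrable_on {0..2*pi}" if "\<kappa> > 0" for \<kappa>
      proof (rule integrable_continuous_real, rule continuous_on_powr)
        show "continuous_on {0..2*pi} (RR I a b m \<kappa> \<epsilon> 0)" unfolding RR_def[abs_def] by (intro continuous_intros cU)
        have "RR I a b m \<kappa> \<epsilon> 0 t > 0" for t unfolding RR_def using that e by (intro add_nonneg_pos add_nonneg_nonneg) auto
        then show "\<forall>t\<in>{0..2*pi}. RR I a b m \<kappa> \<epsilon> 0 t \<noteq> 0" by (auto simp: less_imp_neq[symmetric])
      qed (intro continuous_intros)
      have "IV \<le> integral {0..2*pi} (\<lambda>t. RR I a b m 1 \<epsilon> 0 t powr q)" unfolding IV_def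
        using e q by (intro integral_le iU RRc) (auto simp: RR_def simp flip: sq intro!: powr_mono2)
      also have "\<dots> \<le> K * integral {0..2*pi} (\<lambda>t. RR I a b m \<kappa> \<epsilon> 0 t powr q) + 2*pi * (2 * \<epsilon>) powr q"
        unfolding K_def L_def by (rule conjugate_energy[OF m q(1) k e])
      also have "integral {0..2*pi} (\<lambda>t. RR I a b m \<kappa> \<epsilon> 0 t powr q) \<le>
         integral {0..2*pi} (\<lambda>t. 3 powr q * (\<bar>?U t\<bar> powr p + \<kappa> powr q * \<bar>?V t\<bar> powr p + \<epsilon> powr q))"
      proof (intro integral_le RRc k integrable_on_mult_right integrable_add integrable_on_const iU)
        fix t
        have "RR I a b m \<kappa> \<epsilon> 0 t powr q \<le> 3 powr q * (((?U t)\<^sup>2) powr q + (\<kappa> * (?V t)\<^sup>2) powr q + \<epsilon> powr q)"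
          unfolding RR_def using k e q by (intro three_powr_le) auto
        then show "RR I a b m \<kappa> \<epsilon> 0 t powr q \<le> 3 powr q * (\<bar>?U t\<bar> powr p + \<kappa> powr q * \<bar>?V t\<bar> powr p + \<epsilon> powr q)"
          by (simp add: sq powr_mult)
      qed auto
      also have "\<dots> = 3 powr q * (IU + \<kappa> powr q * IV + 2*pi * \<epsilon> powr q)"
        unfolding IU_def IV_def
        by (subst integral_mult_right, subst integral_add, (intro integrable_add integrable_on_mult_right iU integrable_on_const; simp)+,
            subst integral_add, (intro integrable_on_mult_right iU; simp)+) simp
      finally have "IV \<le> K * (3 powr q * (IU + \<kappa> powr q * IV + 2*pi * \<epsilon> powr q)) + 2*pi * (2 * \<epsilon>) powr q"
        using K by simp
      also have "\<dots> = K * 3 powr q * IU + (K * 3 powr q * \<kappa> powr q) * IV + C * \<epsilon> powr q"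
        by (simp add: C_def powr_mult algebra_simps)
      finally show ?thesis unfolding Kk by simp
    qed
    show "IV \<le> 2 * (K * 3 powr q) * IU"
    proof (rule field_le_epsilon)
      fix e :: real assume e: "e > 0"
      \<comment> \<open>The value of \<epsilon> for which the error term equals the prescribed
        e.\<close>
      have "2 * C * ((e / (2 * C)) powr (1 / q)) powr q = e" using C e q by (simp add: powr_powr)
      then show "IV \<le> 2 * (K * 3 powr q) * IU + e"
        using main[of "(e / (2 * C)) powr (1 / q)"] C e by simp
    qed
  qed (use K in auto)
qed

text \<open>A complex trigonometric polynomial F without constant term splits into two conjugate
  pairs: Re F with Im S, and Im F with Re S, where S carries the sign multiplier. The index set is
  arbitrary, so several indices may share a frequency.\<close>

lemma riesz_1d:
  assumes p: "p > (1::real)"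
  shows "\<exists>A>0. \<forall>(I::'i set) d k. finite I \<and> (\<forall>i\<in>I. k i \<noteq> 0) \<longrightarrow>
    (\<integral>\<^sup>+ t. ennreal (norm (\<Sum>i\<in>I. of_int (sgn (k i)) * d i * cis (of_int (k i) * t)) powr p) * indicator {0..2*pi} t \<partial>lborel) \<le>
    ennreal A * (\<integral>\<^sup>+ t. ennreal (norm (\<Sum>i\<in>I. d i * cis (of_int (k i) * t)) powr p) * indicator {0..2*pi} t \<partial>lborel)"
proof -
  obtain A where A: "A > 0" and bound: "\<forall>(I::'i set) a b m. finite I \<and> (\<forall>i\<in>I. m i \<ge> 1) \<longrightarrow>
    integral {0..2*pi} (\<lambda>t. \<bar>VV I a b m 0 0 t\<bar> powr p) \<le> A * integral {0..2*pi} (\<lambda>t. \<bar>UU I a b m 0 0 t\<bar> powr p)"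
    using conjugate_Lp_bound[OF p, where 'a='i] by (elim exE conjE)
  show ?thesis
  proof (intro exI[of _ "2 powr p * (2 * A)"] conjI allI impI)
    fix I :: "'i set" and d :: "'i \<Rightarrow> complex" and k :: "'i \<Rightarrow> int"
    assume "finite I \<and> (\<forall>i\<in>I. k i \<noteq> 0)"
    then have I: "finite I" and k: "\<And>i. i \<in> I \<Longrightarrow> k i \<noteq> 0" by auto
    define F where "F d t = (\<Sum>i\<in>I. d i * cis (of_int (k i) * t))" for d :: "'i \<Rightarrow> complex" and t
    define S where "S d t = (\<Sum>i\<in>I. of_int (sgn (k i)) * d i * cis (of_int (k i) * t))" for d :: "'i \<Rightarrow> complex" and t
    define m where "m i = nat \<bar>k i\<bar>" for i
    have m: "m i \<ge> 1" if "i \<in> I" for i using k[OF that] by (simp add: m_def)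
    have cF: "continuous_on S' (F d)" "continuous_on S' (S d)" for d S'
      unfolding F_def[abs_def] S_def[abs_def] by (intro continuous_intros)+
    have part: "integral {0..2*pi} (\<lambda>t. \<bar>Im (S d t)\<bar> powr p) \<le> A * integral {0..2*pi} (\<lambda>t. \<bar>Re (F d t)\<bar> powr p)" for d
    proof -
      \<comment> \<open>With m = |k| the sign of the frequency moves into the imaginary part of the
        coefficient, so that only positive frequencies remain.\<close>
      define b where "b i = of_int (sgn (k i)) * Im (d i)" for i
      have cases_k: "of_int (k i) = real (m i) \<and> sgn (k i) = 1 \<or> of_int (k i) = - real (m i) \<and> sgn (k i) = - 1" if "i \<in> I" for i
        using k[OF that] by (auto simp: m_def sgn_if)
      have "Re (F d t) = UU I (\<lambda>i. Re (d i)) b m 0 0 t" for t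
        unfolding F_def UU_def Re_sum
      proof (rule sum.cong[OF refl])
        fix i assume "i \<in> I"
        from cases_k[OF this] show "Re (d i * cis (of_int (k i) * t)) = real (m i) ^ 0 * exp (real (m i) * 0) * (Re (d i) * cos (real (m i) * t) - b i * sin (real (m i) * t))"
          by (elim disjE conjE) (simp_all add: b_def)
      qed
      moreover have "Im (S d t) = VV I (\<lambda>i. Re (d i)) b m 0 0 t" for t
        unfolding S_def VV_def Im_sum
      proof (rule sum.cong[OF refl])
        fix i assume "i \<in> I"
        from cases_k[OF this] show "Im (of_int (sgn (k i)) * d i * cis (of_int (k i) * t)) = real (m i) ^ 0 * exp (real (m i) * 0) * (Re (d i) * sin (real (m i) * t) + b i * cos (real (m i) * t))"
          by (elim disjE conjE) (simp_all add: b_def)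
      qed
      ultimately show ?thesis using bound[rule_format, of I m "\<lambda>i. Re (d i)" b] I m by simp
    qed
    have iF: "F (\<lambda>i. \<i> * d i) t = \<i> * F d t" "S (\<lambda>i. \<i> * d i) t = \<i> * S d t" for t
      unfolding F_def S_def by (simp_all add: sum_distrib_left mult_ac)
    \<comment> \<open>Multiplying all coefficients by i exchanges the roles of real and imaginary
      parts.\<close>
    have part2: "integral {0..2*pi} (\<lambda>t. \<bar>Re (S d t)\<bar> powr p) \<le> A * integral {0..2*pi} (\<lambda>t. \<bar>Im (F d t)\<bar> powr p)"
      using part[of "\<lambda>i. \<i> * d i"] by (simp add: iF)
    have int: "(\<lambda>t. \<bar>Im (S d t)\<bar> powr p) integrable_on {0..2*pi}" "(\<lambda>t. \<bar>Re (S d t)\<bar> powr p) integrable_on {0..2*pi}"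
      "(\<lambda>t. \<bar>Im (F d t)\<bar> powr p) integrable_on {0..2*pi}" "(\<lambda>t. \<bar>Re (F d t)\<bar> powr p) integrable_on {0..2*pi}"
      "(\<lambda>t. norm (F d t) powr p) integrable_on {0..2*pi}" "(\<lambda>t. norm (S d t) powr p) integrable_on {0..2*pi}"
      by (intro integrable_continuous_real continuous_on_powr' continuous_on_rabs continuous_on_norm continuous_on_const
          continuous_on_Re continuous_on_Im cF; use p in auto)+
    have split: "norm w powr p \<le> 2 powr p * (\<bar>Re w\<bar> powr p + \<bar>Im w\<bar> powr p)" for w :: complex
    proof -
      have "norm w powr p \<le> (2 * max \<bar>Re w\<bar> \<bar>Im w\<bar>) powr p"
        using p cmod_le[of w] by (intro powr_mono2) auto
      also have "\<dots> = 2 powr p * max \<bar>Re w\<bar> \<bar>Im w\<bar> powr p" by (simp add: powr_mult)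
      also have "\<dots> \<le> 2 powr p * (\<bar>Re w\<bar> powr p + \<bar>Im w\<bar> powr p)"
        by (intro mult_left_mono) (auto simp: max_def)
      finally show ?thesis .
    qed
    have "integral {0..2*pi} (\<lambda>t. norm (S d t) powr p) \<le> integral {0..2*pi} (\<lambda>t. 2 powr p * (\<bar>Re (S d t)\<bar> powr p + \<bar>Im (S d t)\<bar> powr p))"
      by (intro integral_le int integrable_on_mult_right integrable_add split)
    also have "\<dots> = 2 powr p * (integral {0..2*pi} (\<lambda>t. \<bar>Re (S d t)\<bar> powr p) + integral {0..2*pi} (\<lambda>t. \<bar>Im (S d t)\<bar> powr p))"
      using int by (simp add: integral_add)
    also have "\<dots> \<le> 2 powr p * (A * integral {0..2*pi} (\<lambda>t. \<bar>Im (F d t)\<bar> powr p) + A * integral {0..2*pi} (\<lambda>t. \<bar>Re (F d t)\<bar> powr p))"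
      using part[of d] part2 by (intro mult_left_mono add_mono) auto
    also have "\<dots> \<le> 2 powr p * (A * integral {0..2*pi} (\<lambda>t. norm (F d t) powr p) + A * integral {0..2*pi} (\<lambda>t. norm (F d t) powr p))"
      using A p by (intro mult_left_mono add_mono integral_le int powr_mono2 abs_Im_le_cmod abs_Re_le_cmod) auto
    also have "\<dots> = 2 powr p * (2 * A) * integral {0..2*pi} (\<lambda>t. norm (F d t) powr p)" by simp
    finally have main: "integral {0..2*pi} (\<lambda>t. norm (S d t) powr p) \<le> 2 powr p * (2 * A) * integral {0..2*pi} (\<lambda>t. norm (F d t) powr p)" .
    have conv: "(\<integral>\<^sup>+ t. ennreal (norm (h t) powr p) * indicator {0..2*pi} t \<partial>lborel) = ennreal (integral {0..2*pi} (\<lambda>t. norm (h t) powr p))"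
      if "(\<lambda>t. norm (h t) powr p) integrable_on {0..2*pi}" for h :: "real \<Rightarrow> complex"
      by (rule nn_integral_has_integral_lebesgue'[OF _ integrable_integral[OF that]]) simp
    show "(\<integral>\<^sup>+ t. ennreal (norm (\<Sum>i\<in>I. of_int (sgn (k i)) * d i * cis (of_int (k i) * t)) powr p) * indicator {0..2*pi} t \<partial>lborel) \<le>
      ennreal (2 powr p * (2 * A)) * (\<integral>\<^sup>+ t. ennreal (norm (\<Sum>i\<in>I. d i * cis (of_int (k i) * t)) powr p) * indicator {0..2*pi} t \<partial>lborel)"
      unfolding S_def[symmetric] unfolding F_def[symmetric] conv[OF int(5)] conv[OF int(6)]
      using main A by (subst ennreal_mult'[symmetric]) (auto intro!: ennreal_leI)
  qed (use A in auto)
qed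

section \<open>Sign multipliers on the torus\<close>

definition trig :: "(int \<times> int \<Rightarrow> complex) \<Rightarrow> (int \<times> int) set \<Rightarrow> real \<times> real \<Rightarrow> complex" where
  "trig c I z = (\<Sum>n\<in>I. c n * cis (of_int (fst n) * fst z + of_int (snd n) * snd z))"

lemma continuous_trig: "continuous_on S (trig c I)"
  unfolding trig_def[abs_def] by (intro continuous_intros)

lemma per_trig: "per (trig c I)"
proof -
  have "cis (of_int a * (x + 2*pi) + y) = cis (of_int a * x + y)" "cis (x + of_int a * (y + 2*pi)) = cis (x + of_int a * y)" for a x y
  proof -
    have "cis (of_int a * (2*pi)) = 1" using cis_multiple_2pi[of "of_int a"] by (simp add: mult_ac)
    then show "cis (of_int a * (x + 2*pi) + y) = cis (of_int a * x + y)" "cis (x + of_int a * (y + 2*pi)) = cis (x + of_int a * y)"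
      by (simp_all add: distrib_left flip: cis_mult)
  qed
  then show ?thesis by (simp add: per_def trig_def)
qed

lemma borel_measurable_continuous_lebesgue:
  fixes f :: "real \<times> real \<Rightarrow> 'b::topological_space"
  assumes "continuous_on UNIV f"
  shows "f \<in> borel_measurable lebesgue"
  using borel_measurable_continuous_onI[OF assms] by (intro measurable_completion) simp

lemma trig_in_torus_Lp:
  assumes p: "p > 0"
  shows "trig c I \<in> torus_Lp p"
proof -
  define M where "M = (\<Sum>n\<in>I. norm (c n))"
  have M: "M \<ge> 0" unfolding M_def by (intro sum_nonneg) auto
  have "norm (trig c I z) \<le> M" for z
    unfolding trig_def M_def by (rule order_trans[OF norm_sum]) (simp add: norm_mult)
  then have "pint p (trig c I) \<le> (\<integral>\<^sup>+ z. ennreal (M powr p) \<partial>torus_measure)"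
    unfolding pint_def using p by (intro nn_integral_mono ennreal_leI powr_mono2) auto
  also have "\<dots> < \<infinity>" by (simp add: emeasure_torus ennreal_mult_less_top)
  finally have "Lp_norm p (trig c I) < \<infinity>" unfolding Lp_norm_less_top .
  then show ?thesis
    by (simp add: torus_Lp_iff per_trig borel_measurable_continuous_lebesgue[OF continuous_trig])
qed

lemma nn_integral_torus_iterated:
  assumes [measurable]: "\<phi> \<in> borel_measurable borel"
  shows "nn_integral torus_measure \<phi> = (\<integral>\<^sup>+ y. (\<integral>\<^sup>+ x. \<phi> (x, y) * indicator {0..2*pi} x \<partial>lborel) * indicator {0..2*pi} y \<partial>lborel)"
    and "nn_integral torus_measure \<phi> = (\<integral>\<^sup>+ x. (\<integral>\<^sup>+ y. \<phi> (x, y) * indicator {0..2*pi} y \<partial>lborel) * indicator {0..2*pi} x \<partial>lborel)"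
proof -
  have [measurable]: "\<phi> \<in> borel_measurable (lborel \<Otimes>\<^sub>M lborel)" by (simp add: lborel_prod)
  let ?\<psi> = "\<lambda>z :: real \<times> real. \<phi> z * (indicator {0..2*pi} (fst z) * indicator {0..2*pi} (snd z))"
  have "nn_integral torus_measure \<phi> = nn_integral lborel ?\<psi>"
    unfolding nn_integral_torus nn_integral_completion
    by (intro nn_integral_cong) (auto simp: indicator_def)
  also have "\<dots> = nn_integral (lborel \<Otimes>\<^sub>M lborel) ?\<psi>" by (simp add: lborel_prod)
  finally have eq: "nn_integral torus_measure \<phi> = nn_integral (lborel \<Otimes>\<^sub>M lborel) ?\<psi>" .
  have "nn_integral (lborel \<Otimes>\<^sub>M lborel) ?\<psi> = (\<integral>\<^sup>+ x. \<integral>\<^sup>+ y. ?\<psi> (x, y) \<partial>lborel \<partial>lborel)"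
    by (rule lborel.nn_integral_fst[symmetric]) measurable
  also have "\<dots> = (\<integral>\<^sup>+ x. (\<integral>\<^sup>+ y. \<phi> (x, y) * indicator {0..2*pi} y \<partial>lborel) * indicator {0..2*pi} x \<partial>lborel)"
    by (subst nn_integral_multc[symmetric]) (auto simp: mult_ac)
  finally show "nn_integral torus_measure \<phi> = (\<integral>\<^sup>+ x. (\<integral>\<^sup>+ y. \<phi> (x, y) * indicator {0..2*pi} y \<partial>lborel) * indicator {0..2*pi} x \<partial>lborel)"
    using eq by simp
  have "nn_integral (lborel \<Otimes>\<^sub>M lborel) ?\<psi> = (\<integral>\<^sup>+ y. \<integral>\<^sup>+ x. ?\<psi> (x, y) \<partial>lborel \<partial>lborel)"
    by (rule lborel_pair.nn_integral_snd[symmetric]) measurable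
  also have "\<dots> = (\<integral>\<^sup>+ y. (\<integral>\<^sup>+ x. \<phi> (x, y) * indicator {0..2*pi} x \<partial>lborel) * indicator {0..2*pi} y \<partial>lborel)"
    by (subst nn_integral_multc[symmetric]) (auto simp: mult_ac)
  finally show "nn_integral torus_measure \<phi> = (\<integral>\<^sup>+ y. (\<integral>\<^sup>+ x. \<phi> (x, y) * indicator {0..2*pi} x \<partial>lborel) * indicator {0..2*pi} y \<partial>lborel)"
    using eq by simp
qed

lemma riesz_2d:
  assumes p: "p > (1::real)"
  shows "\<exists>A>0. \<forall>I c. finite I \<longrightarrow>
    ((\<forall>n\<in>I. fst n \<noteq> 0) \<longrightarrow> pint p (trig (\<lambda>n. of_int (sgn (fst n)) * c n) I) \<le> ennreal A * pint p (trig c I)) \<and>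
    ((\<forall>n\<in>I. snd n \<noteq> 0) \<longrightarrow> pint p (trig (\<lambda>n. of_int (sgn (snd n)) * c n) I) \<le> ennreal A * pint p (trig c I))"
proof -
  obtain A where A: "A > 0" and bound: "\<forall>(I::(int \<times> int) set) d k. finite I \<and> (\<forall>i\<in>I. k i \<noteq> 0) \<longrightarrow>
    (\<integral>\<^sup>+ t. ennreal (norm (\<Sum>i\<in>I. of_int (sgn (k i)) * d i * cis (of_int (k i) * t)) powr p) * indicator {0..2*pi} t \<partial>lborel) \<le>
    ennreal A * (\<integral>\<^sup>+ t. ennreal (norm (\<Sum>i\<in>I. d i * cis (of_int (k i) * t)) powr p) * indicator {0..2*pi} t \<partial>lborel)"
    using riesz_1d[OF p, where 'i="int \<times> int"] by (elim exE conjE)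
  have [measurable]: "trig c I \<in> borel_measurable borel" for c I
    by (rule borel_measurable_continuous_onI[OF continuous_trig])
  have m: "(\<lambda>z. ennreal (norm (trig c I z) powr p)) \<in> borel_measurable borel" for c I by measurable
  have m2 [measurable]: "(\<lambda>z. ennreal (norm (trig c I z) powr p)) \<in> borel_measurable (lborel \<Otimes>\<^sub>M lborel)" for c I
    using m[of c I] by (simp add: lborel_prod)
  show ?thesis
  proof (intro exI[of _ A] conjI allI impI A)
    fix I :: "(int \<times> int) set" and c assume I: "finite I" and n0: "\<forall>n\<in>I. fst n \<noteq> (0::int)"
    have 1: "trig (\<lambda>n. of_int (sgn (fst n)) * c n) I (x, y) = (\<Sum>n\<in>I. of_int (sgn (fst n)) * (c n * cis (of_int (snd n) * y)) * cis (of_int (fst n) * x))"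
      "trig c I (x, y) = (\<Sum>n\<in>I. (c n * cis (of_int (snd n) * y)) * cis (of_int (fst n) * x))" for x y
      by (simp_all add: trig_def mult_ac flip: cis_mult)
    have "pint p (trig (\<lambda>n. of_int (sgn (fst n)) * c n) I) \<le> (\<integral>\<^sup>+ y. ennreal A * ((\<integral>\<^sup>+ x. ennreal (norm (trig c I (x, y)) powr p) * indicator {0..2*pi} x \<partial>lborel) * indicator {0..2*pi} y) \<partial>lborel)"
      unfolding pint_def nn_integral_torus_iterated(1)[OF m] 1 mult.assoc[of "ennreal A", symmetric]
      by (intro nn_integral_mono mult_right_mono bound[rule_format]) (use I n0 in auto)
    also have "\<dots> = ennreal A * pint p (trig c I)"
      unfolding pint_def nn_integral_torus_iterated(1)[OF m] by (rule nn_integral_cmult) measurable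
    finally show "pint p (trig (\<lambda>n. of_int (sgn (fst n)) * c n) I) \<le> ennreal A * pint p (trig c I)" .
  next
    fix I :: "(int \<times> int) set" and c assume I: "finite I" and n0: "\<forall>n\<in>I. snd n \<noteq> (0::int)"
    have 1: "trig (\<lambda>n. of_int (sgn (snd n)) * c n) I (x, y) = (\<Sum>n\<in>I. of_int (sgn (snd n)) * (c n * cis (of_int (fst n) * x)) * cis (of_int (snd n) * y))"
      "trig c I (x, y) = (\<Sum>n\<in>I. (c n * cis (of_int (fst n) * x)) * cis (of_int (snd n) * y))" for x y
      by (simp_all add: trig_def mult_ac flip: cis_mult)
    have "pint p (trig (\<lambda>n. of_int (sgn (snd n)) * c n) I) \<le> (\<integral>\<^sup>+ x. ennreal A * ((\<integral>\<^sup>+ y. ennreal (norm (trig c I (x, y)) powr p) * indicator {0..2*pi} y \<partial>lborel) * indicator {0..2*pi} x) \<partial>lborel)"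
      unfolding pint_def nn_integral_torus_iterated(2)[OF m] 1 mult.assoc[of "ennreal A", symmetric]
      by (intro nn_integral_mono mult_right_mono bound[rule_format]) (use I n0 in auto)
    also have "\<dots> = ennreal A * pint p (trig c I)"
      unfolding pint_def nn_integral_torus_iterated(2)[OF m] by (rule nn_integral_cmult) measurable
    finally show "pint p (trig (\<lambda>n. of_int (sgn (snd n)) * c n) I) \<le> ennreal A * pint p (trig c I)" .
  qed
qed

lemma trig_lincomb:
  "trig (\<lambda>n. u * c n + v * d n) I = (\<lambda>z. u * trig c I z + v * trig d I z)"
  unfolding trig_def by (simp add: fun_eq_iff sum_distrib_left sum.distrib algebra_simps)

text \<open>For nonzero n, cis(\<gamma> sgn n) = cos \<gamma> + i sin \<gamma> sgn n, so the sign
  multiplier covers all these phases with a constant independent of \<gamma>.\<close>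

lemma riesz_multiplier:
  assumes p: "p > (1::real)"
  shows "\<exists>A>0. \<forall>I c \<gamma>. finite I \<longrightarrow>
    ((\<forall>n\<in>I. fst n \<noteq> 0) \<longrightarrow> Lp_norm p (trig (\<lambda>n. cis (\<gamma> * of_int (sgn (fst n))) * c n) I) \<le> ennreal A * Lp_norm p (trig c I)) \<and>
    ((\<forall>n\<in>I. snd n \<noteq> 0) \<longrightarrow> Lp_norm p (trig (\<lambda>n. cis (\<gamma> * of_int (sgn (snd n))) * c n) I) \<le> ennreal A * Lp_norm p (trig c I))"
proof -
  obtain A where A: "A > 0" and bound: "\<forall>I c. finite I \<longrightarrow>
    ((\<forall>n\<in>I. fst n \<noteq> 0) \<longrightarrow> pint p (trig (\<lambda>n. of_int (sgn (fst n)) * c n) I) \<le> ennreal A * pint p (trig c I)) \<and>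
    ((\<forall>n\<in>I. snd n \<noteq> 0) \<longrightarrow> pint p (trig (\<lambda>n. of_int (sgn (snd n)) * c n) I) \<le> ennreal A * pint p (trig c I))"
    using riesz_2d[OF p] by (elim exE conjE)
  have gen: "Lp_norm p (trig (\<lambda>n. cis (\<gamma> * of_int (sgn (s n))) * c n) I) \<le> ennreal (1 + A powr (1 / p)) * Lp_norm p (trig c I)"
    if s: "\<And>n. n \<in> I \<Longrightarrow> s n \<noteq> 0" and b: "pint p (trig (\<lambda>n. of_int (sgn (s n)) * c n) I) \<le> ennreal A * pint p (trig c I)"
    for s :: "int \<times> int \<Rightarrow> int" and c I \<gamma>
  proof -
    have L: "trig c I \<in> torus_Lp p" "trig (\<lambda>n. of_int (sgn (s n)) * c n) I \<in> torus_Lp p" using trig_in_torus_Lp p by auto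
    obtain N where N: "N \<ge> 0" "Lp_norm p (trig c I) = ennreal N"
      using L by (cases "Lp_norm p (trig c I)") (auto simp: torus_Lp_iff)
    have "pint p (trig c I) \<le> ennreal (N powr p)" using Lp_norm_le_iff[of p N "trig c I"] N p by simp
    then have "pint p (trig (\<lambda>n. of_int (sgn (s n)) * c n) I) \<le> ennreal A * ennreal (N powr p)"
      by (intro order_trans[OF b] mult_left_mono) auto
    also have "\<dots> = ennreal ((A powr (1 / p) * N) powr p)" using A p by (simp add: powr_mult powr_powr ennreal_mult')
    finally have S: "Lp_norm p (trig (\<lambda>n. of_int (sgn (s n)) * c n) I) \<le> ennreal (A powr (1 / p) * N)"
      using Lp_norm_le_iff[of p "A powr (1 / p) * N"] N p by simp
    have c: "cis (\<gamma> * of_int (sgn (s n))) * c n = of_real (cos \<gamma>) * c n + (\<i> * of_real (sin \<gamma>)) * (of_int (sgn (s n)) * c n)" if "n \<in> I" for n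
      using s[OF that] by (auto simp: sgn_if cis_conv_exp complex_eq_iff Re_exp Im_exp)
    have "trig (\<lambda>n. cis (\<gamma> * of_int (sgn (s n))) * c n) I = trig (\<lambda>n. of_real (cos \<gamma>) * c n + (\<i> * of_real (sin \<gamma>)) * (of_int (sgn (s n)) * c n)) I"
      unfolding trig_def by (intro ext sum.cong refl) (simp add: c)
    also have "\<dots> = (\<lambda>z. of_real (cos \<gamma>) * trig c I z + (\<i> * of_real (sin \<gamma>)) * trig (\<lambda>n. of_int (sgn (s n)) * c n) I z)"
      by (rule trig_lincomb)
    finally have "Lp_norm p (trig (\<lambda>n. cis (\<gamma> * of_int (sgn (s n))) * c n) I) =
       Lp_norm p (\<lambda>z. of_real (cos \<gamma>) * trig c I z + (\<i> * of_real (sin \<gamma>)) * trig (\<lambda>n. of_int (sgn (s n)) * c n) I z)"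
      by simp
    also have "\<dots> \<le> Lp_norm p (\<lambda>z. of_real (cos \<gamma>) * trig c I z) + Lp_norm p (\<lambda>z. (\<i> * of_real (sin \<gamma>)) * trig (\<lambda>n. of_int (sgn (s n)) * c n) I z)"
      using p L by (intro Lp_norm_triangle torus_Lp_measurable torus_Lp_cmult) auto
    also have "Lp_norm p (\<lambda>z. of_real (cos \<gamma>) * trig c I z) \<le> Lp_norm p (trig c I)"
      using p by (intro Lp_norm_mono) (auto simp: norm_mult intro: mult_left_le_one_le)
    also have "Lp_norm p (\<lambda>z. (\<i> * of_real (sin \<gamma>)) * trig (\<lambda>n. of_int (sgn (s n)) * c n) I z) \<le> Lp_norm p (trig (\<lambda>n. of_int (sgn (s n)) * c n) I)"
      using p by (intro Lp_norm_mono) (auto simp: norm_mult intro: mult_left_le_one_le)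
    also note S
    also have "Lp_norm p (trig c I) + ennreal (A powr (1 / p) * N) = ennreal (1 + A powr (1 / p)) * Lp_norm p (trig c I)"
      using N by (simp add: distrib_right flip: ennreal_plus ennreal_mult')
    finally show ?thesis by (simp add: add_left_mono add_right_mono)
  qed
  show ?thesis
  proof (intro exI[of _ "1 + A powr (1 / p)"] conjI allI impI)
    show "1 + A powr (1 / p) > 0" by (intro add_pos_nonneg) auto
    fix I :: "(int \<times> int) set" and c \<gamma> assume I: "finite I"
    show "Lp_norm p (trig (\<lambda>n. cis (\<gamma> * of_int (sgn (fst n))) * c n) I) \<le> ennreal (1 + A powr (1 / p)) * Lp_norm p (trig c I)"
      if n: "\<forall>n\<in>I. fst n \<noteq> 0"
      by (rule gen) (use n bound[rule_format, OF I] in auto)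
    show "Lp_norm p (trig (\<lambda>n. cis (\<gamma> * of_int (sgn (snd n))) * c n) I) \<le> ennreal (1 + A powr (1 / p)) * Lp_norm p (trig c I)"
      if n: "\<forall>n\<in>I. snd n \<noteq> 0"
      by (rule gen) (use n bound[rule_format, OF I] in auto)
  qed
qed

section \<open>Derivatives of trigonometric polynomials\<close>

text \<open>The value of the power series at the boundary point exp(-i \<theta>), which is the
  multiplier by which the series of translations acts on an exponential.\<close>

definition hat :: "(nat \<Rightarrow> real) \<Rightarrow> real \<Rightarrow> complex" where
  "hat a \<theta> = (\<Sum>k. of_real (a k) * cis (- (real k * \<theta>)))"

definition dotp :: "int \<times> int \<Rightarrow> real \<times> real \<Rightarrow> real" where
  "dotp n v = of_int (fst n) * fst v + of_int (snd n) * snd v"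

lemma summable_hat: "ell1 a \<Longrightarrow> summable (\<lambda>k. of_real (a k) * cis (- (real k * \<theta>)))"
  unfolding ell1_def by (rule summable_norm_cancel) (simp add: norm_mult)

lemma op_trig:
  assumes "finite I" "ell1 a"
  shows "op a v (trig c I) = trig (\<lambda>n. hat a (dotp n v) * c n) I"
proof
  fix z
  have eq: "of_real (a k) * trig c I (z - real k *\<^sub>R v) =
    (\<Sum>n\<in>I. (c n * cis (of_int (fst n) * fst z + of_int (snd n) * snd z)) * (of_real (a k) * cis (- (real k * dotp n v))))" for k
    unfolding trig_def sum_distrib_left
  proof (rule sum.cong[OF refl])
    fix n
    have "of_int (fst n) * fst (z - real k *\<^sub>R v) + of_int (snd n) * snd (z - real k *\<^sub>R v) =
       (of_int (fst n) * fst z + of_int (snd n) * snd z) + - (real k * dotp n v)"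
      by (simp add: dotp_def algebra_simps)
    then show "of_real (a k) * (c n * cis (of_int (fst n) * fst (z - real k *\<^sub>R v) + of_int (snd n) * snd (z - real k *\<^sub>R v))) =
       (c n * cis (of_int (fst n) * fst z + of_int (snd n) * snd z)) * (of_real (a k) * cis (- (real k * dotp n v)))"
      by (simp only: cis_mult[symmetric] mult_ac)
  qed
  have "op a v (trig c I) z = (\<Sum>n\<in>I. \<Sum>k. (c n * cis (of_int (fst n) * fst z + of_int (snd n) * snd z)) * (of_real (a k) * cis (- (real k * dotp n v))))"
    unfolding op_def eq by (intro suminf_sum summable_mult summable_hat assms)
  also have "\<dots> = trig (\<lambda>n. hat a (dotp n v) * c n) I z"
    unfolding trig_def hat_def
    by (intro sum.cong refl) (subst suminf_mult[OF summable_hat[OF assms(2)]], simp only: mult_ac)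
  finally show "op a v (trig c I) z = trig (\<lambda>n. hat a (dotp n v) * c n) I z" .
qed

lemma hat_lincomb:
  assumes "ell1 a" "ell1 b"
  shows "hat (\<lambda>k. x * a k + y * b k) \<theta> = of_real x * hat a \<theta> + of_real y * hat b \<theta>"
proof -
  have "hat (\<lambda>k. x * a k + y * b k) \<theta> = (\<Sum>k. of_real x * (of_real (a k) * cis (- (real k * \<theta>))) + of_real y * (of_real (b k) * cis (- (real k * \<theta>))))"
    unfolding hat_def by (intro suminf_cong) (simp add: algebra_simps)
  then show ?thesis
    unfolding hat_def suminf_mult[OF summable_hat[OF assms(1)], symmetric] suminf_mult[OF summable_hat[OF assms(2)], symmetric]
    by (simp only: suminf_add[OF summable_mult[OF summable_hat[OF assms(1)]] summable_mult[OF summable_hat[OF assms(2)]]])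
qed

lemma hat_sum:
  assumes "\<And>i. i \<in> J \<Longrightarrow> ell1 (b i)"
  shows "ell1 (\<lambda>k. \<Sum>i\<in>J. q i * b i k) \<and> hat (\<lambda>k. \<Sum>i\<in>J. q i * b i k) \<theta> = (\<Sum>i\<in>J. of_real (q i) * hat (b i) \<theta>)"
  using assms
proof (induction J rule: infinite_finite_induct)
  case (insert i J)
  then have e: "ell1 (b i)" "ell1 (\<lambda>k. \<Sum>i\<in>J. q i * b i k)" by auto
  have eq: "(\<lambda>k. \<Sum>i\<in>insert i J. q i * b i k) = (\<lambda>k. q i * b i k + 1 * (\<Sum>i\<in>J. q i * b i k))"
    using insert by auto
  show ?case unfolding eq using insert e hat_lincomb[OF e, of "q i" 1 \<theta>] ell1_add[OF ell1_cmult[OF e(1)] e(2)] by simp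
qed (auto simp: hat_def ell1_def)

lemma hat_dil:
  assumes "m > 0"
  shows "hat (dil m a) \<theta> = hat a (real m * \<theta>)"
proof -
  have sm: "strict_mono (\<lambda>k::nat. m * k)" using assms by (simp add: strict_mono_def)
  have "(\<Sum>k. of_real (dil m a (m * k)) * cis (- (real (m * k) * \<theta>))) = hat (dil m a) \<theta>"
    unfolding hat_def
  proof (rule suminf_mono_reindex[OF sm])
    fix n assume "n \<notin> range (\<lambda>k. m * k)"
    then have "dil m a n = 0" by (auto simp: dil_def dvd_def)
    then show "of_real (dil m a n) * cis (- (real n * \<theta>)) = 0" by simp
  qed
  moreover have "dil m a (m * k) = a k" "real (m * k) * \<theta> = real k * (real m * \<theta>)" for k
    using assms by (simp_all add: dil_def mult_ac)
  ultimately show ?thesis by (simp only: hat_def)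
qed

text \<open>The binomial series is available only inside the disc. The radii \<open>x n\<close> tend
  to 1, where Tannery's theorem applies with the summable majorant |bc r k| and the principal power
  is continuous because 1 - cis(-\<theta>) avoids the nonpositive reals.\<close>

lemma hat_bc:
  assumes r: "r > 0" and ne: "cis (- \<theta>) \<noteq> 1"
  shows "hat (bc r) \<theta> = (1 - cis (- \<theta>)) powr of_real r"
proof -
  define w where "w = cis (- \<theta>)"
  define x where "x n = 1 - 1 / (real n + 2)" for n
  have x: "0 < x n" "x n < 1" for n by (auto simp: x_def field_simps)
  have xl: "x \<longlonglongrightarrow> 1"
  proof -
    have "(\<lambda>n. 1 / (real n + 2)) \<longlonglongrightarrow> 0" by real_asymp
    then have "(\<lambda>n. 1 - 1 / (real n + 2)) \<longlonglongrightarrow> 1 - 0" by (intro tendsto_diff tendsto_const)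
    then show ?thesis by (simp add: x_def[abs_def])
  qed
  have val: "(\<Sum>k. of_real (bc r k) * (of_real (x n) * w) ^ k) = (1 - of_real (x n) * w) powr of_real r" for n
  proof -
    have "norm (- (of_real (x n) * w)) < 1" using x[of n] by (simp add: norm_mult w_def)
    from gen_binomial_complex[OF this, of "of_real r"]
    have "(\<lambda>k. (of_real r gchoose k) * (- (of_real (x n) * w)) ^ k) sums (1 - of_real (x n) * w) powr of_real r" by simp
    moreover have "(of_real r gchoose k) * (- y) ^ k = of_real (bc r k) * y ^ k" for k and y :: complex
    proof -
      have "(of_real r gchoose k :: complex) = of_real (r gchoose k)" by (simp add: gbinomial_prod_rev)
      then show ?thesis by (simp add: bc_def power_minus[of y])
    qed
    ultimately show ?thesis by (simp only: sums_iff)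
  qed
  have "(\<lambda>n. \<Sum>k. of_real (bc r k) * (of_real (x n) * w) ^ k) \<longlonglongrightarrow> (\<Sum>k. of_real (bc r k) * (of_real 1 * w) ^ k)"
  proof (rule conjunct2[OF conjunct2[OF tannerys_theorem]])
    show "(\<lambda>n. of_real (bc r k) * (of_real (x n) * w) ^ k) \<longlonglongrightarrow> of_real (bc r k) * (of_real 1 * w) ^ k" for k
      by (intro tendsto_intros xl)
    show "eventually (\<lambda>(k, n). norm (of_real (bc r k) * (of_real (x n) * w) ^ k) \<le> \<bar>bc r k\<bar>) (at_top \<times>\<^sub>F sequentially)"
    proof (intro always_eventually allI, clarify)
      fix k n
      have "\<bar>x n\<bar> ^ k \<le> 1" using x[of n] by (intro power_le_one) auto
      then show "norm (of_real (bc r k) * (of_real (x n) * w) ^ k) \<le> \<bar>bc r k\<bar>"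
        by (simp add: norm_mult norm_power w_def mult_left_le)
    qed
    show "summable (\<lambda>k. \<bar>bc r k\<bar>)" using summable_bc[OF r] by (simp add: ell1_def)
  qed auto
  moreover have "(\<Sum>k. of_real (bc r k) * (of_real 1 * w) ^ k) = hat (bc r) \<theta>"
    unfolding hat_def w_def by (intro suminf_cong) (simp add: Complex.DeMoivre)
  moreover have "(\<lambda>n. (1 - of_real (x n) * w) powr of_real r) \<longlonglongrightarrow> (1 - of_real 1 * w) powr of_real r"
  proof (rule tendsto_powr_complex)
    show "1 - of_real 1 * w \<notin> \<real>\<^sub>\<le>\<^sub>0"
    proof
      assume "1 - of_real 1 * w \<in> \<real>\<^sub>\<le>\<^sub>0"
      then have "Re w \<ge> 1" "Im w = 0" by (auto simp: complex_nonpos_Reals_iff)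
      moreover have "Re w \<le> 1" by (simp add: w_def)
      ultimately have "w = 1" by (simp add: complex_eq_iff)
      then show False using ne by (simp add: w_def)
    qed
  qed (intro tendsto_intros xl)+
  ultimately have "hat (bc r) \<theta> = (1 - of_real 1 * w) powr of_real r"
    unfolding val by (metis LIMSEQ_unique)
  then show ?thesis by (simp add: w_def)
qed

text \<open>The branch used in the Weyl factor is the principal one, since the argument of i n is
  plus or minus pi/2.\<close>

lemma ii_powr:
  assumes "n \<noteq> 0"
  shows "(\<i> * of_int n) powr of_real r = weyl_factor r n"
proof -
  have "\<i> * of_int n = exp (of_real (ln \<bar>of_int n\<bar>) + \<i> * of_real (pi / 2 * of_int (sgn n)))"
  proof -
    have "exp (\<i> * of_real (pi / 2 * of_int (sgn n))) = \<i> * of_int (sgn n)"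
      using assms by (auto simp: sgn_if complex_eq_iff Re_exp Im_exp)
    moreover have "exp (of_real (ln \<bar>of_int n\<bar>) :: complex) = of_int \<bar>n\<bar>"
      using assms by (simp add: exp_of_real flip: of_int_abs)
    moreover have "of_int n = (of_int \<bar>n\<bar> * of_int (sgn n) :: complex)"
      by (simp flip: of_int_mult add: mult.commute[of "\<bar>n\<bar>"] sgn_mult_abs)
    ultimately show ?thesis by (simp only: exp_add mult_ac)
  qed
  moreover have "Im (of_real (ln \<bar>of_int n\<bar>) + \<i> * of_real (pi / 2 * of_int (sgn n))) \<in> {-pi<..pi}"
    using assms by (auto simp: sgn_if)
  ultimately have "Ln (\<i> * of_int n) = of_real (ln \<bar>of_int n\<bar>) + \<i> * of_real (pi / 2 * of_int (sgn n))"
    by (simp add: Ln_exp)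
  then have "(\<i> * of_int n) powr of_real r = exp (of_real (r * ln \<bar>of_int n\<bar>)) * exp (\<i> * of_real (pi * r * of_int (sgn n) / 2))"
    using assms by (simp add: powr_def exp_add[symmetric] algebra_simps del: exp_of_real flip: exp_of_real)
  also have "\<dots> = weyl_factor r n"
    using assms by (simp add: weyl_factor_def powr_def cis_conv_exp flip: exp_of_real)
  finally show ?thesis .
qed

text \<open>The base (1 - exp(-i u \<kappa>)) / |u| converges to i \<kappa> times the sign of h, off
  the branch cut, so its principal power converges. As only |u| is divided out, the sign of h stays
  visible in the limit.\<close>

lemma hat_bc_limit:
  assumes r: "r > 0" and h: "h \<noteq> 0" and \<kappa>: "\<kappa> \<noteq> (0::int)" and u: "u \<longlonglongrightarrow> 0" and us: "\<And>m. u m \<noteq> 0 \<and> sgn (u m) = sgn h"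
  shows "(\<lambda>m. hat (bc r) (u m * of_int \<kappa>) / of_real (\<bar>u m\<bar> powr r)) \<longlonglongrightarrow> weyl_factor r ((if h > 0 then 1 else - 1) * \<kappa>)"
proof -
  define \<sigma> :: int where "\<sigma> = (if h > 0 then 1 else - 1)"
  have ua: "\<bar>u m\<bar> = of_int \<sigma> * u m" for m using us[of m] h by (auto simp: \<sigma>_def sgn_if split: if_splits)
  define z where "z m = - (\<i> * of_real (u m * of_int \<kappa>))" for m
  have z0: "z m \<noteq> 0" for m using us[of m] \<kappa> by (simp add: z_def)
  have "z \<longlonglongrightarrow> - (\<i> * of_real (0 * of_int \<kappa>))" unfolding z_def[abs_def] by (intro tendsto_intros u)
  then have "filterlim z (at 0) sequentially" using z0 by (simp add: filterlim_at)
  then have "(\<lambda>m. (exp (z m) - 1) / z m * (\<i> * of_int (\<sigma> * \<kappa>))) \<longlonglongrightarrow> 1 * (\<i> * of_int (\<sigma> * \<kappa>))"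
    by (intro tendsto_mult tendsto_const filterlim_compose[OF lim_exp_minus_1])
  moreover have "(exp (z m) - 1) / z m * (\<i> * of_int (\<sigma> * \<kappa>)) = (1 - cis (- (u m * of_int \<kappa>))) / of_real \<bar>u m\<bar>" for m
  proof -
    have e: "exp (z m) = cis (- (u m * of_int \<kappa>))" by (simp add: z_def cis_conv_exp)
    have um: "of_real (u m) \<noteq> (0::complex)" "of_int \<kappa> \<noteq> (0::complex)" using us[of m] \<kappa> by auto
    have "\<sigma> = 1 \<or> \<sigma> = - 1" by (simp add: \<sigma>_def)
    then show ?thesis unfolding e ua unfolding z_def using um by (elim disjE) (simp_all add: field_simps)
  qed
  ultimately have lim: "(\<lambda>m. (1 - cis (- (u m * of_int \<kappa>))) / of_real \<bar>u m\<bar>) \<longlonglongrightarrow> \<i> * of_int (\<sigma> * \<kappa>)"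
    by simp
  have s\<kappa>: "\<sigma> * \<kappa> \<noteq> 0" using \<kappa> by (auto simp: \<sigma>_def)
  have "(\<lambda>m. ((1 - cis (- (u m * of_int \<kappa>))) / of_real \<bar>u m\<bar>) powr of_real r) \<longlonglongrightarrow> (\<i> * of_int (\<sigma> * \<kappa>)) powr of_real r"
  proof (rule tendsto_powr_complex[OF _ lim tendsto_const])
    show "\<i> * of_int (\<sigma> * \<kappa>) \<notin> \<real>\<^sub>\<le>\<^sub>0"
      using s\<kappa> by (auto simp: complex_nonpos_Reals_iff)
  qed
  then have L: "(\<lambda>m. ((1 - cis (- (u m * of_int \<kappa>))) / of_real \<bar>u m\<bar>) powr of_real r) \<longlonglongrightarrow> weyl_factor r (\<sigma> * \<kappa>)"
    by (simp only: ii_powr[OF s\<kappa>])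
  have "eventually (\<lambda>m. \<bar>u m\<bar> < 1 / \<bar>of_int \<kappa>\<bar>) sequentially"
    using tendsto_rabs[OF u] \<kappa> by (intro order_tendstoD) auto
  then have "eventually (\<lambda>m. ((1 - cis (- (u m * of_int \<kappa>))) / of_real \<bar>u m\<bar>) powr of_real r = hat (bc r) (u m * of_int \<kappa>) / of_real (\<bar>u m\<bar> powr r)) sequentially"
  proof eventually_elim
    case (elim m)
    have um: "u m \<noteq> 0" using us by auto
    have "\<bar>u m * of_int \<kappa>\<bar> < 1" using elim \<kappa> by (simp add: abs_mult field_simps)
    then have small: "\<bar>u m * of_int \<kappa>\<bar> < pi" using pi_gt3 by linarith
    have ne: "cis (- (u m * of_int \<kappa>)) \<noteq> 1"
    proof
      assume "cis (- (u m * of_int \<kappa>)) = 1"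
      then have "sin (u m * of_int \<kappa>) = 0" by (simp add: complex_eq_iff)
      then have "u m * of_int \<kappa> = 0" using small sin_eq_0_pi[of "u m * of_int \<kappa>"] by linarith
      then show False using um \<kappa> by simp
    qed
    have "((1 - cis (- (u m * of_int \<kappa>))) / of_real \<bar>u m\<bar>) powr of_real r = (1 - cis (- (u m * of_int \<kappa>))) powr of_real r / of_real (\<bar>u m\<bar> powr r)"
    proof -
      let ?z = "1 - cis (- (u m * of_int \<kappa>))"
      \<comment> \<open>Division by a positive real changes only the real part of the logarithm, so
        no branch is crossed.\<close>
      have "Ln (?z / of_real \<bar>u m\<bar>) = Ln ?z - of_real (ln \<bar>u m\<bar>)" using um ne by (intro Ln_divide_of_real) auto
      then show ?thesis using um ne
        by (simp add: powr_def exp_diff exp_of_real right_diff_distrib flip: of_real_mult)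
    qed
    then show ?case using hat_bc[OF r ne] by simp
  qed
  with L show ?thesis unfolding \<sigma>_def by (rule Lim_transform_eventually)
qed

lemma Lp_norm_trig_le:
  assumes p: "p > 1"
  shows "Lp_norm p (trig b I) \<le> ennreal (\<Sum>n\<in>I. norm (b n)) * Lp_norm p (\<lambda>z. 1)"
proof -
  let ?S = "\<Sum>n\<in>I. norm (b n)"
  have S: "?S \<ge> 0" by (intro sum_nonneg) auto
  have one: "Lp_norm p (\<lambda>z. 1) < \<infinity>"
    unfolding Lp_norm_less_top pint_def by (simp add: emeasure_torus)
  have "norm (trig b I z) \<le> norm (of_real ?S * 1 :: complex)" for z
  proof -
    have "norm (trig b I z) \<le> ?S" unfolding trig_def by (rule order_trans[OF norm_sum]) (simp add: norm_mult)
    then show ?thesis using S by (simp only: mult_1_right norm_of_real abs_of_nonneg)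
  qed
  then have "Lp_norm p (trig b I) \<le> Lp_norm p (\<lambda>z. of_real ?S * 1)"
    using p by (intro Lp_norm_mono) auto
  also have "\<dots> = ennreal ?S * Lp_norm p (\<lambda>z. 1)"
    using Lp_norm_cmult[where c="of_real ?S" and f="\<lambda>z. 1" and p=p, OF _ _ one] p
    by (simp only: norm_of_real abs_of_nonneg[OF S] borel_measurable_const)
  finally show ?thesis .
qed

text \<open>Over a finite index set, convergence of the coefficients is uniform convergence of the
  polynomials. One good index suffices, since the bounds passed to the limit hold for every
  m.\<close>

lemma Lp_norm_trig_limit:
  assumes p: "p > 1" and lim: "\<And>n. n \<in> I \<Longrightarrow> (\<lambda>m. c' m n) \<longlonglongrightarrow> c n" and e: "e > 0"
  shows "\<exists>m. Lp_norm p (trig c I) \<le> Lp_norm p (trig (c' m) I) + ennreal e \<and> Lp_norm p (trig (c' m) I) \<le> Lp_norm p (trig c I) + ennreal e"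
proof -
  have one: "Lp_norm p (\<lambda>z. 1) < \<infinity>"
    unfolding Lp_norm_less_top pint_def by (simp add: emeasure_torus)
  then obtain E where E: "E \<ge> 0" "Lp_norm p (\<lambda>z. 1) = ennreal E" by (cases "Lp_norm p (\<lambda>z. 1 :: complex)") auto
  have "(\<lambda>m. \<Sum>n\<in>I. norm (c' m n - c n)) \<longlonglongrightarrow> (\<Sum>n\<in>I. norm (c n - c n))"
    by (intro tendsto_intros lim)
  then have "(\<lambda>m. (\<Sum>n\<in>I. norm (c' m n - c n)) * E) \<longlonglongrightarrow> 0 * E" by (intro tendsto_mult tendsto_const) simp
  then have "eventually (\<lambda>m. (\<Sum>n\<in>I. norm (c' m n - c n)) * E < e) sequentially"
    using e by (intro order_tendstoD) auto
  then obtain m where m: "(\<Sum>n\<in>I. norm (c' m n - c n)) * E < e" by (auto simp: eventually_sequentially)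
  have tri: "Lp_norm p (trig d I) \<le> Lp_norm p (trig d' I) + ennreal e" if "(\<Sum>n\<in>I. norm (d n - d' n)) * E < e" for d d'
  proof -
    have "trig d I = (\<lambda>z. trig d' I z + trig (\<lambda>n. d n - d' n) I z)"
      unfolding trig_def by (simp add: fun_eq_iff sum.distrib[symmetric] algebra_simps)
    then have "Lp_norm p (trig d I) \<le> Lp_norm p (trig d' I) + Lp_norm p (trig (\<lambda>n. d n - d' n) I)"
      using Lp_norm_triangle[OF p, of "trig d' I" "trig (\<lambda>n. d n - d' n) I"] borel_measurable_continuous_lebesgue[OF continuous_trig] by simp
    also have "Lp_norm p (trig (\<lambda>n. d n - d' n) I) \<le> ennreal (\<Sum>n\<in>I. norm (d n - d' n)) * ennreal E"
      using Lp_norm_trig_le[OF p, of "\<lambda>n. d n - d' n" I] by (simp only: E)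
    also have "\<dots> = ennreal ((\<Sum>n\<in>I. norm (d n - d' n)) * E)" by (intro ennreal_mult'[symmetric] sum_nonneg) auto
    also have "\<dots> \<le> ennreal e" using that by (intro ennreal_leI) simp
    finally show ?thesis by (simp add: add_left_mono)
  qed
  show ?thesis using tri[of "c' m" c] tri[of c "c' m"] m by (auto simp: norm_minus_commute intro!: exI[of _ m])
qed

lemma Lp_norm_trig_limit_le:
  assumes p: "p > 1" and lim: "\<And>n. n \<in> I \<Longrightarrow> (\<lambda>m. c' m n) \<longlonglongrightarrow> c n" and B: "\<And>m. Lp_norm p (trig (c' m) I) \<le> B"
  shows "Lp_norm p (trig c I) \<le> B"
proof (rule ennreal_le_epsilon)
  fix e :: real assume "e > 0"
  from Lp_norm_trig_limit[where c'=c' and c=c and I=I, OF p lim this] obtain m where "Lp_norm p (trig c I) \<le> Lp_norm p (trig (c' m) I) + ennreal e" by auto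
  also have "\<dots> \<le> B + ennreal e" by (intro add_right_mono B)
  finally show "Lp_norm p (trig c I) \<le> B + ennreal e" .
qed

lemma Lp_norm_trig_limit_ge:
  assumes p: "p > 1" and lim: "\<And>n. n \<in> I \<Longrightarrow> (\<lambda>m. c' m n) \<longlonglongrightarrow> c n" and X: "\<And>m. X \<le> ennreal K * Lp_norm p (trig (c' m) I)" and K: "K > 0"
  shows "X \<le> ennreal K * Lp_norm p (trig c I)"
proof (rule ennreal_le_epsilon)
  fix e :: real assume "e > 0"
  then have "e / K > 0" using K by simp
  from Lp_norm_trig_limit[where c'=c' and c=c and I=I, OF p lim this] obtain m where m: "Lp_norm p (trig (c' m) I) \<le> Lp_norm p (trig c I) + ennreal (e / K)" by auto
  have "X \<le> ennreal K * (Lp_norm p (trig c I) + ennreal (e / K))" by (rule order_trans[OF X[of m]]) (intro mult_left_mono m, simp)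
  also have "\<dots> = ennreal K * Lp_norm p (trig c I) + ennreal e" using K by (simp add: distrib_left flip: ennreal_mult')
  finally show "X \<le> ennreal K * Lp_norm p (trig c I) + ennreal e" .
qed

lemma hat_cauchy:
  assumes "ell1 a" "ell1 b"
  shows "hat (cauchy a b) \<theta> = hat a \<theta> * hat b \<theta>"
proof -
  have "hat a \<theta> * hat b \<theta> = (\<Sum>k. \<Sum>i\<le>k. (of_real (a i) * cis (- (real i * \<theta>))) * (of_real (b (k - i)) * cis (- (real (k - i) * \<theta>))))"
    unfolding hat_def by (rule Cauchy_product) (use assms in \<open>simp_all add: ell1_def norm_mult\<close>)
  also have "\<dots> = hat (cauchy a b) \<theta>"
    unfolding hat_def
  proof (rule suminf_cong)
    fix k
    have "(of_real (a i) * cis (- (real i * \<theta>))) * (of_real (b (k - i)) * cis (- (real (k - i) * \<theta>))) =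
       of_real (a i * b (k - i)) * cis (- (real k * \<theta>))" if "i \<le> k" for i
    proof -
      have "- (real k * \<theta>) = - (real i * \<theta>) + - (real (k - i) * \<theta>)" using that by (simp add: of_nat_diff algebra_simps)
      then show ?thesis by (simp only: cis_mult[symmetric] of_real_mult mult_ac)
    qed
    note eq = this
    show "(\<Sum>i\<le>k. (of_real (a i) * cis (- (real i * \<theta>))) * (of_real (b (k - i)) * cis (- (real (k - i) * \<theta>)))) =
       of_real (cauchy a b k) * cis (- (real k * \<theta>))"
      unfolding cauchy_def of_real_sum sum_distrib_right by (rule sum.cong[OF refl], rule eq) simp
  qed
  finally show ?thesis by simp
qed

lemma bc_add:
  assumes "r \<ge> 0" "s \<ge> 0"
  shows "cauchy (bc r) (bc s) = bc (r + s)"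
  using symb_mult[OF symb_bc[OF assms(1)] symb_bc[OF assms(2)]] symb_bc[of "r + s"] assms
  by (intro symb_unique) (auto simp: powr_add)

text \<open>Pairs a unit vector with the frequency that belongs to it, so that each one-axis
  estimate is proved once for both axes.\<close>

definition coord_axis :: "real \<times> real \<Rightarrow> (int \<times> int \<Rightarrow> int) \<Rightarrow> bool" where
  "coord_axis e \<kappa> \<longleftrightarrow> e = (1, 0) \<and> \<kappa> = fst \<or> e = (0, 1) \<and> \<kappa> = snd"

lemma dotp_axis: "coord_axis e \<kappa> \<Longrightarrow> dotp n (h *\<^sub>R e) = h * of_int (\<kappa> n)"
  by (auto simp: coord_axis_def dotp_def)

lemma op_trig_axis:
  assumes "finite I" "ell1 a" "coord_axis e \<kappa>"
  shows "op a (h *\<^sub>R e) (trig c I) = trig (\<lambda>n. hat a (h * of_int (\<kappa> n)) * c n) I"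
  using op_trig[OF assms(1,2)] dotp_axis[OF assms(3)] by simp

text \<open>The two phases differ by a factor cis(\<gamma> sgn n), which is the kind of multiplier
  controlled by the conjugate function theorem.\<close>

lemma weyl_factor_sign:
  assumes "n \<noteq> 0"
  shows "weyl_factor r ((if h > 0 then 1 else - 1) * n) = cis ((if h > 0 then 0 else - (pi * r)) * of_int (sgn n)) * weyl_factor r n"
proof (cases "h > 0")
  case False
  have "- (pi * r * of_int (sgn n) / 2) = - (pi * r) * of_int (sgn n) + pi * r * of_int (sgn n) / 2" by simp
  then have "cis (- (pi * r * of_int (sgn n) / 2)) = cis (- (pi * r) * of_int (sgn n)) * cis (pi * r * of_int (sgn n) / 2)"
    by (simp only: cis_mult)
  then show ?thesis using False by (simp add: weyl_factor_def sgn_minus mult_ac)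
qed auto

lemma trig_cong: "(\<And>n. n \<in> I \<Longrightarrow> c n = d n) \<Longrightarrow> trig c I = trig d I"
  unfolding trig_def by (intro ext sum.cong refl) simp

lemma riesz_axis:
  assumes p: "p > (1::real)"
  shows "\<exists>A>0. \<forall>e \<kappa> I c \<gamma>. coord_axis e \<kappa> \<and> finite I \<and> (\<forall>n\<in>I. \<kappa> n \<noteq> 0) \<longrightarrow>
    Lp_norm p (trig (\<lambda>n. cis (\<gamma> * of_int (sgn (\<kappa> n))) * c n) I) \<le> ennreal A * Lp_norm p (trig c I)"
proof -
  obtain A where A: "A > 0" and R: "\<forall>I c \<gamma>. finite I \<longrightarrow>
    ((\<forall>n\<in>I. fst n \<noteq> 0) \<longrightarrow> Lp_norm p (trig (\<lambda>n. cis (\<gamma> * of_int (sgn (fst n))) * c n) I) \<le> ennreal A * Lp_norm p (trig c I)) \<and>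
    ((\<forall>n\<in>I. snd n \<noteq> 0) \<longrightarrow> Lp_norm p (trig (\<lambda>n. cis (\<gamma> * of_int (sgn (snd n))) * c n) I) \<le> ennreal A * Lp_norm p (trig c I))"
    using riesz_multiplier[OF p] by (elim exE conjE)
  show ?thesis
    by (intro exI[of _ A] conjI A allI impI) (use R in \<open>auto simp: coord_axis_def\<close>)
qed

lemma Lp_norm_trig_cmult:
  assumes "p > 1"
  shows "Lp_norm p (trig (\<lambda>n. w * c n) I) = ennreal (norm w) * Lp_norm p (trig c I)"
proof -
  have "trig (\<lambda>n. w * c n) I = (\<lambda>z. w * trig c I z)"
    by (simp add: trig_def fun_eq_iff sum_distrib_left mult_ac)
  then show ?thesis
    using assms trig_in_torus_Lp[of p c I] by (simp add: Lp_norm_cmult torus_Lp_iff)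
qed

text \<open>Only the order r is refined; the difference of order \<beta> keeps its step h. The
  constant C m^r of the dilation estimate, normalised by |h/m|^r, becomes C |h|^r for every m and
  therefore survives the limit.\<close>

lemma trig_derivative_le:
  assumes p: "p > 1" and \<beta>: "\<beta> > 0" and r: "r > 0"
  shows "\<exists>C>0. \<forall>e \<kappa> I c h. coord_axis e \<kappa> \<and> finite I \<and> (\<forall>n\<in>I. \<kappa> n \<noteq> 0) \<longrightarrow>
    Lp_norm p (op (bc (\<beta> + r)) (h *\<^sub>R e) (trig c I)) \<le>
    ennreal (C * \<bar>h\<bar> powr r) * Lp_norm p (op (bc \<beta>) (h *\<^sub>R e) (trig (\<lambda>n. weyl_factor r (\<kappa> n) * c n) I))"
proof -
  obtain A where A: "A > 0" and R: "\<forall>e \<kappa> I c \<gamma>. coord_axis e \<kappa> \<and> finite I \<and> (\<forall>n\<in>I. \<kappa> n \<noteq> 0) \<longrightarrow>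
    Lp_norm p (trig (\<lambda>n. cis (\<gamma> * of_int (sgn (\<kappa> n))) * c n) I) \<le> ennreal A * Lp_norm p (trig c I)"
    using riesz_axis[OF p] by (elim exE conjE)
  obtain C where C: "C > 0" "\<And>m. m > 0 \<Longrightarrow> op_dominates p (dil m (bc r)) (bc r) (C * real m powr r)"
    using dom_scale[OF p r] by auto
  have eb: "ell1 (bc \<beta>)" "ell1 (bc r)" "ell1 (bc (\<beta> + r))" using \<beta> r summable_bc by auto
  show ?thesis
  proof (intro exI[of _ "C * A"] conjI allI impI)
    fix e \<kappa> I c h assume as: "coord_axis e \<kappa> \<and> finite I \<and> (\<forall>n\<in>I. \<kappa> n \<noteq> 0)"
    then have ax: "coord_axis e \<kappa>" and I: "finite I" and \<kappa>: "\<And>n. n \<in> I \<Longrightarrow> \<kappa> n \<noteq> 0" by auto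
    show "Lp_norm p (op (bc (\<beta> + r)) (h *\<^sub>R e) (trig c I)) \<le>
      ennreal (C * A * \<bar>h\<bar> powr r) * Lp_norm p (op (bc \<beta>) (h *\<^sub>R e) (trig (\<lambda>n. weyl_factor r (\<kappa> n) * c n) I))"
    proof (cases "h = 0")
      case True
      then show ?thesis using p \<beta> r by (simp add: op_zero_shift Lp_norm_zero)
    next
      case h: False
      \<comment> \<open>The difference of order \<beta> is absorbed into the coefficients, leaving
        an order r difference of a polynomial.\<close>
      define d where "d n = hat (bc \<beta>) (h * of_int (\<kappa> n)) * c n" for n
      define u where "u m = h / real (Suc m)" for m
      define \<sigma> where "\<sigma> = (if h > 0 then 1 else - 1 :: int)"
      have L: "trig c' I \<in> torus_Lp p" for c' using p trig_in_torus_Lp by simp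
      have hu: "h = real (Suc m) * u m" for m by (simp add: u_def)
      have eq: "op (bc (\<beta> + r)) (h *\<^sub>R e) (trig c I) = op (dil (Suc m) (bc r)) (u m *\<^sub>R e) (trig d I)" for m
      proof -
        have "hat (bc (\<beta> + r)) \<theta> = hat (bc r) \<theta> * hat (bc \<beta>) \<theta>" for \<theta>
          using bc_add[of r \<beta>] hat_cauchy[OF eb(2,1)] \<beta> r by (simp add: add.commute)
        moreover have "hat (dil (Suc m) (bc r)) (u m * of_int (\<kappa> n)) = hat (bc r) (h * of_int (\<kappa> n))" for n
          by (simp add: hat_dil hu[of m] mult_ac del: of_nat_Suc)
        ultimately show ?thesis
          by (subst (1 2) op_trig_axis[OF I _ ax]) (auto simp: norm1_dil eb d_def mult_ac)
      qed
      have "Lp_norm p (op (bc (\<beta> + r)) (h *\<^sub>R e) (trig c I)) \<le> ennreal (C * \<bar>h\<bar> powr r) * Lp_norm p (trig (\<lambda>n. weyl_factor r (\<sigma> * \<kappa> n) * d n) I)"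
      proof (rule Lp_norm_trig_limit_ge[where c'="\<lambda>m n. hat (bc r) (u m * of_int (\<kappa> n)) / of_real (\<bar>u m\<bar> powr r) * d n", OF p])
        fix n assume "n \<in> I"
        have us: "u m \<noteq> 0 \<and> sgn (u m) = sgn h" for m using h by (auto simp: u_def sgn_if zero_less_divide_iff)
        have "u \<longlonglongrightarrow> 0" unfolding u_def[abs_def] by real_asymp
        then show "(\<lambda>m. hat (bc r) (u m * of_int (\<kappa> n)) / of_real (\<bar>u m\<bar> powr r) * d n) \<longlonglongrightarrow> weyl_factor r (\<sigma> * \<kappa> n) * d n"
          unfolding \<sigma>_def using h \<kappa>[OF \<open>n \<in> I\<close>] r us
          by (intro tendsto_mult tendsto_const hat_bc_limit)
      next
        fix m
        have um: "\<bar>u m\<bar> powr r > 0" using h by (simp add: u_def)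
        have "Lp_norm p (op (bc (\<beta> + r)) (h *\<^sub>R e) (trig c I)) \<le> ennreal (C * real (Suc m) powr r) * Lp_norm p (op (bc r) (u m *\<^sub>R e) (trig d I))"
          unfolding eq[of m] by (rule domD[OF C(2) L]) simp
        also have "op (bc r) (u m *\<^sub>R e) (trig d I) = trig (\<lambda>n. of_real (\<bar>u m\<bar> powr r) * (hat (bc r) (u m * of_int (\<kappa> n)) / of_real (\<bar>u m\<bar> powr r) * d n)) I"
          unfolding op_trig_axis[OF I eb(2) ax] using um by simp
        also have "ennreal (C * real (Suc m) powr r) * Lp_norm p \<dots> =
          ennreal (C * \<bar>h\<bar> powr r) * Lp_norm p (trig (\<lambda>n. hat (bc r) (u m * of_int (\<kappa> n)) / of_real (\<bar>u m\<bar> powr r) * d n) I)"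
        proof -
          have "\<bar>h\<bar> powr r = real (Suc m) powr r * \<bar>u m\<bar> powr r"
            by (subst hu[of m]) (simp only: abs_mult abs_of_nat powr_mult)
          then have "ennreal (C * \<bar>h\<bar> powr r) = ennreal (C * real (Suc m) powr r) * ennreal (\<bar>u m\<bar> powr r)"
            using C by (simp add: mult_ac flip: ennreal_mult')
          then show ?thesis by (subst Lp_norm_trig_cmult[OF p]) (simp add: mult_ac)
        qed
        finally show "Lp_norm p (op (bc (\<beta> + r)) (h *\<^sub>R e) (trig c I)) \<le>
          ennreal (C * \<bar>h\<bar> powr r) * Lp_norm p (trig (\<lambda>n. hat (bc r) (u m * of_int (\<kappa> n)) / of_real (\<bar>u m\<bar> powr r) * d n) I)" .
      qed (use C h in auto)
      also have "Lp_norm p (trig (\<lambda>n. weyl_factor r (\<sigma> * \<kappa> n) * d n) I) \<le> ennreal A * Lp_norm p (trig (\<lambda>n. weyl_factor r (\<kappa> n) * d n) I)"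
      proof -
        have "trig (\<lambda>n. weyl_factor r (\<sigma> * \<kappa> n) * d n) I =
          trig (\<lambda>n. cis ((if h > 0 then 0 else - (pi * r)) * of_int (sgn (\<kappa> n))) * (weyl_factor r (\<kappa> n) * d n)) I"
          unfolding \<sigma>_def by (rule trig_cong) (simp only: weyl_factor_sign[OF \<kappa>] mult.assoc)
        then show ?thesis by (simp only: R[rule_format, OF as])
      qed
      also have "trig (\<lambda>n. weyl_factor r (\<kappa> n) * d n) I = op (bc \<beta>) (h *\<^sub>R e) (trig (\<lambda>n. weyl_factor r (\<kappa> n) * c n) I)"
        unfolding op_trig_axis[OF I eb(1) ax] d_def by (simp add: mult_ac)
      also have "ennreal (C * \<bar>h\<bar> powr r) * (ennreal A * X) = ennreal (C * A * \<bar>h\<bar> powr r) * X" for X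
      proof -
        have "ennreal (C * A * \<bar>h\<bar> powr r) = ennreal (C * \<bar>h\<bar> powr r) * ennreal A"
          using A C by (subst ennreal_mult'[symmetric]) (auto simp: mult_ac)
        then show ?thesis by (simp only: mult.assoc)
      qed
      finally show ?thesis by (simp add: mult_left_mono)
    qed
  qed (use A C in auto)
qed

text \<open>The corrected difference \<open>\<psi>\<close> has symbol \<open>(1 - x) powr r\<close> plus terms of higher order, chosen so that the
  quotients \<open>\<psi>(u) / u powr r\<close> at \<open>u = h / 2 ^ j\<close> and \<open>u = h / 2 ^ Suc j\<close> differ by a difference of order \<open>r + N\<close>
  with \<open>N \<ge> \<beta>\<close>.\<close>

lemma trig_derivative_ge_half:
  assumes p: "p > 1" and \<beta>: "\<beta> > 0" and r: "r > 0"
  shows "\<exists>C>0. \<forall>e \<kappa> I c h. coord_axis e \<kappa> \<and> finite I \<and> (\<forall>n\<in>I. \<kappa> n \<noteq> 0) \<and> h \<noteq> 0 \<longrightarrow>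
    Lp_norm p (op (bc \<beta>) (h *\<^sub>R e) (trig (\<lambda>n. weyl_factor r ((if h > 0 then 1 else - 1) * \<kappa> n) * c n) I)) \<le>
    ennreal C * (\<Sum>j. ennreal ((\<bar>h\<bar> / 2 ^ j) powr (- r)) * Lp_norm p (op (bc (\<beta> + r)) ((h / 2 ^ j) *\<^sub>R e) (trig c I)))"
proof -
  \<comment> \<open>With N at least \<beta>, the telescoping error, divisible by (1 - x)^(r + N), is
    divisible by (1 - x)^(\<beta> + r) as well.\<close>
  define N where "N = nat \<lceil>\<beta>\<rceil>"
  have N: "N \<ge> 1" "real N \<ge> \<beta>" using \<beta> unfolding N_def by linarith+
  obtain q R CR where q: "q 0 = (1::real)" and R: "wien R CR" and tel: "\<And>x. x \<in> {0<..<1} \<Longrightarrow>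
     (\<Sum>k<N. q k * (1 - x) powr (r + real k)) - 2 powr (- r) * (\<Sum>k<N. q k * (1 - x ^ 2) powr (r + real k))
       = (1 - x) powr (r + real N) * R x"
    using wien_telescope[OF r N(1)] by blast
  define \<psi> where "\<psi> k = (\<Sum>i<N. q i * bc (r + real i) k)" for k
  define \<epsilon> where "\<epsilon> k = 1 * \<psi> k + (- (2 powr (- r))) * dil 2 \<psi> k" for k
  have eb: "ell1 (bc \<beta>)" "ell1 (bc (\<beta> + r))" "\<And>i. ell1 (bc (r + real i))" using \<beta> r summable_bc by (auto simp: add_pos_nonneg)
  have e\<psi>: "ell1 \<psi>" and hat\<psi>: "\<And>\<theta>. hat \<psi> \<theta> = (\<Sum>i<N. of_real (q i) * hat (bc (r + real i)) \<theta>)"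
    using hat_sum[of "{..<N}" "\<lambda>i. bc (r + real i)" q] eb unfolding \<psi>_def[abs_def] by auto
  have s\<psi>: "symb \<psi> (\<lambda>x. \<Sum>i<N. q i * (1 - x) powr (r + real i))"
  proof -
    have "(\<lambda>k. \<psi> k * x ^ k) sums (\<Sum>i<N. q i * (1 - x) powr (r + real i))" if "x \<in> {0<..<1}" for x
    proof -
      have "(\<lambda>k. \<Sum>i<N. q i * (bc (r + real i) k * x ^ k)) sums (\<Sum>i<N. q i * (1 - x) powr (r + real i))"
        using symb_bc[of "r + real _"] r that by (intro sums_sum sums_mult) (auto simp: symb_def)
      then show ?thesis by (simp only: \<psi>_def sum_distrib_right mult.assoc)
    qed
    then show ?thesis using e\<psi> by (simp add: symb_def)
  qed
  have s\<epsilon>: "symb \<epsilon> (\<lambda>x. (1 - x) powr (r + real N) * R x)"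
    unfolding \<epsilon>_def[abs_def]
    by (rule symb_cong[OF symb_add[OF symb_cmult[OF s\<psi>] symb_cmult[OF symb_dil[OF s\<psi>]]]]) (use tel in auto)
  have e\<epsilon>: "ell1 \<epsilon>" by (rule symb_ell1[OF s\<epsilon>])
  have hat\<epsilon>: "hat \<epsilon> \<theta> = hat \<psi> \<theta> - of_real (2 powr (- r)) * hat \<psi> (2 * \<theta>)" for \<theta>
    using hat_lincomb[OF e\<psi> norm1_dil(1)[OF e\<psi>, of 2], of 1 "- (2 powr (- r))" \<theta>] unfolding \<epsilon>_def[abs_def]
    by (simp add: hat_dil)
  \<comment> \<open>Bound for the telescoping errors. The fixed difference with step h is an M-fold
    dilation in the current step, and dilation does not change the norm, so the constant is
    independent of M.\<close>
  define K1 where "K1 = norm1 (bc (real N - \<beta>)) * CR * norm1 (bc \<beta>)"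
  have dom1: "op_dominates p (cauchy \<epsilon> (dil M (bc \<beta>))) (bc (\<beta> + r)) K1" if M: "M > 0" for M
    unfolding K1_def
  proof (rule op_dominate[OF p])
    show "wien (\<lambda>x. (1 - x) powr (real N - \<beta>) * R x * (1 - x ^ M) powr \<beta>) (norm1 (bc (real N - \<beta>)) * CR * norm1 (bc \<beta>))"
      using N \<beta> by (intro wien_mult R wien_bc wien_dil[OF wien_bc M]) auto
    show "symb (bc (\<beta> + r)) (\<lambda>x. (1 - x) powr (\<beta> + r))" using \<beta> r by (intro symb_bc) auto
    have "(1 - x) powr (r + real N) = (1 - x) powr (real N - \<beta>) * (1 - x) powr (\<beta> + r)" for x :: real
      by (simp flip: powr_add add: add.commute)
    then show "symb (cauchy \<epsilon> (dil M (bc \<beta>))) (\<lambda>x. (1 - x) powr (real N - \<beta>) * R x * (1 - x ^ M) powr \<beta> * (1 - x) powr (\<beta> + r))"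
      by (intro symb_cong[OF symb_mult[OF s\<epsilon> symb_dil[OF symb_bc M]]]) (use \<beta> in \<open>auto simp: mult_ac\<close>)
  qed
  \<comment> \<open>Bound for the initial term, where the corrected difference of step h itself is
    composed with the difference of order \<beta>.\<close>
  define K0 where "K0 = norm1 (\<lambda>k. \<Sum>i<N. q i * bc (real i) k)"
  have dom0: "op_dominates p (cauchy \<psi> (bc \<beta>)) (bc (\<beta> + r)) K0"
  proof (rule op_dominate[OF p])
    have eb0: "ell1 (bc (real i))" for i using symb_ell1[OF symb_bc[of "real i"]] by simp
    have "symb (\<lambda>k. \<Sum>i<N. q i * bc (real i) k) (\<lambda>x. \<Sum>i<N. q i * (1 - x) powr real i)"
      unfolding symb_def
    proof (intro conjI ballI)
      show "ell1 (\<lambda>k. \<Sum>i<N. q i * bc (real i) k)" using hat_sum[of "{..<N}" "\<lambda>i. bc (real i)" q] eb0 by auto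
      fix x :: real assume x: "x \<in> {0<..<1}"
      have "(\<lambda>k. \<Sum>i<N. q i * (bc (real i) k * x ^ k)) sums (\<Sum>i<N. q i * (1 - x) powr real i)"
        using symb_bc[of "real _"] x by (intro sums_sum sums_mult) (auto simp: symb_def)
      then show "(\<lambda>k. (\<Sum>i<N. q i * bc (real i) k) * x ^ k) sums (\<Sum>i<N. q i * (1 - x) powr real i)"
        by (simp only: sum_distrib_right mult.assoc)
    qed
    then show "wien (\<lambda>x. \<Sum>i<N. q i * (1 - x) powr real i) K0" unfolding wien_def K0_def by blast
    show "symb (bc (\<beta> + r)) (\<lambda>x. (1 - x) powr (\<beta> + r))" using \<beta> r by (intro symb_bc) auto
    have "(\<Sum>i<N. q i * (1 - x) powr (r + real i)) * (1 - x) powr \<beta> = (\<Sum>i<N. q i * (1 - x) powr real i) * (1 - x) powr (\<beta> + r)" for x :: real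
      unfolding sum_distrib_right by (intro sum.cong refl) (simp add: powr_add mult_ac)
    then show "symb (cauchy \<psi> (bc \<beta>)) (\<lambda>x. (\<Sum>i<N. q i * (1 - x) powr real i) * (1 - x) powr (\<beta> + r))"
      by (intro symb_cong[OF symb_mult[OF s\<psi> symb_bc]]) (use \<beta> in auto)
  qed
  have K: "K0 \<ge> 0" "K1 \<ge> 0"
  proof -
    have "ell1 (\<lambda>k. \<Sum>i<N. q i * bc (real i) k)"
      using hat_sum[of "{..<N}" "\<lambda>i. bc (real i)" q] symb_ell1[OF symb_bc] by auto
    then show "K0 \<ge> 0" unfolding K0_def by (rule norm1_nonneg)
    show "K1 \<ge> 0" unfolding K1_def using wien_nonneg[OF R] eb(1) N symb_ell1[OF symb_bc[of "real N - \<beta>"]]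
      by (intro mult_nonneg_nonneg norm1_nonneg) auto
  qed
  show ?thesis
  proof (intro exI[of _ "K0 + K1 + 1"] conjI allI impI)
    fix e \<kappa> I c and h :: real assume as: "coord_axis e \<kappa> \<and> finite I \<and> (\<forall>n\<in>I. \<kappa> n \<noteq> 0) \<and> h \<noteq> 0"
    then have ax: "coord_axis e \<kappa>" and I: "finite I" and \<kappa>: "\<And>n. n \<in> I \<Longrightarrow> \<kappa> n \<noteq> 0" and h: "h \<noteq> 0" by auto
    define \<sigma> where "\<sigma> = (if h > 0 then 1 else - 1 :: int)"
    define u where "u J = h / 2 ^ J" for J :: nat
    define a where "a j = ennreal (\<bar>u j\<bar> powr (- r)) * Lp_norm p (op (bc (\<beta> + r)) (u j *\<^sub>R e) (trig c I))" for j
    \<comment> \<open>Coefficients of the approximation at level J: the corrected difference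
      quotient with step u J in place of the Weyl factor, always behind the same difference of order
      \<beta> and step h.\<close>
    define D where "D J = (\<lambda>n. hat \<psi> (u J * of_int (\<kappa> n)) / of_real (\<bar>u J\<bar> powr r) * (hat (bc \<beta>) (h * of_int (\<kappa> n)) * c n))" for J
    have L: "trig c' I \<in> torus_Lp p" for c' using p trig_in_torus_Lp by simp
    have u0: "\<bar>u J\<bar> > 0" for J using h by (simp add: u_def)
    have inv: "1 / of_real (\<bar>u J\<bar> powr r) = (of_real (\<bar>u J\<bar> powr (- r)) :: complex)" for J
      by (simp add: powr_minus divide_inverse)
    have Dn: "D J n = of_real (\<bar>u J\<bar> powr (- r)) * (hat \<psi> (u J * of_int (\<kappa> n)) * (hat (bc \<beta>) (h * of_int (\<kappa> n)) * c n))" for J n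
      unfolding D_def inv[symmetric] by simp
    \<comment> \<open>P and Q are the normalising powers of the finer and the coarser step, linked
      by the factor t = 2^(-r).\<close>
    have gen: "P * (x * (b * c)) = Q * (x' * (b * c)) + P * (((x - t * x') * b) * c)" if "P * t = Q" for P Q t x x' b c :: complex
      unfolding that[symmetric] by (simp add: algebra_simps)
    have step: "Lp_norm p (trig (\<lambda>n. of_real (\<bar>u J\<bar> powr (- r)) * (hat (cauchy x b) (u J * of_int (\<kappa> n)) * c n)) I) \<le> ennreal K * a J"
      if d: "op_dominates p (cauchy x b) (bc (\<beta> + r)) K" and e: "ell1 (cauchy x b)" for x b K J
    proof -
      have "Lp_norm p (op (cauchy x b) (u J *\<^sub>R e) (trig c I)) \<le> ennreal K * Lp_norm p (op (bc (\<beta> + r)) (u J *\<^sub>R e) (trig c I))"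
        by (rule domD[OF d L])
      then have "ennreal (\<bar>u J\<bar> powr (- r)) * Lp_norm p (op (cauchy x b) (u J *\<^sub>R e) (trig c I)) \<le> ennreal K * a J"
        unfolding a_def mult.left_commute[of "ennreal K"] by (rule mult_left_mono) simp
      then show ?thesis
        by (subst Lp_norm_trig_cmult[OF p]) (simp add: op_trig_axis[OF I e ax])
    qed
    have bd: "Lp_norm p (trig (D J) I) \<le> ennreal (K0 + K1 + 1) * (\<Sum>j\<le>J. a j)" for J
    proof (induction J)
      case 0
      have "trig (D 0) I = trig (\<lambda>n. of_real (\<bar>u 0\<bar> powr (- r)) * (hat (cauchy \<psi> (bc \<beta>)) (u 0 * of_int (\<kappa> n)) * c n)) I"
        unfolding D_def hat_cauchy[OF e\<psi> eb(1)] inv[symmetric] by (simp add: u_def mult_ac)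
      then have "Lp_norm p (trig (D 0) I) \<le> ennreal K0 * a 0"
        using step[OF dom0 ell1_cauchy(1)[OF e\<psi> eb(1)], of 0] by simp
      also have "\<dots> \<le> ennreal (K0 + K1 + 1) * a 0" using K by (intro mult_right_mono ennreal_leI) auto
      finally show ?case by simp
    next
      case (Suc J)
      let ?M = "2 ^ Suc J :: nat"
      have eD: "ell1 (dil ?M (bc \<beta>))" using norm1_dil(1)[OF eb(1)] by simp
      let ?E = "\<lambda>n. of_real (\<bar>u (Suc J)\<bar> powr (- r)) * (hat (cauchy \<epsilon> (dil ?M (bc \<beta>))) (u (Suc J) * of_int (\<kappa> n)) * c n)"
      have "D (Suc J) n = D J n + ?E n" for n
      proof -
        have args: "real ?M * (u (Suc J) * of_int (\<kappa> n)) = h * of_int (\<kappa> n)" "2 * (u (Suc J) * of_int (\<kappa> n)) = u J * of_int (\<kappa> n)"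
          by (simp_all add: u_def)
        have M0: "?M > 0" by simp
        have "hat (cauchy \<epsilon> (dil ?M (bc \<beta>))) (u (Suc J) * of_int (\<kappa> n)) =
           (hat \<psi> (u (Suc J) * of_int (\<kappa> n)) - of_real (2 powr (- r)) * hat \<psi> (u J * of_int (\<kappa> n))) * hat (bc \<beta>) (h * of_int (\<kappa> n))"
          by (simp only: hat_cauchy[OF e\<epsilon> eD] hat_dil[OF M0] hat\<epsilon> args)
        moreover have "\<bar>u (Suc J)\<bar> powr (- r) * 2 powr (- r) = \<bar>u J\<bar> powr (- r)"
          by (subst powr_mult[symmetric]) (auto simp: u_def)
        then have "complex_of_real (\<bar>u (Suc J)\<bar> powr (- r)) * of_real (2 powr (- r)) = of_real (\<bar>u J\<bar> powr (- r))"
          by (simp only: of_real_mult[symmetric])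
        ultimately show ?thesis
          unfolding Dn by (simp only: gen)
      qed
      then have "trig (D (Suc J)) I = (\<lambda>z. trig (D J) I z + trig ?E I z)"
        by (simp add: trig_def fun_eq_iff distrib_right sum.distrib)
      then have "Lp_norm p (trig (D (Suc J)) I) \<le> Lp_norm p (trig (D J) I) + Lp_norm p (trig ?E I)"
        using Lp_norm_triangle[OF p torus_Lp_measurable[OF L] torus_Lp_measurable[OF L], of "D J" ?E] by simp
      also have "Lp_norm p (trig ?E I) \<le> ennreal K1 * a (Suc J)"
        by (rule step[OF dom1 ell1_cauchy(1)[OF e\<epsilon> eD]]) simp
      also have "\<dots> \<le> ennreal (K0 + K1 + 1) * a (Suc J)" using K by (intro mult_right_mono ennreal_leI) auto
      also note Suc
      finally show ?case by (simp add: distrib_left add_mono add_left_mono add_right_mono)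
    qed
    have "Lp_norm p (trig (\<lambda>n. weyl_factor r (\<sigma> * \<kappa> n) * (hat (bc \<beta>) (h * of_int (\<kappa> n)) * c n)) I) \<le> ennreal (K0 + K1 + 1) * (\<Sum>j. a j)"
    proof (rule Lp_norm_trig_limit_le[where c'=D, OF p])
      fix J
      show "Lp_norm p (trig (D J) I) \<le> ennreal (K0 + K1 + 1) * (\<Sum>j. a j)"
        by (rule order_trans[OF bd]) (intro mult_left_mono sum_le_suminf, auto)
    next
      fix n assume n: "n \<in> I"
      have ul: "u \<longlonglongrightarrow> 0" unfolding u_def[abs_def] by real_asymp
      have us: "u m \<noteq> 0 \<and> sgn (u m) = sgn h" for m using h by (auto simp: u_def sgn_if zero_less_divide_iff)
      \<comment> \<open>The correction terms i > 0 carry an additional factor |u J|^i and vanish in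
        the limit; only the leading term, with coefficient q 0 = 1, is left.\<close>
      have lim: "(\<lambda>J. hat (bc (r + real i)) (u J * of_int (\<kappa> n)) / of_real (\<bar>u J\<bar> powr r)) \<longlonglongrightarrow> (if i = 0 then weyl_factor r (\<sigma> * \<kappa> n) else 0)" for i
      proof -
        have ip: "r + real i > 0" using r by simp
        have "(\<lambda>J. hat (bc (r + real i)) (u J * of_int (\<kappa> n)) / of_real (\<bar>u J\<bar> powr (r + real i)) * of_real (\<bar>u J\<bar> ^ i)) \<longlonglongrightarrow>
          weyl_factor (r + real i) (\<sigma> * \<kappa> n) * of_real (\<bar>0\<bar> ^ i)"
          unfolding \<sigma>_def by (intro tendsto_intros hat_bc_limit ip h \<kappa> n ul us)
        moreover have "hat (bc (r + real i)) (u J * of_int (\<kappa> n)) / of_real (\<bar>u J\<bar> powr (r + real i)) * of_real (\<bar>u J\<bar> ^ i) =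
          hat (bc (r + real i)) (u J * of_int (\<kappa> n)) / of_real (\<bar>u J\<bar> powr r)" for J
          using u0[of J] by (simp add: powr_add powr_realpow)
        ultimately show ?thesis by (cases "i = 0") (simp_all add: power_0_left)
      qed
      have "(\<lambda>J. \<Sum>i<N. of_real (q i) * (hat (bc (r + real i)) (u J * of_int (\<kappa> n)) / of_real (\<bar>u J\<bar> powr r))) \<longlonglongrightarrow>
        (\<Sum>i<N. of_real (q i) * (if i = 0 then weyl_factor r (\<sigma> * \<kappa> n) else 0))"
        by (intro tendsto_intros lim)
      also have "(\<Sum>i<N. of_real (q i) * (if i = 0 then weyl_factor r (\<sigma> * \<kappa> n) else 0)) = weyl_factor r (\<sigma> * \<kappa> n)"
        using N q by (simp add: if_distrib[of "\<lambda>x. _ * x"] cong: if_cong)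
      finally have "(\<lambda>J. hat \<psi> (u J * of_int (\<kappa> n)) / of_real (\<bar>u J\<bar> powr r)) \<longlonglongrightarrow> weyl_factor r (\<sigma> * \<kappa> n)"
        by (simp add: hat\<psi> sum_divide_distrib)
      then show "(\<lambda>J. D J n) \<longlonglongrightarrow> weyl_factor r (\<sigma> * \<kappa> n) * (hat (bc \<beta>) (h * of_int (\<kappa> n)) * c n)"
        unfolding D_def by (intro tendsto_mult tendsto_const)
    qed
    moreover have "op (bc \<beta>) (h *\<^sub>R e) (trig (\<lambda>n. weyl_factor r (\<sigma> * \<kappa> n) * c n) I) =
       trig (\<lambda>n. weyl_factor r (\<sigma> * \<kappa> n) * (hat (bc \<beta>) (h * of_int (\<kappa> n)) * c n)) I"
      unfolding op_trig_axis[OF I eb(1) ax] by (simp add: mult_ac)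
    ultimately show "Lp_norm p (op (bc \<beta>) (h *\<^sub>R e) (trig (\<lambda>n. weyl_factor r ((if h > 0 then 1 else - 1) * \<kappa> n) * c n) I)) \<le>
      ennreal (K0 + K1 + 1) * (\<Sum>j. ennreal ((\<bar>h\<bar> / 2 ^ j) powr (- r)) * Lp_norm p (op (bc (\<beta> + r)) ((h / 2 ^ j) *\<^sub>R e) (trig c I)))"
      by (simp add: \<sigma>_def a_def u_def)
  qed (use K in auto)
qed

text \<open>The phase depending on the sign of h is exchanged for that of the Weyl derivative at the
  cost of a sign multiplier, which commutes with the difference.\<close>

lemma trig_derivative_ge:
  assumes p: "p > 1" and \<beta>: "\<beta> > 0" and r: "r > 0"
  shows "\<exists>C>0. \<forall>e \<kappa> I c h. coord_axis e \<kappa> \<and> finite I \<and> (\<forall>n\<in>I. \<kappa> n \<noteq> 0) \<longrightarrow>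
    Lp_norm p (op (bc \<beta>) (h *\<^sub>R e) (trig (\<lambda>n. weyl_factor r (\<kappa> n) * c n) I)) \<le>
    ennreal C * (\<Sum>j. ennreal ((\<bar>h\<bar> / 2 ^ j) powr (- r)) * Lp_norm p (op (bc (\<beta> + r)) ((h / 2 ^ j) *\<^sub>R e) (trig c I)))"
proof -
  obtain A where A: "A > 0" and R: "\<forall>e \<kappa> I c \<gamma>. coord_axis e \<kappa> \<and> finite I \<and> (\<forall>n\<in>I. \<kappa> n \<noteq> 0) \<longrightarrow>
    Lp_norm p (trig (\<lambda>n. cis (\<gamma> * of_int (sgn (\<kappa> n))) * c n) I) \<le> ennreal A * Lp_norm p (trig c I)"
    using riesz_axis[OF p] by (elim exE conjE)
  obtain C where C: "C > 0" and half: "\<forall>e \<kappa> I c h. coord_axis e \<kappa> \<and> finite I \<and> (\<forall>n\<in>I. \<kappa> n \<noteq> 0) \<and> h \<noteq> 0 \<longrightarrow>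
    Lp_norm p (op (bc \<beta>) (h *\<^sub>R e) (trig (\<lambda>n. weyl_factor r ((if h > 0 then 1 else - 1) * \<kappa> n) * c n) I)) \<le>
    ennreal C * (\<Sum>j. ennreal ((\<bar>h\<bar> / 2 ^ j) powr (- r)) * Lp_norm p (op (bc (\<beta> + r)) ((h / 2 ^ j) *\<^sub>R e) (trig c I)))"
    using trig_derivative_ge_half[OF p \<beta> r] by (elim exE conjE)
  have eb: "ell1 (bc \<beta>)" using \<beta> summable_bc by auto
  show ?thesis
  proof (intro exI[of _ "A * C"] conjI allI impI)
    fix e \<kappa> I c and h :: real assume as: "coord_axis e \<kappa> \<and> finite I \<and> (\<forall>n\<in>I. \<kappa> n \<noteq> 0)"
    then have ax: "coord_axis e \<kappa>" and I: "finite I" and \<kappa>: "\<And>n. n \<in> I \<Longrightarrow> \<kappa> n \<noteq> 0" by auto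
    show "Lp_norm p (op (bc \<beta>) (h *\<^sub>R e) (trig (\<lambda>n. weyl_factor r (\<kappa> n) * c n) I)) \<le>
      ennreal (A * C) * (\<Sum>j. ennreal ((\<bar>h\<bar> / 2 ^ j) powr (- r)) * Lp_norm p (op (bc (\<beta> + r)) ((h / 2 ^ j) *\<^sub>R e) (trig c I)))"
    proof (cases "h = 0")
      case True
      then show ?thesis using p \<beta> by (simp add: op_zero_shift Lp_norm_zero)
    next
      case h: False
      define \<gamma> where "\<gamma> = (if h > 0 then 0 else - (pi * r))"
      let ?w = "\<lambda>n. weyl_factor r ((if h > 0 then 1 else - 1) * \<kappa> n)"
      have w: "weyl_factor r (\<kappa> n) = cis (- \<gamma> * of_int (sgn (\<kappa> n))) * ?w n" if "n \<in> I" for n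
        unfolding weyl_factor_sign[OF \<kappa>[OF that]] \<gamma>_def[symmetric] mult.assoc[symmetric] cis_mult by simp
      have "Lp_norm p (op (bc \<beta>) (h *\<^sub>R e) (trig (\<lambda>n. weyl_factor r (\<kappa> n) * c n) I)) =
        Lp_norm p (trig (\<lambda>n. cis (- \<gamma> * of_int (sgn (\<kappa> n))) * (hat (bc \<beta>) (h * of_int (\<kappa> n)) * (?w n * c n))) I)"
        unfolding op_trig_axis[OF I eb ax] by (rule arg_cong[OF trig_cong]) (simp only: w mult_ac)
      also have "\<dots> \<le> ennreal A * Lp_norm p (trig (\<lambda>n. hat (bc \<beta>) (h * of_int (\<kappa> n)) * (?w n * c n)) I)"
        by (rule R[rule_format, OF as])
      also have "trig (\<lambda>n. hat (bc \<beta>) (h * of_int (\<kappa> n)) * (?w n * c n)) I = op (bc \<beta>) (h *\<^sub>R e) (trig (\<lambda>n. ?w n * c n) I)"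
        by (rule op_trig_axis[OF I eb ax, symmetric])
      also have "Lp_norm p (op (bc \<beta>) (h *\<^sub>R e) (trig (\<lambda>n. ?w n * c n) I)) \<le>
        ennreal C * (\<Sum>j. ennreal ((\<bar>h\<bar> / 2 ^ j) powr (- r)) * Lp_norm p (op (bc (\<beta> + r)) ((h / 2 ^ j) *\<^sub>R e) (trig c I)))"
        using half as h by blast
      finally show ?thesis using A by (simp add: mult_left_mono ennreal_mult' mult.assoc)
    qed
  qed (use A C in auto)
qed

section \<open>Fejer means\<close>

lemma integrable_torus:
  assumes "p > 1" "f \<in> torus_Lp p"
  shows "integrable torus_measure f"
  using torus_L1[OF assms] measurable_torusI[OF torus_Lp_measurable[OF assms(2)]] by (intro integrableI_bounded) auto

lemma integrable_torus_bounded: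
  fixes f :: "real \<times> real \<Rightarrow> 'b::{banach,second_countable_topology}"
  assumes "f \<in> borel_measurable torus_measure" "\<And>z. norm (f z) \<le> M"
  shows "integrable torus_measure f"
  using finite_measure.integrable_const_bound[OF finite_measure_torus, of f M] assms by auto

lemma measure_torus: "measure torus_measure (space torus_measure) = (2*pi)\<^sup>2"
  by (simp add: measure_def emeasure_torus)

lemma integral_torus_shift_nonneg:
  fixes g :: "real \<times> real \<Rightarrow> real"
  assumes g: "g \<in> borel_measurable lebesgue" "per g" "\<And>z. g z \<ge> 0"
  shows "(LINT z|torus_measure. g (z + v)) = (LINT z|torus_measure. g z)"
proof -
  have "per (\<lambda>z. ennreal (g z))" "(\<lambda>z. ennreal (g z)) \<in> borel_measurable lebesgue" using g by (auto simp: per_def)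
  from nn_integral_torus_shift[OF this(2,1), of v] show ?thesis
    using g measurable_torusI[OF g(1)] measurable_torusI[OF borel_measurable_lebesgue_shift[OF g(1), of v]]
    by (subst (1 2) integral_eq_nn_integral) auto
qed

lemma integrable_torus_shift:
  fixes f :: "real \<times> real \<Rightarrow> 'b::{banach,second_countable_topology}"
  assumes f: "f \<in> borel_measurable lebesgue" "per f" and i: "integrable torus_measure f"
  shows "integrable torus_measure (\<lambda>z. f (z + v))"
proof (rule integrableI_bounded)
  show "(\<lambda>z. f (z + v)) \<in> borel_measurable torus_measure"
    by (rule measurable_torusI[OF borel_measurable_lebesgue_shift[OF f(1)]])
  have "per (\<lambda>z. ennreal (norm (f z)))" "(\<lambda>z. ennreal (norm (f z))) \<in> borel_measurable lebesgue" using f by (auto simp: per_def)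
  from nn_integral_torus_shift[OF this(2,1), of v] show "(\<integral>\<^sup>+ z. ennreal (norm (f (z + v))) \<partial>torus_measure) < \<infinity>"
    using i by (simp add: integrable_iff_bounded)
qed

lemma integral_torus_shift_real:
  fixes g :: "real \<times> real \<Rightarrow> real"
  assumes g: "g \<in> borel_measurable lebesgue" "per g" and i: "integrable torus_measure g"
  shows "(LINT z|torus_measure. g (z + v)) = (LINT z|torus_measure. g z)"
proof -
  have i2: "integrable torus_measure (\<lambda>z. g (z + v))" by (rule integrable_torus_shift[OF g i])
  have "(LINT z|torus_measure. max (g (z + v)) 0) = (LINT z|torus_measure. max (g z) 0)"
    by (rule integral_torus_shift_nonneg[where g="\<lambda>z. max (g z) 0"]) (use g in \<open>auto simp: per_def\<close>)
  moreover have "(LINT z|torus_measure. max (- g (z + v)) 0) = (LINT z|torus_measure. max (- g z) 0)"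
    by (rule integral_torus_shift_nonneg[where g="\<lambda>z. max (- g z) 0"]) (use g in \<open>auto simp: per_def\<close>)
  ultimately have "(LINT z|torus_measure. max (g (z + v)) 0) - (LINT z|torus_measure. max (- g (z + v)) 0) =
    (LINT z|torus_measure. max (g z) 0) - (LINT z|torus_measure. max (- g z) 0)" by simp
  then have "(LINT z|torus_measure. max (g (z + v)) 0 - max (- g (z + v)) 0) = (LINT z|torus_measure. max (g z) 0 - max (- g z) 0)"
    using i i2 by (subst (1 2) Bochner_Integration.integral_diff) auto
  moreover have "max x 0 - max (- x) 0 = x" for x :: real by auto
  ultimately show ?thesis by simp
qed

lemma integral_torus_shift:
  fixes f :: "real \<times> real \<Rightarrow> complex"
  assumes f: "f \<in> borel_measurable lebesgue" "per f" and i: "integrable torus_measure f"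
  shows "(LINT z|torus_measure. f (z + v)) = (LINT z|torus_measure. f z)"
proof -
  have i2: "integrable torus_measure (\<lambda>z. f (z + v))" by (rule integrable_torus_shift[OF f i])
  have "(LINT z|torus_measure. Re (f (z + v))) = (LINT z|torus_measure. Re (f z))"
    by (rule integral_torus_shift_real[where g="\<lambda>z. Re (f z)"]) (use f i in \<open>auto simp: per_def\<close>)
  moreover have "(LINT z|torus_measure. Im (f (z + v))) = (LINT z|torus_measure. Im (f z))"
    by (rule integral_torus_shift_real[where g="\<lambda>z. Im (f z)"]) (use f i in \<open>auto simp: per_def\<close>)
  ultimately show ?thesis using i i2 by (simp add: complex_eq_iff)
qed

lemma trig_dotp: "trig c I z = (\<Sum>n\<in>I. c n * cis (dotp n z))"
  by (simp add: trig_def dotp_def)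

lemma fourier_coeff_dotp:
  "fourier_coeff f (fst n) (snd n) = (LINT z|torus_measure. f z * cis (- dotp n z)) / of_real ((2*pi)\<^sup>2)"
  by (simp add: fourier_coeff_def dotp_def)

lemma dotp_add: "dotp n (z + w) = dotp n z + dotp n w"
  by (simp add: dotp_def algebra_simps)

lemma dotp_diff: "dotp n (z - w) = dotp n z - dotp n w"
  by (simp add: dotp_def algebra_simps)

lemma dotp_scaleR: "dotp n (x *\<^sub>R z) = x * dotp n z"
  by (simp add: dotp_def algebra_simps)

lemma dotp_minus: "dotp (- n) z = - dotp n z"
  by (simp add: dotp_def)

lemma dotp_freq_add: "dotp (n + m) z = dotp n z + dotp m z"
  by (simp add: dotp_def algebra_simps)

lemma continuous_dotp [continuous_intros]: "continuous_on S g \<Longrightarrow> continuous_on S (\<lambda>z. dotp n (g z))"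
  unfolding dotp_def by (intro continuous_intros)

lemma per_cis_dotp: "per (\<lambda>z. cis (dotp n z))"
  using per_trig[of "\<lambda>_. 1" "{n}"] by (simp add: trig_dotp[abs_def])

lemma borel_measurable_cis_dotp [measurable]: "(\<lambda>z. cis (dotp n z)) \<in> borel_measurable lebesgue"
  by (intro borel_measurable_continuous_lebesgue continuous_intros)

lemma measurable_torus_continuous:
  fixes f :: "real \<times> real \<Rightarrow> 'b::topological_space"
  shows "continuous_on UNIV f \<Longrightarrow> f \<in> borel_measurable torus_measure"
  by (intro measurable_torusI borel_measurable_continuous_lebesgue)

text \<open>For n different from 0 there is a vector v with n . v = pi. Translating by v preserves
  the integral but reverses the sign of the integrand.\<close>

lemma integral_cis_dotp:
  "(LINT z|torus_measure. cis (dotp n z)) = (if n = 0 then of_real ((2*pi)\<^sup>2) else 0)"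
proof (cases "n = 0")
  case True
  then show ?thesis by (simp add: dotp_def measure_torus scaleR_conv_of_real)
next
  case False
  obtain v where v: "dotp n v = pi"
  proof (cases "fst n = 0")
    case True
    then have "snd n \<noteq> 0" using False by (simp add: prod_eq_iff)
    then have "dotp n (0, pi / of_int (snd n)) = pi" by (simp add: dotp_def)
    then show ?thesis by (rule that)
  next
    case False
    then have "dotp n (pi / of_int (fst n), 0) = pi" by (simp add: dotp_def)
    then show ?thesis by (rule that)
  qed
  have i: "integrable torus_measure (\<lambda>z. cis (dotp n z))"
    by (rule integrable_torus_bounded[where M=1]) (auto intro!: measurable_torus_continuous continuous_intros)
  have "(LINT z|torus_measure. cis (dotp n z)) = (LINT z|torus_measure. cis (dotp n (z + v)))"
    by (rule integral_torus_shift[OF borel_measurable_cis_dotp per_cis_dotp i, symmetric])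
  also have "\<dots> = - (LINT z|torus_measure. cis (dotp n z))"
    by (simp add: dotp_add v flip: cis_mult)
  finally show ?thesis using False by simp
qed

text \<open>The L_1 norms of the terms are |a k| times that of f, which justifies integration term
  by term; each translate contributes a character value, and these add up to
  \<open>hat a\<close>.\<close>

lemma fourier_coeff_op:
  assumes p: "p > 1" and f: "f \<in> torus_Lp p" and a: "ell1 a"
  shows "fourier_coeff (op a v f) (fst n) (snd n) = hat a (dotp n v) * fourier_coeff f (fst n) (snd n)"
proof -
  have fm: "f \<in> borel_measurable lebesgue" "per f" using f by (auto simp: torus_Lp_iff)
  have fi: "integrable torus_measure f" by (rule integrable_torus[OF p f])
  define G where "G z = f z * cis (- dotp n z)" for z
  have eG: "cis (- dotp n z) = cis (dotp (- n) z)" for z by (simp add: dotp_minus)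
  have Gm: "G \<in> borel_measurable lebesgue" "per G"
    unfolding G_def eG using fm per_cis_dotp[of "- n"] by (auto simp: per_def)
  have Gi: "integrable torus_measure G"
    by (rule Bochner_Integration.integrable_bound[OF fi]) (use measurable_torusI[OF Gm(1)] in \<open>auto simp: G_def norm_mult\<close>)
  define T where "T k z = of_real (a k) * f (z - real k *\<^sub>R v) * cis (- dotp n z)" for k z
  have TG: "T k z = (of_real (a k) * cis (- (real k * dotp n v))) * G (z + (- (real k *\<^sub>R v)))" for k z
  proof -
    have "- dotp n z = - (real k * dotp n v) + - dotp n (z - real k *\<^sub>R v)" by (simp add: dotp_diff dotp_scaleR)
    then have "cis (- dotp n z) = cis (- (real k * dotp n v)) * cis (- dotp n (z - real k *\<^sub>R v))" by (simp only: cis_mult)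
    then show ?thesis by (simp add: T_def G_def)
  qed
  have Gs: "integrable torus_measure (\<lambda>z. G (z + w))" "(LINT z|torus_measure. G (z + w)) = (LINT z|torus_measure. G z)"
    "(LINT z|torus_measure. norm (G (z + w))) = (LINT z|torus_measure. norm (G z))" for w
  proof -
    show "integrable torus_measure (\<lambda>z. G (z + w))" by (rule integrable_torus_shift[OF Gm Gi])
    show "(LINT z|torus_measure. G (z + w)) = (LINT z|torus_measure. G z)" by (rule integral_torus_shift[OF Gm Gi])
    show "(LINT z|torus_measure. norm (G (z + w))) = (LINT z|torus_measure. norm (G z))"
      by (rule integral_torus_shift_nonneg[where g="\<lambda>z. norm (G z)"]) (use Gm in \<open>auto simp: per_def\<close>)
  qed
  have Ti: "integrable torus_measure (T k)" for k unfolding TG[abs_def] by (intro integrable_mult_right Gs)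
  have nT: "(LINT z|torus_measure. norm (T k z)) = \<bar>a k\<bar> * (LINT z|torus_measure. norm (G z))" for k
    unfolding TG norm_mult using Gs(3)[of "- (real k *\<^sub>R v)"] by simp
  have IT: "(LINT z|torus_measure. T k z) = of_real (a k) * cis (- (real k * dotp n v)) * (LINT z|torus_measure. G z)" for k
    unfolding TG using Gs(2)[of "- (real k *\<^sub>R v)"] by simp
  have "op a v f z * cis (- dotp n z) = (\<Sum>k. T k z)" if "summable (\<lambda>k. norm (of_real (a k) * f (z - real k *\<^sub>R v)))" for z
    unfolding op_def T_def by (rule suminf_mult2[OF summable_norm_cancel[OF that]])
  moreover have sumT: "AE z in torus_measure. summable (\<lambda>k. norm (T k z))"
  proof -
    have "(\<integral>\<^sup>+ z. (\<Sum>k. ennreal (norm (T k z))) \<partial>torus_measure) = (\<Sum>k. \<integral>\<^sup>+ z. ennreal (norm (T k z)) \<partial>torus_measure)"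
      using Ti by (intro nn_integral_suminf) auto
    also have "\<dots> = (\<Sum>k. ennreal (\<bar>a k\<bar> * (LINT z|torus_measure. norm (G z))))"
      using nT by (subst nn_integral_eq_integral[OF integrable_norm[OF Ti]]) auto
    also have "\<dots> < \<infinity>"
      using a by (subst suminf_ennreal2) (auto simp: ell1_def intro!: summable_mult2)
    finally have "(\<integral>\<^sup>+ z. (\<Sum>k. ennreal (norm (T k z))) \<partial>torus_measure) \<noteq> \<infinity>" by simp
    moreover have [measurable]: "T k \<in> borel_measurable torus_measure" for k by (rule borel_measurable_integrable[OF Ti])
    have "(\<lambda>z. \<Sum>k. ennreal (norm (T k z))) \<in> borel_measurable torus_measure" by measurable
    ultimately have "AE z in torus_measure. (\<Sum>k. ennreal (norm (T k z))) \<noteq> \<infinity>" by (intro nn_integral_noteq_infinite)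
    then show ?thesis by eventually_elim (auto intro!: summable_suminf_not_top)
  qed
  ultimately have "AE z in torus_measure. op a v f z * cis (- dotp n z) = (\<Sum>k. T k z)"
    by (auto simp: T_def norm_mult elim!: eventually_mono)
  then have "(LINT z|torus_measure. op a v f z * cis (- dotp n z)) = (LINT z|torus_measure. (\<Sum>k. T k z))"
  proof (rule integral_cong_AE[rotated 2])
    have [measurable]: "T k \<in> borel_measurable torus_measure" for k by (rule borel_measurable_integrable[OF Ti])
    have [measurable]: "op a v f \<in> borel_measurable torus_measure" by (rule measurable_torusI[OF measurable_op[OF fm(1)]])
    have [measurable]: "(\<lambda>z. cis (- dotp n z)) \<in> borel_measurable torus_measure"
      by (intro measurable_torus_continuous continuous_intros)
    show "(\<lambda>z. op a v f z * cis (- dotp n z)) \<in> borel_measurable torus_measure" by measurable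
    show "(\<lambda>z. \<Sum>k. T k z) \<in> borel_measurable torus_measure" by measurable
  qed
  also have "\<dots> = (\<Sum>k. LINT z|torus_measure. T k z)"
    by (rule integral_suminf[OF Ti sumT]) (unfold nT, use a in \<open>auto simp: ell1_def intro!: summable_mult2\<close>)
  also have "\<dots> = hat a (dotp n v) * (LINT z|torus_measure. G z)"
    unfolding IT hat_def by (rule suminf_mult2[OF summable_hat[OF a], symmetric])
  finally show ?thesis unfolding fourier_coeff_dotp G_def by simp
qed

section \<open>The Fejer kernel and its contraction properties\<close>

definition fejer_idx :: "nat \<Rightarrow> ((nat \<times> nat) \<times> (nat \<times> nat)) set" where
  "fejer_idx n = ({..<n} \<times> {..<n}) \<times> ({..<n} \<times> {..<n})"

definition fejer_freq :: "(nat \<times> nat) \<times> (nat \<times> nat) \<Rightarrow> int \<times> int" where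
  "fejer_freq a = (int (fst (fst a)) - int (snd (fst a)), int (fst (snd a)) - int (snd (snd a)))"

text \<open>Counts how often a frequency occurs when the squared Dirichlet sums are multiplied out;
  on the frequencies that occur it is the product of the factors 1 - |b|/n of the two
  coordinates.\<close>

definition fejer_weight :: "nat \<Rightarrow> int \<times> int \<Rightarrow> real" where
  "fejer_weight n b = real (card {a \<in> fejer_idx n. fejer_freq a = b}) / (real n)\<^sup>2"

text \<open>Written as a product of squared moduli, so that positivity is evident; the expansion
  into exponentials is a separate lemma.\<close>

definition fejer_kernel :: "nat \<Rightarrow> real \<times> real \<Rightarrow> real" where
  "fejer_kernel n u = (norm (\<Sum>k<n. cis (real k * fst u)))\<^sup>2 * (norm (\<Sum>k<n. cis (real k * snd u)))\<^sup>2 / (real n)\<^sup>2"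

text \<open>Defined on the Fourier side, so that its interaction with differences and Weyl
  derivatives is a comparison of coefficients.\<close>

definition fejer :: "nat \<Rightarrow> (real \<times> real \<Rightarrow> complex) \<Rightarrow> real \<times> real \<Rightarrow> complex" where
  "fejer n F = trig (\<lambda>b. of_real (fejer_weight n b) * fourier_coeff F (fst b) (snd b)) (fejer_freq ` fejer_idx n)"

lemma finite_fejer_idx [simp]: "finite (fejer_idx n)" by (simp add: fejer_idx_def)

lemma fejer_kernel_nonneg: "fejer_kernel n u \<ge> 0" by (simp add: fejer_kernel_def)

lemma continuous_fejer_kernel [continuous_intros]: "continuous_on S g \<Longrightarrow> continuous_on S (\<lambda>z. fejer_kernel n (g z))"
  unfolding fejer_kernel_def by (cases "n = 0") (auto intro!: continuous_intros)

lemma fejer_kernel_minus: "fejer_kernel n (- u) = fejer_kernel n u"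
proof -
  have "norm (\<Sum>k<n. cis (real k * (- t))) = norm (\<Sum>k<n. cis (real k * t))" for t
  proof -
    have "(\<Sum>k<n. cis (real k * (- t))) = cnj (\<Sum>k<n. cis (real k * t))" by (simp add: cis_cnj)
    then show ?thesis by (simp only: complex_mod_cnj)
  qed
  then show ?thesis by (simp add: fejer_kernel_def)
qed

lemma fejer_kernel_expand:
  "of_real (fejer_kernel n u) = (\<Sum>a\<in>fejer_idx n. cis (dotp (fejer_freq a) u)) / of_real ((real n)\<^sup>2)"
proof -
  have sq: "of_real ((norm (\<Sum>k<n. cis (real k * t)))\<^sup>2) = (\<Sum>x\<in>{..<n}\<times>{..<n}. cis (of_int (int (fst x) - int (snd x)) * t))" for t
  proof -
    have "of_real ((norm (\<Sum>k<n. cis (real k * t)))\<^sup>2) = (\<Sum>j<n. cis (real j * t)) * cnj (\<Sum>k<n. cis (real k * t))"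
      by (simp only: complex_norm_square)
    also have "\<dots> = (\<Sum>j<n. \<Sum>k<n. cis (real j * t) * cis (- (real k * t)))"
      by (simp add: cis_cnj sum_product)
    also have "\<dots> = (\<Sum>x\<in>{..<n}\<times>{..<n}. cis (of_int (int (fst x) - int (snd x)) * t))"
      by (simp add: sum.cartesian_product cis_mult algebra_simps case_prod_beta)
    finally show ?thesis .
  qed
  have "of_real (fejer_kernel n u) * of_real ((real n)\<^sup>2) =
      of_real ((norm (\<Sum>k<n. cis (real k * fst u)))\<^sup>2) * (of_real ((norm (\<Sum>k<n. cis (real k * snd u)))\<^sup>2) :: complex)"
    by (cases "n = 0") (simp_all add: fejer_kernel_def)
  also have "\<dots> = (\<Sum>x\<in>{..<n}\<times>{..<n}. \<Sum>y\<in>{..<n}\<times>{..<n}. cis (of_int (int (fst x) - int (snd x)) * fst u) * cis (of_int (int (fst y) - int (snd y)) * snd u))"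
    unfolding sq by (rule sum_product)
  also have "\<dots> = (\<Sum>a\<in>fejer_idx n. cis (dotp (fejer_freq a) u))"
    unfolding fejer_idx_def
    by (simp add: sum.cartesian_product cis_mult dotp_def fejer_freq_def case_prod_beta)
  finally have eq: "of_real (fejer_kernel n u) * of_real ((real n)\<^sup>2) = (\<Sum>a\<in>fejer_idx n. cis (dotp (fejer_freq a) u))" .
  show ?thesis
  proof (cases "n = 0")
    case True
    then show ?thesis by (simp add: fejer_kernel_def)
  next
    case False
    then show ?thesis using eq by (simp add: field_simps)
  qed
qed

lemma fejer_integral:
  assumes F: "integrable torus_measure F"
  shows "fejer n F z = (LINT w|torus_measure. F w * of_real (fejer_kernel n (z - w))) / of_real ((2*pi)\<^sup>2)"
proof -
  let ?c = "\<lambda>b. fourier_coeff F (fst b) (snd b)" and ?N = "of_real ((real n)\<^sup>2) :: complex"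
  have int: "integrable torus_measure (\<lambda>w. F w * cis (- dotp b w))" for b
  proof (rule Bochner_Integration.integrable_bound[OF F])
    have [measurable]: "F \<in> borel_measurable torus_measure" using F by simp
    have [measurable]: "(\<lambda>w. cis (- dotp b w)) \<in> borel_measurable torus_measure"
      by (intro measurable_torus_continuous continuous_intros)
    show "(\<lambda>w. F w * cis (- dotp b w)) \<in> borel_measurable torus_measure" by measurable
  qed (simp add: norm_mult)
  have "F w * of_real (fejer_kernel n (z - w)) = (\<Sum>a\<in>fejer_idx n. cis (dotp (fejer_freq a) z) / ?N * (F w * cis (- dotp (fejer_freq a) w)))" for w
    unfolding fejer_kernel_expand sum_divide_distrib sum_distrib_left
  proof (rule sum.cong[OF refl])
    fix a
    have "cis (dotp (fejer_freq a) (z - w)) = cis (dotp (fejer_freq a) z) * cis (- dotp (fejer_freq a) w)"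
      by (simp add: dotp_diff cis_mult)
    then show "F w * (cis (dotp (fejer_freq a) (z - w)) / ?N) = cis (dotp (fejer_freq a) z) / ?N * (F w * cis (- dotp (fejer_freq a) w))"
      by simp
  qed
  then have "(LINT w|torus_measure. F w * of_real (fejer_kernel n (z - w))) / of_real ((2*pi)\<^sup>2) =
    (\<Sum>a\<in>fejer_idx n. cis (dotp (fejer_freq a) z) / ?N * (LINT w|torus_measure. F w * cis (- dotp (fejer_freq a) w))) / of_real ((2*pi)\<^sup>2)"
    using int by (simp add: Bochner_Integration.integral_sum)
  also have "\<dots> = (\<Sum>a\<in>fejer_idx n. cis (dotp (fejer_freq a) z) / ?N * ?c (fejer_freq a))"
    unfolding sum_divide_distrib fourier_coeff_dotp by simp
  also have "\<dots> = (\<Sum>b\<in>fejer_freq ` fejer_idx n. \<Sum>a\<in>{a \<in> fejer_idx n. fejer_freq a = b}. cis (dotp (fejer_freq a) z) / ?N * ?c (fejer_freq a))"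
    by (rule sum.image_gen) simp
  also have "\<dots> = fejer n F z"
    unfolding fejer_def trig_dotp by (intro sum.cong refl) (simp add: fejer_weight_def)
  finally show ?thesis by simp
qed

text \<open>Obtained from the Fejer mean of the conjugate character. It yields the total mass of the
  kernel for b = 0 and its first cosine moments for the unit frequencies.\<close>

lemma fejer_character:
  "(LINT w|torus_measure. cis (dotp b (z - w)) * of_real (fejer_kernel n (z - w))) = of_real ((2*pi)\<^sup>2 * fejer_weight n (- b))"
proof -
  let ?F = "\<lambda>w. cis (dotp (- b) w)"
  have i: "integrable torus_measure ?F"
    by (rule integrable_torus_bounded[where M=1]) (auto intro!: measurable_torus_continuous continuous_intros)
  have c: "fourier_coeff ?F (fst m) (snd m) = (if m = - b then 1 else 0)" for m
  proof -
    have "?F w * cis (- dotp m w) = cis (dotp (- b + - m) w)" for w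
      by (simp only: cis_mult dotp_freq_add dotp_minus)
    then have "fourier_coeff ?F (fst m) (snd m) = (if - b + - m = 0 then of_real ((2*pi)\<^sup>2) else 0) / of_real ((2*pi)\<^sup>2)"
      unfolding fourier_coeff_dotp using integral_cis_dotp[of "- b + - m"] by simp
    moreover have "- b + - m = 0 \<longleftrightarrow> m = - b" by (auto simp: add_eq_0_iff)
    ultimately show ?thesis by simp
  qed
  have "fejer n ?F z = of_real (fejer_weight n (- b)) * cis (dotp (- b) z)"
  proof (cases "- b \<in> fejer_freq ` fejer_idx n")
    case True
    then show ?thesis unfolding fejer_def trig_dotp c by (simp add: if_distrib[of "\<lambda>x. _ * x"] if_distrib[of "\<lambda>x. x * _"] cong: if_cong)
  next
    case False
    have "{a \<in> fejer_idx n. fejer_freq a = - b} = {}"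
    proof (rule equals0I)
      fix a assume "a \<in> {a \<in> fejer_idx n. fejer_freq a = - b}"
      then have "- b \<in> fejer_freq ` fejer_idx n" by (intro image_eqI[of _ _ a]) auto
      then show False using False by simp
    qed
    then have "fejer_weight n (- b) = 0" by (simp add: fejer_weight_def)
    then show ?thesis using False unfolding fejer_def trig_dotp c by (auto intro!: sum.neutral)
  qed
  then have "(LINT w|torus_measure. ?F w * of_real (fejer_kernel n (z - w))) = of_real ((2*pi)\<^sup>2 * fejer_weight n (- b)) * cis (dotp (- b) z)"
    unfolding fejer_integral[OF i] by (simp add: field_simps)
  then have "cis (dotp b z) * (LINT w|torus_measure. ?F w * of_real (fejer_kernel n (z - w))) = of_real ((2*pi)\<^sup>2 * fejer_weight n (- b)) * (cis (dotp b z) * cis (dotp (- b) z))"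
    by (simp only: mult_ac)
  also have "cis (dotp b z) * cis (dotp (- b) z) = 1" by (simp add: cis_mult dotp_minus)
  also have "cis (dotp b z) * (LINT w|torus_measure. ?F w * of_real (fejer_kernel n (z - w))) =
     (LINT w|torus_measure. cis (dotp b (z - w)) * of_real (fejer_kernel n (z - w)))"
  proof -
    have "cis (dotp b (z - w)) = cis (dotp b z) * cis (dotp (- b) w)" for w by (simp add: cis_mult dotp_diff dotp_minus)
    then show ?thesis by (simp add: mult.assoc)
  qed
  finally show ?thesis by simp
qed

lemma fejer_weight_0: "n > 0 \<Longrightarrow> fejer_weight n 0 = 1"
proof -
  assume n: "n > 0"
  have "{a \<in> fejer_idx n. fejer_freq a = 0} = (\<lambda>(k, l). ((k, k), (l, l))) ` ({..<n} \<times> {..<n})"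
    by (auto simp: fejer_idx_def fejer_freq_def zero_prod_def image_iff)
  then have "card {a \<in> fejer_idx n. fejer_freq a = 0} = n * n"
    by (simp add: card_image inj_on_def card_cartesian_product)
  then show ?thesis using n by (simp add: fejer_weight_def power2_eq_square)
qed

lemma fejer_weight_1:
  "fejer_weight n (- (1, 0)) = real (n - 1) / real n" "fejer_weight n (- (0, 1)) = real (n - 1) / real n"
proof -
  have "{a \<in> fejer_idx n. fejer_freq a = - (1, 0)} = (\<lambda>(k, l). ((k, Suc k), (l, l))) ` ({..<n - 1} \<times> {..<n})"
       "{a \<in> fejer_idx n. fejer_freq a = - (0, 1)} = (\<lambda>(l, k). ((l, l), (k, Suc k))) ` ({..<n} \<times> {..<n - 1})"
    by (auto simp: fejer_idx_def fejer_freq_def image_iff)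
  then have "card {a \<in> fejer_idx n. fejer_freq a = - (1, 0)} = (n - 1) * n" "card {a \<in> fejer_idx n. fejer_freq a = - (0, 1)} = n * (n - 1)"
    by (simp_all add: card_image inj_on_def card_cartesian_product)
  then show "fejer_weight n (- (1, 0)) = real (n - 1) / real n" "fejer_weight n (- (0, 1)) = real (n - 1) / real n"
    by (simp_all add: fejer_weight_def power2_eq_square)
qed

lemma fejer_kernel_le: "fejer_kernel n u \<le> (real n)\<^sup>2"
proof -
  have 1: "norm (\<Sum>k<n. cis (real k * t)) \<le> real n" for t
    using norm_sum[of "\<lambda>k. cis (real k * t)" "{..<n}"] by simp
  have "(norm (\<Sum>k<n. cis (real k * fst u)))\<^sup>2 * (norm (\<Sum>k<n. cis (real k * snd u)))\<^sup>2 \<le> (real n)\<^sup>2 * (real n)\<^sup>2"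
    by (intro mult_mono power_mono 1) auto
  then show ?thesis by (cases "n = 0") (auto simp: fejer_kernel_def divide_le_eq)
qed

lemma fejer_kernel_measurable [measurable]: "(\<lambda>w. fejer_kernel n (z - w)) \<in> borel_measurable torus_measure"
  by (intro measurable_torus_continuous continuous_intros)

lemma integrable_fejer_kernel: "integrable torus_measure (\<lambda>w. fejer_kernel n (z - w))"
  by (rule integrable_torus_bounded[where M="(real n)\<^sup>2"]) (simp_all add: fejer_kernel_le fejer_kernel_nonneg)

lemma integrable_mult_fejer_kernel:
  fixes F :: "real \<times> real \<Rightarrow> real"
  assumes "integrable torus_measure F"
  shows "integrable torus_measure (\<lambda>w. F w * fejer_kernel n (z - w))"
proof (rule Bochner_Integration.integrable_bound)
  show "integrable torus_measure (\<lambda>w. (real n)\<^sup>2 * F w)" using assms by simp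
  have [measurable]: "F \<in> borel_measurable torus_measure" using assms by simp
  show "(\<lambda>w. F w * fejer_kernel n (z - w)) \<in> borel_measurable torus_measure" by measurable
  show "AE w in torus_measure. norm (F w * fejer_kernel n (z - w)) \<le> norm ((real n)\<^sup>2 * F w)"
    by (intro AE_I2) (simp add: abs_mult fejer_kernel_nonneg mult.commute mult_left_mono fejer_kernel_le)
qed

lemma integral_fejer_kernel: "n > 0 \<Longrightarrow> (LINT w|torus_measure. fejer_kernel n (z - w)) = (2*pi)\<^sup>2"
proof -
  assume "n > 0"
  then have "complex_of_real (LINT w|torus_measure. fejer_kernel n (z - w)) = of_real ((2*pi)\<^sup>2)"
    using fejer_character[of 0 z n] by (simp add: fejer_weight_0 dotp_def)
  then show ?thesis by (simp only: of_real_eq_iff)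
qed

lemma nn_integral_fejer_kernel:
  assumes "n > 0"
  shows "(\<integral>\<^sup>+ w. ennreal (fejer_kernel n (z - w)) \<partial>torus_measure) = ennreal ((2*pi)\<^sup>2)"
  by (subst nn_integral_eq_integral[OF integrable_fejer_kernel]) (simp_all add: fejer_kernel_nonneg integral_fejer_kernel[OF assms])

text \<open>Tonelli's theorem; as the kernel is even, it has the same mass in z as in w.\<close>

lemma nn_integral_fejer:
  assumes n: "n > 0" and [measurable]: "\<phi> \<in> borel_measurable torus_measure"
  shows "(\<integral>\<^sup>+ z. (\<integral>\<^sup>+ w. \<phi> w * ennreal (fejer_kernel n (z - w)) \<partial>torus_measure) \<partial>torus_measure) = ennreal ((2*pi)\<^sup>2) * (\<integral>\<^sup>+ w. \<phi> w \<partial>torus_measure)"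
proof -
  interpret T: finite_measure torus_measure by (rule finite_measure_torus)
  interpret P: pair_sigma_finite torus_measure torus_measure by unfold_locales
  have id [measurable]: "(\<lambda>z. z) \<in> torus_measure \<rightarrow>\<^sub>M borel"
    by (rule measurable_torus_continuous) (rule continuous_on_id)
  have [measurable]: "fejer_kernel n \<in> borel_measurable borel"
    by (rule borel_measurable_continuous_onI) (intro continuous_intros)
  have "(\<lambda>(z, w). \<phi> w * ennreal (fejer_kernel n (z - w))) \<in> borel_measurable (torus_measure \<Otimes>\<^sub>M torus_measure)"
    by measurable
  from P.Fubini[OF this] have "(\<integral>\<^sup>+ z. (\<integral>\<^sup>+ w. \<phi> w * ennreal (fejer_kernel n (z - w)) \<partial>torus_measure) \<partial>torus_measure) =
     (\<integral>\<^sup>+ w. (\<integral>\<^sup>+ z. \<phi> w * ennreal (fejer_kernel n (z - w)) \<partial>torus_measure) \<partial>torus_measure)"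
    by simp
  also have "\<dots> = (\<integral>\<^sup>+ w. \<phi> w * ennreal ((2*pi)\<^sup>2) \<partial>torus_measure)"
  proof (rule nn_integral_cong)
    fix w
    have "fejer_kernel n (z - w) = fejer_kernel n (w - z)" for z
      using fejer_kernel_minus[of n "w - z"] by simp
    then show "(\<integral>\<^sup>+ z. \<phi> w * ennreal (fejer_kernel n (z - w)) \<partial>torus_measure) = \<phi> w * ennreal ((2*pi)\<^sup>2)"
      by (simp only:) (subst nn_integral_cmult, simp, simp only: nn_integral_fejer_kernel[OF n])
  qed
  also have "\<dots> = ennreal ((2*pi)\<^sup>2) * (\<integral>\<^sup>+ w. \<phi> w \<partial>torus_measure)"
    by (subst nn_integral_multc) (auto simp: mult.commute)
  finally show ?thesis .
qed

lemma norm_fejer_le: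
  assumes F: "integrable torus_measure F"
  shows "norm (fejer n F z) \<le> (LINT w|torus_measure. norm (F w) * fejer_kernel n (z - w)) / (2*pi)\<^sup>2"
proof -
  have "norm (LINT w|torus_measure. F w * of_real (fejer_kernel n (z - w))) \<le> (LINT w|torus_measure. norm (F w * of_real (fejer_kernel n (z - w))))"
    by (rule integral_norm_bound)
  also have "\<dots> = (LINT w|torus_measure. norm (F w) * fejer_kernel n (z - w))"
    by (simp add: norm_mult fejer_kernel_nonneg)
  finally show ?thesis unfolding fejer_integral[OF F] norm_divide
    by (simp add: norm_power divide_right_mono)
qed

text \<open>Jensen's inequality for the probability density given by the normalised kernel: the
  tangent inequality at the kernel mean t is integrated against it, and the result is integrated in
  z.\<close>

lemma Lp_norm_fejer_le:
  assumes p: "p > 1" and F: "F \<in> torus_Lp p" and n: "n > 0"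
  shows "Lp_norm p (fejer n F) \<le> Lp_norm p F"
proof -
  let ?c = "(2*pi)\<^sup>2 :: real" and ?K = "\<lambda>z w. fejer_kernel n (z - w)"
  have c: "?c > 0" by simp
  have Fi: "integrable torus_measure F" by (rule integrable_torus[OF p F])
  have [measurable]: "F \<in> borel_measurable torus_measure" using Fi by simp
  have Fp: "integrable torus_measure (\<lambda>w. norm (F w) powr p)"
    using F unfolding torus_Lp_iff Lp_norm_less_top pint_def by (intro integrableI_nonneg) simp_all
  have pw: "ennreal (norm (fejer n F z) powr p) \<le> (\<integral>\<^sup>+ w. ennreal (norm (F w) powr p / ?c) * ennreal (?K z w) \<partial>torus_measure)" for z
  proof -
    define t where "t = (LINT w|torus_measure. norm (F w) * ?K z w) / ?c"
    have t0: "t \<ge> 0" unfolding t_def by (intro divide_nonneg_nonneg integral_nonneg) (auto simp: fejer_kernel_nonneg)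
    let ?A = "t powr p - p * t powr (p - 1) * t" and ?B = "p * t powr (p - 1)"
    have i: "integrable torus_measure (\<lambda>w. norm (F w) * ?K z w)" "integrable torus_measure (\<lambda>w. norm (F w) powr p * ?K z w)"
      by (intro integrable_mult_fejer_kernel integrable_norm Fi Fp)+
    have "norm (fejer n F z) powr p \<le> t powr p" unfolding t_def using p by (intro powr_mono2 norm_fejer_le[OF Fi]) auto
    also have "t powr p = (?A * (LINT w|torus_measure. ?K z w) + ?B * (LINT w|torus_measure. norm (F w) * ?K z w)) / ?c"
      using c unfolding integral_fejer_kernel[OF n] by (simp add: t_def field_simps)
    also have "?A * (LINT w|torus_measure. ?K z w) + ?B * (LINT w|torus_measure. norm (F w) * ?K z w) =
        (LINT w|torus_measure. ?A * ?K z w + ?B * (norm (F w) * ?K z w))"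
      using i(1) integrable_fejer_kernel[of n z] by (subst Bochner_Integration.integral_add) auto
    also have "\<dots> \<le> (LINT w|torus_measure. norm (F w) powr p * ?K z w)"
    proof (rule integral_mono)
      show "integrable torus_measure (\<lambda>w. ?A * ?K z w + ?B * (norm (F w) * ?K z w))"
        using i(1) integrable_fejer_kernel[of n z] by auto
      show "?A * ?K z w + ?B * (norm (F w) * ?K z w) \<le> norm (F w) powr p * ?K z w" for w
        using mult_right_mono[OF powr_tangent[OF p, of "norm (F w)" t] fejer_kernel_nonneg[of n "z - w"]] t0
        by (simp add: algebra_simps)
    qed (rule i)
    finally have "norm (fejer n F z) powr p \<le> (LINT w|torus_measure. norm (F w) powr p * ?K z w) / ?c"
      by (simp add: divide_right_mono)
    also have "\<dots> = (LINT w|torus_measure. norm (F w) powr p / ?c * ?K z w)" by simp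
    finally have "ennreal (norm (fejer n F z) powr p) \<le> ennreal (LINT w|torus_measure. norm (F w) powr p / ?c * ?K z w)"
      by (rule ennreal_leI)
    also have "\<dots> = (\<integral>\<^sup>+ w. ennreal (norm (F w) powr p / ?c * ?K z w) \<partial>torus_measure)"
      by (rule nn_integral_eq_integral[symmetric]) (use i(2) fejer_kernel_nonneg in auto)
    also have "\<dots> = (\<integral>\<^sup>+ w. ennreal (norm (F w) powr p / ?c) * ennreal (?K z w) \<partial>torus_measure)"
      by (simp add: ennreal_mult' fejer_kernel_nonneg flip: times_divide_eq_left)
    finally show ?thesis .
  qed
  have "pint p (fejer n F) \<le> (\<integral>\<^sup>+ z. (\<integral>\<^sup>+ w. ennreal (norm (F w) powr p / ?c) * ennreal (?K z w) \<partial>torus_measure) \<partial>torus_measure)"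
    unfolding pint_def by (intro nn_integral_mono pw)
  also have "\<dots> = ennreal ?c * (\<integral>\<^sup>+ w. ennreal (norm (F w) powr p / ?c) \<partial>torus_measure)"
    by (rule nn_integral_fejer[OF n]) measurable
  also have "\<dots> = (\<integral>\<^sup>+ w. ennreal ?c * ennreal (norm (F w) powr p / ?c) \<partial>torus_measure)"
    by (rule nn_integral_cmult[symmetric]) measurable
  also have "\<dots> = pint p F" unfolding pint_def by (simp flip: ennreal_mult')
  finally have le: "pint p (fejer n F) \<le> pint p F" .
  obtain x where x: "x \<ge> 0" "Lp_norm p F = ennreal x" using F by (cases "Lp_norm p F") (auto simp: torus_Lp_iff)
  then have "pint p F \<le> ennreal (x powr p)" using Lp_norm_le_iff[of p x F] p by simp
  then show ?thesis using le Lp_norm_le_iff[of p x "fejer n F"] p x by simp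
qed

text \<open>The exponent 1 needs no convexity, only the triangle inequality under the integral and
  the mass of the kernel. It serves the density argument for L_1.\<close>

lemma L1_fejer_le:
  assumes F: "integrable torus_measure F" and n: "n > 0"
  shows "(LINT z|torus_measure. norm (fejer n F z)) \<le> (LINT z|torus_measure. norm (F z))"
proof -
  let ?c = "(2*pi)\<^sup>2 :: real" and ?K = "\<lambda>z w. fejer_kernel n (z - w)"
  have [measurable]: "F \<in> borel_measurable torus_measure" using F by simp
  have pw: "ennreal (norm (fejer n F z)) \<le> (\<integral>\<^sup>+ w. ennreal (norm (F w) / ?c) * ennreal (?K z w) \<partial>torus_measure)" for z
  proof -
    have i: "integrable torus_measure (\<lambda>w. norm (F w) * ?K z w)" by (intro integrable_mult_fejer_kernel integrable_norm F)
    have "norm (fejer n F z) \<le> (LINT w|torus_measure. norm (F w) / ?c * ?K z w)"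
      using norm_fejer_le[OF F, of n z] by simp
    then have "ennreal (norm (fejer n F z)) \<le> ennreal (LINT w|torus_measure. norm (F w) / ?c * ?K z w)"
      by (rule ennreal_leI)
    also have "\<dots> = (\<integral>\<^sup>+ w. ennreal (norm (F w) / ?c * ?K z w) \<partial>torus_measure)"
      by (rule nn_integral_eq_integral[symmetric]) (use i fejer_kernel_nonneg in auto)
    also have "\<dots> = (\<integral>\<^sup>+ w. ennreal (norm (F w) / ?c) * ennreal (?K z w) \<partial>torus_measure)"
      by (simp add: ennreal_mult' fejer_kernel_nonneg flip: times_divide_eq_left)
    finally show ?thesis .
  qed
  have "(\<integral>\<^sup>+ z. ennreal (norm (fejer n F z)) \<partial>torus_measure) \<le> (\<integral>\<^sup>+ z. (\<integral>\<^sup>+ w. ennreal (norm (F w) / ?c) * ennreal (?K z w) \<partial>torus_measure) \<partial>torus_measure)"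
    by (intro nn_integral_mono pw)
  also have "\<dots> = ennreal ?c * (\<integral>\<^sup>+ w. ennreal (norm (F w) / ?c) \<partial>torus_measure)"
    by (rule nn_integral_fejer[OF n]) measurable
  also have "\<dots> = (\<integral>\<^sup>+ w. ennreal ?c * ennreal (norm (F w) / ?c) \<partial>torus_measure)"
    by (rule nn_integral_cmult[symmetric]) measurable
  also have "\<dots> = (\<integral>\<^sup>+ w. ennreal (norm (F w)) \<partial>torus_measure)" by (simp flip: ennreal_mult')
  also have "\<dots> = ennreal (LINT w|torus_measure. norm (F w))"
    by (rule nn_integral_eq_integral) (use F in auto)
  finally have le: "(\<integral>\<^sup>+ z. ennreal (norm (fejer n F z)) \<partial>torus_measure) \<le> ennreal (LINT w|torus_measure. norm (F w))" .
  have "(\<lambda>z. norm (fejer n F z)) \<in> borel_measurable torus_measure"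
    unfolding fejer_def by (intro measurable_torus_continuous continuous_intros continuous_trig)
  from integral_eq_nn_integral[OF this] have "(LINT z|torus_measure. norm (fejer n F z)) = enn2real (\<integral>\<^sup>+ z. ennreal (norm (fejer n F z)) \<partial>torus_measure)"
    by simp
  also have "\<dots> \<le> enn2real (ennreal (LINT w|torus_measure. norm (F w)))"
    by (rule enn2real_mono[OF le]) simp
  finally show ?thesis by simp
qed

text \<open>Korovkin's argument: away from \<open>z\<close> the oscillation of \<open>g\<close> is dominated by the trigonometric
  polynomial \<open>2 - cos - cos\<close>, whose Fejer means are explicit.\<close>

lemma fejer_tendsto_interior:
  assumes g: "continuous_on UNIV g" and M: "\<And>w. norm (g w) \<le> M"
    and z: "fst z \<in> {0<..<2*pi}" "snd z \<in> {0<..<2*pi}"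
  shows "(\<lambda>n. fejer (Suc n) g z) \<longlonglongrightarrow> g z"
proof (rule LIMSEQ_I)
  fix e :: real assume e: "e > 0"
  let ?c = "(2*pi)\<^sup>2 :: real" and ?Q = "{0..2*pi} \<times> {0..2*pi}"
  have M0: "M \<ge> 0" using M[of 0] norm_ge_zero[of "g 0"] by linarith
  have gi: "integrable torus_measure g" using g M by (intro integrable_torus_bounded measurable_torus_continuous)
  define q where "q w = 2 - cos (fst (z - w)) - cos (snd (z - w))" for w
  have qc: "continuous_on S q" for S unfolding q_def[abs_def] by (intro continuous_intros)
  have q0: "q w \<ge> 0" for w unfolding q_def using cos_le_one[of "fst (z - w)"] cos_le_one[of "snd (z - w)"] by linarith
  obtain \<eta> where \<eta>: "\<eta> > 0" "\<And>w. dist w z < \<eta> \<Longrightarrow> dist (g w) (g z) < e / 2"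
    using g e unfolding continuous_on_iff by (metis UNIV_I half_gt_zero)
  define T where "T = ?Q \<inter> {w. dist w z \<ge> \<eta>}"
  have "compact T"
  proof -
    have "compact ?Q" by (intro compact_Times) auto
    moreover have "closed {w. dist w z \<ge> \<eta>}" by (intro closed_Collect_le continuous_intros)
    ultimately show ?thesis unfolding T_def by (rule compact_Int_closed)
  qed
  have qpos: "q w > 0" if "w \<in> T" for w
  proof (rule ccontr)
    assume "\<not> q w > 0"
    then have "2 - cos (fst z - fst w) - cos (snd z - snd w) \<le> 0" by (simp add: q_def)
    then have "cos (fst z - fst w) = 1" "cos (snd z - snd w) = 1"
      using cos_le_one[of "fst z - fst w"] cos_le_one[of "snd z - snd w"] by linarith+
    moreover have "x = 0" if cx: "cos x = 1" "\<bar>x\<bar> < 2*pi" for x :: real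
    proof -
      obtain k :: int where "x = of_int k * 2 * pi" using cx(1) unfolding cos_one_2pi_int by blast
      then have k: "x = of_int k * (2*pi)" by simp
      have "\<bar>of_int k\<bar> * (2*pi) < 1 * (2*pi)" using cx(2) by (simp add: k abs_mult)
      then have "\<bar>real_of_int k\<bar> < 1" by (subst (asm) mult_less_cancel_right) auto
      then show ?thesis by (simp add: k)
    qed
    \<comment> \<open>As z is an interior point and w lies in the closed square, the differences are
      smaller than a full period, so both cosines equal 1 only for w = z.\<close>
    moreover have "\<bar>fst z - fst w\<bar> < 2*pi" "\<bar>snd z - snd w\<bar> < 2*pi" using that z by (auto simp: T_def)
    ultimately have "w = z" by (simp add: prod_eq_iff) (metis eq_iff_diff_eq_0)
    then show False using that \<eta> by (simp add: T_def)
  qed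
  have near: "norm (g w - g z) \<le> e / 2" if "w \<in> ?Q" "w \<notin> T" for w
  proof -
    have "\<not> \<eta> \<le> dist w z" using that unfolding T_def by blast
    then show ?thesis using \<eta>(2)[of w] by (simp add: dist_norm)
  qed
  obtain C where C: "C \<ge> 0" "\<And>w. w \<in> ?Q \<Longrightarrow> norm (g w - g z) \<le> e / 2 + C * q w"
  proof (cases "T = {}")
    case True
    then have "norm (g w - g z) \<le> e / 2 + 0 * q w" if "w \<in> ?Q" for w
      using near[OF that] True by simp
    then show ?thesis by (intro that[of 0]) auto
  next
    case False
    obtain w0 where w0: "w0 \<in> T" "\<And>w. w \<in> T \<Longrightarrow> q w0 \<le> q w"
      using continuous_attains_inf[OF \<open>compact T\<close> False qc] by blast
    have p0: "q w0 > 0" by (rule qpos[OF w0(1)])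
    have "norm (g w - g z) \<le> e / 2 + 2 * M / q w0 * q w" if "w \<in> ?Q" for w
    proof (cases "w \<in> T")
      case True
      have "norm (g w - g z) \<le> 2 * M" using norm_triangle_ineq4[of "g w" "g z"] M[of w] M[of z] by linarith
      also have "\<dots> = 2 * M / q w0 * q w0" using p0 by simp
      also have "\<dots> \<le> 2 * M / q w0 * q w" using w0(2)[OF True] M0 p0 by (intro mult_left_mono) auto
      finally show ?thesis using e by simp
    next
      case F: False
      then have "norm (g w - g z) \<le> e / 2" by (rule near[OF that])
      then show ?thesis using q0[of w] M0 p0 by (intro order_trans[OF _ le_add_same_cancel1[THEN iffD2]]) auto
    qed
    then show ?thesis using M0 p0 by (intro that[of "2 * M / q w0"]) auto
  qed
  \<comment> \<open>The Fejer mean of 2 - cos - cos at its zero is 2/(n + 1), so the total error is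
    at most e/2 + 2C/(n + 1), which is below e from this N on.\<close>
  obtain N where N: "4 * C / e < real N" using reals_Archimedean2 by blast
  show "\<exists>no. \<forall>n\<ge>no. norm (fejer (Suc n) g z - g z) < e"
  proof (intro exI[of _ N] allI impI)
    fix n assume "n \<ge> N"
    let ?K = "\<lambda>w. fejer_kernel (Suc n) (z - w)"
    have iK: "integrable torus_measure ?K" by (rule integrable_fejer_kernel)
    have ig: "integrable torus_measure (\<lambda>w. g w - g z)"
      using gi finite_measure.integrable_const[OF finite_measure_torus] by (intro Bochner_Integration.integrable_diff)
    have "fejer (Suc n) g z - g z = fejer (Suc n) (\<lambda>w. g w - g z) z"
    proof -
      have i1: "integrable torus_measure (\<lambda>w. g w * of_real (?K w))"
      proof (rule Bochner_Integration.integrable_bound)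
        show "integrable torus_measure (\<lambda>w. norm (g w) * ?K w)" by (intro integrable_mult_fejer_kernel integrable_norm gi)
        have [measurable]: "g \<in> borel_measurable torus_measure" using gi by simp
        show "(\<lambda>w. g w * of_real (?K w)) \<in> borel_measurable torus_measure" by measurable
      qed (simp add: norm_mult)
      have i2: "integrable torus_measure (\<lambda>w. g z * of_real (?K w))" using iK by simp
      have "(LINT w|torus_measure. (g w - g z) * of_real (?K w)) = (LINT w|torus_measure. g w * of_real (?K w)) - g z * of_real ?c"
        unfolding left_diff_distrib by (subst Bochner_Integration.integral_diff[OF i1 i2]) (simp add: integral_fejer_kernel)
      then show ?thesis unfolding fejer_integral[OF gi] fejer_integral[OF ig] by (simp add: field_simps)
    qed
    then have "norm (fejer (Suc n) g z - g z) \<le> (LINT w|torus_measure. norm (g w - g z) * ?K w) / ?c"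
      using norm_fejer_le[OF ig] by simp
    also have "(LINT w|torus_measure. norm (g w - g z) * ?K w) \<le>
       (LINT w|torus_measure. (e / 2 + 2 * C) * ?K w - C * (cos (fst (z - w)) * ?K w) - C * (cos (snd (z - w)) * ?K w))"
    proof (rule integral_mono)
      show "integrable torus_measure (\<lambda>w. norm (g w - g z) * ?K w)" by (intro integrable_mult_fejer_kernel integrable_norm ig)
      show "integrable torus_measure (\<lambda>w. (e / 2 + 2 * C) * ?K w - C * (cos (fst (z - w)) * ?K w) - C * (cos (snd (z - w)) * ?K w))"
        by (intro Bochner_Integration.integrable_diff integrable_mult_right iK integrable_mult_fejer_kernel integrable_torus_bounded[where M=1])
           (auto intro!: measurable_torus_continuous continuous_intros)
      fix w assume "w \<in> space torus_measure"
      then have "norm (g w - g z) * ?K w \<le> (e / 2 + C * q w) * ?K w"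
        by (intro mult_right_mono C fejer_kernel_nonneg) (simp add: space_torus)
      then show "norm (g w - g z) * ?K w \<le> (e / 2 + 2 * C) * ?K w - C * (cos (fst (z - w)) * ?K w) - C * (cos (snd (z - w)) * ?K w)"
        by (simp add: q_def algebra_simps)
    qed
    also have "(LINT w|torus_measure. (e / 2 + 2 * C) * ?K w - C * (cos (fst (z - w)) * ?K w) - C * (cos (snd (z - w)) * ?K w)) =
       (e / 2 + 2 * C) * ?c - C * (LINT w|torus_measure. cos (fst (z - w)) * ?K w) - C * (LINT w|torus_measure. cos (snd (z - w)) * ?K w)"
    proof -
      have i: "integrable torus_measure (\<lambda>w. C * (cos (fst (z - w)) * ?K w))" "integrable torus_measure (\<lambda>w. C * (cos (snd (z - w)) * ?K w))"
        by (intro integrable_mult_right integrable_mult_fejer_kernel integrable_torus_bounded[where M=1];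
            auto intro!: measurable_torus_continuous continuous_intros)+
      have i3: "integrable torus_measure (\<lambda>w. (e / 2 + 2 * C) * ?K w)" using iK by simp
      show ?thesis
        by (subst Bochner_Integration.integral_diff[OF Bochner_Integration.integrable_diff[OF i3 i(1)] i(2)],
            subst Bochner_Integration.integral_diff[OF i3 i(1)]) (simp add: integral_fejer_kernel)
    qed
    also have "(LINT w|torus_measure. cos (fst (z - w)) * ?K w) = ?c * (real n / real (Suc n))"
    proof -
      have "integrable torus_measure (\<lambda>w. cis (dotp (1, 0) (z - w)) * of_real (?K w))"
        by (rule Bochner_Integration.integrable_bound[OF iK])
           (auto simp: norm_mult intro!: measurable_torus_continuous continuous_intros)
      from integral_Re[OF this] show ?thesis
        using fejer_character[of "(1, 0)" z "Suc n"] fejer_weight_1(1)[of "Suc n"] by (simp add: dotp_def del: of_real_mult of_nat_Suc uminus_prod_def)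
    qed
    also have "(LINT w|torus_measure. cos (snd (z - w)) * ?K w) = ?c * (real n / real (Suc n))"
    proof -
      have "integrable torus_measure (\<lambda>w. cis (dotp (0, 1) (z - w)) * of_real (?K w))"
        by (rule Bochner_Integration.integrable_bound[OF iK])
           (auto simp: norm_mult intro!: measurable_torus_continuous continuous_intros)
      from integral_Re[OF this] show ?thesis
        using fejer_character[of "(0, 1)" z "Suc n"] fejer_weight_1(2)[of "Suc n"] by (simp add: dotp_def del: of_real_mult of_nat_Suc uminus_prod_def)
    qed
    also have "((e / 2 + 2 * C) * ?c - C * (?c * (real n / real (Suc n))) - C * (?c * (real n / real (Suc n)))) / ?c = e / 2 + 2 * C / real (Suc n)"
    proof -
      have y: "real n / real (Suc n) = 1 - 1 / real (Suc n)" by (simp add: field_simps)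
      have "((e / 2 + 2 * C) * c - C * (c * (1 - y)) - C * (c * (1 - y))) / c = e / 2 + 2 * C * y" if "c > 0" for c y :: real
        using that by (simp add: field_simps)
      from this[of ?c "1 / real (Suc n)"] show ?thesis unfolding y by simp
    qed
    finally have "norm (fejer (Suc n) g z - g z) \<le> e / 2 + 2 * C / real (Suc n)" by (simp add: divide_right_mono)
    also have "2 * C / real (Suc n) < e / 2"
    proof -
      have "4 * C < e * real N" using N e by (simp add: field_simps)
      also have "\<dots> \<le> e * real (Suc n)" using \<open>n \<ge> N\<close> e by (intro mult_left_mono) auto
      finally show ?thesis by (simp add: field_simps)
    qed
    finally show "norm (fejer (Suc n) g z - g z) < e" by simp
  qed
qed

section \<open>Convergence in L_1 and recovery of the L_p norm\<close>

lemma AE_torusI: "(AE z in lebesgue. P z) \<Longrightarrow> (AE z in torus_measure. P z)"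
  unfolding torus_measure_def by (subst AE_restrict_space_iff) (auto simp: sets_torus_Q elim!: eventually_mono)

lemma AE_torus_interior: "AE z in torus_measure. fst z \<in> {0<..<2*pi} \<and> snd z \<in> {0<..<2*pi}"
proof -
  have ne: "AE z in torus_measure. fst z \<noteq> c" "AE z in torus_measure. snd z \<noteq> c" for c
    using AE_not_in[OF line_null(1)[of c]] AE_not_in[OF line_null(2)[of c]] by (auto intro!: AE_torusI)
  show ?thesis
    using ne(1)[of 0] ne(1)[of "2*pi"] ne(2)[of 0] ne(2)[of "2*pi"] AE_space
    by eventually_elim (auto simp: space_torus)
qed

text \<open>Radial projection onto the disc of radius M. Being continuous, it truncates approximants
  without destroying their continuity.\<close>

definition clip :: "real \<Rightarrow> complex \<Rightarrow> complex" where
  "clip M z = of_real (M / max M (norm z)) * z"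

lemma continuous_clip: "M > 0 \<Longrightarrow> continuous_on S (clip M)"
  unfolding clip_def by (intro continuous_intros) (auto simp: max_def)

lemma norm_clip: "M > 0 \<Longrightarrow> norm (clip M z) \<le> M"
  by (auto simp: clip_def norm_mult norm_divide max_def divide_le_eq mult_left_mono)

lemma clip_eq: "norm z \<le> M \<Longrightarrow> M > 0 \<Longrightarrow> clip M z = z"
  by (simp add: clip_def max_def)

lemma norm_diff_clip: "M > 0 \<Longrightarrow> norm (z - clip M z) \<le> norm z"
proof -
  assume M: "M > 0"
  define s where "s = M / max M (norm z)"
  have s: "0 \<le> s" "s \<le> 1" using M by (auto simp: s_def max_def divide_le_eq)
  have "z - clip M z = of_real (1 - s) * z" by (simp add: clip_def s_def algebra_simps)
  then have "norm (z - clip M z) = \<bar>1 - s\<bar> * norm z" by (simp add: norm_mult del: of_real_diff)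
  also have "\<dots> \<le> 1 * norm z" using s by (intro mult_right_mono) auto
  finally show ?thesis by simp
qed

text \<open>The function is truncated first, then replaced by truncations of continuous functions
  converging to it almost everywhere; both errors vanish by dominated convergence.\<close>

lemma continuous_dense_L1:
  fixes F :: "real \<times> real \<Rightarrow> complex"
  assumes F: "integrable torus_measure F" "F \<in> borel_measurable lebesgue" and e: "e > 0"
  shows "\<exists>g M. continuous_on UNIV g \<and> (\<forall>z. norm (g z) \<le> M) \<and> (LINT z|torus_measure. norm (F z - g z)) < e"
proof -
  have [measurable]: "F \<in> borel_measurable torus_measure" using F by simp
  have clipm [measurable]: "clip M \<in> borel_measurable borel" if "M > 0" for M
    by (intro borel_measurable_continuous_onI continuous_clip that)
  have "(\<lambda>m. LINT z|torus_measure. norm (F z - clip (real (Suc m)) (F z))) \<longlonglongrightarrow> (LINT z|torus_measure. 0)"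
  proof (rule integral_dominated_convergence[where w="\<lambda>z. norm (F z)"])
    show "AE z in torus_measure. (\<lambda>m. norm (F z - clip (real (Suc m)) (F z))) \<longlonglongrightarrow> 0"
    proof (intro AE_I2 tendsto_eventually)
      fix z
      obtain N where N: "norm (F z) \<le> real N" using real_arch_simple by blast
      show "eventually (\<lambda>m. norm (F z - clip (real (Suc m)) (F z)) = 0) sequentially"
        using eventually_ge_at_top[of N] by eventually_elim (use N in \<open>simp add: clip_eq\<close>)
    qed
    show "AE z in torus_measure. norm (norm (F z - clip (real (Suc m)) (F z))) \<le> norm (F z)" for m
      by (intro AE_I2) (simp add: norm_diff_clip)
    show "(\<lambda>z. norm (F z - clip (real (Suc m)) (F z))) \<in> borel_measurable torus_measure" for m
      using clipm[of "real (Suc m)"] by measurable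
  qed (use F in auto)
  then have "eventually (\<lambda>m. (LINT z|torus_measure. norm (F z - clip (real (Suc m)) (F z))) < e / 2) sequentially"
    using e by (intro order_tendstoD) auto
  then obtain m where m: "(LINT z|torus_measure. norm (F z - clip (real (Suc m)) (F z))) < e / 2"
    by (auto simp: eventually_sequentially)
  define M where "M = real (Suc m)"
  have M: "M > 0" by (simp add: M_def)
  note [measurable] = clipm[OF M]
  \<comment> \<open>This form of Lebesgue measurability supplies the continuous functions,
    converging outside a negligible set.\<close>
  have "F measurable_on UNIV" by (rule lebesgue_measurable_imp_measurable_on[OF F(2)]) simp
  then obtain N g where N: "negligible N" and g: "\<And>n. continuous_on UNIV (g n)" "\<And>x. x \<notin> N \<Longrightarrow> (\<lambda>n. g n x) \<longlonglongrightarrow> F x"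
    by (auto simp: measurable_on_def)
  have aeN: "AE z in torus_measure. z \<notin> N"
    using N by (intro AE_torusI AE_not_in) (simp add: negligible_iff_null_sets)
  have [measurable]: "g n \<in> borel_measurable torus_measure" for n by (rule measurable_torus_continuous[OF g(1)])
  have "(\<lambda>n. LINT z|torus_measure. norm (clip M (F z) - clip M (g n z))) \<longlonglongrightarrow> (LINT z|torus_measure. 0)"
  proof (rule integral_dominated_convergence[where w="\<lambda>z. 2 * M"])
    show "AE z in torus_measure. (\<lambda>n. norm (clip M (F z) - clip M (g n z))) \<longlonglongrightarrow> 0"
      using aeN
    proof eventually_elim
      case (elim z)
      have "isCont (clip M) (F z)" using continuous_clip[OF M, of UNIV] by (simp add: continuous_on_eq_continuous_at)
      then have "(\<lambda>n. clip M (g n z)) \<longlonglongrightarrow> clip M (F z)" by (rule isCont_tendsto_compose) (rule g(2)[OF elim])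
      then have "(\<lambda>n. norm (clip M (F z) - clip M (g n z))) \<longlonglongrightarrow> norm (clip M (F z) - clip M (F z))"
        by (intro tendsto_intros)
      then show ?case by simp
    qed
    show "AE z in torus_measure. norm (norm (clip M (F z) - clip M (g n z))) \<le> 2 * M" for n
    proof (intro AE_I2)
      fix z
      show "norm (norm (clip M (F z) - clip M (g n z))) \<le> 2 * M"
        using norm_triangle_ineq4[of "clip M (F z)" "clip M (g n z)"] norm_clip[OF M, of "F z"] norm_clip[OF M, of "g n z"] by simp
    qed
    show "integrable torus_measure (\<lambda>z. 2 * M)" by (rule finite_measure.integrable_const[OF finite_measure_torus])
  qed measurable
  then have "eventually (\<lambda>n. (LINT z|torus_measure. norm (clip M (F z) - clip M (g n z))) < e / 2) sequentially"
    using e by (intro order_tendstoD) auto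
  then obtain n where n: "(LINT z|torus_measure. norm (clip M (F z) - clip M (g n z))) < e / 2"
    by (auto simp: eventually_sequentially)
  have ic: "integrable torus_measure (\<lambda>z. clip M (h z))" if [measurable]: "h \<in> borel_measurable torus_measure" for h
    by (rule integrable_torus_bounded[where M=M]) (auto simp: norm_clip[OF M])
  have i: "integrable torus_measure (\<lambda>z. norm (F z - clip M (F z)))" "integrable torus_measure (\<lambda>z. norm (clip M (F z) - clip M (g n z)))"
    "integrable torus_measure (\<lambda>z. norm (F z - clip M (g n z)))"
    by (intro integrable_norm Bochner_Integration.integrable_diff ic F; measurable)+
  have "(LINT z|torus_measure. norm (F z - clip M (g n z))) \<le> (LINT z|torus_measure. norm (F z - clip M (F z)) + norm (clip M (F z) - clip M (g n z)))"
    by (intro integral_mono i Bochner_Integration.integrable_add norm_diff_triangle_le) auto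
  also have "\<dots> = (LINT z|torus_measure. norm (F z - clip M (F z))) + (LINT z|torus_measure. norm (clip M (F z) - clip M (g n z)))"
    by (rule Bochner_Integration.integral_add[OF i(1,2)])
  also have "\<dots> < e" using m n by (simp add: M_def)
  finally have "(LINT z|torus_measure. norm (F z - clip M (g n z))) < e" .
  moreover have "continuous_on UNIV (\<lambda>z. clip M (g n z))"
    using continuous_on_compose2[OF continuous_clip[OF M, of UNIV] g(1)] by simp
  ultimately show ?thesis using norm_clip[OF M] by (intro exI[of _ "\<lambda>z. clip M (g n z)"] exI[of _ M]) auto
qed

lemma fejer_diff:
  assumes F: "integrable torus_measure F" and G: "integrable torus_measure G"
  shows "fejer n (\<lambda>w. F w - G w) z = fejer n F z - fejer n G z"
proof -
  have i: "integrable torus_measure (\<lambda>w. H w * of_real (fejer_kernel n (z - w)))" if H: "integrable torus_measure H" for H :: "real \<times> real \<Rightarrow> complex"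
  proof (rule Bochner_Integration.integrable_bound)
    show "integrable torus_measure (\<lambda>w. norm (H w) * fejer_kernel n (z - w))" by (intro integrable_mult_fejer_kernel integrable_norm H)
    have [measurable]: "H \<in> borel_measurable torus_measure" using H by simp
    show "(\<lambda>w. H w * of_real (fejer_kernel n (z - w))) \<in> borel_measurable torus_measure" by measurable
  qed (simp add: norm_mult)
  show ?thesis
    unfolding fejer_integral[OF F] fejer_integral[OF G] fejer_integral[OF Bochner_Integration.integrable_diff[OF F G]] left_diff_distrib
    by (subst Bochner_Integration.integral_diff[OF i[OF F] i[OF G]]) (rule diff_divide_distrib)
qed

lemma continuous_fejer: "continuous_on S (fejer n F)"
  unfolding fejer_def by (rule continuous_trig)

text \<open>The continuous approximant is not assumed periodic, so its Fejer means are followed only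
  at interior points of the square, which is almost everywhere. The error of approximation is
  controlled by the contraction property in L_1.\<close>

lemma fejer_L1_convergence:
  assumes F: "integrable torus_measure F" "F \<in> borel_measurable lebesgue"
  shows "(\<lambda>n. LINT z|torus_measure. norm (fejer (Suc n) F z - F z)) \<longlonglongrightarrow> 0"
proof (rule LIMSEQ_I)
  fix e :: real assume e: "e > 0"
  obtain g M where g: "continuous_on UNIV g" "\<And>z. norm (g z) \<le> M" and Fg: "(LINT z|torus_measure. norm (F z - g z)) < e / 3"
    using continuous_dense_L1[OF F, of "e / 3"] e by auto
  have [measurable]: "fejer n H \<in> borel_measurable torus_measure" for n H by (rule measurable_torus_continuous[OF continuous_fejer])
  have [measurable]: "g \<in> borel_measurable torus_measure" by (rule measurable_torus_continuous[OF g(1)])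
  have gi: "integrable torus_measure g" using g by (intro integrable_torus_bounded) auto
  have bd: "norm (fejer (Suc n) g z) \<le> M" for n z
  proof -
    have "norm (fejer (Suc n) g z) \<le> (LINT w|torus_measure. norm (g w) * fejer_kernel (Suc n) (z - w)) / (2*pi)\<^sup>2"
      by (rule norm_fejer_le[OF gi])
    also have "(LINT w|torus_measure. norm (g w) * fejer_kernel (Suc n) (z - w)) \<le> (LINT w|torus_measure. M * fejer_kernel (Suc n) (z - w))"
      by (intro integral_mono integrable_mult_fejer_kernel integrable_norm gi integrable_mult_right integrable_fejer_kernel mult_right_mono fejer_kernel_nonneg g)
    also have "\<dots> = M * (2*pi)\<^sup>2" by (simp add: integral_fejer_kernel)
    finally show ?thesis by (simp add: divide_right_mono)
  qed
  have "(\<lambda>n. LINT z|torus_measure. norm (fejer (Suc n) g z - g z)) \<longlonglongrightarrow> (LINT z|torus_measure. 0)"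
  proof (rule integral_dominated_convergence[where w="\<lambda>z. 2 * M"])
    show "AE z in torus_measure. (\<lambda>n. norm (fejer (Suc n) g z - g z)) \<longlonglongrightarrow> 0"
      using AE_torus_interior
    proof eventually_elim
      case (elim z)
      have "(\<lambda>n. norm (fejer (Suc n) g z - g z)) \<longlonglongrightarrow> norm (g z - g z)"
        using elim by (intro tendsto_intros fejer_tendsto_interior[OF g]) auto
      then show ?case by simp
    qed
    show "AE z in torus_measure. norm (norm (fejer (Suc n) g z - g z)) \<le> 2 * M" for n
    proof (intro AE_I2)
      fix z
      show "norm (norm (fejer (Suc n) g z - g z)) \<le> 2 * M"
        using norm_triangle_ineq4[of "fejer (Suc n) g z" "g z"] bd[of n z] g(2)[of z] by simp
    qed
    show "integrable torus_measure (\<lambda>z. 2 * M)" by (rule finite_measure.integrable_const[OF finite_measure_torus])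
  qed measurable
  then have "eventually (\<lambda>n. (LINT z|torus_measure. norm (fejer (Suc n) g z - g z)) < e / 3) sequentially"
    using e by (intro order_tendstoD) auto
  then obtain N where N: "\<And>n. n \<ge> N \<Longrightarrow> (LINT z|torus_measure. norm (fejer (Suc n) g z - g z)) < e / 3"
    by (auto simp: eventually_sequentially)
  show "\<exists>no. \<forall>n\<ge>no. norm ((LINT z|torus_measure. norm (fejer (Suc n) F z - F z)) - 0) < e"
  proof (intro exI[of _ N] allI impI)
    fix n assume n: "n \<ge> N"
    let ?D = "\<lambda>w. F w - g w"
    have Di: "integrable torus_measure ?D" using F gi by (intro Bochner_Integration.integrable_diff)
    have ft: "integrable torus_measure (fejer m H)" for m H
    proof -
      have "compact ({0..2*pi} \<times> {0..2*pi} :: (real \<times> real) set)" by (intro compact_Times) auto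
      then have "bounded (fejer m H ` ({0..2*pi} \<times> {0..2*pi}))"
        by (intro compact_imp_bounded compact_continuous_image continuous_fejer)
      then obtain B where B: "\<And>z. z \<in> {0..2*pi} \<times> {0..2*pi} \<Longrightarrow> norm (fejer m H z) \<le> B"
        unfolding bounded_iff by blast
      show ?thesis
        by (rule finite_measure.integrable_const_bound[OF finite_measure_torus, of _ B])
           (auto intro!: AE_I2 B simp: space_torus)
    qed
    have i: "integrable torus_measure (\<lambda>z. norm (fejer (Suc n) ?D z))" "integrable torus_measure (\<lambda>z. norm (fejer (Suc n) g z - g z))"
      "integrable torus_measure (\<lambda>z. norm (?D z))" "integrable torus_measure (\<lambda>z. norm (fejer (Suc n) F z - F z))"
      by (intro integrable_norm Bochner_Integration.integrable_diff ft gi F)+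
    have "(LINT z|torus_measure. norm (fejer (Suc n) F z - F z)) \<le>
       (LINT z|torus_measure. norm (fejer (Suc n) ?D z) + norm (fejer (Suc n) g z - g z) + norm (?D z))"
    proof (intro integral_mono i Bochner_Integration.integrable_add)
      fix z
      have eq: "fejer (Suc n) F z - F z = fejer (Suc n) ?D z + (fejer (Suc n) g z - g z) - ?D z"
        by (simp add: fejer_diff[OF F(1) gi])
      show "norm (fejer (Suc n) F z - F z) \<le> norm (fejer (Suc n) ?D z) + norm (fejer (Suc n) g z - g z) + norm (?D z)"
        unfolding eq using norm_triangle_ineq4[of "fejer (Suc n) ?D z + (fejer (Suc n) g z - g z)" "?D z"]
          norm_triangle_ineq[of "fejer (Suc n) ?D z" "fejer (Suc n) g z - g z"] by linarith
    qed
    also have "\<dots> = (LINT z|torus_measure. norm (fejer (Suc n) ?D z)) + (LINT z|torus_measure. norm (fejer (Suc n) g z - g z)) + (LINT z|torus_measure. norm (?D z))"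
      using i by (subst Bochner_Integration.integral_add, simp, simp, subst Bochner_Integration.integral_add) auto
    also have "\<dots> < e" using L1_fejer_le[OF Di, of "Suc n"] Fg N[OF n] by simp
    finally show "norm ((LINT z|torus_measure. norm (fejer (Suc n) F z - F z)) - 0) < e" by simp
  qed
qed

text \<open>A subsequence of the Fejer means converges almost everywhere, and Fatou's lemma passes
  the bound to F; convergence in L_p itself is never invoked.\<close>

lemma Lp_norm_le_fejer:
  assumes p: "p > 1" and F: "F \<in> torus_Lp p" and B: "\<And>n. Lp_norm p (fejer (Suc n) F) \<le> B"
  shows "Lp_norm p F \<le> B"
proof (cases B)
  case (real b)
  have Fi: "integrable torus_measure F" by (rule integrable_torus[OF p F])
  have Fm: "F \<in> borel_measurable lebesgue" by (rule torus_Lp_measurable[OF F])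
  have [measurable]: "fejer n H \<in> borel_measurable torus_measure" for n H by (rule measurable_torus_continuous[OF continuous_fejer])
  have fi: "integrable torus_measure (fejer n F)" for n
    using integrable_torus[OF p trig_in_torus_Lp] p unfolding fejer_def by simp
  have "\<exists>r. strict_mono r \<and> (AE z in torus_measure. (\<lambda>n. fejer (Suc (r n)) F z - F z) \<longlonglongrightarrow> 0)"
    by (rule tendsto_L1_AE_subseq[OF _ fejer_L1_convergence[OF Fi Fm]]) (auto intro!: fi Fi)
  then obtain r :: "nat \<Rightarrow> nat" where r: "AE z in torus_measure. (\<lambda>n. fejer (Suc (r n)) F z - F z) \<longlonglongrightarrow> 0" by blast
  have "AE z in torus_measure. ennreal (norm (F z) powr p) = liminf (\<lambda>n. ennreal (norm (fejer (Suc (r n)) F z) powr p))"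
    using r
  proof eventually_elim
    case (elim z)
    have "(\<lambda>n. fejer (Suc (r n)) F z) \<longlonglongrightarrow> F z" using elim by (simp add: LIM_zero_iff)
    then have "(\<lambda>n. ennreal (norm (fejer (Suc (r n)) F z) powr p)) \<longlonglongrightarrow> ennreal (norm (F z) powr p)"
      using p by (intro tendsto_ennrealI tendsto_powr2 tendsto_norm tendsto_const) auto
    then show ?case by (rule lim_imp_Liminf[OF trivial_limit_sequentially, symmetric])
  qed
  then have "pint p F = (\<integral>\<^sup>+ z. liminf (\<lambda>n. ennreal (norm (fejer (Suc (r n)) F z) powr p)) \<partial>torus_measure)"
    unfolding pint_def by (rule nn_integral_cong_AE)
  also have "\<dots> \<le> liminf (\<lambda>n. \<integral>\<^sup>+ z. ennreal (norm (fejer (Suc (r n)) F z) powr p) \<partial>torus_measure)"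
    by (rule nn_integral_liminf) measurable
  also have "\<dots> \<le> limsup (\<lambda>n. \<integral>\<^sup>+ z. ennreal (norm (fejer (Suc (r n)) F z) powr p) \<partial>torus_measure)"
    by (rule Liminf_le_Limsup) simp
  also have "\<dots> \<le> ennreal (b powr p)"
  proof (rule Limsup_bounded, intro always_eventually allI)
    fix n
    show "(\<integral>\<^sup>+ z. ennreal (norm (fejer (Suc (r n)) F z) powr p) \<partial>torus_measure) \<le> ennreal (b powr p)"
      using B[of "r n"] Lp_norm_le_iff[of p b "fejer (Suc (r n)) F"] p real by (simp add: pint_def)
  qed
  finally show ?thesis using Lp_norm_le_iff[of p b F] p real by simp
qed simp

section \<open>Moduli of smoothness of Weyl derivatives\<close>

text \<open>A difference along one axis acts as a multiplier, so it is absorbed into the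
  coefficients while the estimate along the other axis is applied.\<close>

lemma trig_derivative_le_2d:
  assumes p: "p > 1" and \<beta>: "\<beta>1 > 0" "\<beta>2 > 0" and r: "r1 > 0" "r2 > 0"
  shows "\<exists>C>0. \<forall>I c h1 h2. finite I \<and> (\<forall>n\<in>I. fst n \<noteq> 0 \<and> snd n \<noteq> 0) \<longrightarrow>
    Lp_norm p (op (bc (\<beta>1 + r1)) (h1, 0) (op (bc (\<beta>2 + r2)) (0, h2) (trig c I))) \<le>
    ennreal (C * (\<bar>h1\<bar> powr r1 * \<bar>h2\<bar> powr r2)) *
      Lp_norm p (op (bc \<beta>1) (h1, 0) (op (bc \<beta>2) (0, h2) (trig (\<lambda>n. weyl_factor r1 (fst n) * (weyl_factor r2 (snd n) * c n)) I)))"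
proof -
  obtain C1 where C1: "C1 > 0" and le1: "\<forall>e \<kappa> I c h. coord_axis e \<kappa> \<and> finite I \<and> (\<forall>n\<in>I. \<kappa> n \<noteq> 0) \<longrightarrow>
    Lp_norm p (op (bc (\<beta>1 + r1)) (h *\<^sub>R e) (trig c I)) \<le>
    ennreal (C1 * \<bar>h\<bar> powr r1) * Lp_norm p (op (bc \<beta>1) (h *\<^sub>R e) (trig (\<lambda>n. weyl_factor r1 (\<kappa> n) * c n) I))"
    using trig_derivative_le[OF p \<beta>(1) r(1)] by (elim exE conjE)
  obtain C2 where C2: "C2 > 0" and le2: "\<forall>e \<kappa> I c h. coord_axis e \<kappa> \<and> finite I \<and> (\<forall>n\<in>I. \<kappa> n \<noteq> 0) \<longrightarrow>
    Lp_norm p (op (bc (\<beta>2 + r2)) (h *\<^sub>R e) (trig c I)) \<le>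
    ennreal (C2 * \<bar>h\<bar> powr r2) * Lp_norm p (op (bc \<beta>2) (h *\<^sub>R e) (trig (\<lambda>n. weyl_factor r2 (\<kappa> n) * c n) I))"
    using trig_derivative_le[OF p \<beta>(2) r(2)] by (elim exE conjE)
  have eb: "ell1 (bc \<beta>1)" "ell1 (bc \<beta>2)" "ell1 (bc (\<beta>2 + r2))" using \<beta> r summable_bc by auto
  have ax: "coord_axis (1, 0) fst" "coord_axis (0, 1) snd" by (auto simp: coord_axis_def)
  have sc: "h *\<^sub>R (1, 0) = (h, 0)" "h *\<^sub>R (0, 1) = (0, h)" for h :: real by simp_all
  show ?thesis
  proof (intro exI[of _ "C1 * C2"] conjI allI impI)
    fix I :: "(int \<times> int) set" and c :: "int \<times> int \<Rightarrow> complex" and h1 h2 :: real assume as: "finite I \<and> (\<forall>n\<in>I. fst n \<noteq> 0 \<and> snd n \<noteq> 0)"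
    then have I: "finite I" by simp
    note tr1 = op_trig_axis[OF I _ ax(1), unfolded sc] and tr2 = op_trig_axis[OF I _ ax(2), unfolded sc]
    let ?c = "\<lambda>n. hat (bc (\<beta>2 + r2)) (h2 * of_int (snd n)) * c n"
    let ?d = "\<lambda>n. hat (bc \<beta>1) (h1 * of_int (fst n)) * (weyl_factor r1 (fst n) * c n)"
    have "Lp_norm p (op (bc (\<beta>1 + r1)) (h1, 0) (op (bc (\<beta>2 + r2)) (0, h2) (trig c I))) =
      Lp_norm p (op (bc (\<beta>1 + r1)) (h1 *\<^sub>R (1, 0)) (trig ?c I))"
      unfolding sc tr2[OF eb(3)] ..
    also have "\<dots> \<le> ennreal (C1 * \<bar>h1\<bar> powr r1) * Lp_norm p (op (bc \<beta>1) (h1 *\<^sub>R (1, 0)) (trig (\<lambda>n. weyl_factor r1 (fst n) * ?c n) I))"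
      by (rule le1[rule_format]) (use as ax in auto)
    also have "op (bc \<beta>1) (h1 *\<^sub>R (1, 0)) (trig (\<lambda>n. weyl_factor r1 (fst n) * ?c n) I) = op (bc (\<beta>2 + r2)) (h2 *\<^sub>R (0, 1)) (trig ?d I)"
      unfolding sc tr1[OF eb(1)] tr2[OF eb(3)] by (rule trig_cong) (simp only: mult_ac)
    also have "Lp_norm p (op (bc (\<beta>2 + r2)) (h2 *\<^sub>R (0, 1)) (trig ?d I)) \<le>
      ennreal (C2 * \<bar>h2\<bar> powr r2) * Lp_norm p (op (bc \<beta>2) (h2 *\<^sub>R (0, 1)) (trig (\<lambda>n. weyl_factor r2 (snd n) * ?d n) I))"
      by (rule le2[rule_format]) (use as ax in auto)
    also have "op (bc \<beta>2) (h2 *\<^sub>R (0, 1)) (trig (\<lambda>n. weyl_factor r2 (snd n) * ?d n) I) =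
      op (bc \<beta>1) (h1, 0) (op (bc \<beta>2) (0, h2) (trig (\<lambda>n. weyl_factor r1 (fst n) * (weyl_factor r2 (snd n) * c n)) I))"
      unfolding sc tr1[OF eb(1)] tr2[OF eb(2)] by (rule trig_cong) (simp only: mult_ac)
    also have "ennreal (C1 * \<bar>h1\<bar> powr r1) * (ennreal (C2 * \<bar>h2\<bar> powr r2) * X) = ennreal (C1 * C2 * (\<bar>h1\<bar> powr r1 * \<bar>h2\<bar> powr r2)) * X" for X
    proof -
      have "ennreal (C1 * C2 * (\<bar>h1\<bar> powr r1 * \<bar>h2\<bar> powr r2)) = ennreal (C1 * \<bar>h1\<bar> powr r1) * ennreal (C2 * \<bar>h2\<bar> powr r2)"
        using C1 C2 by (subst ennreal_mult'[symmetric]) (auto simp: mult_ac)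
      then show ?thesis by (simp only: mult.assoc)
    qed
    finally show "Lp_norm p (op (bc (\<beta>1 + r1)) (h1, 0) (op (bc (\<beta>2 + r2)) (0, h2) (trig c I))) \<le>
      ennreal (C1 * C2 * (\<bar>h1\<bar> powr r1 * \<bar>h2\<bar> powr r2)) *
        Lp_norm p (op (bc \<beta>1) (h1, 0) (op (bc \<beta>2) (0, h2) (trig (\<lambda>n. weyl_factor r1 (fst n) * (weyl_factor r2 (snd n) * c n)) I)))"
      by (simp add: mult_left_mono)
  qed (use C1 C2 in auto)
qed

text \<open>The expansion along the second axis is inserted into each term of the expansion along
  the first; the multipliers may be reordered freely.\<close>

lemma trig_derivative_ge_2d:
  assumes p: "p > 1" and \<beta>: "\<beta>1 > 0" "\<beta>2 > 0" and r: "r1 > 0" "r2 > 0"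
  shows "\<exists>C>0. \<forall>I c h1 h2. finite I \<and> (\<forall>n\<in>I. fst n \<noteq> 0 \<and> snd n \<noteq> 0) \<longrightarrow>
    Lp_norm p (op (bc \<beta>1) (h1, 0) (op (bc \<beta>2) (0, h2) (trig (\<lambda>n. weyl_factor r1 (fst n) * (weyl_factor r2 (snd n) * c n)) I))) \<le>
    ennreal C * (\<Sum>j. ennreal ((\<bar>h1\<bar> / 2 ^ j) powr (- r1)) * (\<Sum>k. ennreal ((\<bar>h2\<bar> / 2 ^ k) powr (- r2)) *
      Lp_norm p (op (bc (\<beta>1 + r1)) (h1 / 2 ^ j, 0) (op (bc (\<beta>2 + r2)) (0, h2 / 2 ^ k) (trig c I)))))"
proof -
  obtain C1 where C1: "C1 > 0" and le1: "\<forall>e \<kappa> I c h. coord_axis e \<kappa> \<and> finite I \<and> (\<forall>n\<in>I. \<kappa> n \<noteq> 0) \<longrightarrow>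
    Lp_norm p (op (bc \<beta>1) (h *\<^sub>R e) (trig (\<lambda>n. weyl_factor r1 (\<kappa> n) * c n) I)) \<le>
    ennreal C1 * (\<Sum>j. ennreal ((\<bar>h\<bar> / 2 ^ j) powr (- r1)) * Lp_norm p (op (bc (\<beta>1 + r1)) ((h / 2 ^ j) *\<^sub>R e) (trig c I)))"
    using trig_derivative_ge[OF p \<beta>(1) r(1)] by (elim exE conjE)
  obtain C2 where C2: "C2 > 0" and le2: "\<forall>e \<kappa> I c h. coord_axis e \<kappa> \<and> finite I \<and> (\<forall>n\<in>I. \<kappa> n \<noteq> 0) \<longrightarrow>
    Lp_norm p (op (bc \<beta>2) (h *\<^sub>R e) (trig (\<lambda>n. weyl_factor r2 (\<kappa> n) * c n) I)) \<le>
    ennreal C2 * (\<Sum>j. ennreal ((\<bar>h\<bar> / 2 ^ j) powr (- r2)) * Lp_norm p (op (bc (\<beta>2 + r2)) ((h / 2 ^ j) *\<^sub>R e) (trig c I)))"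
    using trig_derivative_ge[OF p \<beta>(2) r(2)] by (elim exE conjE)
  have eb: "ell1 (bc \<beta>1)" "ell1 (bc \<beta>2)" "ell1 (bc (\<beta>1 + r1))" "ell1 (bc (\<beta>2 + r2))" using \<beta> r summable_bc by auto
  have ax: "coord_axis (1, 0) fst" "coord_axis (0, 1) snd" by (auto simp: coord_axis_def)
  have sc: "h *\<^sub>R (1, 0) = (h, 0)" "h *\<^sub>R (0, 1) = (0, h)" for h :: real by simp_all
  show ?thesis
  proof (intro exI[of _ "C1 * C2"] conjI allI impI)
    fix I :: "(int \<times> int) set" and c :: "int \<times> int \<Rightarrow> complex" and h1 h2 :: real assume as: "finite I \<and> (\<forall>n\<in>I. fst n \<noteq> 0 \<and> snd n \<noteq> 0)"
    then have I: "finite I" by simp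
    note tr1 = op_trig_axis[OF I _ ax(1), unfolded sc] and tr2 = op_trig_axis[OF I _ ax(2), unfolded sc]
    let ?c = "\<lambda>n. hat (bc \<beta>2) (h2 * of_int (snd n)) * (weyl_factor r2 (snd n) * c n)"
    let ?d = "\<lambda>j n. hat (bc (\<beta>1 + r1)) (h1 / 2 ^ j * of_int (fst n)) * c n"
    let ?a = "\<lambda>j. ennreal ((\<bar>h1\<bar> / 2 ^ j) powr (- r1))"
    let ?S = "\<lambda>j. \<Sum>k. ennreal ((\<bar>h2\<bar> / 2 ^ k) powr (- r2)) *
        Lp_norm p (op (bc (\<beta>1 + r1)) (h1 / 2 ^ j, 0) (op (bc (\<beta>2 + r2)) (0, h2 / 2 ^ k) (trig c I)))"
    have inner: "Lp_norm p (op (bc (\<beta>1 + r1)) ((h1 / 2 ^ j) *\<^sub>R (1, 0)) (trig ?c I)) \<le> ennreal C2 * ?S j" for j :: nat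
    proof -
      have "op (bc (\<beta>1 + r1)) ((h1 / 2 ^ j) *\<^sub>R (1, 0)) (trig ?c I) = op (bc \<beta>2) (h2 *\<^sub>R (0, 1)) (trig (\<lambda>n. weyl_factor r2 (snd n) * ?d j n) I)"
        unfolding sc tr1[OF eb(3)] tr2[OF eb(2)] by (rule trig_cong) (simp only: mult_ac)
      then have "Lp_norm p (op (bc (\<beta>1 + r1)) ((h1 / 2 ^ j) *\<^sub>R (1, 0)) (trig ?c I)) \<le>
        ennreal C2 * (\<Sum>k. ennreal ((\<bar>h2\<bar> / 2 ^ k) powr (- r2)) * Lp_norm p (op (bc (\<beta>2 + r2)) ((h2 / 2 ^ k) *\<^sub>R (0, 1)) (trig (?d j) I)))"
        by (simp only:) (rule le2[rule_format], use as ax in auto)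
      moreover have "op (bc (\<beta>2 + r2)) ((h2 / 2 ^ k) *\<^sub>R (0, 1)) (trig (?d j) I) =
        op (bc (\<beta>1 + r1)) (h1 / 2 ^ j, 0) (op (bc (\<beta>2 + r2)) (0, h2 / 2 ^ k) (trig c I))" for k
        unfolding sc tr1[OF eb(3)] tr2[OF eb(4)] by (rule trig_cong) (simp only: mult_ac)
      ultimately show ?thesis by (simp only:)
    qed
    have "Lp_norm p (op (bc \<beta>1) (h1, 0) (op (bc \<beta>2) (0, h2) (trig (\<lambda>n. weyl_factor r1 (fst n) * (weyl_factor r2 (snd n) * c n)) I))) =
      Lp_norm p (op (bc \<beta>1) (h1 *\<^sub>R (1, 0)) (trig (\<lambda>n. weyl_factor r1 (fst n) * ?c n) I))"
      unfolding sc tr1[OF eb(1)] tr2[OF eb(2)] by (rule arg_cong[OF trig_cong]) (simp only: mult_ac)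
    also have "\<dots> \<le> ennreal C1 * (\<Sum>j. ?a j * Lp_norm p (op (bc (\<beta>1 + r1)) ((h1 / 2 ^ j) *\<^sub>R (1, 0)) (trig ?c I)))"
      by (rule le1[rule_format]) (use as ax in auto)
    also have "\<dots> \<le> ennreal C1 * (\<Sum>j. ?a j * (ennreal C2 * ?S j))"
      by (intro mult_left_mono suminf_le inner) auto
    also have "\<dots> = ennreal C1 * (ennreal C2 * (\<Sum>j. ?a j * ?S j))"
      by (simp only: mult.left_commute[of _ "ennreal C2"] ennreal_suminf_cmult)
    also have "\<dots> = ennreal (C1 * C2) * (\<Sum>j. ?a j * ?S j)"
      using C1 by (simp only: ennreal_mult'[OF less_imp_le] mult.assoc)
    finally show "Lp_norm p (op (bc \<beta>1) (h1, 0) (op (bc \<beta>2) (0, h2) (trig (\<lambda>n. weyl_factor r1 (fst n) * (weyl_factor r2 (snd n) * c n)) I))) \<le>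
      ennreal (C1 * C2) * (\<Sum>j. ?a j * ?S j)" .
  qed (use C1 C2 in auto)
qed

text \<open>Frequencies with a vanishing component are left out, because the one-axis derivative
  estimates require nonzero frequencies.\<close>

definition fejer_support :: "nat \<Rightarrow> (int \<times> int) set" where
  "fejer_support n = {b \<in> fejer_freq ` fejer_idx n. fst b \<noteq> 0 \<and> snd b \<noteq> 0}"

definition fejer_coeff :: "nat \<Rightarrow> (real \<times> real \<Rightarrow> complex) \<Rightarrow> int \<times> int \<Rightarrow> complex" where
  "fejer_coeff n f b = of_real (fejer_weight n b) * fourier_coeff f (fst b) (snd b)"

lemma fejer_support: "finite (fejer_support n)" "\<forall>b\<in>fejer_support n. fst b \<noteq> 0 \<and> snd b \<noteq> 0"
  by (auto simp: fejer_support_def)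

lemma hat_bc_0: "r > 0 \<Longrightarrow> hat (bc r) 0 = 0"
  using sums_of_real[OF bc_sums_zero, of r, where 'a=complex] by (simp add: hat_def sums_iff)

text \<open>A mixed difference annihilates the frequencies on the coordinate axes.\<close>

lemma fejer_op_op:
  assumes p: "p > 1" and f: "f \<in> torus_Lp p" and \<alpha>: "\<alpha>1 > 0" "\<alpha>2 > 0"
  shows "fejer n (op (bc \<alpha>1) (h1, 0) (op (bc \<alpha>2) (0, h2) f)) =
    op (bc \<alpha>1) (h1, 0) (op (bc \<alpha>2) (0, h2) (trig (fejer_coeff n f) (fejer_support n)))"
proof -
  have e: "ell1 (bc \<alpha>1)" "ell1 (bc \<alpha>2)" using \<alpha> summable_bc by auto
  have f2: "op (bc \<alpha>2) (0, h2) f \<in> torus_Lp p" using p f e torus_Lp_op by auto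
  let ?c = "\<lambda>b. hat (bc \<alpha>1) (dotp b (h1, 0)) * (hat (bc \<alpha>2) (dotp b (0, h2)) * fejer_coeff n f b)"
  have "fejer n (op (bc \<alpha>1) (h1, 0) (op (bc \<alpha>2) (0, h2) f)) = trig ?c (fejer_freq ` fejer_idx n)"
    unfolding fejer_def by (rule trig_cong) (simp add: fourier_coeff_op[OF p f2 e(1)] fourier_coeff_op[OF p f e(2)] fejer_coeff_def)
  also have "\<dots> = trig ?c (fejer_support n)"
  proof
    fix z
    show "trig ?c (fejer_freq ` fejer_idx n) z = trig ?c (fejer_support n) z"
      unfolding trig_def
      by (rule sum.mono_neutral_right) (auto simp: fejer_support_def dotp_def hat_bc_0 \<alpha>)
  qed
  also have "\<dots> = op (bc \<alpha>1) (h1, 0) (op (bc \<alpha>2) (0, h2) (trig (fejer_coeff n f) (fejer_support n)))"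
    unfolding op_trig[OF fejer_support(1) e(2)] op_trig[OF fejer_support(1) e(1)] ..
  finally show ?thesis .
qed

lemma fejer_coeff_derivative:
  assumes "\<And>n1 n2. n1 \<noteq> 0 \<Longrightarrow> n2 \<noteq> 0 \<Longrightarrow> fourier_coeff g n1 n2 = weyl_factor r1 n1 * weyl_factor r2 n2 * fourier_coeff f n1 n2"
  shows "trig (fejer_coeff n g) (fejer_support n) =
    trig (\<lambda>b. weyl_factor r1 (fst b) * (weyl_factor r2 (snd b) * fejer_coeff n f b)) (fejer_support n)"
  by (rule trig_cong) (simp add: fejer_support_def fejer_coeff_def assms)

text \<open>Each Fejer mean of the difference of f is a polynomial to which the estimate applies,
  its right side being a Fejer mean of the difference of g. Contraction removes the mean on the
  right, \<open>Lp_norm_le_fejer\<close> removes it on the left.\<close>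

lemma mm_derivative_le:
  assumes p: "p > 1" and \<beta>: "\<beta>1 > 0" "\<beta>2 > 0" and r: "r1 > 0" "r2 > 0"
  shows "\<exists>C>0. \<forall>f \<in> torus_Lp0 p. \<forall>g \<in> torus_Lp p. has_weyl_derivative r1 r2 f g \<longrightarrow>
    (\<forall>\<delta>1>0. \<forall>\<delta>2>0. mixed_modulus p (\<beta>1 + r1) (\<beta>2 + r2) f \<delta>1 \<delta>2 \<le>
      ennreal C * (ennreal (\<delta>1 powr r1 * \<delta>2 powr r2) * mixed_modulus p \<beta>1 \<beta>2 g \<delta>1 \<delta>2))"
proof -
  obtain C where C: "C > 0" and le: "\<forall>I c h1 h2. finite I \<and> (\<forall>n\<in>I. fst n \<noteq> 0 \<and> snd n \<noteq> 0) \<longrightarrow>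
    Lp_norm p (op (bc (\<beta>1 + r1)) (h1, 0) (op (bc (\<beta>2 + r2)) (0, h2) (trig c I))) \<le>
    ennreal (C * (\<bar>h1\<bar> powr r1 * \<bar>h2\<bar> powr r2)) *
      Lp_norm p (op (bc \<beta>1) (h1, 0) (op (bc \<beta>2) (0, h2) (trig (\<lambda>n. weyl_factor r1 (fst n) * (weyl_factor r2 (snd n) * c n)) I)))"
    using trig_derivative_le_2d[OF p \<beta> r] by (elim exE conjE)
  have \<alpha>: "\<beta>1 + r1 > 0" "\<beta>2 + r2 > 0" using \<beta> r by auto
  have e: "ell1 (bc \<beta>1)" "ell1 (bc \<beta>2)" "ell1 (bc (\<beta>1 + r1))" "ell1 (bc (\<beta>2 + r2))" using \<beta> \<alpha> summable_bc by auto
  show ?thesis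
  proof (intro exI[of _ C] conjI ballI allI impI C)
    fix f g and \<delta>1 \<delta>2 :: real assume "f \<in> torus_Lp0 p" and g: "g \<in> torus_Lp p" and fg: "has_weyl_derivative r1 r2 f g"
      and \<delta>: "\<delta>1 > 0" "\<delta>2 > 0"
    then have f: "f \<in> torus_Lp p" by (simp add: torus_Lp0_def)
    have tg: "trig (fejer_coeff n g) (fejer_support n) =
      trig (\<lambda>b. weyl_factor r1 (fst b) * (weyl_factor r2 (snd b) * fejer_coeff n f b)) (fejer_support n)" for n
      by (rule fejer_coeff_derivative) (use fg in \<open>simp add: has_weyl_derivative_def\<close>)
    show "mixed_modulus p (\<beta>1 + r1) (\<beta>2 + r2) f \<delta>1 \<delta>2 \<le> ennreal C * (ennreal (\<delta>1 powr r1 * \<delta>2 powr r2) * mixed_modulus p \<beta>1 \<beta>2 g \<delta>1 \<delta>2)"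
    proof (rule mm_le[OF p f \<alpha>])
      fix h1 h2 assume h: "\<bar>h1\<bar> \<le> \<delta>1" "\<bar>h2\<bar> \<le> \<delta>2"
      let ?F = "op (bc (\<beta>1 + r1)) (h1, 0) (op (bc (\<beta>2 + r2)) (0, h2) f)" and ?G = "op (bc \<beta>1) (h1, 0) (op (bc \<beta>2) (0, h2) g)"
      have T: "?F \<in> torus_Lp p" "?G \<in> torus_Lp p" using p f g e torus_Lp_op by auto
      show "Lp_norm p ?F \<le> ennreal C * (ennreal (\<delta>1 powr r1 * \<delta>2 powr r2) * mixed_modulus p \<beta>1 \<beta>2 g \<delta>1 \<delta>2)"
      proof (rule Lp_norm_le_fejer[OF p T(1)])
        fix n
        have "Lp_norm p (fejer (Suc n) ?F) \<le> ennreal (C * (\<bar>h1\<bar> powr r1 * \<bar>h2\<bar> powr r2)) * Lp_norm p (fejer (Suc n) ?G)"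
          unfolding fejer_op_op[OF p f \<alpha>] fejer_op_op[OF p g \<beta>] tg by (rule le[rule_format, OF conjI[OF fejer_support]])
        also have "\<dots> \<le> ennreal (C * (\<delta>1 powr r1 * \<delta>2 powr r2)) * mixed_modulus p \<beta>1 \<beta>2 g \<delta>1 \<delta>2"
        proof (intro mult_mono ennreal_leI)
          show "Lp_norm p (fejer (Suc n) ?G) \<le> mixed_modulus p \<beta>1 \<beta>2 g \<delta>1 \<delta>2"
            by (rule order_trans[OF Lp_norm_fejer_le[OF p T(2)] mm_ge[OF p g \<beta> h]]) simp
        qed (use C r h in \<open>auto intro!: powr_mono2\<close>)
        also have "\<dots> = ennreal C * (ennreal (\<delta>1 powr r1 * \<delta>2 powr r2) * mixed_modulus p \<beta>1 \<beta>2 g \<delta>1 \<delta>2)"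
          using C by (simp only: ennreal_mult'[OF less_imp_le] mult.assoc)
        finally show "Lp_norm p (fejer (Suc n) ?F) \<le> \<dots>" .
      qed
    qed
  qed
qed

text \<open>The dyadic double sum is bounded uniformly in the Fejer index before passing to the
  limit, so only g has to be recovered from its means. The sum is then compared with the integral
  one variable at a time.\<close>

lemma mm_derivative_ge:
  assumes p: "p > 1" and \<beta>: "\<beta>1 > 0" "\<beta>2 > 0" and r: "r1 > 0" "r2 > 0"
  shows "\<exists>C>0. \<forall>f \<in> torus_Lp0 p. \<forall>g \<in> torus_Lp p. has_weyl_derivative r1 r2 f g \<longrightarrow>
    (\<forall>\<delta>1>0. \<forall>\<delta>2>0. mixed_modulus p \<beta>1 \<beta>2 g \<delta>1 \<delta>2 \<le>
      ennreal C * (\<integral>\<^sup>+ t1 \<in> {0<..\<delta>1}. (\<integral>\<^sup>+ t2 \<in> {0<..\<delta>2}.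
         ennreal (t1 powr (- r1) * t2 powr (- r2)) * mixed_modulus p (\<beta>1 + r1) (\<beta>2 + r2) f t1 t2
         / ennreal t2 \<partial>lborel) / ennreal t1 \<partial>lborel))"
proof -
  obtain C where C: "C > 0" and le: "\<forall>I c h1 h2. finite I \<and> (\<forall>n\<in>I. fst n \<noteq> 0 \<and> snd n \<noteq> 0) \<longrightarrow>
    Lp_norm p (op (bc \<beta>1) (h1, 0) (op (bc \<beta>2) (0, h2) (trig (\<lambda>n. weyl_factor r1 (fst n) * (weyl_factor r2 (snd n) * c n)) I))) \<le>
    ennreal C * (\<Sum>j. ennreal ((\<bar>h1\<bar> / 2 ^ j) powr (- r1)) * (\<Sum>k. ennreal ((\<bar>h2\<bar> / 2 ^ k) powr (- r2)) *
      Lp_norm p (op (bc (\<beta>1 + r1)) (h1 / 2 ^ j, 0) (op (bc (\<beta>2 + r2)) (0, h2 / 2 ^ k) (trig c I)))))"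
    using trig_derivative_ge_2d[OF p \<beta> r] by (elim exE conjE)
  have \<alpha>: "\<beta>1 + r1 > 0" "\<beta>2 + r2 > 0" using \<beta> r by auto
  have e: "ell1 (bc \<beta>1)" "ell1 (bc \<beta>2)" "ell1 (bc (\<beta>1 + r1))" "ell1 (bc (\<beta>2 + r2))" using \<beta> \<alpha> summable_bc by auto
  obtain D where D: "D > 0" and scale: "\<And>f \<delta>1 \<delta>2 t1 t2. f \<in> torus_Lp p \<Longrightarrow> 0 < t1 \<Longrightarrow> t1 \<le> \<delta>1 \<Longrightarrow> 0 < t2 \<Longrightarrow> t2 \<le> \<delta>2 \<Longrightarrow>
    mixed_modulus p (\<beta>1 + r1) (\<beta>2 + r2) f \<delta>1 \<delta>2 \<le>
      ennreal (D * ((\<delta>1 / t1) powr (\<beta>1 + r1) * (\<delta>2 / t2) powr (\<beta>2 + r2))) * mixed_modulus p (\<beta>1 + r1) (\<beta>2 + r2) f t1 t2"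
    using mm_scale[OF p \<alpha>] by blast
  \<comment> \<open>Doubling constants of the modulus in either variable, from the scaling estimate
    with ratio 2 in one variable and 1 in the other.\<close>
  define K1 where "K1 = D * 2 powr (\<beta>1 + r1)"
  define K2 where "K2 = D * 2 powr (\<beta>2 + r2)"
  have K: "K1 > 0" "K2 > 0" using D by (auto simp: K1_def K2_def)
  show ?thesis
  proof (intro exI[of _ "C * (2 * K2 * (2 * K1))"] conjI ballI allI impI)
    fix f g and \<delta>1 \<delta>2 :: real assume "f \<in> torus_Lp0 p" and g: "g \<in> torus_Lp p" and fg: "has_weyl_derivative r1 r2 f g"
      and \<delta>: "\<delta>1 > 0" "\<delta>2 > 0"
    then have f: "f \<in> torus_Lp p" by (simp add: torus_Lp0_def)
    have tg: "trig (fejer_coeff n g) (fejer_support n) =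
      trig (\<lambda>b. weyl_factor r1 (fst b) * (weyl_factor r2 (snd b) * fejer_coeff n f b)) (fejer_support n)" for n
      by (rule fejer_coeff_derivative) (use fg in \<open>simp add: has_weyl_derivative_def\<close>)
    let ?w = "mixed_modulus p (\<beta>1 + r1) (\<beta>2 + r2) f"
    let ?J = "\<lambda>\<delta>1 \<delta>2. \<integral>\<^sup>+ t1 \<in> {0<..\<delta>1}. (\<integral>\<^sup>+ t2 \<in> {0<..\<delta>2}. ennreal (t1 powr (- r1) * t2 powr (- r2)) * ?w t1 t2 / ennreal t2 \<partial>lborel) / ennreal t1 \<partial>lborel"
    have dbl1: "?w (2 * t) s \<le> ennreal K1 * ?w t s" if "t > 0" "s > 0" for t s
      using scale[OF f, of t "2 * t" s s] that by (simp add: K1_def)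
    have dbl2: "?w t (2 * s) \<le> ennreal K2 * ?w t s" if "t > 0" "s > 0" for t s
      using scale[OF f, of t t s "2 * s"] that by (simp add: K2_def)
    show "mixed_modulus p \<beta>1 \<beta>2 g \<delta>1 \<delta>2 \<le> ennreal (C * (2 * K2 * (2 * K1))) * ?J \<delta>1 \<delta>2"
    proof (rule mm_le[OF p g \<beta>])
      fix h1 h2 assume h: "\<bar>h1\<bar> \<le> \<delta>1" "\<bar>h2\<bar> \<le> \<delta>2"
      let ?G = "op (bc \<beta>1) (h1, 0) (op (bc \<beta>2) (0, h2) g)"
      let ?F = "\<lambda>j k. op (bc (\<beta>1 + r1)) (h1 / 2 ^ j, 0) (op (bc (\<beta>2 + r2)) (0, h2 / 2 ^ k) f)"
      have T: "?G \<in> torus_Lp p" "?F j k \<in> torus_Lp p" for j k using p f g e torus_Lp_op by auto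
      show "Lp_norm p ?G \<le> ennreal (C * (2 * K2 * (2 * K1))) * ?J \<delta>1 \<delta>2"
      proof (cases "h1 = 0 \<or> h2 = 0")
        case True
        then have "?G = (\<lambda>z. 0)" using \<beta> op_zero_shift[of \<beta>1] op_zero_shift[of \<beta>2] by (auto simp: zero_prod_def op_zero_fun)
        then show ?thesis using p by (simp add: Lp_norm_zero)
      next
        case False
        then have h0: "\<bar>h1\<bar> > 0" "\<bar>h2\<bar> > 0" by auto
        let ?a = "\<lambda>j. ennreal ((\<bar>h1\<bar> / 2 ^ j) powr (- r1))" and ?b = "\<lambda>k. ennreal ((\<bar>h2\<bar> / 2 ^ k) powr (- r2))"
        \<comment> \<open>The inner integral as a function of the outer variable. It inherits
          monotonicity and the doubling condition, as needed for the second comparison.\<close>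
        define V where "V t = (\<integral>\<^sup>+ s \<in> {0<..\<bar>h2\<bar>}. ennreal (s powr (- r2)) * ?w t s / ennreal s \<partial>lborel)" for t
        have "Lp_norm p ?G \<le> ennreal C * (\<Sum>j. ?a j * (\<Sum>k. ?b k * ?w (\<bar>h1\<bar> / 2 ^ j) (\<bar>h2\<bar> / 2 ^ k)))"
        proof (rule Lp_norm_le_fejer[OF p T(1)])
          fix n
          have "Lp_norm p (fejer (Suc n) ?G) \<le> ennreal C * (\<Sum>j. ?a j * (\<Sum>k. ?b k * Lp_norm p (fejer (Suc n) (?F j k))))"
            unfolding fejer_op_op[OF p f \<alpha>] fejer_op_op[OF p g \<beta>] tg by (rule le[rule_format, OF conjI[OF fejer_support]])
          also have "\<dots> \<le> ennreal C * (\<Sum>j. ?a j * (\<Sum>k. ?b k * ?w (\<bar>h1\<bar> / 2 ^ j) (\<bar>h2\<bar> / 2 ^ k)))"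
            by (intro mult_left_mono suminf_le order_trans[OF Lp_norm_fejer_le[OF p T(2)] mm_ge[OF p f \<alpha>]]) auto
          finally show "Lp_norm p (fejer (Suc n) ?G) \<le> \<dots>" .
        qed
        also have "\<dots> \<le> ennreal C * (\<Sum>j. ?a j * (ennreal (2 * K2) * V (\<bar>h1\<bar> / 2 ^ j)))"
        proof (intro mult_left_mono suminf_le)
          fix j
          have "\<bar>h1\<bar> / 2 ^ j > 0" using h0 by simp
          then show "(\<Sum>k. ?b k * ?w (\<bar>h1\<bar> / 2 ^ j) (\<bar>h2\<bar> / 2 ^ k)) \<le> ennreal (2 * K2) * V (\<bar>h1\<bar> / 2 ^ j)"
            unfolding V_def by (intro dyadic_sum_le_integral_0[OF mono_mm2 K(2) dbl2 r(2) h0(2)])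
        qed auto
        also have "\<dots> = ennreal C * (ennreal (2 * K2) * (\<Sum>j. ?a j * V (\<bar>h1\<bar> / 2 ^ j)))"
          by (simp only: mult.left_commute[of _ "ennreal (2 * K2)"] ennreal_suminf_cmult)
        also have "(\<Sum>j. ?a j * V (\<bar>h1\<bar> / 2 ^ j)) \<le> ennreal (2 * K1) * (\<integral>\<^sup>+ t \<in> {0<..\<bar>h1\<bar>}. ennreal (t powr (- r1)) * V t / ennreal t \<partial>lborel)"
        proof (rule dyadic_sum_le_integral_0[OF _ K(1) _ r(1) h0(1)])
          show "mono V" unfolding V_def
            by (intro monoI nn_integral_mono mult_right_mono divide_right_mono_ennreal mult_left_mono mm_mono) auto
          fix t :: real assume t: "t > 0"
          have "V (2 * t) \<le> (\<integral>\<^sup>+ s. ennreal K1 * (ennreal (s powr (- r2)) * ?w t s / ennreal s * indicator {0<..\<bar>h2\<bar>} s) \<partial>lborel)"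
            unfolding V_def
          proof (rule nn_integral_mono)
            fix s
            show "ennreal (s powr (- r2)) * ?w (2 * t) s / ennreal s * indicator {0<..\<bar>h2\<bar>} s \<le>
              ennreal K1 * (ennreal (s powr (- r2)) * ?w t s / ennreal s * indicator {0<..\<bar>h2\<bar>} s)"
            proof (cases "s \<in> {0<..\<bar>h2\<bar>}")
              case True
              then have "ennreal (s powr (- r2)) * ?w (2 * t) s / ennreal s \<le> ennreal (s powr (- r2)) * (ennreal K1 * ?w t s) / ennreal s"
                by (intro divide_right_mono_ennreal mult_left_mono dbl1 t) auto
              also have "\<dots> = ennreal K1 * (ennreal (s powr (- r2)) * ?w t s / ennreal s)"
                unfolding divide_ennreal_def by (simp only: mult_ac)
              finally show ?thesis using True by simp
            qed simp
          qed
          also have "\<dots> = ennreal K1 * V t" unfolding V_def by (rule nn_integral_cmult) measurable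
          finally show "V (2 * t) \<le> ennreal K1 * V t" .
        qed
        also have "(\<integral>\<^sup>+ t \<in> {0<..\<bar>h1\<bar>}. ennreal (t powr (- r1)) * V t / ennreal t \<partial>lborel) = ?J \<bar>h1\<bar> \<bar>h2\<bar>"
        proof (rule nn_integral_cong)
          fix t :: real
          have "ennreal (t powr (- r1)) * V t = (\<integral>\<^sup>+ s. ennreal (t powr (- r1)) * (ennreal (s powr (- r2)) * ?w t s / ennreal s * indicator {0<..\<bar>h2\<bar>} s) \<partial>lborel)"
            unfolding V_def by (rule nn_integral_cmult[symmetric]) measurable
          also have "\<dots> = (\<integral>\<^sup>+ s \<in> {0<..\<bar>h2\<bar>}. ennreal (t powr (- r1) * s powr (- r2)) * ?w t s / ennreal s \<partial>lborel)"
            by (intro nn_integral_cong) (simp add: ennreal_mult' divide_ennreal_def mult.assoc)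
          finally show "ennreal (t powr (- r1)) * V t / ennreal t * indicator {0<..\<bar>h1\<bar>} t =
            (\<integral>\<^sup>+ s \<in> {0<..\<bar>h2\<bar>}. ennreal (t powr (- r1) * s powr (- r2)) * ?w t s / ennreal s \<partial>lborel) / ennreal t * indicator {0<..\<bar>h1\<bar>} t"
            by simp
        qed
        \<comment> \<open>The dyadic comparison runs up to |h1| and |h2|; enlarging the domain makes
          the bound independent of the steps.\<close>
        also have "?J \<bar>h1\<bar> \<bar>h2\<bar> \<le> ?J \<delta>1 \<delta>2"
          by (intro nn_integral_mono mult_mono divide_right_mono_ennreal order_refl) (use h in \<open>auto simp: indicator_def\<close>)
        also have "ennreal C * (ennreal (2 * K2) * (ennreal (2 * K1) * ?J \<delta>1 \<delta>2)) = ennreal (C * (2 * K2 * (2 * K1))) * ?J \<delta>1 \<delta>2"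
        proof -
          have "ennreal (C * (2 * K2 * (2 * K1))) = ennreal C * (ennreal (2 * K2) * ennreal (2 * K1))"
            using C K by (subst ennreal_mult', simp)+ simp
          then show ?thesis by (simp only: mult.assoc)
        qed
        finally show ?thesis by (simp add: mult_left_mono)
      qed
    qed
  qed (use C K in auto)
qed

section \<open>Quotient and dilation forms of the scaling estimate\<close>

lemma mm_quotient:
  assumes p: "p > 1" and \<alpha>1: "\<alpha>1 > 0" and \<alpha>2: "\<alpha>2 > 0"
  shows "\<exists>C>0. \<forall>f \<in> torus_Lp p. \<forall>\<delta>1 \<delta>2 t1 t2.
      0 < t1 \<and> t1 \<le> \<delta>1 \<and> \<delta>1 \<le> 1 \<and> 0 < t2 \<and> t2 \<le> \<delta>2 \<and> \<delta>2 \<le> 1 \<longrightarrow>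
      mixed_modulus p \<alpha>1 \<alpha>2 f \<delta>1 \<delta>2 / ennreal (\<delta>1 powr \<alpha>1 * \<delta>2 powr \<alpha>2) \<le>
        ennreal C * (mixed_modulus p \<alpha>1 \<alpha>2 f t1 t2 / ennreal (t1 powr \<alpha>1 * t2 powr \<alpha>2))"
proof -
  obtain C where C: "C > 0" and scale: "\<And>f \<delta>1 \<delta>2 t1 t2. f \<in> torus_Lp p \<Longrightarrow> 0 < t1 \<Longrightarrow> t1 \<le> \<delta>1 \<Longrightarrow> 0 < t2 \<Longrightarrow> t2 \<le> \<delta>2 \<Longrightarrow>
    mixed_modulus p \<alpha>1 \<alpha>2 f \<delta>1 \<delta>2 \<le> ennreal (C * ((\<delta>1 / t1) powr \<alpha>1 * (\<delta>2 / t2) powr \<alpha>2)) * mixed_modulus p \<alpha>1 \<alpha>2 f t1 t2"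
    using mm_scale[OF p \<alpha>1 \<alpha>2] by blast
  show ?thesis
  proof (intro exI[of _ C] conjI C ballI allI impI)
    fix f \<delta>1 \<delta>2 t1 t2
    assume f: "f \<in> torus_Lp p" and a: "0 < t1 \<and> t1 \<le> \<delta>1 \<and> \<delta>1 \<le> (1::real) \<and> 0 < t2 \<and> t2 \<le> \<delta>2 \<and> \<delta>2 \<le> (1::real)"
    let ?d = "\<delta>1 powr \<alpha>1 * \<delta>2 powr \<alpha>2" and ?t = "t1 powr \<alpha>1 * t2 powr \<alpha>2"
    have d: "?d > 0" "?t > 0" using a by auto
    have "mixed_modulus p \<alpha>1 \<alpha>2 f \<delta>1 \<delta>2 / ennreal ?d \<le>
      ennreal (C * ((\<delta>1 / t1) powr \<alpha>1 * (\<delta>2 / t2) powr \<alpha>2)) * mixed_modulus p \<alpha>1 \<alpha>2 f t1 t2 / ennreal ?d"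
      using scale[OF f] a by (intro divide_right_mono_ennreal) auto
    also have "\<dots> = ennreal C * (mixed_modulus p \<alpha>1 \<alpha>2 f t1 t2 / ennreal ?t)"
    proof -
      have "1 / ?d * (C * ((\<delta>1 / t1) powr \<alpha>1 * (\<delta>2 / t2) powr \<alpha>2)) = C * (1 / ?t)"
        using a by (simp add: powr_divide)
      then have "ennreal (1 / ?d) * ennreal (C * ((\<delta>1 / t1) powr \<alpha>1 * (\<delta>2 / t2) powr \<alpha>2)) = ennreal C * ennreal (1 / ?t)"
        using C d by (simp flip: ennreal_mult')
      then show ?thesis
        unfolding ennreal_divide_ennreal_pos[OF d(1)] ennreal_divide_ennreal_pos[OF d(2)] by (simp only: mult.assoc[symmetric])
    qed
    finally show "mixed_modulus p \<alpha>1 \<alpha>2 f \<delta>1 \<delta>2 / ennreal ?d \<le> ennreal C * (mixed_modulus p \<alpha>1 \<alpha>2 f t1 t2 / ennreal ?t)" .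
  qed
qed

lemma mm_dilate:
  assumes p: "p > 1" and \<alpha>1: "\<alpha>1 > 0" and \<alpha>2: "\<alpha>2 > 0"
  shows "\<exists>C>0. \<forall>f \<in> torus_Lp p. \<forall>\<delta>1>0. \<forall>\<delta>2>0. \<forall>l1>1. \<forall>l2>1.
      mixed_modulus p \<alpha>1 \<alpha>2 f (l1 * \<delta>1) (l2 * \<delta>2) \<le>
        ennreal C * (ennreal (l1 powr \<alpha>1 * l2 powr \<alpha>2) * mixed_modulus p \<alpha>1 \<alpha>2 f \<delta>1 \<delta>2)"
proof -
  obtain C where C: "C > 0" and scale: "\<And>f \<delta>1 \<delta>2 t1 t2. f \<in> torus_Lp p \<Longrightarrow> 0 < t1 \<Longrightarrow> t1 \<le> \<delta>1 \<Longrightarrow> 0 < t2 \<Longrightarrow> t2 \<le> \<delta>2 \<Longrightarrow>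
    mixed_modulus p \<alpha>1 \<alpha>2 f \<delta>1 \<delta>2 \<le> ennreal (C * ((\<delta>1 / t1) powr \<alpha>1 * (\<delta>2 / t2) powr \<alpha>2)) * mixed_modulus p \<alpha>1 \<alpha>2 f t1 t2"
    using mm_scale[OF p \<alpha>1 \<alpha>2] by blast
  show ?thesis
  proof (intro exI[of _ C] conjI C ballI allI impI)
    fix f and \<delta>1 \<delta>2 l1 l2 :: real
    assume f: "f \<in> torus_Lp p" and a: "\<delta>1 > 0" "\<delta>2 > 0" "l1 > 1" "l2 > 1"
    have "mixed_modulus p \<alpha>1 \<alpha>2 f (l1 * \<delta>1) (l2 * \<delta>2) \<le> ennreal (C * (l1 powr \<alpha>1 * l2 powr \<alpha>2)) * mixed_modulus p \<alpha>1 \<alpha>2 f \<delta>1 \<delta>2"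
      using scale[OF f, of \<delta>1 "l1 * \<delta>1" \<delta>2 "l2 * \<delta>2"] a by simp
    then show "mixed_modulus p \<alpha>1 \<alpha>2 f (l1 * \<delta>1) (l2 * \<delta>2) \<le>
        ennreal C * (ennreal (l1 powr \<alpha>1 * l2 powr \<alpha>2) * mixed_modulus p \<alpha>1 \<alpha>2 f \<delta>1 \<delta>2)"
      using C by (simp only: ennreal_mult'[OF less_imp_le] mult.assoc)
  qed
qed

theorem theorem4p1:
  fixes p \<alpha>1 \<alpha>2 :: real
  assumes p: "1 < p" and \<alpha>1: "0 < \<alpha>1" and \<alpha>2: "0 < \<alpha>2"
  shows
    "\<comment> \<open>(1)\<close>
     (\<forall>f \<in> torus_Lp p. \<forall>\<delta>1>0. \<forall>\<delta>2>0.
        mixed_modulus p \<alpha>1 \<alpha>2 f \<delta>1 0 = 0 \<and>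
        mixed_modulus p \<alpha>1 \<alpha>2 f 0 \<delta>2 = 0 \<and>
        mixed_modulus p \<alpha>1 \<alpha>2 f 0 0 = 0) \<and>
     \<comment> \<open>(2)\<close>
     (\<exists>C>0. \<forall>f \<in> torus_Lp p. \<forall>g \<in> torus_Lp p. \<forall>\<delta>1>0. \<forall>\<delta>2>0.
        mixed_modulus p \<alpha>1 \<alpha>2 (\<lambda>z. f z + g z) \<delta>1 \<delta>2 \<le>
          ennreal C * (mixed_modulus p \<alpha>1 \<alpha>2 f \<delta>1 \<delta>2 + mixed_modulus p \<alpha>1 \<alpha>2 g \<delta>1 \<delta>2)) \<and>
     \<comment> \<open>(3)\<close>
     (\<exists>C>0. \<forall>f \<in> torus_Lp p. \<forall>\<delta>1 \<delta>2 t1 t2.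
        0 < \<delta>1 \<and> \<delta>1 \<le> t1 \<and> 0 < \<delta>2 \<and> \<delta>2 \<le> t2 \<longrightarrow>
        mixed_modulus p \<alpha>1 \<alpha>2 f \<delta>1 \<delta>2 \<le> ennreal C * mixed_modulus p \<alpha>1 \<alpha>2 f t1 t2) \<and>
     \<comment> \<open>(4)\<close>
     (\<exists>C>0. \<forall>f \<in> torus_Lp p. \<forall>\<delta>1 \<delta>2 t1 t2.
        0 < t1 \<and> t1 \<le> \<delta>1 \<and> \<delta>1 \<le> 1 \<and> 0 < t2 \<and> t2 \<le> \<delta>2 \<and> \<delta>2 \<le> 1 \<longrightarrow>
        mixed_modulus p \<alpha>1 \<alpha>2 f \<delta>1 \<delta>2 / ennreal (\<delta>1 powr \<alpha>1 * \<delta>2 powr \<alpha>2) \<le>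
          ennreal C * (mixed_modulus p \<alpha>1 \<alpha>2 f t1 t2 / ennreal (t1 powr \<alpha>1 * t2 powr \<alpha>2))) \<and>
     \<comment> \<open>(5)\<close>
     (\<exists>C>0. \<forall>f \<in> torus_Lp p. \<forall>\<delta>1>0. \<forall>\<delta>2>0. \<forall>l1>1. \<forall>l2>1.
        mixed_modulus p \<alpha>1 \<alpha>2 f (l1 * \<delta>1) (l2 * \<delta>2) \<le>
          ennreal C * (ennreal (l1 powr \<alpha>1 * l2 powr \<alpha>2) * mixed_modulus p \<alpha>1 \<alpha>2 f \<delta>1 \<delta>2)) \<and>
     \<comment> \<open>(6)\<close>
     (\<forall>\<beta>1>\<alpha>1. \<forall>\<beta>2>\<alpha>2. \<exists>C>0. \<forall>f \<in> torus_Lp p. \<forall>\<delta>1>0. \<forall>\<delta>2>0.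
        mixed_modulus p \<beta>1 \<beta>2 f \<delta>1 \<delta>2 \<le> ennreal C * mixed_modulus p \<alpha>1 \<alpha>2 f \<delta>1 \<delta>2) \<and>
     \<comment> \<open>(7)\<close>
     (\<forall>\<beta>1>\<alpha>1. \<forall>\<beta>2>\<alpha>2. \<exists>C>0. \<forall>f \<in> torus_Lp p. \<forall>\<delta>1 \<delta>2.
        0 < \<delta>1 \<and> \<delta>1 \<le> 1/2 \<and> 0 < \<delta>2 \<and> \<delta>2 \<le> 1/2 \<longrightarrow>
        mixed_modulus p \<alpha>1 \<alpha>2 f \<delta>1 \<delta>2 \<le>
          ennreal C * (ennreal (\<delta>1 powr \<alpha>1 * \<delta>2 powr \<alpha>2) *
            (\<integral>\<^sup>+ t1 \<in> {\<delta>1..1}. (\<integral>\<^sup>+ t2 \<in> {\<delta>2..1}.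
               mixed_modulus p \<beta>1 \<beta>2 f t1 t2 / ennreal (t1 powr \<alpha>1 * t2 powr \<alpha>2)
               / ennreal t2 \<partial>lborel) / ennreal t1 \<partial>lborel))) \<and>
     \<comment> \<open>(8)\<close>
     (\<forall>\<beta>1>\<alpha>1. \<forall>\<beta>2>\<alpha>2. \<exists>C>0. \<forall>f \<in> torus_Lp p. \<forall>\<delta>1 \<delta>2.
        0 < \<delta>1 \<and> \<delta>1 < 1/2 \<and> 0 < \<delta>2 \<and> \<delta>2 < 1/2 \<longrightarrow>
        mixed_modulus p \<alpha>1 \<alpha>2 f \<delta>1 \<delta>2 / ennreal (\<delta>1 powr \<alpha>1 * \<delta>2 powr \<alpha>2) \<le>
          ennreal C * (mixed_modulus p \<beta>1 \<beta>2 f \<delta>1 \<delta>2 / ennreal (\<delta>1 powr \<beta>1 * \<delta>2 powr \<beta>2))) \<and>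
     \<comment> \<open>(9)\<close>
     (\<forall>\<beta>1>0. \<forall>\<beta>2>0. \<forall>r1>0. \<forall>r2>0. \<exists>C>0.
        \<forall>f \<in> torus_Lp0 p. \<forall>g \<in> torus_Lp p. has_weyl_derivative r1 r2 f g \<longrightarrow>
        (\<forall>\<delta>1>0. \<forall>\<delta>2>0.
          mixed_modulus p (\<beta>1 + r1) (\<beta>2 + r2) f \<delta>1 \<delta>2 \<le>
            ennreal C * (ennreal (\<delta>1 powr r1 * \<delta>2 powr r2) * mixed_modulus p \<beta>1 \<beta>2 g \<delta>1 \<delta>2))) \<and>
     \<comment> \<open>(10)\<close>
     (\<forall>\<beta>1>0. \<forall>\<beta>2>0. \<forall>r1>0. \<forall>r2>0. \<exists>C>0.
        \<forall>f \<in> torus_Lp0 p. \<forall>g \<in> torus_Lp p. has_weyl_derivative r1 r2 f g \<longrightarrow>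
        (\<forall>\<delta>1>0. \<forall>\<delta>2>0.
          mixed_modulus p \<beta>1 \<beta>2 g \<delta>1 \<delta>2 \<le>
            ennreal C *
            (\<integral>\<^sup>+ t1 \<in> {0<..\<delta>1}. (\<integral>\<^sup>+ t2 \<in> {0<..\<delta>2}.
               ennreal (t1 powr (- r1) * t2 powr (- r2)) *
               mixed_modulus p (\<beta>1 + r1) (\<beta>2 + r2) f t1 t2
               / ennreal t2 \<partial>lborel) / ennreal t1 \<partial>lborel)))"
proof (intro conjI, goal_cases)
  case 1
  show ?case using mm_zero[OF p _ \<alpha>1 \<alpha>2] by blast
next
  case 2
  show ?case using mm_add[OF p _ _ \<alpha>1 \<alpha>2] by (intro exI[of _ 1]) simp
next
  case 3
  show ?case by (intro exI[of _ 1]) (simp add: mm_mono)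
next
  case 4
  show ?case by (rule mm_quotient[OF p \<alpha>1 \<alpha>2])
next
  case 5
  show ?case by (rule mm_dilate[OF p \<alpha>1 \<alpha>2])
next
  case 6
  show ?case using mm_higher[OF p \<alpha>1 \<alpha>2] by blast
next
  case 7
  show ?case by (intro allI impI mm_marchaud p \<alpha>1 \<alpha>2)
next
  case 8
  show ?case by (intro allI impI mm_lower_order p \<alpha>1 \<alpha>2)
next
  case 9
  show ?case by (intro allI impI mm_derivative_le p)
next
  case 10
  show ?case by (intro allI impI mm_derivative_ge p)
qed

end
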